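(* Let $H$ be a finite-dimensional Hopf algebra over a field $k$, with a pair of normalized integrals $\Lambda\in H$, $\lambda\in H^*$. Then the Kuperberg invariant of the 3-torus $T^3$ with the framing $f_1$, namely $$Z(T^3,f_1,H)=\lambda\big(S^2(\Lambda^3_{(2)})S(\Lambda^1_{(3)})S(\Lambda^3_{(4)})\Lambda^1_{(1)}\big)\,\lambda\big(\Lambda^1_{(4)}S(\Lambda^2_{(3)})S(\Lambda^1_{(2)})\Lambda^2_{(1)}\big)\,\lambda\big(S(\Lambda^2_{(4)})S(\Lambda^3_{(3)})\Lambda^2_{(2)}\Lambda^3_{(1)}\big),$$ is a gauge invariant of $H$; that is, it takes the same value on any two gauge equivalent finite-dimensional Hopf algebras.
   Context: $H$ has comultiplication $\Delta$, counit $\varepsilon$ and antipode $S$. Sweedler notation is used with sums suppressed: $\Delta^n(x)=x_{(1)}\otimes\cdots\otimes x_{(n)}$ is the iterated comultiplication. Normalized integrals: $\Lambda\in H$ is a left integral ($x\Lambda=\varepsilon(x)\Lambda$ for all $x$) and $\lambda\in H^*$ is a right cointegral ($\lambda(x_{(1)})x_{(2)}=\lambda(x)1_H$ for all $x$) with $\lambda(\Lambda)=1$. $\Lambda^1,\Lambda^2,\Lambda^3$ denote three copies of $\Lambda$. The displayed expression is obtained by expanding $\Delta^4(\Lambda^i)=\Lambda^i_{(1)}\otimes\Lambda^i_{(2)}\otimes\Lambda^i_{(3)}\otimes\Lambda^i_{(4)}$ for each $i=1,2,3$ and summing the product of the three values of $\lambda$ over all the summands. Two finite-dimensional Hopf algebras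 $H,K$ over $k$ are gauge equivalent if $\operatorname{Rep}(H)$ and $\operatorname{Rep}(K)$ are equivalent as ($k$-linear) monoidal categories. Equivalently, $K\cong H_F$ for some normalized 2-cocycle $F=\sum_i f^{[1]}_i\otimes f^{[2]}_i\in H\otimes H$ (invertible, $(F\otimes 1)(\Delta\otimes\mathrm{id})(F)=(1\otimes F)(\mathrm{id}\otimes\Delta)(F)$, $(\varepsilon\otimes\mathrm{id})(F)=(\mathrm{id}\otimes\varepsilon)(F)=1$), where $H_F$ is $H$ as an algebra with $\Delta_F(x)=F\Delta(x)F^{-1}$, $\varepsilon_F=\varepsilon$, $S_F(x)=uS(x)u^{-1}$, $u=\sum_i f^{[1]}_iS(f^{[2]}_i)$. A quantity $Z(H)$ is a gauge invariant if $Z(H)=Z(K)$ whenever $H$ and $K$ are gauge equivalent. The framing $f_1$ of $T^3$ is given by a specific genus three framed Heegaard diagram, and the displayed formula is the value of Kuperberg's invariant on that diagram; for the purposes of this statement $Z(T^3,f_1,H)$ is defined by the displayed formula. *)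

theory Defs
  imports Complex_Main "Jordan_Normal_Form.Matrix"
begin

section \<open>Tensors over a field\<close>

text \<open>
  A tensor is written as a finite formal sum of pure tensors, that is, as a list of tuples.  The
  two predicates below are equality in \<open>V \<otimes> V\<close> and \<open>V \<otimes> V \<otimes> V\<close>: by the universal property the
  linear forms on a tensor power are exactly the multilinear forms, and over a field the linear
  forms separate the points of a vector space.
\<close>

definition linear_form :: "('k::field \<Rightarrow> 'v::ab_group_add \<Rightarrow> 'v) \<Rightarrow> ('v \<Rightarrow> 'k) \<Rightarrow> bool" where
  "linear_form s f \<longleftrightarrow> Vector_Spaces.linear s (*) f"

definition bilinear_form :: "('k::field \<Rightarrow> 'v::ab_group_add \<Rightarrow> 'v) \<Rightarrow> ('v \<Rightarrow> 'v \<Rightarrow> 'k) \<Rightarrow> bool" where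
  "bilinear_form s B \<longleftrightarrow>
     (\<forall>y. linear_form s (\<lambda>x. B x y)) \<and> (\<forall>x. linear_form s (\<lambda>y. B x y))"

definition trilinear_form ::
  "('k::field \<Rightarrow> 'v::ab_group_add \<Rightarrow> 'v) \<Rightarrow> ('v \<Rightarrow> 'v \<Rightarrow> 'v \<Rightarrow> 'k) \<Rightarrow> bool" where
  "trilinear_form s T \<longleftrightarrow>
     (\<forall>y z. linear_form s (\<lambda>x. T x y z)) \<and> (\<forall>x z. linear_form s (\<lambda>y. T x y z)) \<and>
     (\<forall>x y. linear_form s (\<lambda>z. T x y z))"

definition tensor2_eq ::
  "('k::field \<Rightarrow> 'v::ab_group_add \<Rightarrow> 'v) \<Rightarrow> ('v \<times> 'v) list \<Rightarrow> ('v \<times> 'v) list \<Rightarrow> bool" where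
  "tensor2_eq s xs ys \<longleftrightarrow>
     (\<forall>B. bilinear_form s B \<longrightarrow> (\<Sum>(a, b)\<leftarrow>xs. B a b) = (\<Sum>(a, b)\<leftarrow>ys. B a b))"

definition tensor3_eq ::
  "('k::field \<Rightarrow> 'v::ab_group_add \<Rightarrow> 'v) \<Rightarrow> ('v \<times> 'v \<times> 'v) list \<Rightarrow> ('v \<times> 'v \<times> 'v) list \<Rightarrow> bool"
where
  "tensor3_eq s xs ys \<longleftrightarrow>
     (\<forall>T. trilinear_form s T \<longrightarrow> (\<Sum>(a, b, c)\<leftarrow>xs. T a b c) = (\<Sum>(a, b, c)\<leftarrow>ys. T a b c))"


section \<open>Finite-dimensional Hopf algebras\<close>

text \<open>
  The underlying ring is the whole type \<open>'h\<close>.  The comultiplication picks, for every \<open>x\<close>, one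
  formal sum representing the tensor \<open>\<Delta>(x)\<close>; all conditions on it are stated up to equality of
  tensors, and everything defined from it below is multilinear in the tensor factors, hence
  independent of the chosen representatives.
\<close>

record ('k, 'h) hopf =
  hscale :: "'k \<Rightarrow> 'h \<Rightarrow> 'h"
  comult :: "'h \<Rightarrow> ('h \<times> 'h) list"
  counit :: "'h \<Rightarrow> 'k"
  antipode :: "'h \<Rightarrow> 'h"

locale fd_hopf_algebra =
  fixes H :: "('k::field, 'h::ring_1) hopf"
  assumes finite_dim: "\<exists>B. finite_dimensional_vector_space (hscale H) B"
    and scale_mult_left: "hscale H c x * y = hscale H c (x * y)"
    and scale_mult_right: "x * hscale H c y = hscale H c (x * y)"
    and comult_add: "tensor2_eq (hscale H) (comult H (x + y)) (comult H x @ comult H y)"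
    and comult_scale: "tensor2_eq (hscale H) (comult H (hscale H c x))
          [(hscale H c a, b). (a, b) \<leftarrow> comult H x]"
    and coassoc: "tensor3_eq (hscale H)
          [(a1, a2, b). (a, b) \<leftarrow> comult H x, (a1, a2) \<leftarrow> comult H a]
          [(a, b1, b2). (a, b) \<leftarrow> comult H x, (b1, b2) \<leftarrow> comult H b]"
    and counit_linear: "linear_form (hscale H) (counit H)"
    and counit_left: "(\<Sum>(a, b)\<leftarrow>comult H x. hscale H (counit H a) b) = x"
    and counit_right: "(\<Sum>(a, b)\<leftarrow>comult H x. hscale H (counit H b) a) = x"
    and comult_mult: "tensor2_eq (hscale H) (comult H (x * y))
          [(a * c, b * d). (a, b) \<leftarrow> comult H x, (c, d) \<leftarrow> comult H y]"
    and comult_one: "tensor2_eq (hscale H) (comult H 1) [(1, 1)]"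
    and counit_mult: "counit H (x * y) = counit H x * counit H y"
    and counit_one: "counit H 1 = 1"
    and antipode_linear: "Vector_Spaces.linear (hscale H) (hscale H) (antipode H)"
    and antipode_left: "(\<Sum>(a, b)\<leftarrow>comult H x. antipode H a * b) = hscale H (counit H x) 1"
    and antipode_right: "(\<Sum>(a, b)\<leftarrow>comult H x. a * antipode H b) = hscale H (counit H x) 1"

definition left_integral :: "('k::field, 'h::ring_1) hopf \<Rightarrow> 'h \<Rightarrow> bool" where
  "left_integral H \<Lambda> \<longleftrightarrow> (\<forall>x. x * \<Lambda> = hscale H (counit H x) \<Lambda>)"

definition right_cointegral :: "('k::field, 'h::ring_1) hopf \<Rightarrow> ('h \<Rightarrow> 'k) \<Rightarrow> bool" where
  "right_cointegral H l \<longleftrightarrow> linear_form (hscale H) l \<and>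
     (\<forall>x. (\<Sum>(a, b)\<leftarrow>comult H x. hscale H (l a) b) = hscale H (l x) 1)"

definition normalized_integrals :: "('k::field, 'h::ring_1) hopf \<Rightarrow> 'h \<Rightarrow> ('h \<Rightarrow> 'k) \<Rightarrow> bool" where
  "normalized_integrals H \<Lambda> l \<longleftrightarrow> left_integral H \<Lambda> \<and> right_cointegral H l \<and> l \<Lambda> = 1"

definition comult4 :: "('k, 'h) hopf \<Rightarrow> 'h \<Rightarrow> ('h \<times> 'h \<times> 'h \<times> 'h) list" where
  "comult4 H x =
     [(x1, x2, x3, x4). (x1, y) \<leftarrow> comult H x, (x2, z) \<leftarrow> comult H y, (x3, x4) \<leftarrow> comult H z]"


section \<open>The Kuperberg invariant of the framed 3-torus\<close>

text \<open>The tuples \<open>(a1, \<dots>)\<close>, \<open>(b1, \<dots>)\<close>, \<open>(c1, \<dots>)\<close> come from the copies \<open>\<Lambda>\<^sup>1\<close>, \<open>\<Lambda>\<^sup>2\<close>, \<open>\<Lambda>\<^sup>3\<close>.\<close>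

definition kuperberg_T3 :: "('k::field, 'h::ring_1) hopf \<Rightarrow> 'h \<Rightarrow> ('h \<Rightarrow> 'k) \<Rightarrow> 'k" where
  "kuperberg_T3 H \<Lambda> l = (let S = antipode H in
     \<Sum>(a1, a2, a3, a4)\<leftarrow>comult4 H \<Lambda>. \<Sum>(b1, b2, b3, b4)\<leftarrow>comult4 H \<Lambda>.
     \<Sum>(c1, c2, c3, c4)\<leftarrow>comult4 H \<Lambda>.
       l (S (S c2) * S a3 * S c4 * a1) *
       l (a4 * S b3 * S a2 * b1) *
       l (S b4 * S c3 * b2 * c1))"


section \<open>Linear monoidal categories and their equivalences\<close>

text \<open>
  \<open>Comp C g f\<close> is \<open>g \<circ> f\<close>.  The structure morphisms are
  \<open>Assoc C X Y Z : (X \<otimes> Y) \<otimes> Z \<rightarrow> X \<otimes> (Y \<otimes> Z)\<close>, \<open>LUnit C X : 1 \<otimes> X \<rightarrow> X\<close> and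
  \<open>RUnit C X : X \<otimes> 1 \<rightarrow> X\<close>.  Hom sets need not be disjoint, so a functor receives the source and
  target of a morphism along with it.
\<close>

record ('k, 'o, 'm) lin_moncat =
  Obj :: "'o set"
  Hom :: "'o \<Rightarrow> 'o \<Rightarrow> 'm set"
  Comp :: "'m \<Rightarrow> 'm \<Rightarrow> 'm"
  Ident :: "'o \<Rightarrow> 'm"
  AddM :: "'m \<Rightarrow> 'm \<Rightarrow> 'm"
  ScaleM :: "'k \<Rightarrow> 'm \<Rightarrow> 'm"
  TensO :: "'o \<Rightarrow> 'o \<Rightarrow> 'o"
  TensM :: "'m \<Rightarrow> 'm \<Rightarrow> 'm"
  UnitO :: "'o"
  Assoc :: "'o \<Rightarrow> 'o \<Rightarrow> 'o \<Rightarrow> 'm"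
  LUnit :: "'o \<Rightarrow> 'm"
  RUnit :: "'o \<Rightarrow> 'm"

definition iso_in :: "('k, 'o, 'm) lin_moncat \<Rightarrow> 'o \<Rightarrow> 'o \<Rightarrow> 'm \<Rightarrow> bool" where
  "iso_in C X Y f \<longleftrightarrow> f \<in> Hom C X Y \<and>
     (\<exists>g \<in> Hom C Y X. Comp C g f = Ident C X \<and> Comp C f g = Ident C Y)"

definition linear_functor :: "('k, 'o1, 'm1) lin_moncat \<Rightarrow> ('k, 'o2, 'm2) lin_moncat \<Rightarrow>
    ('o1 \<Rightarrow> 'o2) \<Rightarrow> ('o1 \<Rightarrow> 'o1 \<Rightarrow> 'm1 \<Rightarrow> 'm2) \<Rightarrow> bool" where
  "linear_functor C D F Fm \<longleftrightarrow>
     (\<forall>X \<in> Obj C. F X \<in> Obj D) \<and>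
     (\<forall>X \<in> Obj C. \<forall>Y \<in> Obj C. \<forall>f \<in> Hom C X Y. Fm X Y f \<in> Hom D (F X) (F Y)) \<and>
     (\<forall>X \<in> Obj C. Fm X X (Ident C X) = Ident D (F X)) \<and>
     (\<forall>X \<in> Obj C. \<forall>Y \<in> Obj C. \<forall>Z \<in> Obj C. \<forall>f \<in> Hom C X Y. \<forall>g \<in> Hom C Y Z.
        Fm X Z (Comp C g f) = Comp D (Fm Y Z g) (Fm X Y f)) \<and>
     (\<forall>X \<in> Obj C. \<forall>Y \<in> Obj C. \<forall>f \<in> Hom C X Y. \<forall>g \<in> Hom C X Y.
        Fm X Y (AddM C f g) = AddM D (Fm X Y f) (Fm X Y g)) \<and>
     (\<forall>X \<in> Obj C. \<forall>Y \<in> Obj C. \<forall>c. \<forall>f \<in> Hom C X Y.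
        Fm X Y (ScaleM C c f) = ScaleM D c (Fm X Y f))"

definition natural_iso :: "('k, 'o1, 'm1) lin_moncat \<Rightarrow> ('k, 'o2, 'm2) lin_moncat \<Rightarrow>
    ('o1 \<Rightarrow> 'o2) \<Rightarrow> ('o1 \<Rightarrow> 'o1 \<Rightarrow> 'm1 \<Rightarrow> 'm2) \<Rightarrow>
    ('o1 \<Rightarrow> 'o2) \<Rightarrow> ('o1 \<Rightarrow> 'o1 \<Rightarrow> 'm1 \<Rightarrow> 'm2) \<Rightarrow> ('o1 \<Rightarrow> 'm2) \<Rightarrow> bool" where
  "natural_iso C D F Fm G Gm \<eta> \<longleftrightarrow>
     (\<forall>X \<in> Obj C. iso_in D (F X) (G X) (\<eta> X)) \<and>
     (\<forall>X \<in> Obj C. \<forall>Y \<in> Obj C. \<forall>f \<in> Hom C X Y.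
        Comp D (\<eta> Y) (Fm X Y f) = Comp D (Gm X Y f) (\<eta> X))"

definition linear_equivalence :: "('k, 'o1, 'm1) lin_moncat \<Rightarrow> ('k, 'o2, 'm2) lin_moncat \<Rightarrow>
    ('o1 \<Rightarrow> 'o2) \<Rightarrow> ('o1 \<Rightarrow> 'o1 \<Rightarrow> 'm1 \<Rightarrow> 'm2) \<Rightarrow> bool" where
  "linear_equivalence C D F Fm \<longleftrightarrow> linear_functor C D F Fm \<and>
     (\<exists>G Gm \<eta> \<theta>. linear_functor D C G Gm \<and>
        natural_iso C C (\<lambda>X. X) (\<lambda>X Y f. f)
          (\<lambda>X. G (F X)) (\<lambda>X Y f. Gm (F X) (F Y) (Fm X Y f)) \<eta> \<and>
        natural_iso D D (\<lambda>X. F (G X)) (\<lambda>X Y f. Fm (G X) (G Y) (Gm X Y f))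
          (\<lambda>X. X) (\<lambda>X Y f. f) \<theta>)"

text \<open>
  A strong monoidal structure on a functor: natural isomorphisms
  \<open>J X Y : F X \<otimes> F Y \<rightarrow> F (X \<otimes> Y)\<close> and an isomorphism \<open>u : 1 \<rightarrow> F 1\<close> with the hexagon and the two
  unit squares.
\<close>

definition monoidal_structure :: "('k, 'o1, 'm1) lin_moncat \<Rightarrow> ('k, 'o2, 'm2) lin_moncat \<Rightarrow>
    ('o1 \<Rightarrow> 'o2) \<Rightarrow> ('o1 \<Rightarrow> 'o1 \<Rightarrow> 'm1 \<Rightarrow> 'm2) \<Rightarrow> ('o1 \<Rightarrow> 'o1 \<Rightarrow> 'm2) \<Rightarrow> 'm2 \<Rightarrow> bool" where
  "monoidal_structure C D F Fm J u \<longleftrightarrow>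
     (\<forall>X \<in> Obj C. \<forall>Y \<in> Obj C.
        iso_in D (TensO D (F X) (F Y)) (F (TensO C X Y)) (J X Y)) \<and>
     (\<forall>X \<in> Obj C. \<forall>Y \<in> Obj C. \<forall>X' \<in> Obj C. \<forall>Y' \<in> Obj C.
        \<forall>f \<in> Hom C X X'. \<forall>g \<in> Hom C Y Y'.
        Comp D (Fm (TensO C X Y) (TensO C X' Y') (TensM C f g)) (J X Y) =
        Comp D (J X' Y') (TensM D (Fm X X' f) (Fm Y Y' g))) \<and>
     iso_in D (UnitO D) (F (UnitO C)) u \<and>
     (\<forall>X \<in> Obj C. \<forall>Y \<in> Obj C. \<forall>Z \<in> Obj C.
        Comp D (Fm (TensO C (TensO C X Y) Z) (TensO C X (TensO C Y Z)) (Assoc C X Y Z))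
          (Comp D (J (TensO C X Y) Z) (TensM D (J X Y) (Ident D (F Z)))) =
        Comp D (J X (TensO C Y Z))
          (Comp D (TensM D (Ident D (F X)) (J Y Z)) (Assoc D (F X) (F Y) (F Z)))) \<and>
     (\<forall>X \<in> Obj C.
        Comp D (Fm (TensO C (UnitO C) X) X (LUnit C X))
          (Comp D (J (UnitO C) X) (TensM D u (Ident D (F X)))) = LUnit D (F X)) \<and>
     (\<forall>X \<in> Obj C.
        Comp D (Fm (TensO C X (UnitO C)) X (RUnit C X))
          (Comp D (J X (UnitO C)) (TensM D (Ident D (F X)) u)) = RUnit D (F X))"

definition monoidally_equivalent ::
  "('k, 'o1, 'm1) lin_moncat \<Rightarrow> ('k, 'o2, 'm2) lin_moncat \<Rightarrow> bool" where
  "monoidally_equivalent C D \<longleftrightarrow>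
     (\<exists>F Fm J u. linear_equivalence C D F Fm \<and> monoidal_structure C D F Fm J u)"


section \<open>Finite-dimensional representations and gauge equivalence\<close>

text \<open>
  Finite-dimensional left modules are presented in coordinates: a module structure on \<open>k\<^sup>n\<close> is
  an algebra map from \<open>H\<close> to the \<open>n \<times> n\<close> matrices, and \<open>k\<^sup>m \<otimes> k\<^sup>n\<close> is identified with
  \<open>k\<^bsup>m*n\<^esup>\<close> through the lexicographic order on index pairs, so that the tensor product of linear maps
  is the Kronecker product.  With this identification the associativity and unit isomorphisms of
  vector spaces become identity matrices.
\<close>

definition kron :: "'k::semiring_1 mat \<Rightarrow> 'k mat \<Rightarrow> 'k mat" where
  "kron A B = mat (dim_row A * dim_row B) (dim_col A * dim_col B)
     (\<lambda>(i, j). A $$ (i div dim_row B, j div dim_col B) * B $$ (i mod dim_row B, j mod dim_col B))"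

definition representation_of :: "('k::field, 'h::ring_1) hopf \<Rightarrow> ('h \<Rightarrow> 'k mat) \<Rightarrow> bool" where
  "representation_of H \<rho> \<longleftrightarrow> (\<exists>n.
     (\<forall>x. \<rho> x \<in> carrier_mat n n) \<and>
     (\<forall>x y. \<rho> (x + y) = \<rho> x + \<rho> y) \<and>
     (\<forall>c x. \<rho> (hscale H c x) = c \<cdot>\<^sub>m \<rho> x) \<and>
     (\<forall>x y. \<rho> (x * y) = \<rho> x * \<rho> y) \<and>
     \<rho> 1 = 1\<^sub>m n)"

definition rep_dim :: "('h::ring_1 \<Rightarrow> 'k mat) \<Rightarrow> nat" where
  "rep_dim \<rho> = dim_row (\<rho> 1)"

definition intertwiners :: "('h::ring_1 \<Rightarrow> 'k::field mat) \<Rightarrow> ('h \<Rightarrow> 'k mat) \<Rightarrow> 'k mat set" where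
  "intertwiners \<rho> \<sigma> =
     {A \<in> carrier_mat (rep_dim \<sigma>) (rep_dim \<rho>). \<forall>x. A * \<rho> x = \<sigma> x * A}"

definition tensor_rep ::
  "('k::field, 'h::ring_1) hopf \<Rightarrow> ('h \<Rightarrow> 'k mat) \<Rightarrow> ('h \<Rightarrow> 'k mat) \<Rightarrow> 'h \<Rightarrow> 'k mat" where
  "tensor_rep H \<rho> \<sigma> x =
     (let n = rep_dim \<rho> * rep_dim \<sigma> in
      mat n n (\<lambda>(i, j). \<Sum>(a, b)\<leftarrow>comult H x. kron (\<rho> a) (\<sigma> b) $$ (i, j)))"

definition trivial_rep :: "('k::field, 'h::ring_1) hopf \<Rightarrow> 'h \<Rightarrow> 'k mat" where
  "trivial_rep H x = mat 1 1 (\<lambda>_. counit H x)"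

definition Rep :: "('k::field, 'h::ring_1) hopf \<Rightarrow> ('k, 'h \<Rightarrow> 'k mat, 'k mat) lin_moncat" where
  "Rep H = \<lparr>
     Obj = {\<rho>. representation_of H \<rho>},
     Hom = intertwiners,
     Comp = (\<lambda>B A. B * A),
     Ident = (\<lambda>\<rho>. 1\<^sub>m (rep_dim \<rho>)),
     AddM = (+),
     ScaleM = (\<cdot>\<^sub>m),
     TensO = tensor_rep H,
     TensM = kron,
     UnitO = trivial_rep H,
     Assoc = (\<lambda>\<rho> \<sigma> \<tau>. 1\<^sub>m (rep_dim \<rho> * rep_dim \<sigma> * rep_dim \<tau>)),
     LUnit = (\<lambda>\<rho>. 1\<^sub>m (rep_dim \<rho>)),
     RUnit = (\<lambda>\<rho>. 1\<^sub>m (rep_dim \<rho>))\<rparr>"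

definition gauge_equivalent :: "('k::field, 'h::ring_1) hopf \<Rightarrow> ('k, 'l::ring_1) hopf \<Rightarrow> bool" where
  "gauge_equivalent H K \<longleftrightarrow> monoidally_equivalent (Rep H) (Rep K)"

end

theory Submission
  imports Defs "Jordan_Normal_Form.Determinant"
begin

text \<open>
  Since \<open>y \<mapsto> \<Sum> \<lambda>(y \<Lambda>\<^sub>1) S(\<Lambda>\<^sub>2)\<close> is the identity of \<open>H\<close>, the invariant is the trace of the operator
  \<open>(a, b, c) \<mapsto> c\<^sub>3 a\<^sub>2 S(c\<^sub>1) \<otimes> a\<^sub>1 b\<^sub>2 T(a\<^sub>3) \<otimes> T(b\<^sub>1) c\<^sub>2 b\<^sub>3\<close> on \<open>H \<otimes> H \<otimes> H\<close>, where \<open>T\<close> is the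
  inverse of \<open>S\<close>.  A twist \<open>F\<close> with inverse \<open>G\<close> makes \<open>H\<close> and its twisted form the diagonal
  coalgebras of a Hopf category whose off-diagonal comultiplications are \<open>\<Delta>(x) G\<close> and \<open>F \<Delta>(x)\<close>.
  Six applications of \<open>tr (X Y) = tr (Y X)\<close>, each of which changes the index of one of the three
  tensor factors, carry the trace for one diagonal entry, with a factor \<open>p x\<close> inserted, to the trace
  for the other one with \<open>p\<close> times the image of \<open>x\<close> under two inverse antipodes inserted.  Writing
  \<open>1\<close> by means of \<open>F\<close> as a sum of such products shows that both traces agree at \<open>1\<close>.

  A monoidal equivalence \<open>F\<close> from \<open>Rep H\<close> to \<open>Rep K\<close> comes from a twist once \<open>P = F H\<close> is free of
  rank one.  Choose \<open>V\<close> with \<open>F V = K\<close>.  The isomorphisms \<open>H \<otimes> V = H\<^sup>m\<close> and \<open>P \<otimes> K = K\<^sup>d\<close>, with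
  \<open>m = dim V\<close> and \<open>d = dim P\<close>, give \<open>P\<^sup>m = K\<^sup>d\<close>, and counting homomorphisms into \<open>K\<close> gives
  \<open>m = d = dim K\<close>.  As \<open>K\<close> is a Frobenius algebra, \<open>K\<close> and hence \<open>P\<close> are injective modules.  Take a left
  ideal \<open>A\<close> of maximal dimension on which \<open>a \<mapsto> a p\<close> is injective for some \<open>p\<close> in \<open>P\<close>.  If \<open>p\<close> had a
  nonzero annihilator, take \<open>x\<close> in it with \<open>K x\<close> minimal: either the embedding extends to \<open>A + K x\<close>, or
  \<open>dim x P < dim x K\<close>, which contradicts \<open>P\<^sup>m = K\<^sup>d\<close>.  A generator \<open>p\<close> identifies every \<open>M\<close> with \<open>F M\<close>
  through \<open>v \<mapsto> F(h \<mapsto> h v)(p)\<close>, and the twist is read off from \<open>J(p \<otimes> p)\<close>.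
\<close>

section \<open>Traces in a Hopf category\<close>

text \<open>The integrals of a Hopf algebra and of its twist are hard to compare directly. In the
  trace formula \<open>\<Lambda>\<close> and \<open>\<lambda>\<close> survive only as a dual basis
  of \<open>H\<close>, and two traces over different coalgebras are left to compare. Cyclicity
  changes one tensor factor at a time, so the intermediate operators mix both coalgebras; the
  off-diagonal coalgebras give them a place, and the object indices record where \<open>F\<close>
  and \<open>G\<close> cancel. For the second half, P^m = K^m would give P = K by Krull-Schmidt
  cancellation; the maximal left ideal A takes its place. The strict inequality arises thus: if the
  embedding does not extend, every x q equals t p with t in A. Self-injectivity puts t into x K, and
  x itself lies in x K but not in A, so the elements t stay in a proper subspace of x K. The map J
  goes from F X \<otimes> F Y to F (X \<otimes> Y), so J(p \<otimes> p) yields the inverse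
  \<open>G\<close> of the twist. It is counital only up to the scalar by which the unit isomorphism
  of the functor differs from the one given by p.\<close>

definition tsum :: "('a \<times> 'b) list \<Rightarrow> ('a \<Rightarrow> 'b \<Rightarrow> 'c::comm_monoid_add) \<Rightarrow> 'c" where
  "tsum t f = (\<Sum>(a, b)\<leftarrow>t. f a b)"

lemma tsum_Nil [simp]: "tsum [] f = 0"
  and tsum_Cons [simp]: "tsum ((a, b) # t) f = f a b + tsum t f"
  by (simp_all add: tsum_def)

lemma tsum_append [simp]: "tsum (s @ t) f = tsum s f + tsum t f"
  by (induction s) (auto simp: ac_simps)

lemma tsum_0 [simp]: "tsum t (\<lambda>a b. 0) = 0"
  by (induction t) auto

lemma tsum_add: "tsum t (\<lambda>a b. f a b + g a b) = tsum t f + tsum t g"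
  by (induction t) (auto simp: ac_simps)

lemma tsum_sum: "tsum t (\<lambda>a b. \<Sum>i\<in>I. f i a b) = (\<Sum>i\<in>I. tsum t (f i))"
  by (induction t) (auto simp: sum.distrib)

lemma tsum_mult_left: "tsum t (\<lambda>a b. c * f a b) = c * tsum t f" for c :: "'k::semiring_0"
  by (induction t) (auto simp: algebra_simps)

lemma tsum_mult_right: "tsum t (\<lambda>a b. f a b * c) = tsum t f * c" for c :: "'k::semiring_0"
  by (induction t) (auto simp: algebra_simps)

lemma tsum_swap: "tsum s (\<lambda>a b. tsum t (\<lambda>c d. f a b c d)) = tsum t (\<lambda>c d. tsum s (\<lambda>a b. f a b c d))"
  by (induction s) (auto simp: tsum_add)

lemma tsum_swap3: "tsum t (\<lambda>a b. tsum u (\<lambda>c d. tsum (v c d) (\<lambda>e f. g a b c d e f))) =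
    tsum u (\<lambda>c d. tsum (v c d) (\<lambda>e f. tsum t (\<lambda>a b. g a b c d e f)))"
  by (simp only: tsum_swap[of t])

lemma tsum_swap5: "tsum t (\<lambda>a b. tsum (w a b) (\<lambda>c d. tsum u (\<lambda>e f. tsum (v e f) (\<lambda>g h. tsum (v' e f) (\<lambda>k l.
      F a b c d e f g h k l))))) =
    tsum u (\<lambda>e f. tsum (v e f) (\<lambda>g h. tsum (v' e f) (\<lambda>k l. tsum t (\<lambda>a b. tsum (w a b) (\<lambda>c d.
      F a b c d e f g h k l)))))"
  by (simp only: tsum_swap[where s = "w a b" for a b] tsum_swap[of t])

lemma tsum_map: "tsum (map g t) f = tsum t (\<lambda>a b. f (fst (g (a, b))) (snd (g (a, b))))"
  by (induction t) (auto simp: tsum_def split_beta)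

section \<open>Linear and multilinear forms on an algebra\<close>

locale algebra_over =
  fixes s :: "'k::field \<Rightarrow> 'h::ring_1 \<Rightarrow> 'h"
  assumes vector_space: "vector_space s"
    and scale_left: "s c x * y = s c (x * y)"
    and scale_right: "x * s c y = s c (x * y)"
begin

definition lin :: "('h \<Rightarrow> 'k) \<Rightarrow> bool" where
  "lin f \<longleftrightarrow> (\<forall>x y. f (x + y) = f x + f y) \<and> (\<forall>c x. f (s c x) = c * f x)"

definition vlin :: "('h \<Rightarrow> 'h) \<Rightarrow> bool" where
  "vlin f \<longleftrightarrow> (\<forall>x y. f (x + y) = f x + f y) \<and> (\<forall>c x. f (s c x) = s c (f x))"

definition bil :: "('h \<Rightarrow> 'h \<Rightarrow> 'k) \<Rightarrow> bool" where
  "bil f \<longleftrightarrow> (\<forall>y. lin (\<lambda>x. f x y)) \<and> (\<forall>x. lin (\<lambda>y. f x y))"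

definition tri :: "('h \<Rightarrow> 'h \<Rightarrow> 'h \<Rightarrow> 'k) \<Rightarrow> bool" where
  "tri f \<longleftrightarrow> (\<forall>y z. lin (\<lambda>x. f x y z)) \<and> (\<forall>x z. lin (\<lambda>y. f x y z)) \<and> (\<forall>x y. lin (\<lambda>z. f x y z))"

lemma vector_space_mult: "vector_space ((*) :: 'k \<Rightarrow> 'k \<Rightarrow> 'k)"
  by unfold_locales (auto simp: algebra_simps)

lemma lin_iff: "linear_form s f \<longleftrightarrow> lin f"
  unfolding linear_form_def lin_def Vector_Spaces.linear_def module_hom_def module_hom_axioms_def
  using vector_space vector_space_mult
  by (auto simp: vector_space_def Modules.module_def)

lemma vlin_iff: "Vector_Spaces.linear s s f \<longleftrightarrow> vlin f"
  unfolding vlin_def Vector_Spaces.linear_def module_hom_def module_hom_axioms_def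
  using vector_space by (auto simp: vector_space_def Modules.module_def)

lemma bil_iff: "bilinear_form s f \<longleftrightarrow> bil f"
  unfolding bilinear_form_def bil_def lin_iff ..

lemma tri_iff: "trilinear_form s f \<longleftrightarrow> tri f"
  unfolding trilinear_form_def tri_def lin_iff ..

lemma lin_sum_val: "lin f \<Longrightarrow> f (\<Sum>i\<in>I. s (c i) (v i)) = (\<Sum>i\<in>I. c i * f (v i))"
proof -
  assume f: "lin f"
  then have "f 0 = 0" unfolding lin_def by (metis add_cancel_right_left)
  with f show ?thesis by (induction I rule: infinite_finite_induct) (auto simp: lin_def)
qed

lemma lin_mult1: "lin f \<Longrightarrow> lin (\<lambda>x. f x * c)"
  and lin_mult2: "lin f \<Longrightarrow> lin (\<lambda>x. c * f x)"
  by (auto simp: lin_def algebra_simps)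

lemma lin_sum: "(\<And>m. lin (\<lambda>x. f x m)) \<Longrightarrow> lin (\<lambda>x. \<Sum>m\<in>I. f x m)"
  by (auto simp: lin_def sum.distrib sum_distrib_left)

lemma lin_tsum:
  assumes "\<And>c d. lin (\<lambda>x. f x c d)"
  shows "lin (\<lambda>x. tsum t (f x))"
proof -
  have "f (x + y) = (\<lambda>c d. f x c d + f y c d)" "f (s c x) = (\<lambda>d e. c * f x d e)" for x y c
    using assms by (auto simp: lin_def fun_eq_iff)
  then show ?thesis by (simp add: lin_def tsum_add tsum_mult_left)
qed

lemma bilI: "(\<And>y. lin (\<lambda>x. f x y)) \<Longrightarrow> (\<And>x. lin (\<lambda>y. f x y)) \<Longrightarrow> bil f"
  by (simp add: bil_def)

lemma triI: "(\<And>y z. lin (\<lambda>x. f x y z)) \<Longrightarrow> (\<And>x z. lin (\<lambda>y. f x y z)) \<Longrightarrow>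
    (\<And>x y. lin (\<lambda>z. f x y z)) \<Longrightarrow> tri f"
  by (simp add: tri_def)

lemma vlin_id: "vlin (\<lambda>x. x)"
  and vlin_mult1: "vlin g \<Longrightarrow> vlin (\<lambda>x. g x * y)"
  and vlin_mult2: "vlin g \<Longrightarrow> vlin (\<lambda>x. y * g x)"
  by (auto simp: vlin_def algebra_simps scale_left scale_right)

lemma lin_comp: "lin f \<Longrightarrow> vlin g \<Longrightarrow> lin (\<lambda>x. f (g x))"
  by (auto simp: lin_def vlin_def)

end

section \<open>Antipodes, integrals and cyclicity of the trace in a Hopf category\<close>

text \<open>
  The objects are the two truth values, and all morphism coalgebras live on the same algebra:
  composition is the multiplication, \<open>D i j\<close> is the comultiplication of \<open>C\<^sub>i\<^sub>j\<close>, and \<open>A i j\<close> maps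
  \<open>C\<^sub>i\<^sub>j\<close> to \<open>C\<^sub>j\<^sub>i\<close>.
\<close>

locale hopf_category_pre =
  algebra_over s for s :: "'k::field \<Rightarrow> 'h::ring_1 \<Rightarrow> 'h" +
  fixes D :: "bool \<Rightarrow> bool \<Rightarrow> 'h \<Rightarrow> ('h \<times> 'h) list"
    and \<epsilon> :: "'h \<Rightarrow> 'k"
    and A :: "bool \<Rightarrow> bool \<Rightarrow> 'h \<Rightarrow> 'h"
    and n :: nat and b :: "nat \<Rightarrow> 'h" and \<phi> :: "nat \<Rightarrow> 'h \<Rightarrow> 'k"
  assumes D_linear: "bilinear_form s f \<Longrightarrow> linear_form s (\<lambda>x. tsum (D i j x) f)"
    and D_coassoc: "trilinear_form s g \<Longrightarrow>
        tsum (D i j x) (\<lambda>a r. tsum (D i j a) (\<lambda>a1 a2. g a1 a2 r)) =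
        tsum (D i j x) (\<lambda>a r. tsum (D i j r) (\<lambda>r1 r2. g a r1 r2))"
    and \<epsilon>_linear: "linear_form s \<epsilon>"
    and counit_left: "linear_form s h \<Longrightarrow> tsum (D i j x) (\<lambda>a r. \<epsilon> a * h r) = h x"
    and counit_right: "linear_form s h \<Longrightarrow> tsum (D i j x) (\<lambda>a r. \<epsilon> r * h a) = h x"
    and D_mult: "bilinear_form s f \<Longrightarrow> tsum (D i k (x * y)) f =
        tsum (D i j x) (\<lambda>a r. tsum (D j k y) (\<lambda>c d. f (a * c) (r * d)))"
    and D_one: "bilinear_form s f \<Longrightarrow> tsum (D i i 1) f = f 1 1"
    and \<epsilon>_mult: "\<epsilon> (x * y) = \<epsilon> x * \<epsilon> y"
    and \<epsilon>_one: "\<epsilon> 1 = 1"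
    and A_linear: "Vector_Spaces.linear s s (A i j)"
    and A_left: "linear_form s h \<Longrightarrow> tsum (D i j x) (\<lambda>a r. h (A i j a * r)) = \<epsilon> x * h 1"
    and A_right: "linear_form s h \<Longrightarrow> tsum (D i j x) (\<lambda>a r. h (a * A i j r)) = \<epsilon> x * h 1"
    and \<phi>_linear: "linear_form s (\<phi> m)"
    and basis: "(\<Sum>m<n. s (\<phi> m x) (b m)) = x"
begin

lemmas ax = D_linear[unfolded lin_iff bil_iff] D_coassoc[unfolded tri_iff]
  counit_left[unfolded lin_iff] counit_right[unfolded lin_iff]

text \<open>The families \<open>b\<close> and \<open>\<phi>\<close> resolve the identity of the
  algebra, so the trace of an operator X is \<Sum> \<phi> m (X (b m)). All traces below are written
  in this way.\<close>

lemma lin_expand: "lin f \<Longrightarrow> f x = (\<Sum>m<n. \<phi> m x * f (b m))"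
  by (subst (1) basis[symmetric]) (rule lin_sum_val)

definition D3 :: "bool \<Rightarrow> bool \<Rightarrow> 'h \<Rightarrow> ('h \<Rightarrow> 'h \<Rightarrow> 'h \<Rightarrow> 'k) \<Rightarrow> 'k" where
  "D3 i j x f = tsum (D i j x) (\<lambda>a r. tsum (D i j r) (\<lambda>c d. f a c d))"

lemma lin_\<phi>: "vlin g \<Longrightarrow> lin (\<lambda>x. \<phi> m (g x))"
  using \<phi>_linear[unfolded lin_iff] by (auto simp: lin_def vlin_def)

lemma lin_\<epsilon>: "vlin g \<Longrightarrow> lin (\<lambda>x. \<epsilon> (g x))"
  using \<epsilon>_linear[unfolded lin_iff] by (auto simp: lin_def vlin_def)

lemma lin_D: "vlin g \<Longrightarrow> bil f \<Longrightarrow> lin (\<lambda>x. tsum (D i j (g x)) f)"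
  using ax(1)[of f i j] by (auto simp: lin_def vlin_def)

lemma lin_D3: "(\<And>a c d. lin (\<lambda>x. f x a c d)) \<Longrightarrow> lin (\<lambda>x. D3 i j t (f x))"
  unfolding D3_def by (intro lin_tsum)

lemma lin_D3_arg: "vlin g \<Longrightarrow> tri f \<Longrightarrow> lin (\<lambda>x. D3 i j (g x) f)"
  unfolding D3_def tri_def
  by (rule lin_D, assumption, rule bilI)
     (rule lin_tsum, blast, rule lin_D, auto simp: vlin_def bil_def)

lemma vlin_A: "vlin g \<Longrightarrow> vlin (\<lambda>x. A i j (g x))"
  using A_linear[unfolded vlin_iff, of i j]
  by (auto simp: vlin_def)

lemmas pre_lin_rules = lin_\<phi> lin_\<epsilon> lin_mult1 lin_mult2 lin_sum lin_tsum lin_D lin_D3 lin_D3_arg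
  bilI triI vlin_id vlin_mult1 vlin_mult2 vlin_A

text \<open>The coordinate forms \<open>\<phi>\<close> separate points. This turns identities tested
  against all linear forms, as the axioms of the locale are, into equations between
  elements.\<close>

lemma lin_ext: "(\<And>f. lin f \<Longrightarrow> f x = f y) \<Longrightarrow> x = y"
proof -
  assume *: "\<And>f. lin f \<Longrightarrow> f x = f y"
  have "\<phi> m x = \<phi> m y" for m using * \<phi>_linear[unfolded lin_iff] by blast
  then have "(\<Sum>m<n. s (\<phi> m x) (b m)) = (\<Sum>m<n. s (\<phi> m y) (b m))" by simp
  then show ?thesis by (simp only: basis)
qed

lemma A_l: "lin h \<Longrightarrow> tsum (D i j x) (\<lambda>a r. h (A i j a * r)) = \<epsilon> x * h 1"
  and A_r: "lin h \<Longrightarrow> tsum (D i j x) (\<lambda>a r. h (a * A i j r)) = \<epsilon> x * h 1"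
  using A_left[unfolded lin_iff] A_right[unfolded lin_iff] by blast+

lemma D_mult': "bil f \<Longrightarrow> tsum (D i k (x * y)) f =
        tsum (D i j x) (\<lambda>a r. tsum (D j k y) (\<lambda>c d. f (a * c) (r * d)))"
  and D_one': "bil f \<Longrightarrow> tsum (D i i 1) f = f 1 1"
  using D_mult[unfolded bil_iff] D_one[unfolded bil_iff] by blast+

lemma lin_D': "bil f \<Longrightarrow> lin (\<lambda>x. tsum (D i j x) f)"
  by (intro lin_D vlin_id)

lemma coassoc: "tri g \<Longrightarrow> D3 i j x g = tsum (D i j x) (\<lambda>r c. tsum (D i j r) (\<lambda>a b. g a b c))"
  unfolding D3_def using ax(2)[of g i j x] by simp

text \<open>With the threefold coproduct grouped as (\<Delta> \<otimes> id) \<Delta>, the hypothesis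
  turns the inner coproduct into a counit, which the counit law absorbs. This lemma and its mirror
  image carry out the cancellations of the form A(x1) x2 below.\<close>

lemma D3_contract12:
  assumes "tri g" "lin h" "\<And>t c. tsum (D i j t) (\<lambda>a b. g a b c) = \<epsilon> t * h c"
  shows "D3 i j x g = h x"
  using assms by (simp add: coassoc ax)

lemma D3_contract23:
  assumes "lin h" "\<And>t a. tsum (D i j t) (\<lambda>b c. g a b c) = \<epsilon> t * h a"
  shows "D3 i j x g = h x"
  using assms by (simp add: D3_def ax)

text \<open>Both sides are convolution inverse to the multiplication C i j \<otimes> C j k
  \<rightarrow> C i k. Concretely, A(x1 y1) x2 y2 A(y3) A(x3) is contracted from the right to the
  left-hand side and from the left to the right-hand side.\<close>

lemma A_mult: "A i k (x * y) = A j k y * A i j x"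
proof (rule lin_ext)
  fix f assume f: "lin f"
  note [intro!] = lin_comp[OF f] pre_lin_rules
  define F where "F x1 x2 x3 y1 y2 y3 = f (A i k (x1 * y1) * (x2 * (y2 * (A j k y3 * A i j x3))))"
    for x1 x2 x3 y1 y2 y3
  define W where "W = D3 i j x (\<lambda>x1 x2 x3. D3 j k y (\<lambda>y1 y2 y3. F x1 x2 x3 y1 y2 y3))"
  have "D3 j k y (\<lambda>y1 y2 y3. F x1 x2 x3 y1 y2 y3) = f (A i k (x1 * y) * (x2 * A i j x3))" for x1 x2 x3
  proof (rule D3_contract23)
    show "tsum (D j k t) (\<lambda>b c. F x1 x2 x3 a b c) = \<epsilon> t * f (A i k (x1 * a) * (x2 * A i j x3))" for t a
    proof -
      have "lin (\<lambda>z. f (A i k (x1 * a) * (x2 * (z * A i j x3))))" by auto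
      from A_r[OF this, of j k t] show ?thesis by (simp add: F_def mult.assoc)
    qed
  qed auto
  moreover have "D3 i j x (\<lambda>x1 x2 x3. f (A i k (x1 * y) * (x2 * A i j x3))) = f (A i k (x * y))"
  proof (rule D3_contract23)
    show "tsum (D i j t) (\<lambda>b c. f (A i k (a * y) * (b * A i j c))) = \<epsilon> t * f (A i k (a * y))" for t a
    proof -
      have "lin (\<lambda>z. f (A i k (a * y) * z))" by auto
      from A_r[OF this, of i j t] show ?thesis by simp
    qed
  qed auto
  ultimately have 1: "W = f (A i k (x * y))" unfolding W_def by simp
  have "W = tsum (D i j x) (\<lambda>r x3. tsum (D i j r) (\<lambda>x1 x2. tsum (D j k y) (\<lambda>q y3.
      tsum (D j k q) (\<lambda>y1 y2. F x1 x2 x3 y1 y2 y3))))"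
    unfolding W_def F_def by (subst coassoc coassoc, (auto)[1])+ simp
  also have "\<dots> = tsum (D i j x) (\<lambda>r x3. tsum (D j k y) (\<lambda>q y3. tsum (D i j r) (\<lambda>x1 x2. 
      tsum (D j k q) (\<lambda>y1 y2. F x1 x2 x3 y1 y2 y3))))"
    by (subst tsum_swap) simp
  also have "\<dots> = tsum (D i j x) (\<lambda>r x3. tsum (D j k y) (\<lambda>q y3.
      \<epsilon> (r * q) * f (A j k y3 * A i j x3)))"
  proof -
    have "tsum (D i j r) (\<lambda>x1 x2. tsum (D j k q) (\<lambda>y1 y2. F x1 x2 x3 y1 y2 y3)) =
      \<epsilon> (r * q) * f (A j k y3 * A i j x3)" for r x3 q y3
    proof -
      have "\<epsilon> (r * q) * f (A j k y3 * A i j x3) =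
        tsum (D i k (r * q)) (\<lambda>a b. f (A i k a * b * (A j k y3 * A i j x3)))"
      proof -
        have "lin (\<lambda>z. f (z * (A j k y3 * A i j x3)))" by auto
        from A_l[OF this, of i k "r * q"] show ?thesis by (simp add: mult.assoc)
      qed
      also have "\<dots> = tsum (D i j r) (\<lambda>x1 x2. tsum (D j k q) (\<lambda>y1 y2. F x1 x2 x3 y1 y2 y3))"
        unfolding F_def by (subst D_mult'[of _ i k _ _ j], (auto)[1]) (simp add: mult.assoc)
      finally show ?thesis by simp
    qed
    then show ?thesis by simp
  qed
  also have "\<dots> = tsum (D i j x) (\<lambda>r x3. \<epsilon> r * f (A j k y * A i j x3))"
  proof -
    have "tsum (D j k y) (\<lambda>q y3. \<epsilon> (r * q) * f (A j k y3 * A i j x3)) = \<epsilon> r * f (A j k y * A i j x3)" for r x3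
    proof -
      have "lin (\<lambda>z. f (A j k z * A i j x3))" by auto
      from ax(3)[OF this, of j k y] show ?thesis by (simp add: \<epsilon>_mult mult.assoc tsum_mult_left)
    qed
    then show ?thesis by simp
  qed
  also have "\<dots> = f (A j k y * A i j x)"
  proof -
    have "lin (\<lambda>z. f (A j k y * A i j z))" by auto
    from ax(3)[OF this, of i j x] show ?thesis by simp
  qed
  finally show "f (A i k (x * y)) = f (A j k y * A i j x)" using 1 by simp
qed

lemma bil_lin: "bil f \<Longrightarrow> vlin g \<Longrightarrow> lin (\<lambda>x. f (g x) y)" "bil f \<Longrightarrow> vlin g \<Longrightarrow> lin (\<lambda>x. f y (g x))"
  by (auto simp: bil_def lin_def vlin_def)

text \<open>The same uniqueness argument for convolution inverses of the comultiplication: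
  \<Delta>(A(x1)) \<Delta>(x2) (A \<otimes> A)(\<Delta>op(x3)), with \<Delta>op the opposite
  coproduct, is contracted in two ways.\<close>

lemma A_D: "bil f \<Longrightarrow> tsum (D j i (A i j x)) f = tsum (D i j x) (\<lambda>w z. f (A i j z) (A i j w))"
proof -
  assume f: "bil f"
  note [intro!] = bil_lin[OF f] pre_lin_rules
  define F where "F x1 x2 x3 = tsum (D j i (A i j x1)) (\<lambda>p q. tsum (D i j x2) (\<lambda>u v.
     tsum (D i j x3) (\<lambda>w z. f (p * (u * A i j z)) (q * (v * A i j w)))))" for x1 x2 x3
  have F: "tri F" unfolding F_def by auto
  have "D3 i j x F = tsum (D i j x) (\<lambda>w z. f (A i j z) (A i j w))"
  proof (rule D3_contract12[OF F])
    show "lin (\<lambda>x. tsum (D i j x) (\<lambda>w z. f (A i j z) (A i j w)))" by auto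
    fix t x3
    define G where "G P Q = tsum (D i j x3) (\<lambda>w z. f (P * A i j z) (Q * A i j w))" for P Q
    have G: "bil G" unfolding G_def by auto
    \<comment> \<open>Multiplicativity merges the first two coproducts into that of A(a) b, which
      the antipode identity reduces to the coproduct of 1.\<close>
    have "tsum (D i j t) (\<lambda>a b. F a b x3) = tsum (D i j t) (\<lambda>a b. tsum (D j j (A i j a * b)) G)"
      unfolding D_mult'[OF G, of j j _ _ i] F_def G_def by (simp add: mult.assoc)
    also have "\<dots> = \<epsilon> t * G 1 1"
      using A_l[OF lin_D'[OF G, of j j], of i j t] D_one'[OF G] by simp
    finally show "tsum (D i j t) (\<lambda>a b. F a b x3) = \<epsilon> t * tsum (D i j x3) (\<lambda>w z. f (A i j z) (A i j w))"
      by (simp add: G_def)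
  qed
  moreover have "D3 i j x F = tsum (D j i (A i j x)) f"
  proof (rule D3_contract23)
    show "lin (\<lambda>x. tsum (D j i (A i j x)) f)" using f by auto
    fix t x1
    \<comment> \<open>The four parts occur in the order u, v, w, z. The inner pair v A(w) cancels
      first, and this brings u next to A(z).\<close>
    have *: "tsum (D i j t) (\<lambda>x2 x3. tsum (D i j x2) (\<lambda>u v.
        tsum (D i j x3) (\<lambda>w z. f (p * (u * A i j z)) (q * (v * A i j w))))) = \<epsilon> t * f p q" for p q
    proof -
      have "tsum (D i j t) (\<lambda>x2 x3. tsum (D i j x2) (\<lambda>u v.
          tsum (D i j x3) (\<lambda>w z. f (p * (u * A i j z)) (q * (v * A i j w))))) =
        tsum (D i j t) (\<lambda>u r. D3 i j r (\<lambda>v w z. f (p * (u * A i j z)) (q * (v * A i j w))))"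
        unfolding D3_def by (subst ax(2)) auto
      also have "\<dots> = tsum (D i j t) (\<lambda>u r. f (p * (u * A i j r)) q)"
      proof -
        have "D3 i j r (\<lambda>v w z. f (p * (u * A i j z)) (q * (v * A i j w))) = f (p * (u * A i j r)) q" for u r
        proof (rule D3_contract12)
          fix t c
          have "lin (\<lambda>y. f (p * (u * A i j c)) (q * y))" by auto
          from A_r[OF this, of i j t]
          show "tsum (D i j t) (\<lambda>a b. f (p * (u * A i j c)) (q * (a * A i j b))) =
            \<epsilon> t * f (p * (u * A i j c)) q" by simp
        qed auto
        then show ?thesis by simp
      qed
      also have "\<dots> = \<epsilon> t * f p q"
      proof -
        have "lin (\<lambda>y. f (p * y) q)" by auto
        from A_r[OF this, of i j t] show ?thesis by simp
      qed
      finally show ?thesis .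
    qed
    have "tsum (D i j t) (\<lambda>b c. F x1 b c) = tsum (D j i (A i j x1)) (\<lambda>p q. tsum (D i j t) (\<lambda>x2 x3.
        tsum (D i j x2) (\<lambda>u v. tsum (D i j x3) (\<lambda>w z. f (p * (u * A i j z)) (q * (v * A i j w))))))"
      unfolding F_def by (subst tsum_swap) simp
    then show "tsum (D i j t) (\<lambda>b c. F x1 b c) = \<epsilon> t * tsum (D j i (A i j x1)) f"
      by (simp add: * tsum_mult_left)
  qed
  ultimately show ?thesis by simp
qed

lemma A_one: "A i i 1 = 1"
proof (rule lin_ext)
  fix h assume h: "lin h"
  have "bil (\<lambda>a r. h (A i i a * r))" by (intro bilI lin_comp[OF h] pre_lin_rules)
  from D_one'[OF this, of i] A_l[OF h, of i i 1] show "h (A i i 1) = h 1"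
    by (simp add: \<epsilon>_one)
qed

text \<open>The inserted product A(y2) y3 is read in two ways. By itself it is a counit, and the
  expression is the left-hand side. But A(v) A(y2) = A(y2 v) also makes the coproduct of a product t
  \<Lambda> appear; there t acts by \<epsilon>, as \<Lambda> is a left integral, and the cointegral
  property leaves h(y).\<close>

lemma integral_dual_basis:
  assumes int: "\<And>x. x * \<Lambda> = s (\<epsilon> x) \<Lambda>"
    and coint: "lin l" "\<And>x h. lin h \<Longrightarrow> tsum (D i i x) (\<lambda>u v. l u * h v) = l x * h 1"
    and norm: "l \<Lambda> = 1" and h: "lin h"
  shows "tsum (D i i \<Lambda>) (\<lambda>u v. l (y * u) * h (A i i v)) = h y"
proof -
  note [intro!] = lin_comp[OF coint(1)] lin_comp[OF h] pre_lin_rules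
  let ?W = "D3 i i y (\<lambda>y1 y2 y3. tsum (D i i \<Lambda>) (\<lambda>u v. l (y1 * u) * h (A i i v * (A i i y2 * y3))))"
  have "?W = tsum (D i i \<Lambda>) (\<lambda>u v. l (y * u) * h (A i i v))"
  proof (rule D3_contract23)
    fix t a
    have "tsum (D i i t) (\<lambda>b c. l (a * u) * h (A i i v * (A i i b * c))) = \<epsilon> t * (l (a * u) * h (A i i v))" for u v
    proof -
      have "lin (\<lambda>z. l (a * u) * h (A i i v * z))" by auto
      from A_l[OF this, of i i t] show ?thesis by simp
    qed
    then show "tsum (D i i t) (\<lambda>b c. tsum (D i i \<Lambda>) (\<lambda>u v. l (a * u) * h (A i i v * (A i i b * c)))) =
        \<epsilon> t * tsum (D i i \<Lambda>) (\<lambda>u v. l (a * u) * h (A i i v))"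
      by (subst tsum_swap) (simp only: tsum_mult_left)
  qed auto
  moreover have "?W = h y"
  proof (rule D3_contract12)
    fix t c
    have "tsum (D i i t) (\<lambda>a b. tsum (D i i \<Lambda>) (\<lambda>u v. l (a * u) * h (A i i v * (A i i b * c)))) =
      tsum (D i i (t * \<Lambda>)) (\<lambda>u v. l u * h (A i i v * c))"
      by (subst D_mult'[of _ i i _ _ i], (auto)[1]) (simp add: A_mult[of i i _ _ i] mult.assoc)
    also have "\<dots> = \<epsilon> t * tsum (D i i \<Lambda>) (\<lambda>u v. l u * h (A i i v * c))"
    proof -
      have "lin (\<lambda>x. tsum (D i i x) (\<lambda>u v. l u * h (A i i v * c)))" by auto
      then show ?thesis by (simp add: int lin_def)
    qed
    also have "tsum (D i i \<Lambda>) (\<lambda>u v. l u * h (A i i v * c)) = h c"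
    proof -
      have "lin (\<lambda>v. h (A i i v * c))" by auto
      from coint(2)[OF this, of \<Lambda>] show ?thesis by (simp add: norm A_one)
    qed
    finally show "tsum (D i i t) (\<lambda>a b. tsum (D i i \<Lambda>) (\<lambda>u v. l (a * u) * h (A i i v * (A i i b * c)))) = \<epsilon> t * h c" .
  qed (auto intro: h)
  ultimately show ?thesis by simp
qed

lemma D3_sum: "D3 i j x (\<lambda>a c d. \<Sum>m\<in>I. f m a c d) = (\<Sum>m\<in>I. D3 i j x (f m))"
  by (simp add: D3_def tsum_sum)

lemma D3_mult_left: "D3 i j x (\<lambda>a c d. k * f a c d) = k * D3 i j x f"
  by (simp add: D3_def tsum_mult_left)

lemma D3_swap: "D3 i j x (\<lambda>a b c. D3 k l y (\<lambda>u v w. f a b c u v w)) =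
    D3 k l y (\<lambda>u v w. D3 i j x (\<lambda>a b c. f a b c u v w))"
  unfolding D3_def
  by (subst tsum_swap, subst (2) tsum_swap, subst tsum_swap, subst (2) tsum_swap) simp

lemma tri_lin: "tri f \<Longrightarrow> vlin g \<Longrightarrow> lin (\<lambda>x. f (g x) y z)"
  "tri f \<Longrightarrow> vlin g \<Longrightarrow> lin (\<lambda>x. f y (g x) z)" "tri f \<Longrightarrow> vlin g \<Longrightarrow> lin (\<lambda>x. f y z (g x))"
  by (auto simp: tri_def lin_def vlin_def)

lemma D3_mult:
  assumes f: "tri f"
  shows "D3 i k (x * y) f =
    D3 i j x (\<lambda>x1 x2 x3. D3 j k y (\<lambda>y1 y2 y3. f (x1 * y1) (x2 * y2) (x3 * y3)))"
proof -
  have f': "bil (f p)" for p using f by (auto simp: tri_def bil_def)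
  have "bil (\<lambda>p q. tsum (D i k q) (f p))"
    by (intro bilI lin_tsum lin_D'[OF f'] tri_lin(1)[OF f] vlin_id)
  note 1 = D_mult'[OF this, of i k x y j]
  have "tsum (D i j r) (\<lambda>x2 x3. tsum (D j k y) (\<lambda>y1 q. g x2 x3 y1 q)) =
     tsum (D j k y) (\<lambda>y1 q. tsum (D i j r) (\<lambda>x2 x3. g x2 x3 y1 q))" for r and g :: "'h \<Rightarrow> 'h \<Rightarrow> 'h \<Rightarrow> 'h \<Rightarrow> 'k"
    by (rule tsum_swap)
  with 1 show ?thesis
    unfolding D3_def by (simp only: D_mult'[where f = "f p" and j = j for p, OF f'])
qed

lemma A_D3:
  assumes f: "tri f"
  shows "D3 j i (A i j x) f = D3 i j x (\<lambda>u v w. f (A i j w) (A i j v) (A i j u))"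
proof -
  have f': "bil (f p)" for p using f by (simp add: tri_def bil_def)
  have 1: "bil (\<lambda>p q. tsum (D j i q) (f p))"
    by (intro bilI lin_tsum lin_D'[OF f'] tri_lin(1)[OF f] vlin_id)
  have 2: "tri (\<lambda>u v w. f (A i j w) (A i j v) (A i j u))"
    by (intro triI tri_lin[OF f] vlin_A vlin_id)
  show ?thesis
    unfolding coassoc[OF 2] by (simp add: D3_def A_D[OF 1] A_D[OF f'])
qed

text \<open>This is tr (L X') = tr (X' L). The numbers \<open>c m p\<close> are the matrix entries
  of L, \<open>X m\<close> is the m-th coordinate of L after X', and on the right L is applied
  first. The families X and X' may carry along the data of further tensor factors.\<close>

lemma trace_swap:
  assumes "\<And>m. lin (X' m)" "vlin L" "\<And>m p. c m p = \<phi> m (L (b p))"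
    "\<And>m v. X m v = (\<Sum>p<n. c m p * X' p v)"
  shows "(\<Sum>m<n. X m (b m)) = (\<Sum>m<n. X' m (L (b m)))"
proof -
  have "(\<Sum>m<n. X m (b m)) = (\<Sum>p<n. \<Sum>m<n. \<phi> m (L (b p)) * X' p (b m))"
    by (simp add: assms(3,4)) (rule sum.swap)
  also have "\<dots> = (\<Sum>p<n. X' p (L (b p)))"
    by (intro sum.cong refl lin_expand[symmetric] assms(1))
  finally show ?thesis .
qed

lemma \<phi>_left: "\<phi> p (x * z) = (\<Sum>q<n. \<phi> p (x * b q) * \<phi> q z)"
  using lin_expand[of "\<lambda>z. \<phi> p (x * z)" z] by (simp add: mult.commute pre_lin_rules)

lemma \<phi>_right: "\<phi> p (z * x) = (\<Sum>q<n. \<phi> p (b q * x) * \<phi> q z)"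
  using lin_expand[of "\<lambda>z. \<phi> p (z * x)" z] by (simp add: mult.commute pre_lin_rules)

end

section \<open>Invertible antipodes and the index-changing moves of the trace\<close>

locale hopf_category =
  hopf_category_pre s D \<epsilon> A n b \<phi>
  for s :: "'k::field \<Rightarrow> 'h::ring_1 \<Rightarrow> 'h" and D \<epsilon> A n b \<phi> +
  fixes B :: "bool \<Rightarrow> bool \<Rightarrow> 'h \<Rightarrow> 'h"
  assumes AB: "A i j (B j i x) = x"
    and BA: "B j i (A i j x) = x"
begin

lemma A_inj: "A i j x = A i j y \<Longrightarrow> x = y"
  by (metis BA)

lemma vlin_B:
  assumes g: "vlin g"
  shows "vlin (\<lambda>x. B i j (g x))"
proof -
  have A: "vlin (A j i)" using A_linear vlin_iff by blast
  have "B i j (g (x + y)) = B i j (g x) + B i j (g y)" for x y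
    by (rule A_inj[of j i]) (use g A in \<open>simp add: vlin_def AB\<close>)
  moreover have "B i j (g (s c x)) = s c (B i j (g x))" for c x
    by (rule A_inj[of j i]) (use g A in \<open>simp add: vlin_def AB\<close>)
  ultimately show ?thesis by (simp add: vlin_def)
qed

lemmas lin_rules = pre_lin_rules vlin_B

lemma B_mult: "B i k (x * y) = B j k y * B i j x"
  by (rule A_inj[of k i]) (simp add: AB A_mult[of k i _ _ j])

lemma B_D: "bil f \<Longrightarrow> tsum (D j i (B i j x)) f = tsum (D i j x) (\<lambda>w z. f (B i j z) (B i j w))"
proof -
  assume f: "bil f"
  have "bil (\<lambda>x y. f (B i j y) (B i j x))" by (intro bil_lin[OF f] lin_rules)
  from A_D[OF this, of i j "B i j x"] show ?thesis by (simp add: AB BA)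
qed

lemma B_one: "B i i 1 = 1"
  by (metis A_one BA)

text \<open>\<open>B\<close> reverses products and undoes \<open>A\<close>, so it carries the
  identity for A(a) r to one for B(r) a, in which the parts of the coproduct stand in opposite
  order.\<close>

lemma B_l: "lin h \<Longrightarrow> tsum (D i j x) (\<lambda>a r. h (B i j r * a)) = \<epsilon> x * h 1"
proof -
  assume h: "lin h"
  show ?thesis
    using A_l[OF lin_comp[OF h, OF vlin_B[OF vlin_id]], of i j x j j]
    by (simp add: B_mult[of j j _ _ i] BA B_one)
qed

lemma B_r: "lin h \<Longrightarrow> tsum (D i j x) (\<lambda>a r. h (r * B i j a)) = \<epsilon> x * h 1"
proof -
  assume h: "lin h"
  show ?thesis
    using A_r[OF lin_comp[OF h, OF vlin_B[OF vlin_id]], of i j x i i]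
    by (simp add: B_mult[of i i _ _ j] BA B_one)
qed

lemma B_D3:
  assumes f: "tri f"
  shows "D3 j i (B i j x) f = D3 i j x (\<lambda>u v w. f (B i j w) (B i j v) (B i j u))"
proof -
  have f': "bil (f p)" for p using f by (simp add: tri_def bil_def)
  have 1: "bil (\<lambda>p q. tsum (D j i q) (f p))"
    by (intro bilI lin_tsum lin_D'[OF f'] tri_lin(1)[OF f] vlin_id)
  have 2: "tri (\<lambda>u v w. f (B i j w) (B i j v) (B i j u))"
    by (intro triI tri_lin[OF f] vlin_B vlin_id)
  show ?thesis
    unfolding coassoc[OF 2] by (simp add: D3_def B_D[OF 1] B_D[OF f'])
qed

text \<open>
  The trace of the operator of the invariant, with the three tensor factors taken in \<open>C la ra\<close>,
  \<open>C lb rb\<close>, \<open>C lc rc\<close> and with elements inserted at every place.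
\<close>

definition T :: "bool \<Rightarrow> bool \<Rightarrow> bool \<Rightarrow> bool \<Rightarrow> bool \<Rightarrow> bool \<Rightarrow> 'h \<Rightarrow> 'h \<Rightarrow> 'h \<Rightarrow> 'h \<Rightarrow> 'h \<Rightarrow> 'h \<Rightarrow> 'h \<Rightarrow> 'h \<Rightarrow> 'h \<Rightarrow> 'h \<Rightarrow> 'h \<Rightarrow> 'h \<Rightarrow> 'k" where
  "T la ra lb rb lc rc x1 x2 x3 x4 y1 y2 y3 y4 z1 z2 z3 z4 =
     (\<Sum>i<n. \<Sum>j<n. \<Sum>k<n. D3 la ra (b i) (\<lambda>a1 a2 a3. D3 lb rb (b j) (\<lambda>b1 b2 b3. D3 lc rc (b k) (\<lambda>c1 c2 c3.
        \<phi> i (x1 * c3 * x2 * a2 * x3 * A lc rc c1 * x4) *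
        (\<phi> j (y1 * a1 * y2 * b2 * y3 * B la ra a3 * y4) *
        \<phi> k (z1 * B lb rb b1 * z2 * c2 * z3 * b3 * z4))))))"

text \<open>This is tr (X Y) = tr (Y X), where Y is left multiplication by \<open>x\<close>, a map
  from C i r to C k r. The trace over C k r becomes one over C i r, and multiplicativity of the
  comultiplication places the three parts of \<open>x\<close> beside the places of a1, a2 and a3.
  The five lemmas that follow treat right multiplication and the other two factors in the same
  way.\<close>

lemma a_left: "T k r lb rb lc rc (x * x1) x2 x3 x4 y1 y2 y3 y4 z1 z2 z3 z4 =
  D3 k i x (\<lambda>u1 u2 u3. T i r lb rb lc rc x1 (x2 * u2) x3 x4 (y1 * u1) y2 y3 (B k i u3 * y4) z1 z2 z3 z4)"
proof -
  obtain c where c: "\<And>p z. \<phi> p (x * z) = (\<Sum>q<n. c p q * \<phi> q z)"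
      "\<And>p q. c p q = \<phi> p (x * b q)"
    by (rule that[of "\<lambda>p q. \<phi> p (x * b q)"]) (rule \<phi>_left, rule refl)
  have 0: "D3 k r v (\<lambda>a1 a2 a3. D3 lb rb (b j') (\<lambda>b1 b2 b3. D3 lc rc (b k') (\<lambda>c1 c2 c3.
      \<phi> i' ((x * x1) * c3 * x2 * a2 * x3 * A lc rc c1 * x4) *
      (\<phi> j' (y1 * a1 * y2 * b2 * y3 * B k r a3 * y4) *
      \<phi> k' (z1 * B lb rb b1 * z2 * c2 * z3 * b3 * z4))))) =
    (\<Sum>p<n. c i' p * D3 k r v (\<lambda>a1 a2 a3. D3 lb rb (b j') (\<lambda>b1 b2 b3. D3 lc rc (b k') (\<lambda>c1 c2 c3.
      \<phi> p (x1 * c3 * x2 * a2 * x3 * A lc rc c1 * x4) *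
      (\<phi> j' (y1 * a1 * y2 * b2 * y3 * B k r a3 * y4) *
      \<phi> k' (z1 * B lb rb b1 * z2 * c2 * z3 * b3 * z4))))))" for i' j' k' v
    by (simp add: mult.assoc c(1) sum_distrib_left sum_distrib_right D3_sum D3_mult_left[symmetric]
        mult.assoc[where 'a = 'k] mult.commute[where 'a = 'k] mult.left_commute[where 'a = 'k])
  have 1: "(\<Sum>i'<n. (\<Sum>j'<n. (\<Sum>k'<n. D3 k r (b i') (\<lambda>a1 a2 a3. D3 lb rb (b j') (\<lambda>b1 b2 b3. D3 lc rc (b k') (\<lambda>c1 c2 c3.
      \<phi> i' ((x * x1) * c3 * x2 * a2 * x3 * A lc rc c1 * x4) *
      (\<phi> j' (y1 * a1 * y2 * b2 * y3 * B k r a3 * y4) *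
      \<phi> k' (z1 * B lb rb b1 * z2 * c2 * z3 * b3 * z4)))))))) =
    (\<Sum>i'<n. (\<Sum>j'<n. (\<Sum>k'<n. D3 k r (x * b i') (\<lambda>a1 a2 a3. D3 lb rb (b j') (\<lambda>b1 b2 b3. D3 lc rc (b k') (\<lambda>c1 c2 c3.
      \<phi> i' (x1 * c3 * x2 * a2 * x3 * A lc rc c1 * x4) *
      (\<phi> j' (y1 * a1 * y2 * b2 * y3 * B k r a3 * y4) *
      \<phi> k' (z1 * B lb rb b1 * z2 * c2 * z3 * b3 * z4))))))))"
    by (rule trace_swap[where L = "\<lambda>v. x * v" and c = c
      and X = "\<lambda>i' v. (\<Sum>j'<n. (\<Sum>k'<n. D3 k r v (\<lambda>a1 a2 a3. D3 lb rb (b j') (\<lambda>b1 b2 b3. D3 lc rc (b k') (\<lambda>c1 c2 c3.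
      \<phi> i' ((x * x1) * c3 * x2 * a2 * x3 * A lc rc c1 * x4) *
      (\<phi> j' (y1 * a1 * y2 * b2 * y3 * B k r a3 * y4) *
      \<phi> k' (z1 * B lb rb b1 * z2 * c2 * z3 * b3 * z4)))))))"
      and X' = "\<lambda>i' v. (\<Sum>j'<n. (\<Sum>k'<n. D3 k r v (\<lambda>a1 a2 a3. D3 lb rb (b j') (\<lambda>b1 b2 b3. D3 lc rc (b k') (\<lambda>c1 c2 c3.
      \<phi> i' (x1 * c3 * x2 * a2 * x3 * A lc rc c1 * x4) *
      (\<phi> j' (y1 * a1 * y2 * b2 * y3 * B k r a3 * y4) *
      \<phi> k' (z1 * B lb rb b1 * z2 * c2 * z3 * b3 * z4)))))))"], (intro lin_rules)[1], (intro lin_rules)[1], rule c(2))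
      (simp only: 0 sum_distrib_left, rule trans[OF sum.cong[OF refl sum.swap] sum.swap])
  have "T k r lb rb lc rc (x * x1) x2 x3 x4 y1 y2 y3 y4 z1 z2 z3 z4 =
    (\<Sum>i'<n. (\<Sum>j'<n. (\<Sum>k'<n. D3 k r (x * b i') (\<lambda>a1 a2 a3. D3 lb rb (b j') (\<lambda>b1 b2 b3. D3 lc rc (b k') (\<lambda>c1 c2 c3.
      \<phi> i' (x1 * c3 * x2 * a2 * x3 * A lc rc c1 * x4) *
      (\<phi> j' (y1 * a1 * y2 * b2 * y3 * B k r a3 * y4) *
      \<phi> k' (z1 * B lb rb b1 * z2 * c2 * z3 * b3 * z4))))))))"
    by (simp only: T_def 1)
  also have "\<dots> = (\<Sum>i'<n. (\<Sum>j'<n. (\<Sum>k'<n. D3 k i x (\<lambda>u1 u2 u3. D3 i r (b i') (\<lambda>a1 a2 a3. D3 lb rb (b j') (\<lambda>b1 b2 b3. D3 lc rc (b k') (\<lambda>c1 c2 c3.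
      \<phi> i' (x1 * c3 * (x2 * u2) * a2 * x3 * A lc rc c1 * x4) *
      (\<phi> j' ((y1 * u1) * a1 * y2 * b2 * y3 * B i r a3 * (B k i u3 * y4)) *
      \<phi> k' (z1 * B lb rb b1 * z2 * c2 * z3 * b3 * z4)))))))))"
  proof -
    have "D3 k r (x * b i') (\<lambda>a1 a2 a3. D3 lb rb (b j') (\<lambda>b1 b2 b3. D3 lc rc (b k') (\<lambda>c1 c2 c3. \<phi> i' (x1 * c3 * x2 * a2 * x3 * A lc rc c1 * x4) *
      (\<phi> j' (y1 * a1 * y2 * b2 * y3 * B k r a3 * y4) *
      \<phi> k' (z1 * B lb rb b1 * z2 * c2 * z3 * b3 * z4))))) =
      D3 k i x (\<lambda>u1 u2 u3. D3 i r (b i') (\<lambda>a1 a2 a3. D3 lb rb (b j') (\<lambda>b1 b2 b3. D3 lc rc (b k') (\<lambda>c1 c2 c3. \<phi> i' (x1 * c3 * (x2 * u2) * a2 * x3 * A lc rc c1 * x4) *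
      (\<phi> j' ((y1 * u1) * a1 * y2 * b2 * y3 * B i r a3 * (B k i u3 * y4)) *
      \<phi> k' (z1 * B lb rb b1 * z2 * c2 * z3 * b3 * z4))))))" for i' j' k'
      by (subst D3_mult[of _ k r x _ i], intro lin_rules)
        (simp add: A_mult[of k r _ _ i] B_mult[of k r _ _ i] mult.assoc)
    then show ?thesis
      by simp
  qed
  finally show ?thesis by (simp only: T_def D3_sum)
qed

lemma a_right: "T l k lb rb lc rc x1 x2 x3 (x4 * x) y1 y2 y3 y4 z1 z2 z3 z4 =
  D3 i k x (\<lambda>u1 u2 u3. T l i lb rb lc rc x1 x2 (u2 * x3) x4 y1 (u1 * y2) (y3 * B i k u3) y4 z1 z2 z3 z4)"
proof -
  obtain c where c: "\<And>p z. \<phi> p (z * x) = (\<Sum>q<n. c p q * \<phi> q z)"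
      "\<And>p q. c p q = \<phi> p (b q * x)"
    by (rule that[of "\<lambda>p q. \<phi> p (b q * x)"]) (rule \<phi>_right, rule refl)
  have 0: "D3 l k v (\<lambda>a1 a2 a3. D3 lb rb (b j') (\<lambda>b1 b2 b3. D3 lc rc (b k') (\<lambda>c1 c2 c3.
      \<phi> i' (x1 * c3 * x2 * a2 * x3 * A lc rc c1 * (x4 * x)) *
      (\<phi> j' (y1 * a1 * y2 * b2 * y3 * B l k a3 * y4) *
      \<phi> k' (z1 * B lb rb b1 * z2 * c2 * z3 * b3 * z4))))) =
    (\<Sum>p<n. c i' p * D3 l k v (\<lambda>a1 a2 a3. D3 lb rb (b j') (\<lambda>b1 b2 b3. D3 lc rc (b k') (\<lambda>c1 c2 c3.
      \<phi> p (x1 * c3 * x2 * a2 * x3 * A lc rc c1 * x4) *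
      (\<phi> j' (y1 * a1 * y2 * b2 * y3 * B l k a3 * y4) *
      \<phi> k' (z1 * B lb rb b1 * z2 * c2 * z3 * b3 * z4))))))" for i' j' k' v
    by (simp add: mult.assoc[symmetric, where 'a = 'h] c(1) sum_distrib_left sum_distrib_right D3_sum D3_mult_left[symmetric]
        mult.assoc[where 'a = 'k] mult.commute[where 'a = 'k] mult.left_commute[where 'a = 'k])
  have 1: "(\<Sum>i'<n. (\<Sum>j'<n. (\<Sum>k'<n. D3 l k (b i') (\<lambda>a1 a2 a3. D3 lb rb (b j') (\<lambda>b1 b2 b3. D3 lc rc (b k') (\<lambda>c1 c2 c3.
      \<phi> i' (x1 * c3 * x2 * a2 * x3 * A lc rc c1 * (x4 * x)) *
      (\<phi> j' (y1 * a1 * y2 * b2 * y3 * B l k a3 * y4) *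
      \<phi> k' (z1 * B lb rb b1 * z2 * c2 * z3 * b3 * z4)))))))) =
    (\<Sum>i'<n. (\<Sum>j'<n. (\<Sum>k'<n. D3 l k (b i' * x) (\<lambda>a1 a2 a3. D3 lb rb (b j') (\<lambda>b1 b2 b3. D3 lc rc (b k') (\<lambda>c1 c2 c3.
      \<phi> i' (x1 * c3 * x2 * a2 * x3 * A lc rc c1 * x4) *
      (\<phi> j' (y1 * a1 * y2 * b2 * y3 * B l k a3 * y4) *
      \<phi> k' (z1 * B lb rb b1 * z2 * c2 * z3 * b3 * z4))))))))"
    by (rule trace_swap[where L = "\<lambda>v. v * x" and c = c
      and X = "\<lambda>i' v. (\<Sum>j'<n. (\<Sum>k'<n. D3 l k v (\<lambda>a1 a2 a3. D3 lb rb (b j') (\<lambda>b1 b2 b3. D3 lc rc (b k') (\<lambda>c1 c2 c3.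
      \<phi> i' (x1 * c3 * x2 * a2 * x3 * A lc rc c1 * (x4 * x)) *
      (\<phi> j' (y1 * a1 * y2 * b2 * y3 * B l k a3 * y4) *
      \<phi> k' (z1 * B lb rb b1 * z2 * c2 * z3 * b3 * z4)))))))"
      and X' = "\<lambda>i' v. (\<Sum>j'<n. (\<Sum>k'<n. D3 l k v (\<lambda>a1 a2 a3. D3 lb rb (b j') (\<lambda>b1 b2 b3. D3 lc rc (b k') (\<lambda>c1 c2 c3.
      \<phi> i' (x1 * c3 * x2 * a2 * x3 * A lc rc c1 * x4) *
      (\<phi> j' (y1 * a1 * y2 * b2 * y3 * B l k a3 * y4) *
      \<phi> k' (z1 * B lb rb b1 * z2 * c2 * z3 * b3 * z4)))))))"], (intro lin_rules)[1], (intro lin_rules)[1], rule c(2))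
      (simp only: 0 sum_distrib_left, rule trans[OF sum.cong[OF refl sum.swap] sum.swap])
  have "T l k lb rb lc rc x1 x2 x3 (x4 * x) y1 y2 y3 y4 z1 z2 z3 z4 =
    (\<Sum>i'<n. (\<Sum>j'<n. (\<Sum>k'<n. D3 l k (b i' * x) (\<lambda>a1 a2 a3. D3 lb rb (b j') (\<lambda>b1 b2 b3. D3 lc rc (b k') (\<lambda>c1 c2 c3.
      \<phi> i' (x1 * c3 * x2 * a2 * x3 * A lc rc c1 * x4) *
      (\<phi> j' (y1 * a1 * y2 * b2 * y3 * B l k a3 * y4) *
      \<phi> k' (z1 * B lb rb b1 * z2 * c2 * z3 * b3 * z4))))))))"
    by (simp only: T_def 1)
  also have "\<dots> = (\<Sum>i'<n. (\<Sum>j'<n. (\<Sum>k'<n. D3 i k x (\<lambda>u1 u2 u3. D3 l i (b i') (\<lambda>a1 a2 a3. D3 lb rb (b j') (\<lambda>b1 b2 b3. D3 lc rc (b k') (\<lambda>c1 c2 c3.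
      \<phi> i' (x1 * c3 * x2 * a2 * (u2 * x3) * A lc rc c1 * x4) *
      (\<phi> j' (y1 * a1 * (u1 * y2) * b2 * (y3 * B i k u3) * B l i a3 * y4) *
      \<phi> k' (z1 * B lb rb b1 * z2 * c2 * z3 * b3 * z4)))))))))"
  proof -
    have "D3 l k (b i' * x) (\<lambda>a1 a2 a3. D3 lb rb (b j') (\<lambda>b1 b2 b3. D3 lc rc (b k') (\<lambda>c1 c2 c3. \<phi> i' (x1 * c3 * x2 * a2 * x3 * A lc rc c1 * x4) *
      (\<phi> j' (y1 * a1 * y2 * b2 * y3 * B l k a3 * y4) *
      \<phi> k' (z1 * B lb rb b1 * z2 * c2 * z3 * b3 * z4))))) =
      D3 i k x (\<lambda>u1 u2 u3. D3 l i (b i') (\<lambda>a1 a2 a3. D3 lb rb (b j') (\<lambda>b1 b2 b3. D3 lc rc (b k') (\<lambda>c1 c2 c3. \<phi> i' (x1 * c3 * x2 * a2 * (u2 * x3) * A lc rc c1 * x4) *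
      (\<phi> j' (y1 * a1 * (u1 * y2) * b2 * (y3 * B i k u3) * B l i a3 * y4) *
      \<phi> k' (z1 * B lb rb b1 * z2 * c2 * z3 * b3 * z4))))))" for i' j' k'
      by (subst D3_mult[of _ l k _ x i], intro lin_rules)
        (simp add: A_mult[of l k _ _ i] B_mult[of l k _ _ i] mult.assoc D3_swap[of i k x l i])
    then show ?thesis
      by simp
  qed
  finally show ?thesis by (simp only: T_def D3_sum)
qed

lemma b_left: "T la ra k r lc rc x1 x2 x3 x4 (x * y1) y2 y3 y4 z1 z2 z3 z4 =
  D3 k i x (\<lambda>u1 u2 u3. T la ra i r lc rc x1 x2 x3 x4 y1 (y2 * u2) y3 y4 z1 (B k i u1 * z2) (z3 * u3) z4)"
proof -
  obtain c where c: "\<And>p z. \<phi> p (x * z) = (\<Sum>q<n. c p q * \<phi> q z)"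
      "\<And>p q. c p q = \<phi> p (x * b q)"
    by (rule that[of "\<lambda>p q. \<phi> p (x * b q)"]) (rule \<phi>_left, rule refl)
  have 0: "D3 la ra (b i') (\<lambda>a1 a2 a3. D3 k r v (\<lambda>b1 b2 b3. D3 lc rc (b k') (\<lambda>c1 c2 c3.
      \<phi> i' (x1 * c3 * x2 * a2 * x3 * A lc rc c1 * x4) *
      (\<phi> j' ((x * y1) * a1 * y2 * b2 * y3 * B la ra a3 * y4) *
      \<phi> k' (z1 * B k r b1 * z2 * c2 * z3 * b3 * z4))))) =
    (\<Sum>p<n. c j' p * D3 la ra (b i') (\<lambda>a1 a2 a3. D3 k r v (\<lambda>b1 b2 b3. D3 lc rc (b k') (\<lambda>c1 c2 c3.
      \<phi> i' (x1 * c3 * x2 * a2 * x3 * A lc rc c1 * x4) *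
      (\<phi> p (y1 * a1 * y2 * b2 * y3 * B la ra a3 * y4) *
      \<phi> k' (z1 * B k r b1 * z2 * c2 * z3 * b3 * z4))))))" for i' j' k' v
    by (simp add: mult.assoc c(1) sum_distrib_left sum_distrib_right D3_sum D3_mult_left[symmetric]
        mult.assoc[where 'a = 'k] mult.commute[where 'a = 'k] mult.left_commute[where 'a = 'k])
  have 1: "(\<Sum>j'<n. (\<Sum>k'<n. D3 la ra (b i') (\<lambda>a1 a2 a3. D3 k r (b j') (\<lambda>b1 b2 b3. D3 lc rc (b k') (\<lambda>c1 c2 c3.
      \<phi> i' (x1 * c3 * x2 * a2 * x3 * A lc rc c1 * x4) *
      (\<phi> j' ((x * y1) * a1 * y2 * b2 * y3 * B la ra a3 * y4) *
      \<phi> k' (z1 * B k r b1 * z2 * c2 * z3 * b3 * z4))))))) =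
    (\<Sum>j'<n. (\<Sum>k'<n. D3 la ra (b i') (\<lambda>a1 a2 a3. D3 k r (x * b j') (\<lambda>b1 b2 b3. D3 lc rc (b k') (\<lambda>c1 c2 c3.
      \<phi> i' (x1 * c3 * x2 * a2 * x3 * A lc rc c1 * x4) *
      (\<phi> j' (y1 * a1 * y2 * b2 * y3 * B la ra a3 * y4) *
      \<phi> k' (z1 * B k r b1 * z2 * c2 * z3 * b3 * z4)))))))" for i'
    by (rule trace_swap[where L = "\<lambda>v. x * v" and c = c
      and X = "\<lambda>j' v. (\<Sum>k'<n. D3 la ra (b i') (\<lambda>a1 a2 a3. D3 k r v (\<lambda>b1 b2 b3. D3 lc rc (b k') (\<lambda>c1 c2 c3.
      \<phi> i' (x1 * c3 * x2 * a2 * x3 * A lc rc c1 * x4) *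
      (\<phi> j' ((x * y1) * a1 * y2 * b2 * y3 * B la ra a3 * y4) *
      \<phi> k' (z1 * B k r b1 * z2 * c2 * z3 * b3 * z4))))))"
      and X' = "\<lambda>j' v. (\<Sum>k'<n. D3 la ra (b i') (\<lambda>a1 a2 a3. D3 k r v (\<lambda>b1 b2 b3. D3 lc rc (b k') (\<lambda>c1 c2 c3.
      \<phi> i' (x1 * c3 * x2 * a2 * x3 * A lc rc c1 * x4) *
      (\<phi> j' (y1 * a1 * y2 * b2 * y3 * B la ra a3 * y4) *
      \<phi> k' (z1 * B k r b1 * z2 * c2 * z3 * b3 * z4))))))"], (intro lin_rules)[1], (intro lin_rules)[1], rule c(2))
      (simp only: 0 sum_distrib_left, rule sum.swap)
  have "T la ra k r lc rc x1 x2 x3 x4 (x * y1) y2 y3 y4 z1 z2 z3 z4 =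
    (\<Sum>i'<n. (\<Sum>j'<n. (\<Sum>k'<n. D3 la ra (b i') (\<lambda>a1 a2 a3. D3 k r (x * b j') (\<lambda>b1 b2 b3. D3 lc rc (b k') (\<lambda>c1 c2 c3.
      \<phi> i' (x1 * c3 * x2 * a2 * x3 * A lc rc c1 * x4) *
      (\<phi> j' (y1 * a1 * y2 * b2 * y3 * B la ra a3 * y4) *
      \<phi> k' (z1 * B k r b1 * z2 * c2 * z3 * b3 * z4))))))))"
    by (simp only: T_def 1)
  also have "\<dots> = (\<Sum>i'<n. (\<Sum>j'<n. (\<Sum>k'<n. D3 k i x (\<lambda>u1 u2 u3. D3 la ra (b i') (\<lambda>a1 a2 a3. D3 i r (b j') (\<lambda>b1 b2 b3. D3 lc rc (b k') (\<lambda>c1 c2 c3.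
      \<phi> i' (x1 * c3 * x2 * a2 * x3 * A lc rc c1 * x4) *
      (\<phi> j' (y1 * a1 * (y2 * u2) * b2 * y3 * B la ra a3 * y4) *
      \<phi> k' (z1 * B i r b1 * (B k i u1 * z2) * c2 * (z3 * u3) * b3 * z4)))))))))"
  proof -
    have "D3 k r (x * b j') (\<lambda>b1 b2 b3. D3 lc rc (b k') (\<lambda>c1 c2 c3. \<phi> i' (x1 * c3 * x2 * a2 * x3 * A lc rc c1 * x4) *
      (\<phi> j' (y1 * a1 * y2 * b2 * y3 * B la ra a3 * y4) *
      \<phi> k' (z1 * B k r b1 * z2 * c2 * z3 * b3 * z4)))) =
      D3 k i x (\<lambda>u1 u2 u3. D3 i r (b j') (\<lambda>b1 b2 b3. D3 lc rc (b k') (\<lambda>c1 c2 c3. \<phi> i' (x1 * c3 * x2 * a2 * x3 * A lc rc c1 * x4) *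
      (\<phi> j' (y1 * a1 * (y2 * u2) * b2 * y3 * B la ra a3 * y4) *
      \<phi> k' (z1 * B i r b1 * (B k i u1 * z2) * c2 * (z3 * u3) * b3 * z4)))))" for i' j' k' a1 a2 a3
      by (subst D3_mult[of _ k r x _ i], intro lin_rules)
        (simp add: A_mult[of k r _ _ i] B_mult[of k r _ _ i] mult.assoc)
    then show ?thesis
      by (simp only: D3_swap[of la ra _ k i x])
  qed
  finally show ?thesis by (simp only: T_def D3_sum)
qed

lemma b_right: "T la ra l k lc rc x1 x2 x3 x4 y1 y2 y3 (y4 * x) z1 z2 z3 z4 =
  D3 i k x (\<lambda>u1 u2 u3. T la ra l i lc rc x1 x2 x3 x4 y1 y2 (u2 * y3) y4 (z1 * B i k u1) z2 z3 (u3 * z4))"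
proof -
  obtain c where c: "\<And>p z. \<phi> p (z * x) = (\<Sum>q<n. c p q * \<phi> q z)"
      "\<And>p q. c p q = \<phi> p (b q * x)"
    by (rule that[of "\<lambda>p q. \<phi> p (b q * x)"]) (rule \<phi>_right, rule refl)
  have 0: "D3 la ra (b i') (\<lambda>a1 a2 a3. D3 l k v (\<lambda>b1 b2 b3. D3 lc rc (b k') (\<lambda>c1 c2 c3.
      \<phi> i' (x1 * c3 * x2 * a2 * x3 * A lc rc c1 * x4) *
      (\<phi> j' (y1 * a1 * y2 * b2 * y3 * B la ra a3 * (y4 * x)) *
      \<phi> k' (z1 * B l k b1 * z2 * c2 * z3 * b3 * z4))))) =
    (\<Sum>p<n. c j' p * D3 la ra (b i') (\<lambda>a1 a2 a3. D3 l k v (\<lambda>b1 b2 b3. D3 lc rc (b k') (\<lambda>c1 c2 c3.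
      \<phi> i' (x1 * c3 * x2 * a2 * x3 * A lc rc c1 * x4) *
      (\<phi> p (y1 * a1 * y2 * b2 * y3 * B la ra a3 * y4) *
      \<phi> k' (z1 * B l k b1 * z2 * c2 * z3 * b3 * z4))))))" for i' j' k' v
    by (simp add: mult.assoc[symmetric, where 'a = 'h] c(1) sum_distrib_left sum_distrib_right D3_sum D3_mult_left[symmetric]
        mult.assoc[where 'a = 'k] mult.commute[where 'a = 'k] mult.left_commute[where 'a = 'k])
  have 1: "(\<Sum>j'<n. (\<Sum>k'<n. D3 la ra (b i') (\<lambda>a1 a2 a3. D3 l k (b j') (\<lambda>b1 b2 b3. D3 lc rc (b k') (\<lambda>c1 c2 c3.
      \<phi> i' (x1 * c3 * x2 * a2 * x3 * A lc rc c1 * x4) *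
      (\<phi> j' (y1 * a1 * y2 * b2 * y3 * B la ra a3 * (y4 * x)) *
      \<phi> k' (z1 * B l k b1 * z2 * c2 * z3 * b3 * z4))))))) =
    (\<Sum>j'<n. (\<Sum>k'<n. D3 la ra (b i') (\<lambda>a1 a2 a3. D3 l k (b j' * x) (\<lambda>b1 b2 b3. D3 lc rc (b k') (\<lambda>c1 c2 c3.
      \<phi> i' (x1 * c3 * x2 * a2 * x3 * A lc rc c1 * x4) *
      (\<phi> j' (y1 * a1 * y2 * b2 * y3 * B la ra a3 * y4) *
      \<phi> k' (z1 * B l k b1 * z2 * c2 * z3 * b3 * z4)))))))" for i'
    by (rule trace_swap[where L = "\<lambda>v. v * x" and c = c
      and X = "\<lambda>j' v. (\<Sum>k'<n. D3 la ra (b i') (\<lambda>a1 a2 a3. D3 l k v (\<lambda>b1 b2 b3. D3 lc rc (b k') (\<lambda>c1 c2 c3.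
      \<phi> i' (x1 * c3 * x2 * a2 * x3 * A lc rc c1 * x4) *
      (\<phi> j' (y1 * a1 * y2 * b2 * y3 * B la ra a3 * (y4 * x)) *
      \<phi> k' (z1 * B l k b1 * z2 * c2 * z3 * b3 * z4))))))"
      and X' = "\<lambda>j' v. (\<Sum>k'<n. D3 la ra (b i') (\<lambda>a1 a2 a3. D3 l k v (\<lambda>b1 b2 b3. D3 lc rc (b k') (\<lambda>c1 c2 c3.
      \<phi> i' (x1 * c3 * x2 * a2 * x3 * A lc rc c1 * x4) *
      (\<phi> j' (y1 * a1 * y2 * b2 * y3 * B la ra a3 * y4) *
      \<phi> k' (z1 * B l k b1 * z2 * c2 * z3 * b3 * z4))))))"], (intro lin_rules)[1], (intro lin_rules)[1], rule c(2))
      (simp only: 0 sum_distrib_left, rule sum.swap)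
  have "T la ra l k lc rc x1 x2 x3 x4 y1 y2 y3 (y4 * x) z1 z2 z3 z4 =
    (\<Sum>i'<n. (\<Sum>j'<n. (\<Sum>k'<n. D3 la ra (b i') (\<lambda>a1 a2 a3. D3 l k (b j' * x) (\<lambda>b1 b2 b3. D3 lc rc (b k') (\<lambda>c1 c2 c3.
      \<phi> i' (x1 * c3 * x2 * a2 * x3 * A lc rc c1 * x4) *
      (\<phi> j' (y1 * a1 * y2 * b2 * y3 * B la ra a3 * y4) *
      \<phi> k' (z1 * B l k b1 * z2 * c2 * z3 * b3 * z4))))))))"
    by (simp only: T_def 1)
  also have "\<dots> = (\<Sum>i'<n. (\<Sum>j'<n. (\<Sum>k'<n. D3 i k x (\<lambda>u1 u2 u3. D3 la ra (b i') (\<lambda>a1 a2 a3. D3 l i (b j') (\<lambda>b1 b2 b3. D3 lc rc (b k') (\<lambda>c1 c2 c3.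
      \<phi> i' (x1 * c3 * x2 * a2 * x3 * A lc rc c1 * x4) *
      (\<phi> j' (y1 * a1 * y2 * b2 * (u2 * y3) * B la ra a3 * y4) *
      \<phi> k' ((z1 * B i k u1) * B l i b1 * z2 * c2 * z3 * b3 * (u3 * z4))))))))))"
  proof -
    have "D3 l k (b j' * x) (\<lambda>b1 b2 b3. D3 lc rc (b k') (\<lambda>c1 c2 c3. \<phi> i' (x1 * c3 * x2 * a2 * x3 * A lc rc c1 * x4) *
      (\<phi> j' (y1 * a1 * y2 * b2 * y3 * B la ra a3 * y4) *
      \<phi> k' (z1 * B l k b1 * z2 * c2 * z3 * b3 * z4)))) =
      D3 i k x (\<lambda>u1 u2 u3. D3 l i (b j') (\<lambda>b1 b2 b3. D3 lc rc (b k') (\<lambda>c1 c2 c3. \<phi> i' (x1 * c3 * x2 * a2 * x3 * A lc rc c1 * x4) *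
      (\<phi> j' (y1 * a1 * y2 * b2 * (u2 * y3) * B la ra a3 * y4) *
      \<phi> k' ((z1 * B i k u1) * B l i b1 * z2 * c2 * z3 * b3 * (u3 * z4))))))" for i' j' k' a1 a2 a3
      by (subst D3_mult[of _ l k _ x i], intro lin_rules)
        (simp add: A_mult[of l k _ _ i] B_mult[of l k _ _ i] mult.assoc D3_swap[of i k x l i])
    then show ?thesis
      by (simp only: D3_swap[of la ra _ i k x])
  qed
  finally show ?thesis by (simp only: T_def D3_sum)
qed

lemma c_left: "T la ra lb rb k r x1 x2 x3 x4 y1 y2 y3 y4 (x * z1) z2 z3 z4 =
  D3 k i x (\<lambda>u1 u2 u3. T la ra lb rb i r (x1 * u3) x2 x3 (A k i u1 * x4) y1 y2 y3 y4 z1 (z2 * u2) z3 z4)"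
proof -
  obtain c where c: "\<And>p z. \<phi> p (x * z) = (\<Sum>q<n. c p q * \<phi> q z)"
      "\<And>p q. c p q = \<phi> p (x * b q)"
    by (rule that[of "\<lambda>p q. \<phi> p (x * b q)"]) (rule \<phi>_left, rule refl)
  have 0: "D3 la ra (b i') (\<lambda>a1 a2 a3. D3 lb rb (b j') (\<lambda>b1 b2 b3. D3 k r v (\<lambda>c1 c2 c3.
      \<phi> i' (x1 * c3 * x2 * a2 * x3 * A k r c1 * x4) *
      (\<phi> j' (y1 * a1 * y2 * b2 * y3 * B la ra a3 * y4) *
      \<phi> k' ((x * z1) * B lb rb b1 * z2 * c2 * z3 * b3 * z4))))) =
    (\<Sum>p<n. c k' p * D3 la ra (b i') (\<lambda>a1 a2 a3. D3 lb rb (b j') (\<lambda>b1 b2 b3. D3 k r v (\<lambda>c1 c2 c3.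
      \<phi> i' (x1 * c3 * x2 * a2 * x3 * A k r c1 * x4) *
      (\<phi> j' (y1 * a1 * y2 * b2 * y3 * B la ra a3 * y4) *
      \<phi> p (z1 * B lb rb b1 * z2 * c2 * z3 * b3 * z4))))))" for i' j' k' v
    by (simp add: mult.assoc c(1) sum_distrib_left sum_distrib_right D3_sum D3_mult_left[symmetric]
        mult.assoc[where 'a = 'k] mult.commute[where 'a = 'k] mult.left_commute[where 'a = 'k])
  have 1: "(\<Sum>k'<n. D3 la ra (b i') (\<lambda>a1 a2 a3. D3 lb rb (b j') (\<lambda>b1 b2 b3. D3 k r (b k') (\<lambda>c1 c2 c3.
      \<phi> i' (x1 * c3 * x2 * a2 * x3 * A k r c1 * x4) *
      (\<phi> j' (y1 * a1 * y2 * b2 * y3 * B la ra a3 * y4) *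
      \<phi> k' ((x * z1) * B lb rb b1 * z2 * c2 * z3 * b3 * z4)))))) =
    (\<Sum>k'<n. D3 la ra (b i') (\<lambda>a1 a2 a3. D3 lb rb (b j') (\<lambda>b1 b2 b3. D3 k r (x * b k') (\<lambda>c1 c2 c3.
      \<phi> i' (x1 * c3 * x2 * a2 * x3 * A k r c1 * x4) *
      (\<phi> j' (y1 * a1 * y2 * b2 * y3 * B la ra a3 * y4) *
      \<phi> k' (z1 * B lb rb b1 * z2 * c2 * z3 * b3 * z4))))))" for i' j'
    by (rule trace_swap[where L = "\<lambda>v. x * v" and c = c
      and X = "\<lambda>k' v. D3 la ra (b i') (\<lambda>a1 a2 a3. D3 lb rb (b j') (\<lambda>b1 b2 b3. D3 k r v (\<lambda>c1 c2 c3.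
      \<phi> i' (x1 * c3 * x2 * a2 * x3 * A k r c1 * x4) *
      (\<phi> j' (y1 * a1 * y2 * b2 * y3 * B la ra a3 * y4) *
      \<phi> k' ((x * z1) * B lb rb b1 * z2 * c2 * z3 * b3 * z4)))))"
      and X' = "\<lambda>k' v. D3 la ra (b i') (\<lambda>a1 a2 a3. D3 lb rb (b j') (\<lambda>b1 b2 b3. D3 k r v (\<lambda>c1 c2 c3.
      \<phi> i' (x1 * c3 * x2 * a2 * x3 * A k r c1 * x4) *
      (\<phi> j' (y1 * a1 * y2 * b2 * y3 * B la ra a3 * y4) *
      \<phi> k' (z1 * B lb rb b1 * z2 * c2 * z3 * b3 * z4)))))"], (intro lin_rules)[1], (intro lin_rules)[1], rule c(2))
      (rule 0)
  have "T la ra lb rb k r x1 x2 x3 x4 y1 y2 y3 y4 (x * z1) z2 z3 z4 =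
    (\<Sum>i'<n. (\<Sum>j'<n. (\<Sum>k'<n. D3 la ra (b i') (\<lambda>a1 a2 a3. D3 lb rb (b j') (\<lambda>b1 b2 b3. D3 k r (x * b k') (\<lambda>c1 c2 c3.
      \<phi> i' (x1 * c3 * x2 * a2 * x3 * A k r c1 * x4) *
      (\<phi> j' (y1 * a1 * y2 * b2 * y3 * B la ra a3 * y4) *
      \<phi> k' (z1 * B lb rb b1 * z2 * c2 * z3 * b3 * z4))))))))"
    by (simp only: T_def 1)
  also have "\<dots> = (\<Sum>i'<n. (\<Sum>j'<n. (\<Sum>k'<n. D3 k i x (\<lambda>u1 u2 u3. D3 la ra (b i') (\<lambda>a1 a2 a3. D3 lb rb (b j') (\<lambda>b1 b2 b3. D3 i r (b k') (\<lambda>c1 c2 c3.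
      \<phi> i' ((x1 * u3) * c3 * x2 * a2 * x3 * A i r c1 * (A k i u1 * x4)) *
      (\<phi> j' (y1 * a1 * y2 * b2 * y3 * B la ra a3 * y4) *
      \<phi> k' (z1 * B lb rb b1 * (z2 * u2) * c2 * z3 * b3 * z4)))))))))"
  proof -
    have "D3 k r (x * b k') (\<lambda>c1 c2 c3. \<phi> i' (x1 * c3 * x2 * a2 * x3 * A k r c1 * x4) *
      (\<phi> j' (y1 * a1 * y2 * b2 * y3 * B la ra a3 * y4) *
      \<phi> k' (z1 * B lb rb b1 * z2 * c2 * z3 * b3 * z4))) =
      D3 k i x (\<lambda>u1 u2 u3. D3 i r (b k') (\<lambda>c1 c2 c3. \<phi> i' ((x1 * u3) * c3 * x2 * a2 * x3 * A i r c1 * (A k i u1 * x4)) *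
      (\<phi> j' (y1 * a1 * y2 * b2 * y3 * B la ra a3 * y4) *
      \<phi> k' (z1 * B lb rb b1 * (z2 * u2) * c2 * z3 * b3 * z4))))" for i' j' k' a1 a2 a3 b1 b2 b3
      by (subst D3_mult[of _ k r x _ i], intro lin_rules)
        (simp add: A_mult[of k r _ _ i] B_mult[of k r _ _ i] mult.assoc)
    then show ?thesis
      by (simp only: D3_swap[of la ra _ k i x] D3_swap[of lb rb _ k i x])
  qed
  finally show ?thesis by (simp only: T_def D3_sum)
qed

lemma c_right: "T la ra lb rb l k x1 x2 x3 x4 y1 y2 y3 y4 z1 z2 z3 (z4 * x) =
  D3 i k x (\<lambda>u1 u2 u3. T la ra lb rb l i x1 (u3 * x2) (x3 * A i k u1) x4 y1 y2 y3 y4 z1 z2 (u2 * z3) z4)"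
proof -
  obtain c where c: "\<And>p z. \<phi> p (z * x) = (\<Sum>q<n. c p q * \<phi> q z)"
      "\<And>p q. c p q = \<phi> p (b q * x)"
    by (rule that[of "\<lambda>p q. \<phi> p (b q * x)"]) (rule \<phi>_right, rule refl)
  have 0: "D3 la ra (b i') (\<lambda>a1 a2 a3. D3 lb rb (b j') (\<lambda>b1 b2 b3. D3 l k v (\<lambda>c1 c2 c3.
      \<phi> i' (x1 * c3 * x2 * a2 * x3 * A l k c1 * x4) *
      (\<phi> j' (y1 * a1 * y2 * b2 * y3 * B la ra a3 * y4) *
      \<phi> k' (z1 * B lb rb b1 * z2 * c2 * z3 * b3 * (z4 * x)))))) =
    (\<Sum>p<n. c k' p * D3 la ra (b i') (\<lambda>a1 a2 a3. D3 lb rb (b j') (\<lambda>b1 b2 b3. D3 l k v (\<lambda>c1 c2 c3.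
      \<phi> i' (x1 * c3 * x2 * a2 * x3 * A l k c1 * x4) *
      (\<phi> j' (y1 * a1 * y2 * b2 * y3 * B la ra a3 * y4) *
      \<phi> p (z1 * B lb rb b1 * z2 * c2 * z3 * b3 * z4))))))" for i' j' k' v
    by (simp add: mult.assoc[symmetric, where 'a = 'h] c(1) sum_distrib_left sum_distrib_right D3_sum D3_mult_left[symmetric]
        mult.assoc[where 'a = 'k] mult.commute[where 'a = 'k] mult.left_commute[where 'a = 'k])
  have 1: "(\<Sum>k'<n. D3 la ra (b i') (\<lambda>a1 a2 a3. D3 lb rb (b j') (\<lambda>b1 b2 b3. D3 l k (b k') (\<lambda>c1 c2 c3.
      \<phi> i' (x1 * c3 * x2 * a2 * x3 * A l k c1 * x4) *
      (\<phi> j' (y1 * a1 * y2 * b2 * y3 * B la ra a3 * y4) *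
      \<phi> k' (z1 * B lb rb b1 * z2 * c2 * z3 * b3 * (z4 * x))))))) =
    (\<Sum>k'<n. D3 la ra (b i') (\<lambda>a1 a2 a3. D3 lb rb (b j') (\<lambda>b1 b2 b3. D3 l k (b k' * x) (\<lambda>c1 c2 c3.
      \<phi> i' (x1 * c3 * x2 * a2 * x3 * A l k c1 * x4) *
      (\<phi> j' (y1 * a1 * y2 * b2 * y3 * B la ra a3 * y4) *
      \<phi> k' (z1 * B lb rb b1 * z2 * c2 * z3 * b3 * z4))))))" for i' j'
    by (rule trace_swap[where L = "\<lambda>v. v * x" and c = c
      and X = "\<lambda>k' v. D3 la ra (b i') (\<lambda>a1 a2 a3. D3 lb rb (b j') (\<lambda>b1 b2 b3. D3 l k v (\<lambda>c1 c2 c3.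
      \<phi> i' (x1 * c3 * x2 * a2 * x3 * A l k c1 * x4) *
      (\<phi> j' (y1 * a1 * y2 * b2 * y3 * B la ra a3 * y4) *
      \<phi> k' (z1 * B lb rb b1 * z2 * c2 * z3 * b3 * (z4 * x))))))"
      and X' = "\<lambda>k' v. D3 la ra (b i') (\<lambda>a1 a2 a3. D3 lb rb (b j') (\<lambda>b1 b2 b3. D3 l k v (\<lambda>c1 c2 c3.
      \<phi> i' (x1 * c3 * x2 * a2 * x3 * A l k c1 * x4) *
      (\<phi> j' (y1 * a1 * y2 * b2 * y3 * B la ra a3 * y4) *
      \<phi> k' (z1 * B lb rb b1 * z2 * c2 * z3 * b3 * z4)))))"], (intro lin_rules)[1], (intro lin_rules)[1], rule c(2))
      (rule 0)
  have "T la ra lb rb l k x1 x2 x3 x4 y1 y2 y3 y4 z1 z2 z3 (z4 * x) =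
    (\<Sum>i'<n. (\<Sum>j'<n. (\<Sum>k'<n. D3 la ra (b i') (\<lambda>a1 a2 a3. D3 lb rb (b j') (\<lambda>b1 b2 b3. D3 l k (b k' * x) (\<lambda>c1 c2 c3.
      \<phi> i' (x1 * c3 * x2 * a2 * x3 * A l k c1 * x4) *
      (\<phi> j' (y1 * a1 * y2 * b2 * y3 * B la ra a3 * y4) *
      \<phi> k' (z1 * B lb rb b1 * z2 * c2 * z3 * b3 * z4))))))))"
    by (simp only: T_def 1)
  also have "\<dots> = (\<Sum>i'<n. (\<Sum>j'<n. (\<Sum>k'<n. D3 i k x (\<lambda>u1 u2 u3. D3 la ra (b i') (\<lambda>a1 a2 a3. D3 lb rb (b j') (\<lambda>b1 b2 b3. D3 l i (b k') (\<lambda>c1 c2 c3.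
      \<phi> i' (x1 * c3 * (u3 * x2) * a2 * (x3 * A i k u1) * A l i c1 * x4) *
      (\<phi> j' (y1 * a1 * y2 * b2 * y3 * B la ra a3 * y4) *
      \<phi> k' (z1 * B lb rb b1 * z2 * c2 * (u2 * z3) * b3 * z4)))))))))"
  proof -
    have "D3 l k (b k' * x) (\<lambda>c1 c2 c3. \<phi> i' (x1 * c3 * x2 * a2 * x3 * A l k c1 * x4) *
      (\<phi> j' (y1 * a1 * y2 * b2 * y3 * B la ra a3 * y4) *
      \<phi> k' (z1 * B lb rb b1 * z2 * c2 * z3 * b3 * z4))) =
      D3 i k x (\<lambda>u1 u2 u3. D3 l i (b k') (\<lambda>c1 c2 c3. \<phi> i' (x1 * c3 * (u3 * x2) * a2 * (x3 * A i k u1) * A l i c1 * x4) *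
      (\<phi> j' (y1 * a1 * y2 * b2 * y3 * B la ra a3 * y4) *
      \<phi> k' (z1 * B lb rb b1 * z2 * c2 * (u2 * z3) * b3 * z4))))" for i' j' k' a1 a2 a3 b1 b2 b3
      by (subst D3_mult[of _ l k _ x i], intro lin_rules)
        (simp add: A_mult[of l k _ _ i] B_mult[of l k _ _ i] mult.assoc D3_swap[of i k x l i])
    then show ?thesis
      by (simp only: D3_swap[of la ra _ i k x] D3_swap[of lb rb _ i k x])
  qed
  finally show ?thesis by (simp only: T_def D3_sum)
qed

lemma T_lin:
  assumes "vlin g"
  shows "lin (\<lambda>x. T la ra lb rb lc rc (g x) x2 x3 x4 y1 y2 y3 y4 z1 z2 z3 z4)"
    and "lin (\<lambda>x. T la ra lb rb lc rc x1 (g x) x3 x4 y1 y2 y3 y4 z1 z2 z3 z4)"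
    and "lin (\<lambda>x. T la ra lb rb lc rc x1 x2 (g x) x4 y1 y2 y3 y4 z1 z2 z3 z4)"
    and "lin (\<lambda>x. T la ra lb rb lc rc x1 x2 x3 (g x) y1 y2 y3 y4 z1 z2 z3 z4)"
    and "lin (\<lambda>x. T la ra lb rb lc rc x1 x2 x3 x4 (g x) y2 y3 y4 z1 z2 z3 z4)"
    and "lin (\<lambda>x. T la ra lb rb lc rc x1 x2 x3 x4 y1 (g x) y3 y4 z1 z2 z3 z4)"
    and "lin (\<lambda>x. T la ra lb rb lc rc x1 x2 x3 x4 y1 y2 (g x) y4 z1 z2 z3 z4)"
    and "lin (\<lambda>x. T la ra lb rb lc rc x1 x2 x3 x4 y1 y2 y3 (g x) z1 z2 z3 z4)"
    and "lin (\<lambda>x. T la ra lb rb lc rc x1 x2 x3 x4 y1 y2 y3 y4 (g x) z2 z3 z4)"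
    and "lin (\<lambda>x. T la ra lb rb lc rc x1 x2 x3 x4 y1 y2 y3 y4 z1 (g x) z3 z4)"
    and "lin (\<lambda>x. T la ra lb rb lc rc x1 x2 x3 x4 y1 y2 y3 y4 z1 z2 (g x) z4)"
    and "lin (\<lambda>x. T la ra lb rb lc rc x1 x2 x3 x4 y1 y2 y3 y4 z1 z2 z3 (g x))"
  unfolding T_def by (intro lin_rules assms)+

lemmas lin_T_rules = lin_rules T_lin

lemma D_coassoc': "tri g \<Longrightarrow> tsum (D i j x) (\<lambda>a r. tsum (D i j a) (\<lambda>a1 a2. g a1 a2 r)) =
        tsum (D i j x) (\<lambda>a r. tsum (D i j r) (\<lambda>r1 r2. g a r1 r2))"
  by (rule ax(2))

text \<open>Coassociativity regroups two neighbouring parts of an iterated coproduct into the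
  coproduct of one part, to which the antipode identity applies. Thus neighbours that meet as A(a) c
  vanish; \<open>collapse_B\<close> is the same for B(c) a.\<close>

lemma collapse_A:
  assumes "bil F"
  shows "tsum (D i j x) (\<lambda>a r. tsum (D i j r) (\<lambda>c q. F (A i j a * c) q)) = F 1 x"
proof -
  have "tsum (D i j x) (\<lambda>a r. tsum (D i j r) (\<lambda>c q. F (A i j a * c) q)) =
     tsum (D i j x) (\<lambda>a r. tsum (D i j a) (\<lambda>c d. F (A i j c * d) r))"
    by (rule D_coassoc'[symmetric]) (intro triI bil_lin[OF assms] lin_rules)
  also have "\<dots> = F 1 x"
  proof -
    have 1: "lin (\<lambda>x. F x r)" "lin (F y)" for r y
      using assms by (auto simp: bil_def)
    show ?thesis by (simp add: A_l[OF 1(1)] ax(3)[OF 1(2)])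
  qed
  finally show ?thesis .
qed

lemma collapse_B:
  assumes "bil F"
  shows "tsum (D i j x) (\<lambda>a r. tsum (D i j r) (\<lambda>c q. F (B i j c * a) q)) = F 1 x"
proof -
  have "tsum (D i j x) (\<lambda>a r. tsum (D i j r) (\<lambda>c q. F (B i j c * a) q)) =
     tsum (D i j x) (\<lambda>a r. tsum (D i j a) (\<lambda>c d. F (B i j d * c) r))"
    by (rule D_coassoc'[symmetric]) (intro triI bil_lin[OF assms] lin_rules)
  also have "\<dots> = F 1 x"
  proof -
    have 1: "lin (\<lambda>x. F x r)" "lin (F y)" for r y
      using assms by (auto simp: bil_def)
    show ?thesis by (simp add: B_l[OF 1(1)] ax(3)[OF 1(2)])
  qed
  finally show ?thesis .
qed

text \<open>The index j is changed to i six times: first the left indices of the factors c, a, b,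
  then the right indices of a, c, b. Each move scatters parts of \<open>x\<close> over slots of
  \<open>T\<close>, and the order of the moves is such that adjacent parts meet as A(a) c or B(c) a
  and cancel. Here \<open>x\<close> belongs to C j i and \<open>P\<close> to C i j; the part that
  survives has passed through two inverse antipodes.\<close>

lemma T_shift:
  "T j j j j j j 1 1 1 1 1 1 1 1 (x * P) 1 1 1 = T i i i i i i 1 1 1 1 1 1 1 1 (P * B i j (B j i x)) 1 1 1"
proof -
  let ?D = "D j i"
  have "T j j j j j j 1 1 1 1 1 1 1 1 (x * P) 1 1 1 =
    D3 j i x (\<lambda>u1 u2 u3. T j j j j i j u3 1 1 (A j i u1) 1 1 1 1 P u2 1 1)"
    by (subst c_left[where i = i]) simp
  also have "\<dots> = D3 j i x (\<lambda>u1 u2 u3. D3 j i u3 (\<lambda>v1 v2 v3.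
      T i j j j i j 1 v2 1 (A j i u1) v1 1 1 (B j i v3) P u2 1 1))"
  proof -
    have "T j j j j i j u3 1 1 (A j i u1) 1 1 1 1 P u2 1 1 = D3 j i u3 (\<lambda>v1 v2 v3.
      T i j j j i j 1 v2 1 (A j i u1) v1 1 1 (B j i v3) P u2 1 1)" for u1 u2 u3
      using a_left[of j j j j i j u3 1 1 1 "A j i u1" 1 1 1 1 P u2 1 1 i] by simp
    then show ?thesis by simp
  qed
  also have "\<dots> = D3 j i x (\<lambda>u1 u2 u3. D3 j i u3 (\<lambda>v1 v2 v3. D3 j i v1 (\<lambda>w1 w2 w3.
      T i j i j i j 1 v2 1 (A j i u1) 1 w2 1 (B j i v3) P (B j i w1 * u2) w3 1)))"
  proof -
    have "T i j j j i j 1 v2 1 (A j i u1) v1 1 1 (B j i v3) P u2 1 1 = D3 j i v1 (\<lambda>w1 w2 w3.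
      T i j i j i j 1 v2 1 (A j i u1) 1 w2 1 (B j i v3) P (B j i w1 * u2) w3 1)" for u1 u2 v1 v2 v3
      using b_left[of i j j j i j 1 v2 1 "A j i u1" v1 1 1 1 "B j i v3" P u2 1 1 i] by simp
    then show ?thesis by simp
  qed
  \<comment> \<open>The parts now occur in the order u1, u2, w1, w2, w3, v2, v3. The slot
    \<open>z2\<close> holds B(w1) u2, so these two neighbours cancel and five parts remain.\<close>
  also have "\<dots> = tsum (?D x) (\<lambda>x1 r. tsum (?D r) (\<lambda>t v. tsum (?D t) (\<lambda>x2 x3. tsum (?D v) (\<lambda>x4 x5.
      T i j i j i j 1 x4 1 (A j i x1) 1 x2 1 (B j i x5) P 1 x3 1))))"
  proof -
    have "tsum (?D r) (\<lambda>u2 u3. tsum (?D u3) (\<lambda>v1 v. tsum (?D v) (\<lambda>v2 v3. tsum (?D v1) (\<lambda>w1 t.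
        tsum (?D t) (\<lambda>w2 w3. T i j i j i j 1 v2 1 (A j i u1) 1 w2 1 (B j i v3) P (B j i w1 * u2) w3 1))))) =
      tsum (?D r) (\<lambda>t v. tsum (?D t) (\<lambda>x2 x3. tsum (?D v) (\<lambda>x4 x5.
        T i j i j i j 1 x4 1 (A j i u1) 1 x2 1 (B j i x5) P 1 x3 1)))" (is "?l = ?r") for u1 r
    proof -
      let ?F = "\<lambda>z q. tsum (?D q) (\<lambda>t v. tsum (?D t) (\<lambda>x2 x3. tsum (?D v) (\<lambda>x4 x5.
        T i j i j i j 1 x4 1 (A j i u1) 1 x2 1 (B j i x5) P z x3 1)))"
      have "tsum (?D u3) (\<lambda>v1 v. tsum (?D v) (\<lambda>v2 v3. tsum (?D v1) (\<lambda>w1 t.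
        tsum (?D t) (\<lambda>w2 w3. T i j i j i j 1 v2 1 (A j i u1) 1 w2 1 (B j i v3) P (B j i w1 * u2) w3 1)))) =
        tsum (?D u3) (\<lambda>w1 q. ?F (B j i w1 * u2) q)" (is "?l1 = _") for u2 u3
      proof -
        have "?l1 = tsum (?D u3) (\<lambda>v1 v. tsum (?D v1) (\<lambda>w1 t. tsum (?D t) (\<lambda>w2 w3. tsum (?D v) (\<lambda>v2 v3.
          T i j i j i j 1 v2 1 (A j i u1) 1 w2 1 (B j i v3) P (B j i w1 * u2) w3 1))))"
          by (subst tsum_swap3) simp
        also have "\<dots> = tsum (?D u3) (\<lambda>w1 q. ?F (B j i w1 * u2) q)"
          by (subst D_coassoc', intro lin_T_rules) simp
        finally show ?thesis .
      qed
      then show ?thesis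
        by (simp only:) (subst collapse_B[where F = ?F], intro lin_T_rules, simp)
    qed
    then show ?thesis unfolding D3_def by simp
  qed
  \<comment> \<open>Since \<open>A\<close> reverses coproducts, moving A(x1) distributes the parts
    p, q, m of x1 in reversed order. At \<open>y2\<close> the last one meets its neighbour as A(m)
    x2 and cancels; at \<open>y3\<close> an inverse antipode undoes \<open>A\<close> and leaves
    p.\<close>
  also have "\<dots> = tsum (?D x) (\<lambda>x1 y. tsum (?D y) (\<lambda>x2 z. tsum (?D z) (\<lambda>x3 v. tsum (?D v) (\<lambda>x4 x5.
      T i i i j i j 1 x4 (A j i x2) 1 1 1 x1 (B j i x5) P 1 x3 1))))"
  proof -
    let ?G = "\<lambda>x1 x2 c x3 x4 x5. T i i i j i j 1 x4 (A j i x2) 1 1 c x1 (B j i x5) P 1 x3 1"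
    have 1: "T i j i j i j 1 x4 1 (A j i x1) 1 x2 1 (B j i x5) P 1 x3 1 =
      D3 j i x1 (\<lambda>p q m. ?G p q (A j i m * x2) x3 x4 x5)" for x1 x2 x3 x4 x5
    proof -
      have "tri (\<lambda>u1 u2 u3. T i i i j i j 1 x4 u2 1 1 (u1 * x2) (B i j u3) (B j i x5) P 1 x3 1)"
        by (intro lin_T_rules)
      from A_D3[OF this, of i j x1]
      show ?thesis
        using a_right[of i j i j i j 1 x4 1 1 "A j i x1" 1 x2 1 "B j i x5" P 1 x3 1 i]
        by (simp add: BA)
    qed
    let ?I = "\<lambda>r p q m. tsum (?D r) (\<lambda>t v. tsum (?D t) (\<lambda>x2 x3. tsum (?D v) (\<lambda>x4 x5.
        ?G p q (A j i m * x2) x3 x4 x5)))"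
    have "tsum (?D r) (\<lambda>t v. tsum (?D t) (\<lambda>x2 x3. tsum (?D v) (\<lambda>x4 x5.
      T i j i j i j 1 x4 1 (A j i x1) 1 x2 1 (B j i x5) P 1 x3 1))) =
      tsum (?D x1) (\<lambda>p e. tsum (?D e) (\<lambda>q m. ?I r p q m))" for x1 r
      unfolding 1 D3_def by (rule tsum_swap5[symmetric])
    then have "tsum (?D x) (\<lambda>x1 r. tsum (?D r) (\<lambda>t v. tsum (?D t) (\<lambda>x2 x3. tsum (?D v) (\<lambda>x4 x5.
      T i j i j i j 1 x4 1 (A j i x1) 1 x2 1 (B j i x5) P 1 x3 1)))) =
      tsum (?D x) (\<lambda>x1 r. tsum (?D x1) (\<lambda>p e. tsum (?D e) (\<lambda>q m. ?I r p q m)))"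
      by simp
    also have "\<dots> = tsum (?D x) (\<lambda>p y. tsum (?D y) (\<lambda>e r. tsum (?D e) (\<lambda>q m. ?I r p q m)))"
      by (rule D_coassoc') (intro lin_T_rules)
    also have "\<dots> = tsum (?D x) (\<lambda>p y. tsum (?D y) (\<lambda>q z. tsum (?D z) (\<lambda>m r. ?I r p q m)))"
      by (subst D_coassoc', intro lin_T_rules) simp
    also have "\<dots> = tsum (?D x) (\<lambda>p y. tsum (?D y) (\<lambda>q z. tsum (?D z) (\<lambda>m r. tsum (?D r) (\<lambda>x2 w.
        tsum (?D w) (\<lambda>x3 v. tsum (?D v) (\<lambda>x4 x5. ?G p q (A j i m * x2) x3 x4 x5))))))"
      by (subst D_coassoc', intro lin_T_rules) simp
    also have "\<dots> = tsum (?D x) (\<lambda>p y. tsum (?D y) (\<lambda>q z.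
        tsum (?D z) (\<lambda>x3 v. tsum (?D v) (\<lambda>x4 x5. ?G p q 1 x3 x4 x5))))"
      by (subst collapse_A[where F = "\<lambda>c w. tsum (?D w) (\<lambda>x3 v. tsum (?D v) (\<lambda>x4 x5. ?G p q c x3 x4 x5))" for p q])
        (intro lin_T_rules, simp)
    finally show ?thesis .
  qed
  \<comment> \<open>\<open>c_right\<close> is read from right to left: the insertions A(x2), x3 and
    x4 are exactly the traces left by the three parts of a single r at \<open>z4\<close>.\<close>
  also have "\<dots> = tsum (?D x) (\<lambda>x1 y. tsum (?D y) (\<lambda>r x5.
      T i i i j i i 1 1 1 1 1 1 x1 (B j i x5) P 1 1 r))"
  proof -
    have 1: "T i i i j i i 1 1 1 1 1 1 x1 (B j i x5) P 1 1 r = tsum (?D r) (\<lambda>x2 m. tsum (?D m) (\<lambda>x3 x4.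
      T i i i j i j 1 x4 (A j i x2) 1 1 1 x1 (B j i x5) P 1 x3 1))" for x1 r x5
      using c_right[of i i i j i i 1 1 1 1 1 1 x1 "B j i x5" P 1 1 1 r j] by (simp add: D3_def)
    let ?G = "\<lambda>x1 x2 x3 x4 x5. T i i i j i j 1 x4 (A j i x2) 1 1 1 x1 (B j i x5) P 1 x3 1"
    have "tsum (?D y) (\<lambda>r x5. tsum (?D r) (\<lambda>x2 m. tsum (?D m) (\<lambda>x3 x4. ?G x1 x2 x3 x4 x5))) =
      tsum (?D y) (\<lambda>x2 z. tsum (?D z) (\<lambda>m x5. tsum (?D m) (\<lambda>x3 x4. ?G x1 x2 x3 x4 x5)))" for x1 y
      by (rule D_coassoc') (intro lin_T_rules)
    also have "\<dots> x1 y = tsum (?D y) (\<lambda>x2 z. tsum (?D z) (\<lambda>x3 v. tsum (?D v) (\<lambda>x4 x5. ?G x1 x2 x3 x4 x5)))" for x1 y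
      by (subst D_coassoc', intro lin_T_rules) simp
    finally show ?thesis unfolding 1 by simp
  qed
  \<comment> \<open>Moving B(x5) leaves B(a) r at \<open>z4\<close> and B(b) x1 at
    \<open>y3\<close>. The first product cancels because a follows r; then b follows x1, and the
    second cancels too. Only c is left.\<close>
  also have "\<dots> = T i i i i i i 1 1 1 1 1 1 1 1 (P * B i j (B j i x)) 1 1 1"
  proof -
    let ?G = "\<lambda>x1 r a b c. T i i i i i i 1 1 1 1 1 1 (b * x1) 1 (P * B i j (B j i c)) 1 1 (a * r)"
    have 1: "T i i i j i i 1 1 1 1 1 1 x1 (B j i x5) P 1 1 r =
        tsum (?D x5) (\<lambda>a e. tsum (?D e) (\<lambda>b c. ?G x1 r (B j i a) (B j i b) c))" for x1 r x5
    proof -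
      have "tri (\<lambda>u1 u2 u3. T i i i i i i 1 1 1 1 1 1 (u2 * x1) 1 (P * B i j u1) 1 1 (u3 * r))"
        by (intro lin_T_rules)
      from B_D3[OF this, of i j x5]
      show ?thesis
        using b_right[of i i i j i i 1 1 1 1 1 1 x1 1 "B j i x5" P 1 1 r i] by (simp add: D3_def)
    qed
    have "tsum (?D x) (\<lambda>x1 y. tsum (?D y) (\<lambda>r x5. T i i i j i i 1 1 1 1 1 1 x1 (B j i x5) P 1 1 r)) =
      tsum (?D x) (\<lambda>x1 y. tsum (?D y) (\<lambda>b c. T i i i i i i 1 1 1 1 1 1 (B j i b * x1) 1 (P * B i j (B j i c)) 1 1 1))"
      unfolding 1
      by (subst collapse_B[where F = "\<lambda>z e. tsum (?D e) (\<lambda>b c. T i i i i i i 1 1 1 1 1 1 (B j i b * x1) 1 (P * B i j (B j i c)) 1 1 z)" for x1])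
        (intro lin_T_rules, simp)
    also have "\<dots> = T i i i i i i 1 1 1 1 1 1 1 1 (P * B i j (B j i x)) 1 1 1"
      by (rule collapse_B[where F = "\<lambda>z c. T i i i i i i 1 1 1 1 1 1 z 1 (P * B i j (B j i c)) 1 1 1"])
        (intro lin_T_rules)
    finally show ?thesis .
  qed
  finally show ?thesis .
qed

text \<open>The identity for r B(a) inserts the coproduct of 1, taken in C j i. After
  \<open>T_shift\<close> the inserted product is B(a) B(B(r)) = B(B(r) a), and the identity for B(r)
  a contracts it to B(1) = 1.\<close>

lemma T_eq: "T j j j j j j 1 1 1 1 1 1 1 1 1 1 1 1 = T i i i i i i 1 1 1 1 1 1 1 1 1 1 1 1"
proof -
  have "T j j j j j j 1 1 1 1 1 1 1 1 1 1 1 1 =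
      tsum (D j i 1) (\<lambda>a r. T j j j j j j 1 1 1 1 1 1 1 1 (r * B j i a) 1 1 1)"
    by (subst B_r, intro lin_T_rules) (simp add: \<epsilon>_one)
  also have "\<dots> = tsum (D j i 1) (\<lambda>a r. T i i i i i i 1 1 1 1 1 1 1 1 (B i i (B j i r * a)) 1 1 1)"
    by (subst T_shift[of j _ _ i]) (simp add: B_mult[of i i _ _ j])
  also have "\<dots> = T i i i i i i 1 1 1 1 1 1 1 1 1 1 1 1"
    by (subst B_l[of "\<lambda>z. T i i i i i i 1 1 1 1 1 1 1 1 (B i i z) 1 1 1"], intro lin_T_rules)
      (simp add: \<epsilon>_one B_one)
  finally show ?thesis .
qed

text \<open>The dual basis identity is used with y = A(b m) and the form X m after \<open>B\<close>;
  the antipodes cancel and X m (b m) is left. Thus one copy of \<Lambda> and one value of l close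
  one tensor factor to a trace.\<close>

lemma integral_trace:
  assumes dual: "\<And>y h. lin h \<Longrightarrow> tsum (D i i \<Lambda>) (\<lambda>u v. l (y * u) * h (A i i v)) = h y"
    and X: "\<And>m. lin (X m)" and c: "\<And>m u. c m u = l (A i i (b m) * u)"
    and Y: "\<And>u v. Y u v = (\<Sum>m<n. c m u * X m v)"
  shows "tsum (D i i \<Lambda>) Y = (\<Sum>m<n. X m (b m))"
proof -
  have "tsum (D i i \<Lambda>) (\<lambda>u v. c m u * X m v) = X m (b m)" for m
    using dual[OF lin_comp[OF X vlin_B[OF vlin_id]], of "A i i (b m)" m i i] by (simp add: BA c)
  moreover have "Y = (\<lambda>u v. \<Sum>m<n. c m u * X m v)" by (intro ext Y)
  ultimately show ?thesis by (simp add: tsum_sum)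
qed

lemma integral_T:
  assumes l: "lin l"
    and dual: "\<And>y h. lin h \<Longrightarrow> tsum (D i i \<Lambda>) (\<lambda>u v. l (y * u) * h (A i i v)) = h y"
  shows "tsum (D i i \<Lambda>) (\<lambda>a1 a. D3 i i a (\<lambda>a2 a3 a4.
      tsum (D i i \<Lambda>) (\<lambda>b1 b. D3 i i b (\<lambda>b2 b3 b4.
      tsum (D i i \<Lambda>) (\<lambda>c1 c. D3 i i c (\<lambda>c2 c3 c4.
        l (A i i (A i i c2) * A i i a3 * A i i c4 * a1) *
        l (a4 * A i i b3 * A i i a2 * b1) *
        l (A i i b4 * A i i c3 * b2 * c1)))))))
    = T i i i i i i 1 1 1 1 1 1 1 1 1 1 1 1" (is "?Z = _")
proof -
  let ?S = "A i i" and ?S' = "B i i"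
  obtain c where c: "\<And>m u. c m u = l (?S (b m) * u)"
    by (rule that[of "\<lambda>m u. l (?S (b m) * u)"]) (rule refl)
  have l_expand: "l (?S y * u) = (\<Sum>m<n. c m u * \<phi> m y)" for y u
    using lin_expand[of "\<lambda>y. l (?S y * u)" y] by (simp add: c mult.commute lin_comp[OF l] lin_rules)
  \<comment> \<open>Each argument of l is rewritten as S(y) u, with u the first part of one copy of
    \<Lambda>. Factors without S are written as S of an inverse antipode. The three elements y are
    the components of the operator whose trace is \<open>T\<close>.\<close>
  have e1: "l (?S (?S c2) * ?S a3 * ?S c4 * a1) = (\<Sum>m<n. c m a1 * \<phi> m (c4 * a3 * ?S c2))" for c2 a3 c4 a1
    unfolding l_expand[symmetric] by (simp add: A_mult[of i i _ _ i] mult.assoc)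
  have e2: "l (a4 * ?S b3 * ?S a2 * b1) = (\<Sum>m<n. c m b1 * \<phi> m (a2 * b3 * ?S' a4))" for a4 b3 a2 b1
    unfolding l_expand[symmetric] by (simp add: A_mult[of i i _ _ i] mult.assoc AB)
  have e3: "l (?S b4 * ?S c3 * b2 * c1) = (\<Sum>m<n. c m c1 * \<phi> m (?S' b2 * c3 * b4))" for b4 c3 b2 c1
    unfolding l_expand[symmetric] by (simp add: A_mult[of i i _ _ i] mult.assoc AB)
  let ?D = "D i i \<Lambda>" and ?D3 = "D3 i i"
  note [simp] = mult.assoc[where 'a = 'k] mult.commute[where 'a = 'k] mult.left_commute[where 'a = 'k]
  note push = sum_distrib_left sum_distrib_right D3_sum D3_mult_left[symmetric] tsum_sum tsum_mult_left[symmetric]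
  have 1: "tsum ?D (\<lambda>c1 c. ?D3 c (\<lambda>c2 c3 c4. p c2 c4 * q * l (?S b4 * ?S c3 * b2 * c1))) =
     (\<Sum>k<n. ?D3 (b k) (\<lambda>c2 c3 c4. p c2 c4 * q * \<phi> k (?S' b2 * c3 * b4)))"
     if p: "bil p" for p q b2 b4
    by (rule integral_trace[OF dual _ c, where X = "\<lambda>k v. ?D3 v (\<lambda>c2 c3 c4. p c2 c4 * q * \<phi> k (?S' b2 * c3 * b4))"],
      assumption, (intro lin_rules bil_lin[OF p])[1]) (simp add: e3 push)
  have 2: "tsum ?D (\<lambda>b1 b'. ?D3 b' (\<lambda>b2 b3 b4. \<Sum>k<n. ?D3 (b k) (\<lambda>c2 c3 c4. p c2 c4 *
        l (a4 * ?S b3 * ?S a2 * b1) * \<phi> k (?S' b2 * c3 * b4)))) =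
     (\<Sum>j<n. \<Sum>k<n. ?D3 (b j) (\<lambda>b2 b3 b4. ?D3 (b k) (\<lambda>c2 c3 c4. p c2 c4 *
        \<phi> j (a2 * b3 * ?S' a4) * \<phi> k (?S' b2 * c3 * b4))))"
     if p: "bil p" for p a2 a4
    by (rule integral_trace[OF dual _ c, where X = "\<lambda>j v. \<Sum>k<n. ?D3 v (\<lambda>b2 b3 b4. ?D3 (b k) (\<lambda>c2 c3 c4. p c2 c4 *
        \<phi> j (a2 * b3 * ?S' a4) * \<phi> k (?S' b2 * c3 * b4)))"],
      assumption, (intro lin_rules bil_lin[OF p])[1]) (simp add: e2 push, subst sum.swap, intro sum.cong refl, simp)
  have bil: "bil (\<lambda>c2 c4. l (?S (?S c2) * ?S a3 * ?S c4 * a1))" for a3 a1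
    by (intro bilI lin_comp[OF l] lin_rules)
  have 3: "?Z = tsum ?D (\<lambda>a1 a. ?D3 a (\<lambda>a2 a3 a4. \<Sum>j<n. \<Sum>k<n. ?D3 (b j) (\<lambda>b2 b3 b4. ?D3 (b k) (\<lambda>c2 c3 c4.
      l (?S (?S c2) * ?S a3 * ?S c4 * a1) * \<phi> j (a2 * b3 * ?S' a4) * \<phi> k (?S' b2 * c3 * b4)))))"
    by (simp only: 1[OF bil] 2[OF bil])
  also have "\<dots> = (\<Sum>i'<n. \<Sum>j<n. \<Sum>k<n. ?D3 (b i') (\<lambda>a2 a3 a4. ?D3 (b j) (\<lambda>b2 b3 b4. ?D3 (b k) (\<lambda>c2 c3 c4.
      \<phi> i' (c4 * a3 * ?S c2) * \<phi> j (a2 * b3 * ?S' a4) * \<phi> k (?S' b2 * c3 * b4)))))"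
    by (rule integral_trace[OF dual _ c, where X = "\<lambda>i' v. \<Sum>j<n. \<Sum>k<n. ?D3 v (\<lambda>a2 a3 a4. ?D3 (b j) (\<lambda>b2 b3 b4. ?D3 (b k) (\<lambda>c2 c3 c4.
      \<phi> i' (c4 * a3 * ?S c2) * \<phi> j (a2 * b3 * ?S' a4) * \<phi> k (?S' b2 * c3 * b4))))"],
      assumption, (intro lin_rules)[1]) (simp add: e1 push, subst (2) sum.swap, subst sum.swap, intro sum.cong refl, simp)
  also have "\<dots> = T i i i i i i 1 1 1 1 1 1 1 1 1 1 1 1"
    unfolding T_def by (simp del: mult.commute)
  finally show ?thesis .
qed

end

section \<open>The invariant of a twisted Hopf algebra\<close>

lemma sum_list_concat_map: "sum_list (map g (concat (map h xs))) = (\<Sum>x\<leftarrow>xs. sum_list (map g (h x)))"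
  by (induction xs) auto

section \<open>A Hopf algebra as a Hopf category\<close>

context fd_hopf_algebra
begin

abbreviation "sc \<equiv> hscale H"
abbreviation "\<Delta> \<equiv> comult H"
abbreviation "eps \<equiv> counit H"
abbreviation "S \<equiv> antipode H"

sublocale algebra_over sc
proof (rule algebra_over.intro)
  obtain Bs where "finite_dimensional_vector_space sc Bs" using finite_dim by blast
  then show "vector_space sc" by (simp add: finite_dimensional_vector_space_def)
qed (rule scale_mult_left scale_mult_right)+

lemma exists_coordinates:
  "\<exists>(n::nat) b \<phi>. (\<forall>m. linear_form sc (\<phi> m)) \<and> (\<forall>x. (\<Sum>m<n. sc (\<phi> m x) (b m)) = x) \<and>
     (\<forall>m<n. \<forall>k<n. \<phi> m (b k) = (if m = k then 1 else 0))"
proof -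
  obtain Bs where "finite_dimensional_vector_space sc Bs" using finite_dim by blast
  then interpret fdvs: finite_dimensional_vector_space sc Bs .
  obtain b where b: "bij_betw b {..<card Bs} Bs"
    using ex_bij_betw_nat_finite[OF fdvs.finite_Basis] by (auto simp: atLeast0LessThan)
  have "linear_form sc (\<lambda>x. fdvs.representation Bs x (b m))" for m
    unfolding lin_iff lin_def
    by (simp add: fdvs.representation_add fdvs.representation_scale fdvs.independent_Basis fdvs.span_Basis)
  moreover have "(\<Sum>m<card Bs. sc (fdvs.representation Bs x (b m)) (b m)) = x" for x
    using sum.reindex_bij_betw[OF b, of "\<lambda>v. sc (fdvs.representation Bs x v) v"]
      fdvs.sum_representation_eq[OF fdvs.independent_Basis _ fdvs.finite_Basis order_refl, of x]
    by (simp add: fdvs.span_Basis)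
  moreover have "fdvs.representation Bs (b k) (b m) = (if m = k then 1 else 0)"
    if "m < card Bs" "k < card Bs" for m k
  proof -
    have "b k \<in> Bs" using b that by (auto simp: bij_betw_def)
    moreover have "b k = b m \<longleftrightarrow> k = m" using b that by (auto simp: bij_betw_def inj_on_def)
    ultimately show ?thesis
      using fdvs.representation_basis[OF fdvs.independent_Basis, of "b k"] by auto
  qed
  ultimately show ?thesis
    by (intro exI[of _ "card Bs"] exI[of _ b] exI[of _ "\<lambda>m x. fdvs.representation Bs x (b m)"]) simp
qed

lemma surj_imp_inj:
  assumes "vlin f" "surj f"
  shows "inj f"
proof -
  obtain Bs where "finite_dimensional_vector_space sc Bs" using finite_dim by blast
  then interpret fdvs: finite_dimensional_vector_space sc Bs .
  show ?thesis using fdvs.linear_surj_imp_inj assms vlin_iff by blast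
qed

text \<open>Left multiplication by u is surjective, hence injective by finite dimension, and it
  sends \<open>q * u\<close> and 1 to the same element.\<close>

lemma right_inverse_imp_left:
  fixes u q :: 'h
  assumes "u * q = 1" shows "q * u = 1"
proof -
  have "inj (\<lambda>x. u * x)"
  proof (rule surj_imp_inj)
    show "vlin (\<lambda>x. u * x)" by (intro vlin_mult2 vlin_id)
    have "u * (q * x) = x" for x using assms by (simp add: mult.assoc[symmetric])
    then show "surj (\<lambda>x. u * x)" by (rule surjI)
  qed
  moreover have "u * (q * u) = u * 1" using assms by (simp add: mult.assoc[symmetric])
  ultimately show ?thesis by (simp add: inj_def)
qed

lemma tsum_comult_lin: "bil f \<Longrightarrow> lin (\<lambda>x. tsum (\<Delta> x) f)"
proof -
  assume f: "bil f"
  have "(\<Sum>(a, b)\<leftarrow>\<Delta> (x + y). f a b) = (\<Sum>(a, b)\<leftarrow>\<Delta> x @ \<Delta> y. f a b)" for x y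
    using comult_add f unfolding tensor2_eq_def bil_iff by blast
  moreover have "(\<Sum>(a, b)\<leftarrow>\<Delta> (sc c x). f a b) = (\<Sum>(a, b)\<leftarrow>[(sc c a, b). (a, b) \<leftarrow> \<Delta> x]. f a b)" for c x
    using comult_scale f unfolding tensor2_eq_def bil_iff by blast
  moreover have "(\<Sum>(a, b)\<leftarrow>[(sc c a, b). (a, b) \<leftarrow> t]. f a b) = c * (\<Sum>(a, b)\<leftarrow>t. f a b)" for c t
    using f by (induction t) (auto simp: bil_def lin_def algebra_simps)
  ultimately show ?thesis by (simp add: lin_def tsum_def)
qed

lemma tsum_comult_mult: "bil f \<Longrightarrow> tsum (\<Delta> (x * y)) f =
    tsum (\<Delta> x) (\<lambda>a r. tsum (\<Delta> y) (\<lambda>c d. f (a * c) (r * d)))"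
proof -
  assume f: "bil f"
  have "(\<Sum>(a, b)\<leftarrow>\<Delta> (x * y). f a b) =
      (\<Sum>(a, b)\<leftarrow>[(a * c, b * d). (a, b) \<leftarrow> \<Delta> x, (c, d) \<leftarrow> \<Delta> y]. f a b)"
    using comult_mult f unfolding tensor2_eq_def bil_iff by blast
  then show ?thesis by (simp add: tsum_def split_def sum_list_concat_map comp_def)
qed

lemma tsum_comult_one: "bil f \<Longrightarrow> tsum (\<Delta> 1) f = f 1 1"
proof -
  assume f: "bil f"
  have "(\<Sum>(a, b)\<leftarrow>\<Delta> 1. f a b) = (\<Sum>(a, b)\<leftarrow>[(1, 1)]. f a b)"
    using comult_one f unfolding tensor2_eq_def bil_iff by blast
  then show ?thesis by (simp add: tsum_def)
qed

lemma tsum_coassoc: "tri g \<Longrightarrow> tsum (\<Delta> x) (\<lambda>a r. tsum (\<Delta> a) (\<lambda>a1 a2. g a1 a2 r)) =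
    tsum (\<Delta> x) (\<lambda>a r. tsum (\<Delta> r) (\<lambda>r1 r2. g a r1 r2))"
proof -
  assume g: "tri g"
  have "(\<Sum>(a, b, c)\<leftarrow>[(a1, a2, b). (a, b) \<leftarrow> \<Delta> x, (a1, a2) \<leftarrow> \<Delta> a]. g a b c) =
    (\<Sum>(a, b, c)\<leftarrow>[(a, b1, b2). (a, b) \<leftarrow> \<Delta> x, (b1, b2) \<leftarrow> \<Delta> b]. g a b c)"
    using coassoc g unfolding tensor3_eq_def tri_iff by blast
  then show ?thesis by (simp add: tsum_def split_def sum_list_concat_map comp_def)
qed

lemma eps_lin: "lin eps"
  using counit_linear lin_iff by blast

lemma lin_0: "lin h \<Longrightarrow> h 0 = 0"
  unfolding lin_def by (metis add_cancel_right_left)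

lemma lin_tsum_val: "lin h \<Longrightarrow> h (tsum t f) = tsum t (\<lambda>a b. h (f a b))"
  by (induction t) (auto simp: lin_0 lin_def)

lemma tsum_counit_left: "lin h \<Longrightarrow> tsum (\<Delta> x) (\<lambda>a r. eps a * h r) = h x"
  and tsum_counit_right: "lin h \<Longrightarrow> tsum (\<Delta> x) (\<lambda>a r. eps r * h a) = h x"
proof -
  assume h: "lin h"
  have "tsum (\<Delta> x) (\<lambda>a r. eps a * h r) = h (tsum (\<Delta> x) (\<lambda>a r. sc (eps a) r))"
    "tsum (\<Delta> x) (\<lambda>a r. eps r * h a) = h (tsum (\<Delta> x) (\<lambda>a r. sc (eps r) a))"
    unfolding lin_tsum_val[OF h] using h by (simp_all add: lin_def)
  with counit_left[of x] counit_right[of x]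
  show "tsum (\<Delta> x) (\<lambda>a r. eps a * h r) = h x" "tsum (\<Delta> x) (\<lambda>a r. eps r * h a) = h x"
    by (simp_all add: tsum_def)
qed

lemma tsum_antipode_left: "lin h \<Longrightarrow> tsum (\<Delta> x) (\<lambda>a r. h (S a * r)) = eps x * h 1"
  and tsum_antipode_right: "lin h \<Longrightarrow> tsum (\<Delta> x) (\<lambda>a r. h (a * S r)) = eps x * h 1"
proof -
  assume h: "lin h"
  show "tsum (\<Delta> x) (\<lambda>a r. h (S a * r)) = eps x * h 1" "tsum (\<Delta> x) (\<lambda>a r. h (a * S r)) = eps x * h 1"
    unfolding lin_tsum_val[OF h, symmetric] using antipode_left[of x] antipode_right[of x] h
    by (simp_all add: tsum_def lin_def)
qed

lemma S_vlin: "vlin S"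
  using antipode_linear vlin_iff by blast

text \<open>All four morphism coalgebras are \<open>H\<close> itself. In this way the results on
  Hopf categories, such as the dual basis given by the integrals, apply to a single Hopf
  algebra.\<close>

lemma hopf_category_pre:
  assumes "\<And>m. linear_form sc (\<phi> m)" "\<And>x. (\<Sum>m<n. sc (\<phi> m x) (b m)) = x"
  shows "hopf_category_pre sc (\<lambda>_ _. \<Delta>) eps (\<lambda>_ _. S) n b \<phi>"
  by (intro hopf_category_pre.intro hopf_category_pre_axioms.intro algebra_over_axioms;
      (unfold bil_iff lin_iff tri_iff vlin_iff)?)
    (erule tsum_comult_lin tsum_coassoc tsum_counit_left tsum_counit_right tsum_comult_mult
      tsum_comult_one tsum_antipode_left tsum_antipode_right |
     rule eps_lin counit_mult counit_one S_vlin assms assms(1)[unfolded lin_iff])+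

lemma tsum_cointegral:
  assumes "right_cointegral H l" "lin h"
  shows "tsum (\<Delta> x) (\<lambda>u v. l u * h v) = l x * h 1"
proof -
  have "tsum (\<Delta> x) (\<lambda>u v. l u * h v) = h (tsum (\<Delta> x) (\<lambda>u v. sc (l u) v))"
    unfolding lin_tsum_val[OF assms(2)] using assms(2) by (simp add: lin_def)
  then show ?thesis
    using assms unfolding right_cointegral_def by (simp add: tsum_def lin_def)
qed

lemma dual_basis:
  assumes "normalized_integrals H \<Lambda> l" and h: "lin h"
  shows "tsum (\<Delta> \<Lambda>) (\<lambda>u v. l (y * u) * h (S v)) = h y"
proof -
  obtain n :: nat and b \<phi> where "\<And>m. linear_form sc (\<phi> m)" "\<And>x. (\<Sum>m<n. sc (\<phi> m x) (b m)) = x"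
    using exists_coordinates by blast
  then interpret hopf_category_pre sc "\<lambda>_ _. \<Delta>" eps "\<lambda>_ _. S" n b \<phi>
    by (rule hopf_category_pre)
  have 1: "x * \<Lambda> = sc (eps x) \<Lambda>" "right_cointegral H l" "l \<Lambda> = 1" for x
    using assms(1) by (auto simp: normalized_integrals_def left_integral_def)
  then have 2: "lin l" by (simp add: right_cointegral_def lin_iff)
  show ?thesis
    by (rule integral_dual_basis[OF 1(1) 2 tsum_cointegral[OF 1(2)] 1(3) h])
qed

text \<open>The dual basis identity displays every y as a value of S, and finite dimension does the
  rest. The inverse antipodes of the Hopf category come from here.\<close>

lemma bij_S:
  assumes "normalized_integrals H \<Lambda> l"
  shows "bij S"
proof -
  obtain n :: nat and b \<phi> where *: "\<And>m. linear_form sc (\<phi> m)" "\<And>x. (\<Sum>m<n. sc (\<phi> m x) (b m)) = x"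
    using exists_coordinates by blast
  then interpret hopf_category_pre sc "\<lambda>_ _. \<Delta>" eps "\<lambda>_ _. S" n b \<phi>
    by (rule hopf_category_pre)
  have "y = S (tsum (\<Delta> \<Lambda>) (\<lambda>u v. sc (l (y * u)) v))" for y
  proof (rule lin_ext)
    fix h assume h: "lin h"
    then have hS: "lin (\<lambda>v. h (S v))" by (rule lin_comp[OF _ S_vlin])
    show "h y = h (S (tsum (\<Delta> \<Lambda>) (\<lambda>u v. sc (l (y * u)) v)))"
      unfolding lin_tsum_val[OF hS] using hS dual_basis[OF assms h, of y] by (simp add: lin_def)
  qed
  then have "surj S" unfolding surj_def by blast
  then show ?thesis using surj_imp_inj[OF S_vlin] by (simp add: bij_def)
qed

lemma kuperberg_T3_tsum: "kuperberg_T3 H \<Lambda> l =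
   tsum (\<Delta> \<Lambda>) (\<lambda>a1 a. tsum (\<Delta> a) (\<lambda>a2 y. tsum (\<Delta> y) (\<lambda>a3 a4.
   tsum (\<Delta> \<Lambda>) (\<lambda>b1 b. tsum (\<Delta> b) (\<lambda>b2 y. tsum (\<Delta> y) (\<lambda>b3 b4.
   tsum (\<Delta> \<Lambda>) (\<lambda>c1 c. tsum (\<Delta> c) (\<lambda>c2 y. tsum (\<Delta> y) (\<lambda>c3 c4.
       l (S (S c2) * S a3 * S c4 * a1) * l (a4 * S b3 * S a2 * b1) * l (S b4 * S c3 * b2 * c1))))))))))"
proof -
  have "(\<Sum>(a1, a2, a3, a4)\<leftarrow>comult4 H x. f a1 a2 a3 a4) =
     tsum (\<Delta> x) (\<lambda>a1 a. tsum (\<Delta> a) (\<lambda>a2 y. tsum (\<Delta> y) (\<lambda>a3 a4. f a1 a2 a3 a4)))" for x and f :: "'h \<Rightarrow> 'h \<Rightarrow> 'h \<Rightarrow> 'h \<Rightarrow> 'k"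
    unfolding comult4_def tsum_def by (simp add: split_def sum_list_concat_map comp_def)
  then show ?thesis unfolding kuperberg_T3_def Let_def by simp
qed

end

section \<open>Twisting a Hopf algebra by a 2-cocycle\<close>

lemma tsum_pairs:
  "tsum [(a * c, b * d). (a, b) \<leftarrow> t, (c, d) \<leftarrow> u] f = tsum t (\<lambda>a b. tsum u (\<lambda>c d. f (a * c) (b * d)))"
  by (simp add: tsum_def split_def sum_list_concat_map comp_def)

lemma tsum_swap4: "tsum g (\<lambda>a b. tsum f (\<lambda>c d. tsum t (\<lambda>p q. tsum (w p q) (\<lambda>r s. X a b c d p q r s)))) =
    tsum t (\<lambda>p q. tsum (w p q) (\<lambda>r s. tsum g (\<lambda>a b. tsum f (\<lambda>c d. X a b c d p q r s))))"
  unfolding tsum_swap3[of f] by (rule tsum_swap3)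

lemma tsum_reorder:
  "tsum f (\<lambda>c d. tsum x (\<lambda>a b. tsum f' (\<lambda>p q. tsum (v c d) (\<lambda>k l. tsum (w a b) (\<lambda>r t. X a b c d p q k l r t))))) =
   tsum x (\<lambda>a b. tsum (w a b) (\<lambda>r t. tsum f' (\<lambda>p q. tsum f (\<lambda>c d. tsum (v c d) (\<lambda>k l. X a b c d p q k l r t)))))"
  by (simp only: tsum_swap[where s = "w a b" for a b]) (simp only: tsum_swap[of f x] tsum_swap[of f f'])

text \<open>\<open>F\<close> is the twist and \<open>G\<close> its inverse; on the algebra of
  \<open>H\<close>, the coproduct of \<open>H'\<close> is F \<Delta> G. The twist, cocycle and
  counit laws are stated for \<open>G\<close> because a monoidal functor delivers \<open>G\<close>;
  the laws for \<open>F\<close> are derived.\<close>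

locale gauge_twist =
  H: fd_hopf_algebra H + H': fd_hopf_algebra H'
  for H H' :: "('k::field, 'h::ring_1) hopf" +
  fixes F G :: "('h \<times> 'h) list"
  assumes scale_eq: "hscale H' = hscale H"
    and counit_eq: "counit H' = counit H"
    and GF: "H.bil f \<Longrightarrow> tsum G (\<lambda>a b. tsum F (\<lambda>c d. f (a * c) (b * d))) = f 1 1"
    and FG: "H.bil f \<Longrightarrow> tsum F (\<lambda>a b. tsum G (\<lambda>c d. f (a * c) (b * d))) = f 1 1"
    and twist: "H.bil f \<Longrightarrow> tsum (comult H x) (\<lambda>a b. tsum G (\<lambda>c d. f (a * c) (b * d))) =
        tsum G (\<lambda>a b. tsum (comult H' x) (\<lambda>c d. f (a * c) (b * d)))"
    and cocycle_G: "H.tri g \<Longrightarrow>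
        tsum G (\<lambda>a b. tsum (comult H a) (\<lambda>a1 a2. tsum G (\<lambda>c d. g (a1 * c) (a2 * d) b))) =
        tsum G (\<lambda>a b. tsum (comult H b) (\<lambda>b1 b2. tsum G (\<lambda>c d. g a (b1 * c) (b2 * d))))"
    and counit_G_left: "H.lin h \<Longrightarrow> tsum G (\<lambda>a b. counit H a * h b) = h 1"
    and counit_G_right: "H.lin h \<Longrightarrow> tsum G (\<lambda>a b. counit H b * h a) = h 1"
begin

lemma H'_lin: "H'.lin = H.lin" and H'_bil: "H'.bil = H.bil" and H'_tri: "H'.tri = H.tri" and H'_vlin: "H'.vlin = H.vlin"
  by (simp_all add: scale_eq)

abbreviation "lin \<equiv> H.lin"
abbreviation "bil \<equiv> H.bil"
abbreviation "tri \<equiv> H.tri"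
abbreviation "vlin \<equiv> H.vlin"
abbreviation "\<Delta> \<equiv> comult H"
abbreviation "\<Delta>' \<equiv> comult H'"
abbreviation "S \<equiv> antipode H"
abbreviation "S' \<equiv> antipode H'"
abbreviation "eps \<equiv> counit H"

lemma lin_comult: "vlin g \<Longrightarrow> bil f \<Longrightarrow> lin (\<lambda>x. tsum (\<Delta> (g x)) f)"
  and lin_comult': "vlin g \<Longrightarrow> bil f \<Longrightarrow> lin (\<lambda>x. tsum (\<Delta>' (g x)) f)"
  using H.tsum_comult_lin[of f] H'.tsum_comult_lin[of f]
  by (auto simp: H'_lin H'_bil H.lin_def H.vlin_def)

lemma lin_eps: "vlin g \<Longrightarrow> lin (\<lambda>x. eps (g x))"
  using H.eps_lin by (auto simp: H.lin_def H.vlin_def)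

lemma vlin_S: "vlin g \<Longrightarrow> vlin (\<lambda>x. S (g x))" and vlin_S': "vlin g \<Longrightarrow> vlin (\<lambda>x. S' (g x))"
  using H.S_vlin H'.S_vlin by (auto simp: H'_vlin H.vlin_def)

lemma bil_lin: "bil f \<Longrightarrow> vlin g \<Longrightarrow> lin (\<lambda>x. f (g x) y)" "bil f \<Longrightarrow> vlin g \<Longrightarrow> lin (\<lambda>x. f y (g x))"
  by (auto simp: H.bil_def H.lin_def H.vlin_def)

lemma tri_lin: "tri f \<Longrightarrow> vlin g \<Longrightarrow> lin (\<lambda>x. f (g x) y z)"
  "tri f \<Longrightarrow> vlin g \<Longrightarrow> lin (\<lambda>x. f y (g x) z)" "tri f \<Longrightarrow> vlin g \<Longrightarrow> lin (\<lambda>x. f y z (g x))"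
  by (auto simp: H.tri_def H.lin_def H.vlin_def)

lemmas rules = H.lin_mult1 H.lin_mult2 lin_eps H.lin_tsum lin_comult lin_comult' H.bilI H.triI
  H.vlin_id H.vlin_mult1 H.vlin_mult2 vlin_S vlin_S'

lemmas \<Delta>_mult = H.tsum_comult_mult and \<Delta>_one = H.tsum_comult_one

text \<open>Apply \<epsilon> \<otimes> h to G F = 1 \<otimes> 1. As \<epsilon> is multiplicative,
  the contribution of \<open>G\<close> is 1 and that of \<open>F\<close> remains.\<close>

lemma counit_F_left: "lin h \<Longrightarrow> tsum F (\<lambda>a b. eps a * h b) = h 1"
proof -
  assume h: "lin h"
  have "h 1 = tsum G (\<lambda>a b. tsum F (\<lambda>c d. eps (a * c) * h (b * d)))"
    by (subst GF) (intro rules H.lin_comp[OF h], simp add: H.counit_one)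
  also have "\<dots> = tsum F (\<lambda>c d. eps c * tsum G (\<lambda>a b. eps a * h (b * d)))"
    by (subst tsum_swap) (simp add: H.counit_mult tsum_mult_left[symmetric] ac_simps)
  also have "\<dots> = tsum F (\<lambda>c d. eps c * h d)"
    by (subst counit_G_left, intro rules H.lin_comp[OF h]) simp
  finally show ?thesis ..
qed

lemma counit_F_right: "lin h \<Longrightarrow> tsum F (\<lambda>a b. eps b * h a) = h 1"
proof -
  assume h: "lin h"
  have "h 1 = tsum G (\<lambda>a b. tsum F (\<lambda>c d. eps (b * d) * h (a * c)))"
    by (subst GF[where f = "\<lambda>x y. eps y * h x"]) (intro rules H.lin_comp[OF h], simp add: H.counit_one)
  also have "\<dots> = tsum F (\<lambda>c d. eps d * tsum G (\<lambda>a b. eps b * h (a * c)))"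
    by (subst tsum_swap) (simp add: H.counit_mult tsum_mult_left[symmetric] ac_simps)
  also have "\<dots> = tsum F (\<lambda>c d. eps d * h c)"
    by (subst counit_G_right, intro rules H.lin_comp[OF h]) simp
  finally show ?thesis ..
qed

text \<open>
  Evaluation of trilinear forms at \<open>(F \<otimes> 1)(\<Delta> \<otimes> id)(F)\<close>, \<open>(1 \<otimes> F)(id \<otimes> \<Delta>)(F)\<close> and at the
  corresponding expressions in \<open>G\<close>.
\<close>

definition "F_l g = tsum F (\<lambda>a b. tsum F (\<lambda>c d. tsum (\<Delta> c) (\<lambda>c1 c2. g (a * c1) (b * c2) d)))"
definition "F_r g = tsum F (\<lambda>a b. tsum F (\<lambda>c d. tsum (\<Delta> d) (\<lambda>d1 d2. g c (a * d1) (b * d2))))"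
definition "G_l g = tsum G (\<lambda>a b. tsum (\<Delta> a) (\<lambda>a1 a2. tsum G (\<lambda>c d. g (a1 * c) (a2 * d) b)))"
definition "G_r g = tsum G (\<lambda>a b. tsum (\<Delta> b) (\<lambda>b1 b2. tsum G (\<lambda>c d. g a (b1 * c) (b2 * d))))"

text \<open>The inner factors (\<Delta> \<otimes> id)(F) and (\<Delta> \<otimes> id)(G) multiply to
  \<Delta>(1) \<otimes> 1, after which the outer \<open>F\<close> and \<open>G\<close> meet.\<close>

lemma F_l_G_l: "tri g \<Longrightarrow> F_l (\<lambda>x y z. G_l (\<lambda>u v w. g (x * u) (y * v) (z * w))) = g 1 1 1"
proof -
  assume g: "tri g"
  note R = rules tri_lin[OF g]
  have "F_l (\<lambda>x y z. G_l (\<lambda>u v w. g (x * u) (y * v) (z * w))) =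
    tsum F (\<lambda>a b. tsum F (\<lambda>c d. tsum (\<Delta> c) (\<lambda>c1 c2. 
      tsum G (\<lambda>a' b'. tsum (\<Delta> a') (\<lambda>a1 a2. tsum G (\<lambda>c' d'. g (a * (c1 * a1 * c')) (b * (c2 * a2 * d')) (d * b')))))))"
    unfolding F_l_def G_l_def by (simp add: mult.assoc)
  also have "\<dots> = tsum F (\<lambda>a b. tsum F (\<lambda>c d. tsum G (\<lambda>a' b'. tsum (\<Delta> (c * a')) (\<lambda>c1 c2. 
       tsum G (\<lambda>c' d'. g (a * (c1 * c')) (b * (c2 * d')) (d * b'))))))"
    by (subst \<Delta>_mult, intro R) (subst (3) tsum_swap, simp)
  also have "\<dots> = tsum F (\<lambda>a b. tsum G (\<lambda>c' d'. g (a * c') (b * d') 1))"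
    by (subst FG[where f = "\<lambda>x y. tsum (\<Delta> x) (\<lambda>c1 c2. tsum G (\<lambda>c' d'. g (a * (c1 * c')) (b * (c2 * d')) y))" for a b],
      intro R) (subst \<Delta>_one, intro R, simp)
  also have "\<dots> = g 1 1 1"
    by (rule FG[where f = "\<lambda>x y. g x y 1"]) (intro R)
  finally show ?thesis .
qed

lemma G_r_F_r: "tri g \<Longrightarrow> G_r (\<lambda>x y z. F_r (\<lambda>u v w. g (x * u) (y * v) (z * w))) = g 1 1 1"
proof -
  assume g: "tri g"
  note R = rules tri_lin[OF g]
  have "G_r (\<lambda>x y z. F_r (\<lambda>u v w. g (x * u) (y * v) (z * w))) =
    tsum G (\<lambda>a b. tsum (\<Delta> b) (\<lambda>b1 b2. tsum G (\<lambda>c d. tsum F (\<lambda>a' b'. tsum F (\<lambda>c' d'. tsum (\<Delta> d') (\<lambda>d1 d2.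
      g (a * c') (b1 * (c * a') * d1) (b2 * (d * b') * d2)))))))"
    unfolding F_r_def G_r_def by (simp add: mult.assoc)
  also have "\<dots> = tsum G (\<lambda>a b. tsum (\<Delta> b) (\<lambda>b1 b2. tsum F (\<lambda>c' d'. tsum (\<Delta> d') (\<lambda>d1 d2.
      g (a * c') (b1 * d1) (b2 * d2)))))"
    by (subst GF[where f = "\<lambda>x y. tsum F (\<lambda>c' d'. tsum (\<Delta> d') (\<lambda>d1 d2.
      g (a * c') (b1 * x * d1) (b2 * y * d2)))" for a b1 b2], intro R) simp
  also have "\<dots> = tsum G (\<lambda>a b. tsum F (\<lambda>c' d'. tsum (\<Delta> (b * d')) (\<lambda>d1 d2. g (a * c') d1 d2)))"
    by (subst \<Delta>_mult, intro R) (subst (2) tsum_swap, simp)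
  also have "\<dots> = tsum (\<Delta> 1) (g 1)"
    by (rule GF[where f = "\<lambda>x y. tsum (\<Delta> y) (\<lambda>d1 d2. g x d1 d2)"]) (intro R)
  also have "\<dots> = g 1 1 1"
    by (rule \<Delta>_one) (intro R)
  finally show ?thesis .
qed

text \<open>Inverses of equal elements are equal: F_l = F_l G_r F_r = F_l G_l F_r = F_r, with
  products in the threefold tensor power.\<close>

lemma cocycle_F: 
  assumes g: "tri g"
  shows "F_l g = F_r g"
proof -
  note R = rules tri_lin[OF g]
  have *: "G_r (\<lambda>u v w. F_r (\<lambda>u' v' w'. g (x * u * u') (y * v * v') (z * w * w'))) =
    G_l (\<lambda>u v w. F_r (\<lambda>u' v' w'. g (x * u * u') (y * v * v') (z * w * w')))" for x y z
    unfolding G_l_def G_r_def by (rule cocycle_G[symmetric]) (unfold F_r_def, intro R)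
  have "F_l g = F_l (\<lambda>x y z. G_r (\<lambda>u v w. F_r (\<lambda>u' v' w'. g (x * (u * u')) (y * (v * v')) (z * (w * w')))))"
    by (subst G_r_F_r) (intro R, simp)
  also have "\<dots> = F_l (\<lambda>x y z. G_l (\<lambda>u v w. F_r (\<lambda>u' v' w'. g (x * u * u') (y * v * v') (z * w * w'))))"
    using * by (simp add: mult.assoc)
  also have "\<dots> = F_r g"
    using F_l_G_l[of "\<lambda>x y z. F_r (\<lambda>u' v' w'. g (x * u') (y * v') (z * w'))"]
    unfolding F_r_def
  proof (rule back_subst)
    show "tri (\<lambda>x y z. tsum F (\<lambda>a b. tsum F (\<lambda>c d. tsum (\<Delta> d) (\<lambda>d1 d2.
        g (x * c) (y * (a * d1)) (z * (b * d2))))))" by (intro R)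
  qed simp
  finally show ?thesis .
qed

text \<open>Multiplied by 1 \<otimes> G on the left and by (\<Delta> \<otimes> id)(G) on the right,
  the cocycle law for \<open>F\<close> becomes (1 \<otimes> G)(F \<otimes> 1) = (id \<otimes>
  \<Delta>)(F) (\<Delta> \<otimes> id)(G). It serves to show that \<open>u\<close> is
  invertible.\<close>

lemma F_mid_G: "tri g \<Longrightarrow> tsum G (\<lambda>c d. tsum F (\<lambda>a b. g a (c * b) d)) =
  tsum F (\<lambda>a b. tsum (\<Delta> b) (\<lambda>b1 b2. tsum G (\<lambda>c d. tsum (\<Delta> c) (\<lambda>c1 c2. g (a * c1) (b1 * c2) (b2 * d)))))"
  (is "_ \<Longrightarrow> ?l = ?r")
proof -
  assume g: "tri g"
  note R = rules tri_lin[OF g]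
  \<comment> \<open>\<open>?M\<close> multiplies its argument by (\<Delta> \<otimes> id)(G) on the
    right before g is applied; a factor (\<Delta> \<otimes> id)(F) in front of it cancels
    this.\<close>
  let ?M = "\<lambda>x y z. tsum G (\<lambda>a b. tsum (\<Delta> a) (\<lambda>a1 a2. g (x * a1) (y * a2) (z * b)))"
  have "tsum F (\<lambda>r t. tsum (\<Delta> r) (\<lambda>r1 r2. ?M (x * r1) (y * r2) (z * t))) = g x y z" for x y z
  proof -
    have "tsum F (\<lambda>r t. tsum (\<Delta> r) (\<lambda>r1 r2. ?M (x * r1) (y * r2) (z * t))) =
      tsum F (\<lambda>r t. tsum G (\<lambda>a b. tsum (\<Delta> (r * a)) (\<lambda>a1 a2. g (x * a1) (y * a2) (z * (t * b)))))"
      by (subst \<Delta>_mult, intro R) (subst (2) tsum_swap, simp add: mult.assoc)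
    also have "\<dots> = g x y z"
      by (subst FG[where f = "\<lambda>u v. tsum (\<Delta> u) (\<lambda>a1 a2. g (x * a1) (y * a2) (z * v))"], intro R)
        (subst \<Delta>_one, intro R, simp)
    finally show ?thesis .
  qed
  then have "?l = tsum G (\<lambda>c d. tsum F (\<lambda>a b. tsum F (\<lambda>r t. tsum (\<Delta> r) (\<lambda>r1 r2. ?M (a * r1) (c * b * r2) (d * t)))))"
    by simp
  also have "\<dots> = tsum G (\<lambda>c d. F_l (\<lambda>u v w. ?M u (c * v) (d * w)))"
    unfolding F_l_def by (simp only: mult.assoc)
  also have "\<dots> = tsum G (\<lambda>c d. F_r (\<lambda>u v w. ?M u (c * v) (d * w)))"
    by (subst cocycle_F) (intro R, simp)
  also have "\<dots> = tsum F (\<lambda>p q. tsum (\<Delta> q) (\<lambda>q1 q2. tsum G (\<lambda>c d. tsum F (\<lambda>a b. ?M p (c * a * q1) (d * b * q2)))))"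
    unfolding F_r_def by (subst tsum_swap4) (simp add: mult.assoc)
  also have "\<dots> = tsum F (\<lambda>p q. tsum (\<Delta> q) (\<lambda>q1 q2. ?M p q1 q2))"
    by (subst GF[where f = "\<lambda>x y. ?M p (x * q1) (y * q2)" for p q1 q2], intro R) simp
  finally show "?l = ?r" by simp
qed

text \<open>\<open>u\<close> is the element that conjugates the antipode in the usual description of
  a twisted Hopf algebra; \<open>q\<close> will be its inverse.\<close>

definition "u = tsum F (\<lambda>a b. a * S b)"
definition "q = tsum G (\<lambda>a b. S a * b)"

lemma lin_u: "lin h \<Longrightarrow> h u = tsum F (\<lambda>a b. h (a * S b))"
  and lin_q: "lin h \<Longrightarrow> h q = tsum G (\<lambda>a b. h (S a * b))"
  unfolding u_def q_def by (rule H.lin_tsum_val, assumption)+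

lemma lin_ext: "(\<And>f. lin f \<Longrightarrow> f x = f y) \<Longrightarrow> x = y"
proof -
  obtain n :: nat and b \<phi> where "\<And>m. linear_form (hscale H) (\<phi> m)" "\<And>x. (\<Sum>m<n. hscale H (\<phi> m x) (b m)) = x"
    using H.exists_coordinates by blast
  then interpret hopf_category_pre "hscale H" "\<lambda>_ _. \<Delta>" eps "\<lambda>_ _. S" n b \<phi>
    by (rule H.hopf_category_pre)
  show "(\<And>f. lin f \<Longrightarrow> f x = f y) \<Longrightarrow> x = y" by (rule lin_ext)
qed

lemma S_mult: "S (x * y) = S y * S x"
proof -
  obtain n :: nat and b \<phi> where "\<And>m. linear_form (hscale H) (\<phi> m)" "\<And>x. (\<Sum>m<n. hscale H (\<phi> m x) (b m)) = x"
    using H.exists_coordinates by blast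
  then interpret hopf_category_pre "hscale H" "\<lambda>_ _. \<Delta>" eps "\<lambda>_ _. S" n b \<phi>
    by (rule H.hopf_category_pre)
  show ?thesis by (rule A_mult)
qed

lemma S_one: "S 1 = 1"
proof -
  obtain n :: nat and b \<phi> where "\<And>m. linear_form (hscale H) (\<phi> m)" "\<And>x. (\<Sum>m<n. hscale H (\<phi> m x) (b m)) = x"
    using H.exists_coordinates by blast
  then interpret hopf_category_pre "hscale H" "\<lambda>_ _. \<Delta>" eps "\<lambda>_ _. S" n b \<phi>
    by (rule H.hopf_category_pre)
  show ?thesis by (rule A_one)
qed

text \<open>The product is F1 S(G1 F2) G2, with legs F1, F2 of \<open>F\<close> and G1, G2 of
  \<open>G\<close>. \<open>F_mid_G\<close> splits G1 and F2 by coproducts so that their parts meet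
  in the two antipode identities, and only counits of \<open>F\<close> and \<open>G\<close>
  remain.\<close>

lemma uq: "u * q = 1"
proof (rule lin_ext)
  fix h assume h: "lin h"
  note R = rules H.lin_comp[OF h]
  have "h (u * q) = tsum F (\<lambda>a b. tsum G (\<lambda>c d. h (a * S b * (S c * d))))"
    by (subst lin_u[of "\<lambda>x. h (x * q)"], intro R) (subst lin_q, intro R, simp)
  also have "\<dots> = tsum G (\<lambda>c d. tsum F (\<lambda>a b. h (a * S (c * b) * d)))"
    by (subst tsum_swap) (simp add: S_mult mult.assoc)
  also have "\<dots> = tsum F (\<lambda>a b. tsum (\<Delta> b) (\<lambda>b1 b2. tsum G (\<lambda>c d. tsum (\<Delta> c) (\<lambda>c1 c2.
      h (a * (c1 * S c2) * S b1 * (b2 * d))))))"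
    by (subst F_mid_G) (intro R, simp add: S_mult mult.assoc)
  also have "\<dots> = tsum F (\<lambda>a b. tsum (\<Delta> b) (\<lambda>b1 b2. tsum G (\<lambda>c d. eps c * h (a * S b1 * (b2 * d)))))"
    by (subst H.tsum_antipode_right[where h = "\<lambda>z. h (a * z * S b1 * (b2 * d))" for a b1 b2 d], intro R) simp
  also have "\<dots> = tsum F (\<lambda>a b. tsum (\<Delta> b) (\<lambda>b1 b2. h (a * (S b1 * b2))))"
    by (subst counit_G_left[where h = "\<lambda>z. h (a * S b1 * (b2 * z))" for a b1 b2], intro R) (simp add: mult.assoc)
  also have "\<dots> = tsum F (\<lambda>a b. eps b * h a)"
    by (subst H.tsum_antipode_left[where h = "\<lambda>z. h (a * z)" for a], intro R) simp
  also have "\<dots> = h 1"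
    by (rule counit_F_right) (rule h)
  finally show "h (u * q) = h 1" .
qed

lemma qu: "q * u = 1"
  by (rule H.right_inverse_imp_left) (rule uq)

text \<open>\<open>True\<close> stands for \<open>H\<close> and \<open>False\<close> for
  \<open>H'\<close>. In the mixed coalgebras \<open>F\<close> or \<open>G\<close> stands on the side
  where the index is \<open>False\<close>, so that a product of mixed elements with
  \<open>False\<close> in the middle contains G F, which cancels.\<close>

definition DD :: "bool \<Rightarrow> bool \<Rightarrow> 'h \<Rightarrow> ('h \<times> 'h) list" where
  "DD i j x = (if i then if j then \<Delta> x else [(a * c, b * d). (a, b) \<leftarrow> \<Delta> x, (c, d) \<leftarrow> G]
     else if j then [(a * c, b * d). (a, b) \<leftarrow> F, (c, d) \<leftarrow> \<Delta> x] else \<Delta>' x)"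

text \<open>In \<Delta>(x) G the identity for S(x1) x2 leaves S(G1) G2 = q, which the factor
  \<open>u\<close> removes. In F \<Delta>(x) the identity for x1 S(x2) leaves F1 S(F2) = u, which
  the factor \<open>q\<close> removes.\<close>

definition AA :: "bool \<Rightarrow> bool \<Rightarrow> 'h \<Rightarrow> 'h" where
  "AA i j x = (if i then if j then S x else u * S x else if j then S x * q else S' x)"

lemma DD_simps:
  "DD True True = \<Delta>" "DD False False = \<Delta>'"
  "tsum (DD True False x) f = tsum (\<Delta> x) (\<lambda>a b. tsum G (\<lambda>c d. f (a * c) (b * d)))"
  "tsum (DD False True x) f = tsum F (\<lambda>a b. tsum (\<Delta> x) (\<lambda>c d. f (a * c) (b * d)))"
  by (auto simp: DD_def tsum_pairs fun_eq_iff)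

lemma AA_simps: "AA True True = S" "AA False False = S'" "AA True False x = u * S x" "AA False True x = S x * q"
  by (auto simp: AA_def fun_eq_iff)

lemma \<Delta>'_eq: "bil f \<Longrightarrow> tsum (\<Delta>' x) f =
  tsum F (\<lambda>a b. tsum (\<Delta> x) (\<lambda>c d. tsum G (\<lambda>k l. f (a * c * k) (b * d * l))))"
proof -
  assume f: "bil f"
  note R = rules bil_lin[OF f]
  have "tsum F (\<lambda>a b. tsum (\<Delta> x) (\<lambda>c d. tsum G (\<lambda>k l. f (a * c * k) (b * d * l)))) =
    tsum F (\<lambda>a b. tsum (\<Delta> x) (\<lambda>c d. tsum G (\<lambda>k l. f (a * (c * k)) (b * (d * l)))))"
    by (simp add: mult.assoc)
  also have "\<dots> = tsum F (\<lambda>a b. tsum G (\<lambda>k l. tsum (\<Delta>' x) (\<lambda>c d. f (a * k * c) (b * l * d))))"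
    by (subst twist, intro R) (simp add: mult.assoc)
  also have "\<dots> = tsum (\<Delta>' x) f"
    by (subst FG[where f = "\<lambda>p q. tsum (\<Delta>' x) (\<lambda>c d. f (p * c) (q * d))"], intro R) simp
  finally show ?thesis ..
qed

lemma DD_lin: "bil f \<Longrightarrow> lin (\<lambda>x. tsum (DD i j x) f)"
proof -
  assume f: "bil f"
  note R = rules bil_lin[OF f]
  show ?thesis
  proof (cases i; cases j)
    assume "i" "j" then show ?thesis using H.tsum_comult_lin[OF f] by (simp add: DD_simps)
  next
    assume "i" "\<not> j" then show ?thesis by (simp add: DD_simps) (intro R)
  next
    assume "\<not> i" "j" then show ?thesis by (simp add: DD_simps) (intro R)
  next
    assume "\<not> i" "\<not> j" then show ?thesis
      using H'.tsum_comult_lin f by (simp add: DD_simps H'_lin H'_bil)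
  qed
qed

text \<open>The eight choices of i, j, k differ in what stands between the two coproducts. It is
  nothing for the middle object \<open>True\<close>. For \<open>False\<close>, G F cancels when both
  factors are mixed, G is moved past a twisted coproduct by \<open>twist\<close>, and a twisted
  coproduct before F is expanded as F \<Delta> G.\<close>

lemma DD_mult: "bil f \<Longrightarrow> tsum (DD i k (x * y)) f =
    tsum (DD i j x) (\<lambda>a b. tsum (DD j k y) (\<lambda>c d. f (a * c) (b * d)))"
proof -
  assume f: "bil f"
  note R = rules bil_lin[OF f]
  have GF': "tsum G (\<lambda>c d. tsum F (\<lambda>p q. tsum (\<Delta> y) (\<lambda>r t. f (a * (c * (p * r))) (b * (d * (q * t)))))) =
      tsum (\<Delta> y) (\<lambda>r t. f (a * r) (b * t))" for a b
  proof -
    have "bil (\<lambda>P Q. tsum (\<Delta> y) (\<lambda>r t. f (a * (P * r)) (b * (Q * t))))" by (intro R)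
    from GF[OF this] show ?thesis by (simp add: mult.assoc)
  qed
  have twist': "tsum (\<Delta> y) (\<lambda>r t. tsum G (\<lambda>c d. f (a * (r * c)) (b * (t * d)))) =
      tsum G (\<lambda>c d. tsum (\<Delta>' y) (\<lambda>r t. f (a * (c * r)) (b * (d * t))))" for a b
    by (rule twist) (intro R)
  have \<Delta>f: "tsum (\<Delta> (x * y)) (\<lambda>r t. f (a * r) (b * t)) =
      tsum (\<Delta> x) (\<lambda>c d. tsum (\<Delta> y) (\<lambda>r t. f (a * (c * r)) (b * (d * t))))" for a b
    by (rule \<Delta>_mult) (intro R)
  have \<Delta>G: "tsum (\<Delta> (x * y)) (\<lambda>r t. tsum G (\<lambda>k l. f (a * (r * k)) (b * (t * l)))) =
      tsum (\<Delta> x) (\<lambda>c d. tsum (\<Delta> y) (\<lambda>r t. tsum G (\<lambda>k l. f (a * (c * (r * k))) (b * (d * (t * l))))))" for a b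
    by (subst \<Delta>_mult) (intro R, simp add: mult.assoc)
  have 1: ?thesis if "i" "j" "k"
    using that \<Delta>_mult[OF f] by (simp add: DD_simps)
  have 2: ?thesis if "\<not> i" "\<not> j" "\<not> k"
    using that H'.tsum_comult_mult f by (simp add: DD_simps H'_bil)
  have 3: ?thesis if "i" "j" "\<not> k"
    using that by (simp add: DD_simps) (subst \<Delta>_mult, intro R, simp add: mult.assoc)
  have 4: ?thesis if "i" "\<not> j" "k"
    using that by (simp add: DD_simps mult.assoc \<Delta>_mult[OF f] GF')
  have 5: ?thesis if "i" "\<not> j" "\<not> k"
    using that \<Delta>G[of 1 1] by (simp add: DD_simps mult.assoc twist')
  have 6: ?thesis if "\<not> i" "j" "k"
    using that by (simp add: DD_simps mult.assoc \<Delta>f)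
  have 7: ?thesis if "\<not> i" "j" "\<not> k"
    using that by (simp add: DD_simps mult.assoc \<Delta>'_eq[OF f] \<Delta>G)
  have 8: ?thesis if "\<not> i" "\<not> j" "k"
  proof -
    have "bil (\<lambda>a b. tsum F (\<lambda>c d. tsum (\<Delta> y) (\<lambda>r t. f (a * (c * r)) (b * (d * t)))))" by (intro R)
    note * = \<Delta>'_eq[OF this, of x]
    have "tsum (DD i j x) (\<lambda>a b. tsum (DD j k y) (\<lambda>c d. f (a * c) (b * d))) =
      tsum F (\<lambda>a b. tsum (\<Delta> x) (\<lambda>c d. tsum G (\<lambda>k l. tsum F (\<lambda>p q. tsum (\<Delta> y) (\<lambda>r t.
        f (a * c * (k * (p * r))) (b * d * (l * (q * t))))))))"
      using that * by (simp add: DD_simps mult.assoc)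
    also have "\<dots> = tsum (DD i k (x * y)) f"
      using that by (simp add: DD_simps GF' \<Delta>f) (simp add: mult.assoc)
    finally show ?thesis ..
  qed
  from 1 2 3 4 5 6 7 8 show ?thesis by blast
qed

text \<open>Coassociativity of \<Delta>(x) G amounts to that of \<Delta> together with the cocycle
  law for \<open>G\<close>, and that of F \<Delta>(x) to the law for \<open>F\<close>.\<close>

lemma DD_coassoc: "tri g \<Longrightarrow> tsum (DD i j x) (\<lambda>a r. tsum (DD i j a) (\<lambda>a1 a2. g a1 a2 r)) =
    tsum (DD i j x) (\<lambda>a r. tsum (DD i j r) (\<lambda>r1 r2. g a r1 r2))"
proof -
  assume g: "tri g"
  note R = rules tri_lin[OF g]
  have 1: ?thesis if "i" "j"
    using that H.tsum_coassoc[OF g] by (simp add: DD_simps)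
  have 2: ?thesis if "\<not> i" "\<not> j"
    using that H'.tsum_coassoc g by (simp add: DD_simps H'_tri)
  have 3: ?thesis if "i" "\<not> j"
  proof -
    have a: "tsum (\<Delta> (a * c)) (\<lambda>k l. tsum G (\<lambda>p q. g (k * p) (l * q) r)) =
      tsum (\<Delta> a) (\<lambda>a1 a2. tsum (\<Delta> c) (\<lambda>c1 c2. tsum G (\<lambda>p q. g (a1 * (c1 * p)) (a2 * (c2 * q)) r)))" for a c r
      by (subst \<Delta>_mult) (intro R, simp add: mult.assoc)
    have b: "tsum (\<Delta> (a * c)) (\<lambda>k l. tsum G (\<lambda>p q. g r (k * p) (l * q))) =
      tsum (\<Delta> a) (\<lambda>a1 a2. tsum (\<Delta> c) (\<lambda>c1 c2. tsum G (\<lambda>p q. g r (a1 * (c1 * p)) (a2 * (c2 * q)))))" for a c r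
      by (subst \<Delta>_mult) (intro R, simp add: mult.assoc)
    have "tsum (\<Delta> x) (\<lambda>a b. tsum G (\<lambda>c d. tsum (\<Delta> (a * c)) (\<lambda>k l. tsum G (\<lambda>p q. g (k * p) (l * q) (b * d))))) =
      tsum (\<Delta> x) (\<lambda>a b. tsum (\<Delta> a) (\<lambda>a1 a2. tsum G (\<lambda>c d. tsum (\<Delta> c) (\<lambda>c1 c2. tsum G (\<lambda>p q.
        g (a1 * (c1 * p)) (a2 * (c2 * q)) (b * d))))))"
      unfolding a by (subst (2) tsum_swap) simp
    also have "\<dots> = tsum (\<Delta> x) (\<lambda>a b. tsum (\<Delta> b) (\<lambda>b1 b2. tsum G (\<lambda>c d. tsum (\<Delta> c) (\<lambda>c1 c2. tsum G (\<lambda>p q.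
        g (a * (c1 * p)) (b1 * (c2 * q)) (b2 * d))))))"
      by (subst H.tsum_coassoc) (intro R, simp)
    also have "\<dots> = tsum (\<Delta> x) (\<lambda>a b. tsum (\<Delta> b) (\<lambda>b1 b2. tsum G (\<lambda>c d. tsum (\<Delta> d) (\<lambda>c1 c2. tsum G (\<lambda>p q.
        g (a * c) (b1 * (c1 * p)) (b2 * (c2 * q)))))))"
      by (subst cocycle_G) (intro R, simp)
    also have "\<dots> = tsum (\<Delta> x) (\<lambda>a b. tsum G (\<lambda>c d. tsum (\<Delta> (b * d)) (\<lambda>k l. tsum G (\<lambda>p q. g (a * c) (k * p) (l * q)))))"
      unfolding b by (subst (2) tsum_swap) simp
    finally show ?thesis using that by (simp add: DD_simps)
  qed
  have 4: ?thesis if "\<not> i" "j"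
  proof -
    have a: "tsum (\<Delta> (c * a)) (\<lambda>k l. g (p * k) (q * l) r) =
      tsum (\<Delta> c) (\<lambda>c1 c2. tsum (\<Delta> a) (\<lambda>a1 a2. g (p * c1 * a1) (q * c2 * a2) r))" for a c r p q
      by (subst \<Delta>_mult) (intro R, simp add: mult.assoc)
    have b: "tsum (\<Delta> (c * a)) (\<lambda>k l. g r (p * k) (q * l)) =
      tsum (\<Delta> c) (\<lambda>c1 c2. tsum (\<Delta> a) (\<lambda>a1 a2. g r (p * c1 * a1) (q * c2 * a2)))" for a c r p q
      by (subst \<Delta>_mult) (intro R, simp add: mult.assoc)
    have "tsum F (\<lambda>c d. tsum (\<Delta> x) (\<lambda>a b. tsum F (\<lambda>p q. tsum (\<Delta> (c * a)) (\<lambda>k l. g (p * k) (q * l) (d * b))))) =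
      tsum (\<Delta> x) (\<lambda>a b. tsum (\<Delta> a) (\<lambda>a1 a2. F_l (\<lambda>u v w. g (u * a1) (v * a2) (w * b))))"
      unfolding a F_l_def by (subst tsum_reorder) simp
    also have "\<dots> = tsum (\<Delta> x) (\<lambda>a b. tsum (\<Delta> b) (\<lambda>a1 a2. F_l (\<lambda>u v w. g (u * a) (v * a1) (w * a2))))"
      unfolding F_l_def by (subst H.tsum_coassoc) (intro R, simp)
    also have "\<dots> = tsum (\<Delta> x) (\<lambda>a b. tsum (\<Delta> b) (\<lambda>a1 a2. F_r (\<lambda>u v w. g (u * a) (v * a1) (w * a2))))"
      by (subst cocycle_F) (intro R, simp)
    also have "\<dots> = tsum F (\<lambda>c d. tsum (\<Delta> x) (\<lambda>a b. tsum F (\<lambda>p q. tsum (\<Delta> (d * b)) (\<lambda>k l. g (c * a) (p * k) (q * l)))))"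
      unfolding b F_r_def by (subst tsum_reorder) simp
    finally show ?thesis using that by (simp add: DD_simps)
  qed
  from 1 2 3 4 show ?thesis by blast
qed

lemma DD_counit: "lin h \<Longrightarrow> tsum (DD i j x) (\<lambda>a r. eps a * h r) = h x"
  "lin h \<Longrightarrow> tsum (DD i j x) (\<lambda>a r. eps r * h a) = h x"
proof -
  assume h: "lin h"
  note R = rules H.lin_comp[OF h]
  have G: "tsum G (\<lambda>c d. eps c * h (b * d)) = h b" "tsum G (\<lambda>c d. eps d * h (b * c)) = h b" for b
    using counit_G_left[of "\<lambda>z. h (b * z)"] counit_G_right[of "\<lambda>z. h (b * z)"] by (simp_all add: R)
  have F: "tsum F (\<lambda>c d. eps c * h (d * b)) = h b" "tsum F (\<lambda>c d. eps d * h (c * b)) = h b" for b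
    using counit_F_left[of "\<lambda>z. h (z * b)"] counit_F_right[of "\<lambda>z. h (z * b)"] by (simp_all add: R)
  have D: "tsum (\<Delta> x) (\<lambda>c d. eps c * h (b * d)) = h (b * x)" "tsum (\<Delta> x) (\<lambda>c d. eps d * h (b * c)) = h (b * x)" for b
    using H.tsum_counit_left[of "\<lambda>z. h (b * z)"] H.tsum_counit_right[of "\<lambda>z. h (b * z)"] by (simp_all add: R)
  show "tsum (DD i j x) (\<lambda>a r. eps a * h r) = h x" "tsum (DD i j x) (\<lambda>a r. eps r * h a) = h x"
    using H.tsum_counit_left[OF h, of x] H.tsum_counit_right[OF h, of x]
      H'.tsum_counit_left[of h x] H'.tsum_counit_right[of h x] h
    by (cases i; cases j; simp add: DD_simps H'_lin counit_eq H.counit_mult mult.assoc tsum_mult_left G D F)+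
qed

lemma DD_antipode: "lin h \<Longrightarrow> tsum (DD i j x) (\<lambda>a r. h (AA i j a * r)) = eps x * h 1"
  "lin h \<Longrightarrow> tsum (DD i j x) (\<lambda>a r. h (a * AA i j r)) = eps x * h 1"
proof -
  assume h: "lin h"
  note R = rules H.lin_comp[OF h]
  have l: "tsum (\<Delta> x) (\<lambda>a r. h (b * (S a * (r * c)))) = eps x * h (b * c)" for b c
    using H.tsum_antipode_left[of "\<lambda>z. h (b * (z * c))" x] by (simp add: R mult.assoc)
  have r: "tsum (\<Delta> x) (\<lambda>a r. h (b * (a * (S r * c)))) = eps x * h (b * c)" for b c
    using H.tsum_antipode_right[of "\<lambda>z. h (b * (z * c))" x] by (simp add: R mult.assoc)
  have q: "tsum G (\<lambda>a b. h (k * (S a * (b * m)))) = h (k * (q * m))" for k m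
    using lin_q[of "\<lambda>z. h (k * (z * m))"] by (simp add: R mult.assoc)
  have u: "tsum F (\<lambda>a b. h (k * (a * (S b * m)))) = h (k * (u * m))" for k m
    using lin_u[of "\<lambda>z. h (k * (z * m))"] by (simp add: R mult.assoc)
  \<comment> \<open>Expanding \<open>q\<close> and \<open>u\<close> gives S(F1) q F2 = 1 and, in the
    next fact, G1 u S(G2) = 1, both by G F = 1 \<otimes> 1. These are the antipode identities in
    which the correcting factor ends up between the legs.\<close>
  have FqS: "tsum F (\<lambda>c d. h (k * (S c * (q * (d * m))))) = h (k * m)" for k m
  proof -
    have "h (k * (S c * (q * (d * m)))) = tsum G (\<lambda>a b. h (k * (S (a * c) * (b * d * m))))" for c d
      using q[of "k * S c" "d * m"] by (simp add: S_mult mult.assoc)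
    then have "tsum F (\<lambda>c d. h (k * (S c * (q * (d * m))))) = tsum G (\<lambda>a b. tsum F (\<lambda>c d. h (k * (S (a * c) * (b * d * m)))))"
      by (subst tsum_swap) simp
    also have "\<dots> = h (k * m)"
      by (subst GF[where f = "\<lambda>x y. h (k * (S x * (y * m)))"], intro R) (simp add: S_one)
    finally show ?thesis .
  qed
  have GuS: "tsum G (\<lambda>a b. h (m * (a * (u * (S b * k))))) = h (m * k)" for m k
  proof -
    have "tsum G (\<lambda>a b. h (m * (a * (u * (S b * k))))) = tsum G (\<lambda>a b. tsum F (\<lambda>c d. h (m * ((a * c) * (S (b * d) * k)))))"
    proof -
      have "h (m * (a * (u * (S b * k)))) = tsum F (\<lambda>c d. h (m * ((a * c) * (S (b * d) * k))))" for a b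
        using u[of "m * a" "S b * k"] by (simp add: S_mult mult.assoc)
      then show ?thesis by simp
    qed
    also have "\<dots> = h (m * k)"
      by (subst GF[where f = "\<lambda>x y. h (m * (x * (S y * k)))"], intro R) (simp add: S_one)
    finally show ?thesis .
  qed
  have A: "tsum (DD i j x) (\<lambda>a r. h (AA i j a * r)) = eps x * h 1"
    "tsum (DD i j x) (\<lambda>a r. h (a * AA i j r)) = eps x * h 1" if "i" "j"
    using that H.tsum_antipode_left[OF h] H.tsum_antipode_right[OF h] by (simp_all add: DD_simps AA_simps)
  have B: "tsum (DD i j x) (\<lambda>a r. h (AA i j a * r)) = eps x * h 1"
    "tsum (DD i j x) (\<lambda>a r. h (a * AA i j r)) = eps x * h 1" if "\<not> i" "\<not> j"
    using that H'.tsum_antipode_left[of h] H'.tsum_antipode_right[of h] h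
    by (simp_all add: DD_simps AA_simps H'_lin counit_eq)
  have C: "tsum (DD i j x) (\<lambda>a r. h (AA i j a * r)) = eps x * h 1"
    "tsum (DD i j x) (\<lambda>a r. h (a * AA i j r)) = eps x * h 1" if "i" "\<not> j"
  proof -
    have "tsum (\<Delta> x) (\<lambda>a b. tsum G (\<lambda>c d. h (u * (S c * (S a * (b * d)))))) = eps x * h 1"
      apply (subst tsum_swap)
      using l[of "u * S c" d for c d] q[of u 1]
      by (simp add: mult.assoc tsum_mult_left uq)
    then show "tsum (DD i j x) (\<lambda>a r. h (AA i j a * r)) = eps x * h 1"
      using that by (simp add: DD_simps AA_simps S_mult mult.assoc)
    show "tsum (DD i j x) (\<lambda>a r. h (a * AA i j r)) = eps x * h 1"
      using that GuS r[of 1 1] by (simp add: DD_simps AA_simps S_mult mult.assoc)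
  qed
  have E: "tsum (DD i j x) (\<lambda>a r. h (AA i j a * r)) = eps x * h 1"
    "tsum (DD i j x) (\<lambda>a r. h (a * AA i j r)) = eps x * h 1" if "\<not> i" "j"
  proof -
    have "tsum F (\<lambda>a b. tsum (\<Delta> x) (\<lambda>c d. h (S c * (S a * (q * (b * d)))))) = eps x * h 1"
      using l[of 1 1] by (subst tsum_swap) (simp add: FqS)
    then show "tsum (DD i j x) (\<lambda>a r. h (AA i j a * r)) = eps x * h 1"
      using that by (simp add: DD_simps AA_simps S_mult mult.assoc)
    have "tsum F (\<lambda>a b. tsum (\<Delta> x) (\<lambda>c d. h (a * (c * (S d * (S b * q)))))) = eps x * h 1"
      using r[of _ "S b * q" for b] u[of 1 q] by (simp add: tsum_mult_left uq)
    then show "tsum (DD i j x) (\<lambda>a r. h (a * AA i j r)) = eps x * h 1"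
      using that by (simp add: DD_simps AA_simps S_mult mult.assoc)
  qed
  from A B C E show "tsum (DD i j x) (\<lambda>a r. h (AA i j a * r)) = eps x * h 1"
    "tsum (DD i j x) (\<lambda>a r. h (a * AA i j r)) = eps x * h 1"
    by blast+
qed

lemma DD_one: "bil f \<Longrightarrow> tsum (DD i i 1) f = f 1 1"
  using H.tsum_comult_one H'.tsum_comult_one by (cases i) (simp_all add: DD_simps H'_bil)

text \<open>The inverse of x \<mapsto> u S(x) takes y to the preimage of q y under S, and the
  inverse of x \<mapsto> S(x) q takes it to the preimage of y u. As \<open>BB j i\<close> inverts
  \<open>AA i j\<close>, the formulas stand at exchanged indices.\<close>

definition BB :: "bool \<Rightarrow> bool \<Rightarrow> 'h \<Rightarrow> 'h" where
  "BB i j y = (if i then if j then inv_into UNIV S y else inv_into UNIV S (y * u) else if j then inv_into UNIV S (q * y) else inv_into UNIV S' y)"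

lemma AA_vlin: "Vector_Spaces.linear (hscale H) (hscale H) (AA i j)"
proof -
  have "AA i j = (\<lambda>x. if i then if j then S x else u * S x else if j then S x * q else S' x)"
    by (auto simp: AA_def fun_eq_iff)
  then show ?thesis
    unfolding H.vlin_iff by (cases i; cases j; simp; intro rules)
qed

theorem kuperberg_T3_eq:
  assumes int: "normalized_integrals H \<Lambda> l" and int': "normalized_integrals H' \<Lambda>' l'"
  shows "kuperberg_T3 H \<Lambda> l = kuperberg_T3 H' \<Lambda>' l'"
proof -
  have S: "bij S" "bij S'" using H.bij_S[OF int] H'.bij_S[OF int'] by auto
  obtain n :: nat and b \<phi> where "\<And>m. linear_form (hscale H) (\<phi> m)" "\<And>x. (\<Sum>m<n. hscale H (\<phi> m x) (b m)) = x"
    using H.exists_coordinates by blast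
  then interpret pre: hopf_category_pre "hscale H" DD eps AA n b \<phi>
    by (intro hopf_category_pre.intro hopf_category_pre_axioms.intro H.algebra_over_axioms;
      (unfold H.bil_iff H.lin_iff H.tri_iff)?)
    (erule DD_lin DD_coassoc DD_counit DD_antipode DD_mult |
     erule DD_one |
     rule H.eps_lin H.counit_mult H.counit_one AA_vlin | simp add: H.lin_iff)+
  interpret hopf_category "hscale H" DD eps AA n b \<phi> BB
  proof
    show "AA i j (BB j i x) = x" for i j x
      using S by (cases i; cases j) (simp_all add: AA_def BB_def bij_is_surj surj_f_inv_f mult.assoc uq
          mult.assoc[symmetric, of u q] mult.assoc[symmetric, of _ u q])
    show "BB j i (AA i j x) = x" for i j x
      using S by (cases i; cases j) (simp_all add: AA_def BB_def bij_is_inj inv_f_f mult.assoc qu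
          mult.assoc[symmetric, of q u])
  qed
  \<comment> \<open>The diagonal entries at \<open>True\<close> and \<open>False\<close> carry the
    integrals of \<open>H\<close> and of \<open>H'\<close> respectively, so
    \<open>integral_T\<close> recognises each invariant as its own trace.\<close>
  have "kuperberg_T3 H \<Lambda> l = T True True True True True True 1 1 1 1 1 1 1 1 1 1 1 1"
    unfolding H.kuperberg_T3_tsum
  proof (subst integral_T[of l True \<Lambda>, symmetric, unfolded pre.D3_def DD_simps AA_simps])
    show "lin l" using int by (simp add: normalized_integrals_def right_cointegral_def H.lin_iff)
    show "tsum (\<Delta> \<Lambda>) (\<lambda>u v. l (y * u) * h (S v)) = h y" if "lin h" for y h
      by (rule H.dual_basis[OF int that])
  qed (rule refl)
  also have "\<dots> = T False False False False False False 1 1 1 1 1 1 1 1 1 1 1 1"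
    by (rule T_eq)
  also have "\<dots> = kuperberg_T3 H' \<Lambda>' l'"
    unfolding H'.kuperberg_T3_tsum
  proof (subst integral_T[of l' False \<Lambda>', symmetric, unfolded pre.D3_def DD_simps AA_simps])
    show "lin l'" using int' by (simp add: normalized_integrals_def right_cointegral_def scale_eq H.lin_iff)
    show "tsum (\<Delta>' \<Lambda>') (\<lambda>u v. l' (y * u) * h (S' v)) = h y" if "lin h" for y h
      using H'.dual_basis[OF int'] that by (simp add: H'_lin)
  qed (rule refl)
  finally show ?thesis .
qed

end

section \<open>Representations in coordinates\<close>

lemma mult_unit_vec: "A \<in> carrier_mat r c \<Longrightarrow> j < c \<Longrightarrow> A *\<^sub>v unit_vec c j = col A j" for A :: "'k::field mat"
  by (intro eq_vecI) auto

lemma mat_eq_vecI: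
  fixes A B :: "'k::field mat"
  assumes "A \<in> carrier_mat r c" "B \<in> carrier_mat r c" "\<And>v. v \<in> carrier_vec c \<Longrightarrow> A *\<^sub>v v = B *\<^sub>v v"
  shows "A = B"
proof (rule eq_matI)
  fix i j assume ij: "i < dim_row B" "j < dim_col B"
  have "col A j = col B j"
    using assms(3)[of "unit_vec c j"] ij assms(1,2) by (auto simp: mult_unit_vec)
  then show "A $$ (i, j) = B $$ (i, j)" using ij assms(1,2) by (metis carrier_matD index_col)
qed (use assms in auto)

lemma sum_div_mod: "(\<Sum>i<m * k. f (i div k) (i mod k)) = (\<Sum>a<m. \<Sum>b<k. f a b)" for f :: "nat \<Rightarrow> nat \<Rightarrow> 'a::comm_monoid_add"
proof (induction m)
  case (Suc m)
  have "(\<Sum>i<Suc m * k. f (i div k) (i mod k)) =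
    (\<Sum>i<m * k. f (i div k) (i mod k)) + (\<Sum>i\<in>{m * k..<m * k + k}. f (i div k) (i mod k))"
    by (subst sum.union_disjoint[symmetric]) (auto intro!: sum.cong)
  also have "(\<Sum>i\<in>{m * k..<m * k + k}. f (i div k) (i mod k)) = (\<Sum>b<k. f m b)"
  proof (rule sum.reindex_bij_witness[of _ "\<lambda>b. m * k + b" "\<lambda>i. i - m * k"])
    fix i assume i: "i \<in> {m * k..<m * k + k}"
    then have "i div k = m" by (intro div_nat_eqI) (auto simp: algebra_simps)
    then show "f m (i - m * k) = f (i div k) (i mod k)" by (simp add: modulo_nat_def)
  qed auto
  finally show ?case using Suc by simp
qed simp

definition kronv :: "'k::semiring_1 vec \<Rightarrow> 'k vec \<Rightarrow> 'k vec" where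
  "kronv v w = vec (dim_vec v * dim_vec w) (\<lambda>i. v $ (i div dim_vec w) * w $ (i mod dim_vec w))"

lemma dim_kronv [simp]: "dim_vec (kronv v w) = dim_vec v * dim_vec w"
  by (simp add: kronv_def)

lemma kronv_carrier [simp]: "v \<in> carrier_vec a \<Longrightarrow> w \<in> carrier_vec b \<Longrightarrow> kronv v w \<in> carrier_vec (a * b)"
  by (simp add: kronv_def)

lemma index_kronv: "i < dim_vec v * dim_vec w \<Longrightarrow> kronv v w $ i = v $ (i div dim_vec w) * w $ (i mod dim_vec w)"
  by (simp add: kronv_def)

lemma div_mod_bounds: "i < a * b \<Longrightarrow> i div b < a" "i < a * b \<Longrightarrow> i mod b < b" for i a b :: nat
  by (auto simp: less_mult_imp_div_less) (metis mod_less_divisor mult_0_right not_gr_zero not_less_zero)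

lemma kron_carrier [simp]: "A \<in> carrier_mat a b \<Longrightarrow> B \<in> carrier_mat c d \<Longrightarrow> kron A B \<in> carrier_mat (a * c) (b * d)"
  by (auto simp: kron_def)

lemma dim_kron [simp]: "dim_row (kron A B) = dim_row A * dim_row B" "dim_col (kron A B) = dim_col A * dim_col B"
  by (auto simp: kron_def)

lemma kron_mult_kronv:
  fixes A :: "'k::comm_semiring_1 mat"
  assumes "dim_vec v = dim_col A" "dim_vec w = dim_col B"
  shows "kron A B *\<^sub>v kronv v w = kronv (A *\<^sub>v v) (B *\<^sub>v w)"
proof (rule eq_vecI)
  fix i assume "i < dim_vec (kronv (A *\<^sub>v v) (B *\<^sub>v w))"
  then have i: "i < dim_row A * dim_row B" by simp
  note b = div_mod_bounds[OF i]
  have "(kron A B *\<^sub>v kronv v w) $ i = (\<Sum>j<dim_col A * dim_col B.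
      A $$ (i div dim_row B, j div dim_col B) * B $$ (i mod dim_row B, j mod dim_col B) *
      (v $ (j div dim_col B) * w $ (j mod dim_col B)))"
    using i assms by (auto simp: scalar_prod_def kron_def kronv_def atLeast0LessThan intro!: sum.cong)
  also have "\<dots> = (\<Sum>j<dim_col A. \<Sum>l<dim_col B. A $$ (i div dim_row B, j) * B $$ (i mod dim_row B, l) * (v $ j * w $ l))"
    by (rule sum_div_mod)
  also have "\<dots> = (\<Sum>j<dim_col A. A $$ (i div dim_row B, j) * v $ j) * (\<Sum>l<dim_col B. B $$ (i mod dim_row B, l) * w $ l)"
    by (simp add: sum_product ac_simps)
  also have "\<dots> = kronv (A *\<^sub>v v) (B *\<^sub>v w) $ i"
    using i b assms by (simp add: index_kronv scalar_prod_def atLeast0LessThan)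
  finally show "(kron A B *\<^sub>v kronv v w) $ i = kronv (A *\<^sub>v v) (B *\<^sub>v w) $ i" .
qed simp

lemma unit_vec_kronv: "i < a * b \<Longrightarrow> unit_vec (a * b) i = kronv (unit_vec a (i div b)) (unit_vec b (i mod b))"
proof (rule eq_vecI)
  fix j assume i: "i < a * b" and "j < dim_vec (kronv (unit_vec a (i div b)) (unit_vec b (i mod b)))"
  then have j: "j < a * b" by simp
  have "j = i" if "j div b = i div b" "j mod b = i mod b" using that by (metis div_mult_mod_eq)
  then show "unit_vec (a * b) i $ j = kronv (unit_vec a (i div b)) (unit_vec b (i mod b)) $ j"
    using i j div_mod_bounds[OF i] div_mod_bounds[OF j] by (auto simp: index_kronv)
qed simp

text \<open>Every unit vector of the product space is a pure tensor, so testing on pure tensors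
  compares all columns.\<close>

lemma kron_eq_vecI:
  fixes A B :: "'k::field mat"
  assumes A: "A \<in> carrier_mat r (a * b)" and B: "B \<in> carrier_mat r (a * b)"
    and eq: "\<And>v w. v \<in> carrier_vec a \<Longrightarrow> w \<in> carrier_vec b \<Longrightarrow> A *\<^sub>v kronv v w = B *\<^sub>v kronv v w"
  shows "A = B"
proof (rule eq_matI)
  fix i j assume ij: "i < dim_row B" "j < dim_col B"
  then have j: "j < a * b" using B by simp
  have "A *\<^sub>v unit_vec (a * b) j = B *\<^sub>v unit_vec (a * b) j"
    unfolding unit_vec_kronv[OF j] by (rule eq) auto
  then have "col A j = col B j" using mult_unit_vec[OF A j] mult_unit_vec[OF B j] by simp
  then show "A $$ (i, j) = B $$ (i, j)" using ij A B by (metis carrier_matD index_col)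
qed (use A B in auto)

lemma kronv_smult_left: "kronv (c \<cdot>\<^sub>v v) w = c \<cdot>\<^sub>v kronv v w" for c :: "'k::comm_ring_1"
  by (intro eq_vecI; auto simp: index_kronv div_mod_bounds algebra_simps)

text \<open>The lexicographic enumeration of triples is the same for both bracketings. For this
  reason identity matrices can serve as associators.\<close>

lemma kronv_assoc: "kronv (kronv u v) w = kronv u (kronv v w)" for u :: "'k::comm_ring_1 vec"
proof (rule eq_vecI)
  fix i assume "i < dim_vec (kronv u (kronv v w))"
  then have i: "i < dim_vec u * (dim_vec v * dim_vec w)" by simp
  then have i1: "i < (dim_vec u * dim_vec v) * dim_vec w" by (simp add: mult.assoc)
  have e: "i div dim_vec w div dim_vec v = i div (dim_vec v * dim_vec w)"
    "i mod (dim_vec v * dim_vec w) div dim_vec w = i div dim_vec w mod dim_vec v"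
    "i mod (dim_vec v * dim_vec w) mod dim_vec w = i mod dim_vec w"
    using mod_mult2_eq[of i "dim_vec w" "dim_vec v"]
    by (cases "dim_vec w = 0"; simp add: div_mult2_eq[symmetric] mult.commute)+
  show "kronv (kronv u v) w $ i = kronv u (kronv v w) $ i"
    using i i1 div_mod_bounds[OF i] div_mod_bounds[OF i1] by (simp add: index_kronv e mult.assoc)
qed (simp add: mult.assoc)

text \<open>If c were smaller than r, padding with zeros would give square matrices with product 1.
  They would commute, but the product in the other order has a zero in its last diagonal
  entry.\<close>

lemma left_inverse_dim_le:
  fixes A :: "'k::field mat"
  assumes A: "A \<in> carrier_mat r c" and B: "B \<in> carrier_mat c r" and AB: "A * B = 1\<^sub>m r"
  shows "r \<le> c"
proof (rule ccontr)
  assume "\<not> r \<le> c"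
  then have c: "c < r" by simp
  let ?A = "mat r r (\<lambda>(i, j). if j < c then A $$ (i, j) else 0)"
  let ?B = "mat r r (\<lambda>(i, j). if i < c then B $$ (i, j) else 0)"
  have "?A * ?B = A * B"
  proof (rule eq_matI)
    fix i j assume "i < dim_row (A * B)" "j < dim_col (A * B)"
    then have ij: "i < r" "j < r" using A B by auto
    have "(?A * ?B) $$ (i, j) = (\<Sum>l\<in>{0..<r}. (if l < c then A $$ (i, l) * B $$ (l, j) else 0))"
      using ij by (auto simp: scalar_prod_def intro!: sum.cong)
    also have "\<dots> = (\<Sum>l\<in>{0..<c}. A $$ (i, l) * B $$ (l, j))"
      using c by (intro sum.mono_neutral_cong_right) auto
    also have "\<dots> = (A * B) $$ (i, j)" using ij A B by (auto simp: scalar_prod_def)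
    finally show "(?A * ?B) $$ (i, j) = (A * B) $$ (i, j)" .
  qed (use A B in auto)
  then have "?A * ?B = 1\<^sub>m r" by (simp only: AB)
  then have "?B * ?A = 1\<^sub>m r"
    by (rule mat_mult_left_right_inverse[rotated 2]) simp_all
  moreover have "(?B * ?A) $$ (r - 1, r - 1) = 0"
  proof -
    have "\<not> r - Suc 0 < c" using c by auto
    then show ?thesis using c by (simp add: scalar_prod_def)
  qed
  ultimately show False using c by simp
qed

lemma inj_mat_inverse:
  fixes A :: "'k::field mat"
  assumes A: "A \<in> carrier_mat n n" and inj: "\<And>v. v \<in> carrier_vec n \<Longrightarrow> A *\<^sub>v v = 0\<^sub>v n \<Longrightarrow> v = 0\<^sub>v n"
  shows "\<exists>B \<in> carrier_mat n n. A * B = 1\<^sub>m n \<and> B * A = 1\<^sub>m n"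
proof -
  have "det A \<noteq> 0" using det_0_iff_vec_prod_zero[OF A] inj by auto
  from det_non_zero_imp_unit[OF A this, of "()"] show ?thesis
    by (auto simp: Units_def ring_mat_def)
qed

text \<open>The length N is an argument so that even an empty formal sum yields a vector of the
  right size.\<close>

definition vsum :: "nat \<Rightarrow> ('a \<times> 'b) list \<Rightarrow> ('a \<Rightarrow> 'b \<Rightarrow> 'k::comm_ring_1 vec) \<Rightarrow> 'k vec" where
  "vsum N t f = vec N (\<lambda>i. tsum t (\<lambda>a b. f a b $ i))"

lemma vsum_carrier [simp]: "vsum N t f \<in> carrier_vec N" by (simp add: vsum_def)
lemma dim_vsum [simp]: "dim_vec (vsum N t f) = N" by (simp add: vsum_def)
lemma index_vsum [simp]: "i < N \<Longrightarrow> vsum N t f $ i = tsum t (\<lambda>a b. f a b $ i)" by (simp add: vsum_def)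

lemma mult_vsum:
  assumes M: "M \<in> carrier_mat r N" and f: "\<And>a b. f a b \<in> carrier_vec N"
  shows "M *\<^sub>v vsum N t f = vsum r t (\<lambda>a b. M *\<^sub>v f a b)"
proof (rule eq_vecI)
  fix i assume "i < dim_vec (vsum r t (\<lambda>a b. M *\<^sub>v f a b))"
  then have i: "i < r" by simp
  have "(M *\<^sub>v vsum N t f) $ i = (\<Sum>j\<in>{0..<N}. tsum t (\<lambda>a b. M $$ (i, j) * f a b $ j))"
    using i M by (simp add: scalar_prod_def tsum_mult_left)
  also have "\<dots> = tsum t (\<lambda>a b. \<Sum>j\<in>{0..<N}. M $$ (i, j) * f a b $ j)"
    by (rule tsum_sum[symmetric])
  also have "\<dots> = vsum r t (\<lambda>a b. M *\<^sub>v f a b) $ i"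
  proof -
    have "dim_vec (f a b) = N" for a b using f[of a b] by simp
    then show ?thesis using i M by (simp add: scalar_prod_def)
  qed
  finally show "(M *\<^sub>v vsum N t f) $ i = vsum r t (\<lambda>a b. M *\<^sub>v f a b) $ i" .
qed (use M in simp)

lemma mv_assoc: "dim_col A = dim_row B \<Longrightarrow> dim_col B = dim_vec v \<Longrightarrow> (A * B) *\<^sub>v v = A *\<^sub>v (B *\<^sub>v v)"
  for A :: "'k::field mat"
  by (rule assoc_mult_mat_vec[OF carrier_matI carrier_matI carrier_vecI]) (rule refl | simp)+

lemma mv_smult_mat: "dim_col A = dim_vec v \<Longrightarrow> (c \<cdot>\<^sub>m A) *\<^sub>v v = c \<cdot>\<^sub>v (A *\<^sub>v v)"
  for A :: "'k::field mat"
  by (intro eq_vecI) (auto simp: scalar_prod_def sum_distrib_left mult.assoc)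

lemma mv_smult: "dim_col A = dim_vec v \<Longrightarrow> A *\<^sub>v (c \<cdot>\<^sub>v v) = c \<cdot>\<^sub>v (A *\<^sub>v v)"
  for A :: "'k::field mat"
  by (intro eq_vecI) (auto simp: scalar_prod_def sum_distrib_left ac_simps)

lemma mv_add: "dim_col A = dim_vec v \<Longrightarrow> dim_vec v = dim_vec w \<Longrightarrow> A *\<^sub>v (v + w) = A *\<^sub>v v + A *\<^sub>v w"
  for A :: "'k::field mat"
  by (rule mult_add_distrib_mat_vec[OF carrier_matI carrier_vecI carrier_vecI]) (rule refl | simp)+

lemma mv_add_mat: "dim_col A = dim_vec v \<Longrightarrow> dim_col B = dim_vec v \<Longrightarrow> dim_row A = dim_row B \<Longrightarrow>
    (A + B) *\<^sub>v v = A *\<^sub>v v + B *\<^sub>v v"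
  for A :: "'k::field mat"
  by (rule add_mult_distrib_mat_vec[OF carrier_matI carrier_matI carrier_vecI]) (rule refl | simp)+

lemmas mv = mv_assoc mv_smult_mat mv_smult mv_add mv_add_mat

text \<open>\<open>representation_of\<close> hides the dimension behind a quantifier; here it is an
  argument, which lets the sizes of all matrices be tracked.\<close>

definition repd :: "('k::field \<Rightarrow> 'h::ring_1 \<Rightarrow> 'h) \<Rightarrow> ('h \<Rightarrow> 'k mat) \<Rightarrow> nat \<Rightarrow> bool" where
  "repd s \<rho> d \<longleftrightarrow> (\<forall>x. \<rho> x \<in> carrier_mat d d) \<and> (\<forall>x y. \<rho> (x + y) = \<rho> x + \<rho> y) \<and>
     (\<forall>c x. \<rho> (s c x) = c \<cdot>\<^sub>m \<rho> x) \<and> (\<forall>x y. \<rho> (x * y) = \<rho> x * \<rho> y) \<and> \<rho> 1 = 1\<^sub>m d"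

lemma representation_of_iff: "representation_of H \<rho> \<longleftrightarrow> (\<exists>d. repd (hscale H) \<rho> d)"
  by (simp add: representation_of_def repd_def)

lemma rep_dim_eq: "repd s \<rho> d \<Longrightarrow> rep_dim \<rho> = d"
  by (simp add: repd_def rep_dim_def)

lemma repd_carrier: "repd s \<rho> d \<Longrightarrow> \<rho> x \<in> carrier_mat d d"
  by (simp add: repd_def)

lemma repd_dims: "repd s \<rho> d \<Longrightarrow> dim_row (\<rho> x) = d" "repd s \<rho> d \<Longrightarrow> dim_col (\<rho> x) = d"
  by (rule carrier_matD[OF repd_carrier]; assumption)+

lemma repd_vec:
  assumes "repd s \<rho> d" "v \<in> carrier_vec d"
  shows "\<rho> x *\<^sub>v v \<in> carrier_vec d" "\<rho> (x + y) *\<^sub>v v = \<rho> x *\<^sub>v v + \<rho> y *\<^sub>v v"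
    "\<rho> (s c x) *\<^sub>v v = c \<cdot>\<^sub>v (\<rho> x *\<^sub>v v)" "\<rho> (x * y) *\<^sub>v v = \<rho> x *\<^sub>v (\<rho> y *\<^sub>v v)" "\<rho> 1 *\<^sub>v v = v"
proof -
  have c: "\<rho> x \<in> carrier_mat d d" for x using assms by (simp add: repd_def)
  show "\<rho> x *\<^sub>v v \<in> carrier_vec d" by (rule mult_mat_vec_carrier[OF c assms(2)])
  show "\<rho> (x + y) *\<^sub>v v = \<rho> x *\<^sub>v v + \<rho> y *\<^sub>v v"
    using assms add_mult_distrib_mat_vec[OF c c, of v x y] by (simp add: repd_def)
  show "\<rho> (s k x) *\<^sub>v v = k \<cdot>\<^sub>v (\<rho> x *\<^sub>v v)" for k
    using assms(1) mv_smult_mat[of "\<rho> x" v k] carrier_matD[OF c[of x]] carrier_vecD[OF assms(2)]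
    by (simp add: repd_def)
  show "\<rho> (x * y) *\<^sub>v v = \<rho> x *\<^sub>v (\<rho> y *\<^sub>v v)"
    using assms assoc_mult_mat_vec[OF c c, of v x y] by (simp add: repd_def)
  show "\<rho> 1 *\<^sub>v v = v" using assms by (simp add: repd_def)
qed

lemma intertwiners_iff:
  assumes "repd s \<rho> d" "repd s \<sigma> e"
  shows "f \<in> intertwiners \<rho> \<sigma> \<longleftrightarrow> f \<in> carrier_mat e d \<and>
    (\<forall>x. \<forall>v \<in> carrier_vec d. f *\<^sub>v (\<rho> x *\<^sub>v v) = \<sigma> x *\<^sub>v (f *\<^sub>v v))"
proof -
  have c: "\<rho> x \<in> carrier_mat d d" "\<sigma> x \<in> carrier_mat e e" for x
    using assms by (auto simp: repd_def)
  have "f * \<rho> x = \<sigma> x * f \<longleftrightarrow> (\<forall>v \<in> carrier_vec d. f *\<^sub>v (\<rho> x *\<^sub>v v) = \<sigma> x *\<^sub>v (f *\<^sub>v v))"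
    if f: "f \<in> carrier_mat e d" for x
  proof
    assume "f * \<rho> x = \<sigma> x * f"
    then show "\<forall>v \<in> carrier_vec d. f *\<^sub>v (\<rho> x *\<^sub>v v) = \<sigma> x *\<^sub>v (f *\<^sub>v v)"
      using assoc_mult_mat_vec[OF f c(1)] assoc_mult_mat_vec[OF c(2) f] by metis
  next
    assume "\<forall>v \<in> carrier_vec d. f *\<^sub>v (\<rho> x *\<^sub>v v) = \<sigma> x *\<^sub>v (f *\<^sub>v v)"
    then show "f * \<rho> x = \<sigma> x * f"
      using assoc_mult_mat_vec[OF f c(1)] assoc_mult_mat_vec[OF c(2) f]
      by (intro mat_eq_vecI[of _ e d]) (auto simp: mult_carrier_mat[OF f c(1)] mult_carrier_mat[OF c(2) f])
  qed
  then show ?thesis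
    unfolding intertwiners_def by (auto simp: rep_dim_eq[OF assms(1)] rep_dim_eq[OF assms(2)])
qed

section \<open>Hopf algebras in coordinates and the regular module\<close>

locale coord_hopf = fd_hopf_algebra H for H :: "('k::field, 'h::ring_1) hopf" +
  fixes n :: nat and b :: "nat \<Rightarrow> 'h" and \<phi> :: "nat \<Rightarrow> 'h \<Rightarrow> 'k"
  assumes \<phi>_lin: "lin (\<phi> m)"
    and basis_eq: "(\<Sum>m<n. sc (\<phi> m x) (b m)) = x"
    and basis_dual: "m < n \<Longrightarrow> k < n \<Longrightarrow> \<phi> m (b k) = (if m = k then 1 else 0)"

lemma (in fd_hopf_algebra) exists_coord_hopf: "\<exists>n b \<phi>. coord_hopf H n b \<phi>"
proof -
  obtain n :: nat and b \<phi> where *: "\<forall>m. linear_form sc (\<phi> m)" "\<forall>x. (\<Sum>m<n. sc (\<phi> m x) (b m)) = x"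
    "\<forall>m<n. \<forall>k<n. \<phi> m (b k) = (if m = k then 1 else 0)"
    using exists_coordinates by blast
  have "coord_hopf H n b \<phi>"
    by unfold_locales (use * lin_iff in auto)
  then show ?thesis by blast
qed

context coord_hopf
begin

definition vh :: "'h \<Rightarrow> 'k vec" where "vh x = vec n (\<lambda>m. \<phi> m x)"
definition hv :: "'k vec \<Rightarrow> 'h" where "hv v = (\<Sum>m<n. sc (v $ m) (b m))"

lemma vh_carrier [simp]: "vh x \<in> carrier_vec n" and dim_vh [simp]: "dim_vec (vh x) = n"
  by (simp_all add: vh_def)

lemma hv_vh [simp]: "hv (vh x) = x"
  by (simp add: hv_def vh_def basis_eq)

lemma lin_hv: "lin f \<Longrightarrow> f (hv v) = (\<Sum>m<n. v $ m * f (b m))"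
  unfolding hv_def by (rule lin_sum_val)

lemma vh_hv [simp]: "v \<in> carrier_vec n \<Longrightarrow> vh (hv v) = v"
  by (intro eq_vecI) (auto simp: vh_def lin_hv[OF \<phi>_lin] basis_dual sum.delta if_distrib cong: if_cong)

lemma vh_add: "vh (x + y) = vh x + vh y" and vh_scale: "vh (sc c x) = c \<cdot>\<^sub>v vh x"
  using \<phi>_lin by (auto simp: vh_def lin_def intro!: eq_vecI)

lemma hv_add: "v \<in> carrier_vec n \<Longrightarrow> w \<in> carrier_vec n \<Longrightarrow> hv (v + w) = hv v + hv w"
  by (metis hv_vh vh_hv vh_add)

lemma hv_smult: "v \<in> carrier_vec n \<Longrightarrow> hv (c \<cdot>\<^sub>v v) = sc c (hv v)"
  by (metis hv_vh vh_hv vh_scale)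

lemma vh_eq_iff: "vh x = vh y \<longleftrightarrow> x = y"
  by (metis hv_vh)

abbreviation "rep \<equiv> repd sc"

definition linv :: "('h \<Rightarrow> 'k vec) \<Rightarrow> nat \<Rightarrow> bool" where
  "linv g d \<longleftrightarrow> (\<forall>x. g x \<in> carrier_vec d) \<and> (\<forall>x y. g (x + y) = g x + g y) \<and> (\<forall>c x. g (sc c x) = c \<cdot>\<^sub>v g x)"

lemma linv_dim: "linv g d \<Longrightarrow> dim_vec (g x) = d"
  by (simp add: linv_def carrier_vecD)

lemma linv_index: "linv g d \<Longrightarrow> i < d \<Longrightarrow> lin (\<lambda>x. g x $ i)"
proof -
  assume g: "linv g d" and i: "i < d"
  have "dim_vec (g x) = d" for x by (rule linv_dim[OF g])
  then have "i < dim_vec (g x)" for x using i by metis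
  then show ?thesis
    unfolding lin_def using g by (metis linv_def index_add_vec(1) index_smult_vec(1))
qed

definition rmat :: "('h \<Rightarrow> 'k vec) \<Rightarrow> nat \<Rightarrow> 'k mat" where
  "rmat g d = mat d n (\<lambda>(i, j). g (b j) $ i)"

lemma rmat_carrier [simp]: "rmat g d \<in> carrier_mat d n" by (simp add: rmat_def)

lemma rmat_vh:
  assumes g: "linv g d" shows "rmat g d *\<^sub>v vh x = g x"
proof (rule eq_vecI)
  show "dim_vec (rmat g d *\<^sub>v vh x) = dim_vec (g x)" using linv_dim[OF g] by (simp add: rmat_def)
  fix i assume "i < dim_vec (g x)"
  then have i: "i < d" using g by (metis carrier_vecD linv_def)
  have "(rmat g d *\<^sub>v vh x) $ i = (\<Sum>m<n. \<phi> m x * g (b m) $ i)"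
    using i by (simp add: rmat_def vh_def scalar_prod_def atLeast0LessThan mult.commute)
  also have "\<dots> = g x $ i"
    using lin_hv[OF linv_index[OF g i], of "vh x"] unfolding hv_vh by (simp add: vh_def)
  finally show "(rmat g d *\<^sub>v vh x) $ i = g x $ i" .
qed

definition reg :: "'h \<Rightarrow> 'k mat" where "reg x = rmat (\<lambda>y. vh (x * y)) n"

text \<open>This is the isomorphism V \<rightarrow> Hom(H, V) that expresses freeness of the regular
  module on 1; in coordinates that module is k^n, whence the n columns.\<close>

definition rv :: "('h \<Rightarrow> 'k mat) \<Rightarrow> nat \<Rightarrow> 'k vec \<Rightarrow> 'k mat" where
  "rv \<rho> d v = rmat (\<lambda>x. \<rho> x *\<^sub>v v) d"

lemma reg_vh: "reg x *\<^sub>v vh y = vh (x * y)"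
  unfolding reg_def by (rule rmat_vh) (simp add: linv_def algebra_simps vh_add vh_scale scale_mult_right)

lemma reg_carrier [simp]: "reg x \<in> carrier_mat n n" by (simp add: reg_def)

lemma dim_reg [simp]: "dim_row (reg x) = n" "dim_col (reg x) = n"
  using reg_carrier[of x] by blast+

lemma mat_eq_vhI: "A \<in> carrier_mat r n \<Longrightarrow> B \<in> carrier_mat r n \<Longrightarrow> (\<And>x. A *\<^sub>v vh x = B *\<^sub>v vh x) \<Longrightarrow> A = B"
  by (rule mat_eq_vecI) (assumption | metis vh_hv)+

lemma reg_rep: "rep reg n"
  unfolding repd_def
proof (intro conjI allI)
  show "reg (x + y) = reg x + reg y" for x y
    by (rule mat_eq_vhI[of _ n]) (auto simp: reg_vh mv distrib_right vh_add)
  show "reg (sc c x) = c \<cdot>\<^sub>m reg x" for c x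
    by (rule mat_eq_vhI[of _ n]) (auto simp: reg_vh mv scale_mult_left vh_scale)
  show "reg (x * y) = reg x * reg y" for x y
    by (rule mat_eq_vhI[of _ n]) (auto simp: reg_vh mv mult.assoc)
  show "reg 1 = 1\<^sub>m n"
    by (rule mat_eq_vhI[of _ n]) (auto simp: reg_vh)
qed simp

lemma linv_rep: "rep \<rho> d \<Longrightarrow> v \<in> carrier_vec d \<Longrightarrow> linv (\<lambda>x. \<rho> x *\<^sub>v v) d"
  by (simp add: linv_def repd_vec)

lemma rv_vh: "rep \<rho> d \<Longrightarrow> v \<in> carrier_vec d \<Longrightarrow> rv \<rho> d v *\<^sub>v vh x = \<rho> x *\<^sub>v v"
  unfolding rv_def by (rule rmat_vh) (rule linv_rep)

lemma rv_carrier [simp]: "rv \<rho> d v \<in> carrier_mat d n" by (simp add: rv_def)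

lemma rv_intertwiner: "rep \<rho> d \<Longrightarrow> v \<in> carrier_vec d \<Longrightarrow> rv \<rho> d v \<in> intertwiners reg \<rho>"
  proof (subst intertwiners_iff[OF reg_rep], assumption, intro conjI allI ballI)
  assume *: "rep \<rho> d" "v \<in> carrier_vec d"
  show "rv \<rho> d v *\<^sub>v (reg x *\<^sub>v w) = \<rho> x *\<^sub>v (rv \<rho> d v *\<^sub>v w)" if "w \<in> carrier_vec n" for x w
  proof -
    have "w = vh (hv w)" using that by simp
    then show ?thesis using rv_vh[OF *] repd_vec(4)[OF *] by (metis reg_vh)
  qed
qed simp

text \<open>As 1 generates the regular module, a module map is determined by its value
  there.\<close>

lemma intertwiner_reg: "rep \<rho> d \<Longrightarrow> f \<in> intertwiners reg \<rho> \<Longrightarrow> f = rv \<rho> d (f *\<^sub>v vh 1)"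
proof (rule mat_eq_vhI[of _ d])
  assume \<rho>: "rep \<rho> d" and f: "f \<in> intertwiners reg \<rho>"
  then have f': "f \<in> carrier_mat d n" "\<And>x v. v \<in> carrier_vec n \<Longrightarrow> f *\<^sub>v (reg x *\<^sub>v v) = \<rho> x *\<^sub>v (f *\<^sub>v v)"
    by (auto simp: intertwiners_iff[OF reg_rep \<rho>])
  show "f \<in> carrier_mat d n" by fact
  show "f *\<^sub>v vh x = rv \<rho> d (f *\<^sub>v vh 1) *\<^sub>v vh x" for x
    using f'(2)[of "vh 1" x] f'(1) rv_vh[OF \<rho>, of "f *\<^sub>v vh 1" x] by (simp add: reg_vh)
qed simp

end

lemma idx_kron: "v \<in> carrier_vec d \<Longrightarrow> w \<in> carrier_vec e \<Longrightarrow> i < d * e \<Longrightarrow>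
    kronv v w $ i = v $ (i div e) * w $ (i mod e)"
  by (metis carrier_vecD index_kronv)

lemma sum_unit_vec_mv:
  fixes w :: "'k::field vec"
  assumes M: "M \<in> carrier_mat e d" and w: "w \<in> carrier_vec d" and l: "l < e"
  shows "(\<Sum>k<d. w $ k * (M *\<^sub>v unit_vec d k) $ l) = (M *\<^sub>v w) $ l"
  using M w l by (simp add: mult_unit_vec[OF M] scalar_prod_def atLeast0LessThan mult.commute)

lemma sum_kronv_unit_right:
  fixes w :: "'k::field vec"
  assumes M: "M \<in> carrier_mat e d" and w: "w \<in> carrier_vec d" and i: "i < a * e" and u: "u \<in> carrier_vec a"
  shows "(\<Sum>k<d. w $ k * kronv u (M *\<^sub>v unit_vec d k) $ i) = kronv u (M *\<^sub>v w) $ i"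
proof -
  have c: "M *\<^sub>v unit_vec d k \<in> carrier_vec e" "M *\<^sub>v w \<in> carrier_vec e" for k
    using M by (metis carrier_matD(1) carrier_vecI dim_mult_mat_vec)+
  show ?thesis
    using sum_unit_vec_mv[OF M w div_mod_bounds(2)[OF i], symmetric]
    by (simp add: idx_kron[OF u c(1) i] idx_kron[OF u c(2) i] sum_distrib_left ac_simps)
qed

lemma sum_kronv_unit_left:
  fixes w :: "'k::field vec"
  assumes M: "M \<in> carrier_mat e d" and w: "w \<in> carrier_vec d" and j: "j < e * a" and u: "u \<in> carrier_vec a"
  shows "(\<Sum>k<d. w $ k * kronv (M *\<^sub>v unit_vec d k) u $ j) = kronv (M *\<^sub>v w) u $ j"
proof -
  have c: "M *\<^sub>v unit_vec d k \<in> carrier_vec e" "M *\<^sub>v w \<in> carrier_vec e" for k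
    using M by (metis carrier_matD(1) carrier_vecI dim_mult_mat_vec)+
  show ?thesis
    using sum_unit_vec_mv[OF M w div_mod_bounds(1)[OF j], symmetric]
    by (simp add: idx_kron[OF c(1) u j] idx_kron[OF c(2) u j] sum_distrib_left sum_distrib_right ac_simps)
qed

lemma kron3_eq_vecI:
  fixes A B :: "'k::field mat"
  assumes A: "A \<in> carrier_mat r (a * b * c)" and B: "B \<in> carrier_mat r (a * b * c)"
    and eq: "\<And>u v w. u \<in> carrier_vec a \<Longrightarrow> v \<in> carrier_vec b \<Longrightarrow> w \<in> carrier_vec c \<Longrightarrow>
      A *\<^sub>v kronv (kronv u v) w = B *\<^sub>v kronv (kronv u v) w"
  shows "A = B"
proof (rule eq_matI)
  fix i j assume ij: "i < dim_row B" "j < dim_col B"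
  then have j: "j < a * b * c" using B by simp
  have "A *\<^sub>v unit_vec (a * b * c) j = B *\<^sub>v unit_vec (a * b * c) j"
    unfolding unit_vec_kronv[OF j] unit_vec_kronv[OF div_mod_bounds(1)[OF j]] by (rule eq) auto
  then have "col A j = col B j" using mult_unit_vec[OF A j] mult_unit_vec[OF B j] by simp
  then show "A $$ (i, j) = B $$ (i, j)" using ij A B by (metis carrier_matD index_col)
qed (use A B in auto)

lemma kronv_vsum_left:
  assumes "\<And>x y. f x y \<in> carrier_vec a"
  shows "kronv (vsum a t f) w = vsum (a * dim_vec w) t (\<lambda>x y. kronv (f x y) w)"
proof (intro eq_vecI)
  have d: "dim_vec (f x y) = a" for x y using assms[of x y] by (rule carrier_vecD)
  fix i assume "i < dim_vec (vsum (a * dim_vec w) t (\<lambda>x y. kronv (f x y) w))"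
  then show "kronv (vsum a t f) w $ i = vsum (a * dim_vec w) t (\<lambda>x y. kronv (f x y) w) $ i"
    using div_mod_bounds[of i a "dim_vec w"] by (simp add: index_kronv d tsum_mult_right)
qed simp

lemma kronv_vsum_right:
  assumes "\<And>x y. f x y \<in> carrier_vec a"
  shows "kronv w (vsum a t f) = vsum (dim_vec w * a) t (\<lambda>x y. kronv w (f x y))"
proof (intro eq_vecI)
  have d: "dim_vec (f x y) = a" for x y using assms[of x y] by (rule carrier_vecD)
  fix i assume "i < dim_vec (vsum (dim_vec w * a) t (\<lambda>x y. kronv w (f x y)))"
  then show "kronv w (vsum a t f) $ i = vsum (dim_vec w * a) t (\<lambda>x y. kronv w (f x y)) $ i"
    using div_mod_bounds[of i "dim_vec w" a] by (simp add: index_kronv d tsum_mult_left)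
qed simp

definition msum :: "nat \<Rightarrow> nat \<Rightarrow> (nat \<Rightarrow> 'k::comm_ring_1 mat) \<Rightarrow> nat \<Rightarrow> 'k mat" where
  "msum r c f M = mat r c (\<lambda>ij. \<Sum>k<M. f k $$ ij)"

lemma msum_carrier [simp]: "msum r c f M \<in> carrier_mat r c" by (simp add: msum_def)

lemma msum_0: "msum r c f 0 = 0\<^sub>m r c"
  and msum_Suc: "f M \<in> carrier_mat r c \<Longrightarrow> msum r c f (Suc M) = msum r c f M + f M"
  by (auto intro!: eq_matI simp: msum_def)

lemma msum_cong: "(\<And>k. k < M \<Longrightarrow> f k = g k) \<Longrightarrow> msum r c f M = msum r c g M"
  by (auto simp: msum_def intro!: eq_matI)

lemma msum_delta: "k < M \<Longrightarrow> A \<in> carrier_mat r c \<Longrightarrow> msum r c (\<lambda>l. if l = k then A else 0\<^sub>m r c) M = A"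
proof (rule eq_matI)
  fix i j assume "k < M" "A \<in> carrier_mat r c" "i < dim_row A" "j < dim_col A"
  moreover from this have "(if l = k then A else 0\<^sub>m r c) $$ (i, j) = (if l = k then A $$ (i, j) else 0)" for l by auto
  ultimately show "msum r c (\<lambda>l. if l = k then A else 0\<^sub>m r c) M $$ (i, j) = A $$ (i, j)"
    by (simp add: msum_def)
qed (auto simp: msum_def)

lemma mult_msum:
  assumes "A \<in> carrier_mat e r" "\<And>k. k < M \<Longrightarrow> f k \<in> carrier_mat r c"
  shows "A * msum r c f M = msum e c (\<lambda>k. A * f k) M"
  using assms(2)
proof (induction M)
  case 0
  then show ?case using assms(1) by (simp add: msum_0)
next
  case (Suc M)
  then have "A * msum r c f (Suc M) = A * msum r c f M + A * f M"
    using assms(1) by (simp add: msum_Suc mult_add_distrib_mat[of _ e r _ c])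
  then show ?case using Suc assms(1) by (simp add: msum_Suc mult_carrier_mat[of _ e r])
qed

lemma msum_mv:
  assumes "\<And>k. k < M \<Longrightarrow> f k \<in> carrier_mat r c" "v \<in> carrier_vec c" "i < r"
  shows "(msum r c f M *\<^sub>v v) $ i = (\<Sum>k<M. (f k *\<^sub>v v) $ i)"
proof -
  have d: "dim_row (f k) = r" "dim_col (f k) = c" if "k < M" for k using assms(1)[OF that] by auto
  have "(msum r c f M *\<^sub>v v) $ i = (\<Sum>j\<in>{0..<c}. \<Sum>k<M. f k $$ (i, j) * v $ j)"
    using assms(2,3) by (simp add: msum_def scalar_prod_def sum_distrib_right)
  also have "\<dots> = (\<Sum>k<M. \<Sum>j\<in>{0..<c}. f k $$ (i, j) * v $ j)" by (rule sum.swap)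
  also have "\<dots> = (\<Sum>k<M. (f k *\<^sub>v v) $ i)"
    using assms(2,3) d by (intro sum.cong) (auto simp: scalar_prod_def)
  finally show ?thesis .
qed

section \<open>Tensor products of modules and absorption by free modules\<close>

context coord_hopf
begin

sublocale pre: hopf_category_pre sc "\<lambda>_ _. \<Delta>" eps "\<lambda>_ _. S" n b \<phi>
  by (rule hopf_category_pre) (use \<phi>_lin basis_eq lin_iff in blast)+

abbreviation "tens \<equiv> tensor_rep H"

lemma vlin_S: "vlin g \<Longrightarrow> vlin (\<lambda>x. S (g x))"
  by (rule pre.vlin_A)

lemma lin_rep: "rep \<rho> d \<Longrightarrow> w \<in> carrier_vec d \<Longrightarrow> i < d \<Longrightarrow> vlin g \<Longrightarrow> lin (\<lambda>x. (\<rho> (g x) *\<^sub>v w) $ i)"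
  by (rule lin_comp[OF linv_index[OF linv_rep]])

lemmas lin_rules = lin_rep pre.lin_\<phi> pre.lin_\<epsilon> lin_mult1 lin_mult2 lin_sum lin_tsum
  vlin_id vlin_mult1 vlin_mult2 vlin_S

lemma bil_kron:
  assumes "rep \<rho> d" "rep \<sigma> e" "v \<in> carrier_vec d" "w \<in> carrier_vec e" "i < d * e"
  shows "bil (\<lambda>a c. kronv (\<rho> a *\<^sub>v v) (\<sigma> c *\<^sub>v w) $ i)"
proof -
  have "(\<lambda>a c. kronv (\<rho> a *\<^sub>v v) (\<sigma> c *\<^sub>v w) $ i) = (\<lambda>a c. (\<rho> a *\<^sub>v v) $ (i div e) * (\<sigma> c *\<^sub>v w) $ (i mod e))"
    using assms by (intro ext idx_kron) (simp_all add: repd_vec)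
  then show ?thesis
    using div_mod_bounds[OF assms(5)] assms by (auto intro!: bilI lin_rules)
qed

lemma tens_carrier: "rep \<rho> d \<Longrightarrow> rep \<sigma> e \<Longrightarrow> tens \<rho> \<sigma> x \<in> carrier_mat (d * e) (d * e)"
  by (simp add: tensor_rep_def Let_def rep_dim_eq)

lemma tens_mv:
  assumes \<rho>: "rep \<rho> d" and \<sigma>: "rep \<sigma> e" and z: "z \<in> carrier_vec (d * e)"
  shows "tens \<rho> \<sigma> x *\<^sub>v z = vsum (d * e) (\<Delta> x) (\<lambda>a c. kron (\<rho> a) (\<sigma> c) *\<^sub>v z)"
proof (rule eq_vecI)
  fix i assume "i < dim_vec (vsum (d * e) (\<Delta> x) (\<lambda>a c. kron (\<rho> a) (\<sigma> c) *\<^sub>v z))"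
  then have i: "i < d * e" by simp
  have "(tens \<rho> \<sigma> x *\<^sub>v z) $ i = (\<Sum>j\<in>{0..<d * e}. tsum (\<Delta> x) (\<lambda>a c. kron (\<rho> a) (\<sigma> c) $$ (i, j)) * z $ j)"
    using i z by (simp add: tensor_rep_def Let_def rep_dim_eq[OF \<rho>] rep_dim_eq[OF \<sigma>] scalar_prod_def tsum_def)
  also have "\<dots> = tsum (\<Delta> x) (\<lambda>a c. \<Sum>j\<in>{0..<d * e}. kron (\<rho> a) (\<sigma> c) $$ (i, j) * z $ j)"
    by (simp add: tsum_sum tsum_mult_right)
  also have "\<dots> = vsum (d * e) (\<Delta> x) (\<lambda>a c. kron (\<rho> a) (\<sigma> c) *\<^sub>v z) $ i"
    using i z by (simp add: scalar_prod_def repd_dims[OF \<rho>] repd_dims[OF \<sigma>])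
  finally show "(tens \<rho> \<sigma> x *\<^sub>v z) $ i = vsum (d * e) (\<Delta> x) (\<lambda>a c. kron (\<rho> a) (\<sigma> c) *\<^sub>v z) $ i" .
qed (use carrier_matD[OF tens_carrier[OF \<rho> \<sigma>]] in simp)

lemma tens_kronv:
  assumes \<rho>: "rep \<rho> d" and \<sigma>: "rep \<sigma> e" and v: "v \<in> carrier_vec d" and w: "w \<in> carrier_vec e"
  shows "tens \<rho> \<sigma> x *\<^sub>v kronv v w = vsum (d * e) (\<Delta> x) (\<lambda>a c. kronv (\<rho> a *\<^sub>v v) (\<sigma> c *\<^sub>v w))"
  using assms by (simp add: tens_mv kron_mult_kronv repd_dims)

lemma tens_rep:
  assumes \<rho>: "rep \<rho> d" and \<sigma>: "rep \<sigma> e"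
  shows "rep (tens \<rho> \<sigma>) (d * e)"
  unfolding repd_def
proof (intro conjI allI)
  note car = tens_carrier[OF \<rho> \<sigma>] and dims = carrier_matD[OF tens_carrier[OF \<rho> \<sigma>]]
  note kv = tens_kronv[OF \<rho> \<sigma>]
  have lin: "lin (\<lambda>x. tsum (\<Delta> x) (\<lambda>a c. kronv (\<rho> a *\<^sub>v v) (\<sigma> c *\<^sub>v w) $ i))"
    if "v \<in> carrier_vec d" "w \<in> carrier_vec e" "i < d * e" for v w i
    by (rule tsum_comult_lin[OF bil_kron[OF \<rho> \<sigma> that]])
  show "tens \<rho> \<sigma> x \<in> carrier_mat (d * e) (d * e)" for x by (rule car)
  show "tens \<rho> \<sigma> (x + y) = tens \<rho> \<sigma> x + tens \<rho> \<sigma> y" for x y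
  proof (rule kron_eq_vecI[of _ "d * e" d e])
    fix v w :: "'k vec" assume vw: "v \<in> carrier_vec d" "w \<in> carrier_vec e"
    then show "tens \<rho> \<sigma> (x + y) *\<^sub>v kronv v w = (tens \<rho> \<sigma> x + tens \<rho> \<sigma> y) *\<^sub>v kronv v w"
      using lin[OF vw] by (simp add: mv_add_mat dims kv) (intro eq_vecI; simp add: lin_def)
  qed (auto intro!: car add_carrier_mat)
  show "tens \<rho> \<sigma> (sc c x) = c \<cdot>\<^sub>m tens \<rho> \<sigma> x" for c x
  proof (rule kron_eq_vecI[of _ "d * e" d e])
    fix v w :: "'k vec" assume vw: "v \<in> carrier_vec d" "w \<in> carrier_vec e"
    then show "tens \<rho> \<sigma> (sc c x) *\<^sub>v kronv v w = (c \<cdot>\<^sub>m tens \<rho> \<sigma> x) *\<^sub>v kronv v w"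
      using lin[OF vw] by (simp add: mv_smult_mat dims kv) (intro eq_vecI; simp add: lin_def)
  qed (auto intro!: car smult_carrier_mat)
  show "tens \<rho> \<sigma> (x * y) = tens \<rho> \<sigma> x * tens \<rho> \<sigma> y" for x y
  proof (rule kron_eq_vecI[of _ "d * e" d e])
    fix v w :: "'k vec" assume vw: "v \<in> carrier_vec d" "w \<in> carrier_vec e"
    have "(tens \<rho> \<sigma> x * tens \<rho> \<sigma> y) *\<^sub>v kronv v w =
        tens \<rho> \<sigma> x *\<^sub>v vsum (d * e) (\<Delta> y) (\<lambda>a c. kronv (\<rho> a *\<^sub>v v) (\<sigma> c *\<^sub>v w))"
      using vw by (simp add: mv_assoc dims kv)
    also have "\<dots> = vsum (d * e) (\<Delta> y) (\<lambda>a c. vsum (d * e) (\<Delta> x) (\<lambda>a' c'.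
        kronv (\<rho> a' *\<^sub>v (\<rho> a *\<^sub>v v)) (\<sigma> c' *\<^sub>v (\<sigma> c *\<^sub>v w))))"
      using vw by (simp add: mult_vsum[OF car] repd_vec[OF \<rho>] repd_vec[OF \<sigma>] kv)
    also have "\<dots> = tens \<rho> \<sigma> (x * y) *\<^sub>v kronv v w"
      using vw by (simp add: kv)
        (intro eq_vecI; simp add: tsum_comult_mult[OF bil_kron[OF \<rho> \<sigma>]]
          repd_vec(4)[OF \<rho>, symmetric] repd_vec(4)[OF \<sigma>, symmetric] tsum_swap[of "\<Delta> x"])
    finally show "tens \<rho> \<sigma> (x * y) *\<^sub>v kronv v w = (tens \<rho> \<sigma> x * tens \<rho> \<sigma> y) *\<^sub>v kronv v w" by simp
  qed (auto intro!: car mult_carrier_mat)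
  show "tens \<rho> \<sigma> 1 = 1\<^sub>m (d * e)"
  proof (rule kron_eq_vecI[of _ "d * e" d e])
    fix v w :: "'k vec" assume vw: "v \<in> carrier_vec d" "w \<in> carrier_vec e"
    then show "tens \<rho> \<sigma> 1 *\<^sub>v kronv v w = 1\<^sub>m (d * e) *\<^sub>v kronv v w"
      by (simp add: kv) (intro eq_vecI; simp add: tsum_comult_one[OF bil_kron[OF \<rho> \<sigma>]]
        repd_vec(5)[OF \<rho>] repd_vec(5)[OF \<sigma>] carrier_vecD[of v d] carrier_vecD[of w e])
  qed (auto intro!: car)
qed

abbreviation "triv \<equiv> trivial_rep H"

lemma triv_mv: "v \<in> carrier_vec 1 \<Longrightarrow> triv x *\<^sub>v v = eps x \<cdot>\<^sub>v v"
  by (intro eq_vecI) (auto simp: trivial_rep_def scalar_prod_def)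

lemma triv_rep: "rep triv 1"
  unfolding repd_def trivial_rep_def using eps_lin
  by (auto simp: lin_def counit_mult counit_one scalar_prod_def intro!: eq_matI)

lemma assoc_intertwiner:
  assumes \<rho>: "rep \<rho> d" and \<sigma>: "rep \<sigma> e" and \<tau>: "rep \<tau> f"
  shows "1\<^sub>m (d * e * f) \<in> intertwiners (tens (tens \<rho> \<sigma>) \<tau>) (tens \<rho> (tens \<sigma> \<tau>))"
proof -
  have r1: "rep (tens (tens \<rho> \<sigma>) \<tau>) (d * e * f)" by (intro tens_rep assms)
  have r2: "rep (tens \<rho> (tens \<sigma> \<tau>)) (d * e * f)"
    unfolding mult.assoc[of d e f] by (intro tens_rep assms)
  have "tens (tens \<rho> \<sigma>) \<tau> x = tens \<rho> (tens \<sigma> \<tau>) x" for x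
  proof (rule kron3_eq_vecI[of _ "d * e * f" d e f])
    fix u v w :: "'k vec" assume c: "u \<in> carrier_vec d" "v \<in> carrier_vec e" "w \<in> carrier_vec f"
    have A: "tens (tens \<rho> \<sigma>) \<tau> x *\<^sub>v kronv (kronv u v) w =
        vsum (d * e * f) (\<Delta> x) (\<lambda>a c. vsum (d * e * f) (\<Delta> a) (\<lambda>a1 a2.
          kronv (kronv (\<rho> a1 *\<^sub>v u) (\<sigma> a2 *\<^sub>v v)) (\<tau> c *\<^sub>v w)))"
      using c by (simp add: tens_kronv[OF tens_rep[OF \<rho> \<sigma>] \<tau>] tens_kronv[OF \<rho> \<sigma>] kronv_vsum_left repd_vec[OF \<tau>]
          kronv_carrier repd_vec[OF \<rho>] repd_vec[OF \<sigma>] repd_dims[OF \<tau>])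
    have B: "tens \<rho> (tens \<sigma> \<tau>) x *\<^sub>v kronv u (kronv v w) =
        vsum (d * (e * f)) (\<Delta> x) (\<lambda>a c. vsum (d * (e * f)) (\<Delta> c) (\<lambda>c1 c2.
          kronv (\<rho> a *\<^sub>v u) (kronv (\<sigma> c1 *\<^sub>v v) (\<tau> c2 *\<^sub>v w))))"
      using c by (simp add: tens_kronv[OF \<rho> tens_rep[OF \<sigma> \<tau>]] tens_kronv[OF \<sigma> \<tau>] kronv_vsum_right repd_vec[OF \<rho>]
          kronv_carrier repd_vec[OF \<sigma>] repd_vec[OF \<tau>] repd_dims[OF \<rho>])
    have tri: "tri (\<lambda>a1 a2 a3. kronv (kronv (\<rho> a1 *\<^sub>v u) (\<sigma> a2 *\<^sub>v v)) (\<tau> a3 *\<^sub>v w) $ i)" if i: "i < d * e * f" for i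
    proof -
      have "kronv (kronv (\<rho> a1 *\<^sub>v u) (\<sigma> a2 *\<^sub>v v)) (\<tau> a3 *\<^sub>v w) $ i =
        ((\<rho> a1 *\<^sub>v u) $ (i div f div e) * (\<sigma> a2 *\<^sub>v v) $ (i div f mod e)) * (\<tau> a3 *\<^sub>v w) $ (i mod f)" for a1 a2 a3
        using c i div_mod_bounds[OF i]
        by (simp add: idx_kron[of _ "d * e" _ f] idx_kron[of _ d _ e] repd_vec[OF \<rho>] repd_vec[OF \<sigma>] repd_vec[OF \<tau>] kronv_carrier)
      then show ?thesis
        using c \<rho> \<sigma> \<tau> div_mod_bounds[OF i] div_mod_bounds[OF div_mod_bounds(1)[OF i]]
        by (auto intro!: triI lin_rules)
    qed
    show "tens (tens \<rho> \<sigma>) \<tau> x *\<^sub>v kronv (kronv u v) w = tens \<rho> (tens \<sigma> \<tau>) x *\<^sub>v kronv (kronv u v) w"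
      unfolding A unfolding kronv_assoc B
      by (intro eq_vecI) (simp_all add: mult.assoc tsum_coassoc[OF tri, unfolded kronv_assoc] del: index_mult_mat_vec)
  qed (auto intro: repd_carrier[OF r1] repd_carrier[OF r2])
  then show ?thesis
    using repd_carrier[OF r2] repd_dims[OF r2]
    by (auto simp: intertwiners_def rep_dim_eq[OF r1] rep_dim_eq[OF r2])
qed

text \<open>A bilinear map on H and k^d factors through the tensor product, and the columns of its
  matrix are the values at pairs of basis elements. Linearity in v is asked for as an expansion in
  unit vectors, the form in which it is verified for the projections below.\<close>

lemma bmat_exists:
  assumes "\<And>x v. v \<in> carrier_vec d \<Longrightarrow> g x v \<in> carrier_vec r"
    and "\<And>v i. v \<in> carrier_vec d \<Longrightarrow> i < r \<Longrightarrow> lin (\<lambda>x. g x v $ i)"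
    and "\<And>x v i. v \<in> carrier_vec d \<Longrightarrow> i < r \<Longrightarrow> (\<Sum>k<d. v $ k * g x (unit_vec d k) $ i) = g x v $ i"
  shows "\<exists>M \<in> carrier_mat r (n * d). \<forall>x. \<forall>v \<in> carrier_vec d. M *\<^sub>v kronv (vh x) v = g x v"
    and "\<exists>M \<in> carrier_mat r (d * n). \<forall>x. \<forall>v \<in> carrier_vec d. M *\<^sub>v kronv v (vh x) = g x v"
proof -
  have key: "(\<Sum>p<n. \<Sum>q<d. \<phi> p x * v $ q * g (b p) (unit_vec d q) $ i) = g x v $ i"
    if v: "v \<in> carrier_vec d" and i: "i < r" for x v i
  proof -
    have "(\<Sum>p<n. \<Sum>q<d. \<phi> p x * v $ q * g (b p) (unit_vec d q) $ i) =
        (\<Sum>p<n. \<phi> p x * g (b p) v $ i)"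
      using assms(3)[OF v i] by (simp add: mult.assoc sum_distrib_left[symmetric])
    also have "\<dots> = g x v $ i"
      using lin_hv[OF assms(2)[OF v i], of "vh x"] unfolding hv_vh by (simp add: vh_def)
    finally show ?thesis .
  qed
  show "\<exists>M \<in> carrier_mat r (n * d). \<forall>x. \<forall>v \<in> carrier_vec d. M *\<^sub>v kronv (vh x) v = g x v"
  proof (intro bexI allI ballI)
    let ?M = "mat r (n * d) (\<lambda>(i, j). g (b (j div d)) (unit_vec d (j mod d)) $ i)"
    fix x and v :: "'k vec" assume v: "v \<in> carrier_vec d"
    show "?M *\<^sub>v kronv (vh x) v = g x v"
    proof (rule eq_vecI)
      fix i assume "i < dim_vec (g x v)"
      then have i: "i < r" using assms(1)[OF v] by (metis carrier_vecD)
      have "(?M *\<^sub>v kronv (vh x) v) $ i =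
          (\<Sum>j<n * d. \<phi> (j div d) x * v $ (j mod d) * g (b (j div d)) (unit_vec d (j mod d)) $ i)"
        using i v by (auto simp: scalar_prod_def atLeast0LessThan index_kronv div_mod_bounds vh_def intro!: sum.cong)
      also have "\<dots> = g x v $ i"
        using key[OF v i] sum_div_mod[of "\<lambda>p q. \<phi> p x * v $ q * g (b p) (unit_vec d q) $ i" d n] by simp
      finally show "(?M *\<^sub>v kronv (vh x) v) $ i = g x v $ i" .
    qed (use assms(1)[OF v, of x] in simp)
  qed simp
  show "\<exists>M \<in> carrier_mat r (d * n). \<forall>x. \<forall>v \<in> carrier_vec d. M *\<^sub>v kronv v (vh x) = g x v"
  proof (intro bexI allI ballI)
    let ?M = "mat r (d * n) (\<lambda>(i, j). g (b (j mod n)) (unit_vec d (j div n)) $ i)"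
    fix x and v :: "'k vec" assume v: "v \<in> carrier_vec d"
    show "?M *\<^sub>v kronv v (vh x) = g x v"
    proof (rule eq_vecI)
      fix i assume "i < dim_vec (g x v)"
      then have i: "i < r" using assms(1)[OF v] by (metis carrier_vecD)
      have "(?M *\<^sub>v kronv v (vh x)) $ i =
          (\<Sum>j<d * n. \<phi> (j mod n) x * v $ (j div n) * g (b (j mod n)) (unit_vec d (j div n)) $ i)"
        using i v by (auto simp: scalar_prod_def atLeast0LessThan index_kronv div_mod_bounds vh_def intro!: sum.cong)
      also have "\<dots> = g x v $ i"
        using key[OF v i] sum_div_mod[of "\<lambda>q p. \<phi> p x * v $ q * g (b p) (unit_vec d q) $ i" n d]
        by (simp add: sum.swap[of _ "{..<n}"])
      finally show "(?M *\<^sub>v kronv v (vh x)) $ i = g x v $ i" .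
    qed (use assms(1)[OF v, of x] in simp)
  qed simp
qed

text \<open>\<open>X\<close> is the \<open>M\<close>-fold direct sum of \<open>Y\<close>, with injections \<open>i\<close> and projections \<open>q\<close>.\<close>

definition powiso :: "('h \<Rightarrow> 'k mat) \<Rightarrow> nat \<Rightarrow> ('h \<Rightarrow> 'k mat) \<Rightarrow> nat \<Rightarrow> nat \<Rightarrow> (nat \<Rightarrow> 'k mat) \<Rightarrow> (nat \<Rightarrow> 'k mat) \<Rightarrow> bool" where
  "powiso X N Y e M i q \<longleftrightarrow> rep X N \<and> rep Y e \<and>
     (\<forall>k<M. i k \<in> intertwiners Y X) \<and> (\<forall>k<M. q k \<in> intertwiners X Y) \<and>
     (\<forall>k<M. \<forall>l<M. q k * i l = (if k = l then 1\<^sub>m e else 0\<^sub>m e e)) \<and>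
     msum N N (\<lambda>k. i k * q k) M = 1\<^sub>m N"

text \<open>The maps \<open>i\<close> make up an invertible module map from the sum of copies of Y
  to X, and its inverse is again a module map. In formulas, q X = \<Sum> q X i q = \<Sum> q i Y q =
  Y q, where \<Sum> i q = 1 is inserted first.\<close>

lemma powisoI:
  assumes X: "rep X N" and Y: "rep Y e" and i: "\<And>k. k < M \<Longrightarrow> i k \<in> intertwiners Y X"
    and q: "\<And>k. k < M \<Longrightarrow> q k \<in> carrier_mat e N"
    and qi: "\<And>k l. k < M \<Longrightarrow> l < M \<Longrightarrow> q k * i l = (if k = l then 1\<^sub>m e else 0\<^sub>m e e)"
    and iq: "msum N N (\<lambda>k. i k * q k) M = 1\<^sub>m N"
  shows "powiso X N Y e M i q"
proof -
  have ic: "i k \<in> carrier_mat N e" "i k * Y x = X x * i k" if "k < M" for k x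
    using i[OF that] by (auto simp: intertwiners_def rep_dim_eq[OF X] rep_dim_eq[OF Y])
  have "q k * X x = Y x * q k" if k: "k < M" for k x
  proof -
    note Xc = repd_carrier[OF X, of x] and Yc = repd_carrier[OF Y, of x] and qc = q[OF k]
    have "q k * X x = q k * X x * msum N N (\<lambda>k. i k * q k) M"
      using Xc qc by (simp add: iq)
    also have "\<dots> = msum e N (\<lambda>l. (q k * X x) * (i l * q l)) M"
      by (rule mult_msum) (use Xc qc ic q in \<open>auto intro!: mult_carrier_mat\<close>)
    also have "\<dots> = msum e N (\<lambda>l. if l = k then Y x * q k else 0\<^sub>m e N) M"
    proof (rule msum_cong)
      fix l assume l: "l < M"
      note il = ic[OF l] and ql = q[OF l]
      have "(q k * X x) * (i l * q l) = q k * (X x * i l) * q l"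
        using Xc qc il(1) ql by (simp add: assoc_mult_mat[of _ e N _ N _ N] assoc_mult_mat[of _ N N _ e _ N]
            assoc_mult_mat[of _ e N _ e _ N])
      also have "\<dots> = (q k * i l) * Y x * q l"
        unfolding il(2)[of x, symmetric] using Yc qc il(1) ql by (simp add: assoc_mult_mat[of _ e N _ e _ e])
      also have "\<dots> = (if l = k then Y x * q k else 0\<^sub>m e N)"
        using qi[OF k l] Yc ql by auto
      finally show "(q k * X x) * (i l * q l) = (if l = k then Y x * q k else 0\<^sub>m e N)" .
    qed
    also have "\<dots> = Y x * q k"
      by (rule msum_delta[OF k]) (use Yc qc in \<open>auto intro!: mult_carrier_mat\<close>)
    finally show ?thesis .
  qed
  then have "\<forall>k<M. q k \<in> intertwiners X Y"
    using q by (auto simp: intertwiners_def rep_dim_eq[OF X] rep_dim_eq[OF Y])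
  then show ?thesis using assms by (simp add: powiso_def)
qed

end

lemma zero_mat_mv: "dim_vec v = c \<Longrightarrow> 0\<^sub>m r c *\<^sub>v v = 0\<^sub>v r" for v :: "'k::field vec"
  by (intro eq_vecI) (auto simp: scalar_prod_def)

context coord_hopf
begin

lemma idx_vh: "i < n \<Longrightarrow> vh x $ i = \<phi> i x"
  by (simp add: vh_def)

text \<open>This is the classical untwisting of a tensor product with a free module: the maps h
  \<mapsto> h (1 \<otimes> e_k) = h1 \<otimes> h2 e_k have the projections h \<otimes> v \<mapsto>
  (S(h2) v)_k h1.\<close>

lemma reg_tens_powiso:
  assumes \<rho>: "rep \<rho> d"
  shows "\<exists>i q. powiso (tens reg \<rho>) (n * d) reg n d i q"
proof -
  let ?X = "tens reg \<rho>"
  have X: "rep ?X (n * d)" by (rule tens_rep[OF reg_rep \<rho>])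
  define i where "i k = rv ?X (n * d) (kronv (vh 1) (unit_vec d k))" for k
  have iv: "i k *\<^sub>v vh h = vsum (n * d) (\<Delta> h) (\<lambda>a c. kronv (vh a) (\<rho> c *\<^sub>v unit_vec d k))" for k h
    unfolding i_def by (subst rv_vh[OF X]) (simp_all add: tens_kronv[OF reg_rep \<rho>] reg_vh)
  have ic: "i k \<in> carrier_mat (n * d) n" for k by (simp add: i_def)
  define g where "g k h v = vsum n (\<Delta> h) (\<lambda>a c. (\<rho> (S c) *\<^sub>v v) $ k \<cdot>\<^sub>v vh a)" for k h v
  have gi: "g k h v $ j = tsum (\<Delta> h) (\<lambda>a c. (\<rho> (S c) *\<^sub>v v) $ k * \<phi> j a)" if "j < n" for k h v j
    using that by (simp add: g_def idx_vh)
  have "\<exists>M \<in> carrier_mat n (n * d). \<forall>x. \<forall>v \<in> carrier_vec d. M *\<^sub>v kronv (vh x) v = g k x v" if k: "k < d" for k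
  proof (rule bmat_exists(1))
    fix v :: "'k vec" and j assume v: "v \<in> carrier_vec d" and j: "j < n"
    have "lin (\<lambda>x. tsum (\<Delta> x) (\<lambda>a c. (\<rho> (S c) *\<^sub>v v) $ k * \<phi> j a))"
      by (intro tsum_comult_lin bilI lin_rep[OF \<rho> v k] lin_rules)
    then show "lin (\<lambda>x. g k x v $ j)" by (simp add: gi[OF j])
    show "(\<Sum>l<d. v $ l * g k x (unit_vec d l) $ j) = g k x v $ j" for x
      using sum_unit_vec_mv[OF repd_carrier[OF \<rho>] v k]
      by (simp add: gi[OF j] tsum_mult_left[symmetric] tsum_sum[symmetric] mult.assoc[symmetric] sum_distrib_right[symmetric])
  qed (simp add: g_def)
  then obtain q where qc: "\<And>k. k < d \<Longrightarrow> q k \<in> carrier_mat n (n * d)"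
    and qv: "\<And>k x v. k < d \<Longrightarrow> v \<in> carrier_vec d \<Longrightarrow> q k *\<^sub>v kronv (vh x) v = g k x v"
    by metis
  have "powiso ?X (n * d) reg n d i q"
  proof (rule powisoI[OF X reg_rep])
    show "i k \<in> intertwiners reg ?X" for k
      unfolding i_def by (rule rv_intertwiner[OF X]) simp
    show "q k \<in> carrier_mat n (n * d)" if "k < d" for k by (rule qc[OF that])
    show "q k * i l = (if k = l then 1\<^sub>m n else 0\<^sub>m n n)" if k: "k < d" and l: "l < d" for k l
    proof (rule mat_eq_vhI)
      fix h
      have kc: "kronv (vh a) (\<rho> c *\<^sub>v unit_vec d l) \<in> carrier_vec (n * d)" for a c
        by (intro kronv_carrier vh_carrier repd_vec(1)[OF \<rho>]) simp
      have "(q k * i l) *\<^sub>v vh h = vsum n (\<Delta> h) (\<lambda>a c. g k a (\<rho> c *\<^sub>v unit_vec d l))"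
        using assoc_mult_mat_vec[OF qc[OF k] ic vh_carrier]
        by (simp add: iv mult_vsum[OF qc[OF k] kc] qv[OF k] repd_vec[OF \<rho>])
      also have "\<dots> = (if k = l then vh h else 0\<^sub>v n)"
      proof (rule eq_vecI)
        fix j assume "j < dim_vec (if k = l then vh h else 0\<^sub>v n)"
        then have j: "j < n" by (simp split: if_splits)
        have u: "unit_vec d l \<in> carrier_vec d" by simp
        have "vsum n (\<Delta> h) (\<lambda>a c. g k a (\<rho> c *\<^sub>v unit_vec d l)) $ j =
          tsum (\<Delta> h) (\<lambda>a c. tsum (\<Delta> a) (\<lambda>a1 a2. (\<rho> (S a2 * c) *\<^sub>v unit_vec d l) $ k * \<phi> j a1))"
          using j by (simp add: gi repd_vec(4)[OF \<rho>])
        also have "\<dots> = tsum (\<Delta> h) (\<lambda>a c. tsum (\<Delta> c) (\<lambda>c1 c2. (\<rho> (S c1 * c2) *\<^sub>v unit_vec d l) $ k * \<phi> j a))"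
          by (rule tsum_coassoc) (intro triI lin_rep[OF \<rho> u k] lin_rules)
        also have "\<dots> = tsum (\<Delta> h) (\<lambda>a c. eps c * ((\<rho> 1 *\<^sub>v unit_vec d l) $ k * \<phi> j a))"
          by (subst tsum_antipode_left[of "\<lambda>y. (\<rho> y *\<^sub>v unit_vec d l) $ k * \<phi> j a" for a])
            (intro lin_rep[OF \<rho> u k] lin_rules refl)+
        also have "\<dots> = (\<rho> 1 *\<^sub>v unit_vec d l) $ k * \<phi> j h"
          by (rule tsum_counit_right) (intro lin_rules)
        also have "\<dots> = (if k = l then vh h else 0\<^sub>v n) $ j"
          using j k l by (simp add: repd_vec(5)[OF \<rho>] idx_vh)
        finally show "vsum n (\<Delta> h) (\<lambda>a c. g k a (\<rho> c *\<^sub>v unit_vec d l)) $ j = (if k = l then vh h else 0\<^sub>v n) $ j" .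
      qed simp
      finally show "(q k * i l) *\<^sub>v vh h = (if k = l then 1\<^sub>m n else 0\<^sub>m n n) *\<^sub>v vh h"
        by (auto simp: zero_mat_mv)
    qed (use qc[OF k] ic in \<open>auto intro: mult_carrier_mat\<close>)
    show "msum (n * d) (n * d) (\<lambda>k. i k * q k) d = 1\<^sub>m (n * d)"
    proof (rule kron_eq_vecI[of _ "n * d" n d])
      fix w v :: "'k vec" assume w: "w \<in> carrier_vec n" and v: "v \<in> carrier_vec d"
      define h where "h = hv w"
      have wh: "w = vh h" using w by (simp add: h_def)
      have iqc: "i k * q k \<in> carrier_mat (n * d) (n * d)" if "k < d" for k
        using ic qc[OF that] by (rule mult_carrier_mat)
      show "msum (n * d) (n * d) (\<lambda>k. i k * q k) d *\<^sub>v kronv w v = 1\<^sub>m (n * d) *\<^sub>v kronv w v"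
        unfolding wh
      proof (rule eq_vecI)
        fix j assume "j < dim_vec (1\<^sub>m (n * d) *\<^sub>v kronv (vh h) v)"
        then have j: "j < n * d" by simp
        have kc: "kronv (vh h) v \<in> carrier_vec (n * d)" using v by simp
        have "((i k * q k) *\<^sub>v kronv (vh h) v) $ j = tsum (\<Delta> h) (\<lambda>a c. tsum (\<Delta> a) (\<lambda>a1 a2.
            (\<rho> (S c) *\<^sub>v v) $ k * kronv (vh a1) (\<rho> a2 *\<^sub>v unit_vec d k) $ j))" if k: "k < d" for k
        proof -
          have "(i k * q k) *\<^sub>v kronv (vh h) v = i k *\<^sub>v g k h v"
            using assoc_mult_mat_vec[OF ic qc[OF k] kc] by (simp add: qv[OF k v])
          also have "\<dots> = vsum (n * d) (\<Delta> h) (\<lambda>a c. (\<rho> (S c) *\<^sub>v v) $ k \<cdot>\<^sub>v (i k *\<^sub>v vh a))"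
            unfolding g_def by (subst mult_vsum[OF ic]) (simp_all add: mv_smult carrier_matD[OF ic])
          finally show ?thesis using j by (simp add: iv tsum_mult_left)
        qed
        then have "(msum (n * d) (n * d) (\<lambda>k. i k * q k) d *\<^sub>v kronv (vh h) v) $ j =
          (\<Sum>k<d. tsum (\<Delta> h) (\<lambda>a c. tsum (\<Delta> a) (\<lambda>a1 a2.
            (\<rho> (S c) *\<^sub>v v) $ k * kronv (vh a1) (\<rho> a2 *\<^sub>v unit_vec d k) $ j)))"
          using msum_mv[OF iqc kc j] by simp
        \<comment> \<open>Summing over k reassembles the vector from its coordinates, and the
          regrouping that follows makes the product of the last two parts, with S on the very last,
          a counit.\<close>
        also have "\<dots> = tsum (\<Delta> h) (\<lambda>a c. tsum (\<Delta> a) (\<lambda>a1 a2. kronv (vh a1) (\<rho> (a2 * S c) *\<^sub>v v) $ j))"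
          using j v by (simp add: tsum_sum[symmetric] sum_kronv_unit_right[OF repd_carrier[OF \<rho>]] repd_vec[OF \<rho>])
        also have "\<dots> = tsum (\<Delta> h) (\<lambda>a c. tsum (\<Delta> a) (\<lambda>a1 a2. \<phi> (j div d) a1 * (\<rho> (a2 * S c) *\<^sub>v v) $ (j mod d)))"
          using j v div_mod_bounds[OF j]
          by (simp add: idx_kron[OF vh_carrier repd_vec(1)[OF \<rho> v]] idx_vh)
        also have "\<dots> = tsum (\<Delta> h) (\<lambda>a c. tsum (\<Delta> c) (\<lambda>c1 c2. \<phi> (j div d) a * (\<rho> (c1 * S c2) *\<^sub>v v) $ (j mod d)))"
          by (rule tsum_coassoc) (intro triI lin_rep[OF \<rho> v div_mod_bounds(2)[OF j]] lin_rules)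
        also have "\<dots> = tsum (\<Delta> h) (\<lambda>a c. eps c * (\<phi> (j div d) a * (\<rho> 1 *\<^sub>v v) $ (j mod d)))"
          by (subst tsum_antipode_right[of "\<lambda>y. \<phi> (j div d) a * (\<rho> y *\<^sub>v v) $ (j mod d)" for a])
            (intro lin_rep[OF \<rho> v div_mod_bounds(2)[OF j]] lin_rules refl)+
        also have "\<dots> = \<phi> (j div d) h * (\<rho> 1 *\<^sub>v v) $ (j mod d)"
          by (rule tsum_counit_right) (intro lin_rules)
        also have "\<dots> = (1\<^sub>m (n * d) *\<^sub>v kronv (vh h) v) $ j"
          using j v div_mod_bounds[OF j] kc by (simp add: idx_kron[OF vh_carrier v] repd_vec(5)[OF \<rho>] idx_vh)
        finally show "(msum (n * d) (n * d) (\<lambda>k. i k * q k) d *\<^sub>v kronv (vh h) v) $ j = (1\<^sub>m (n * d) *\<^sub>v kronv (vh h) v) $ j" .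
      qed (simp add: carrier_matD[OF msum_carrier])
    qed simp_all
  qed
  then show ?thesis by blast
qed

text \<open>With V on the left the untwisting uses the inverse T of S: the maps h \<mapsto> h (e_k
  \<otimes> 1) have the projections v \<otimes> h \<mapsto> (T(h1) v)_k h2, because T(h2) h1 and h2
  T(h1) both reduce to the counit.\<close>

lemma tens_reg_powiso:
  assumes \<rho>: "rep \<rho> d" and bij: "bij S"
  shows "\<exists>i q. powiso (tens \<rho> reg) (d * n) reg n d i q"
proof -
  let ?T = "inv_into UNIV S"
  interpret hopf_category sc "\<lambda>_ _. \<Delta>" eps "\<lambda>_ _. S" n b \<phi> "\<lambda>_ _. ?T"
    by unfold_locales (use bij in \<open>simp_all add: bij_is_surj surj_f_inv_f bij_is_inj\<close>)
  let ?X = "tens \<rho> reg"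
  have X: "rep ?X (d * n)" by (rule tens_rep[OF \<rho> reg_rep])
  define i where "i k = rv ?X (d * n) (kronv (unit_vec d k) (vh 1))" for k
  have iv: "i k *\<^sub>v vh h = vsum (d * n) (\<Delta> h) (\<lambda>a c. kronv (\<rho> a *\<^sub>v unit_vec d k) (vh c))" for k h
    unfolding i_def by (subst rv_vh[OF X]) (simp_all add: tens_kronv[OF \<rho> reg_rep] reg_vh)
  have ic: "i k \<in> carrier_mat (d * n) n" for k by (simp add: i_def)
  define g where "g k h v = vsum n (\<Delta> h) (\<lambda>a c. (\<rho> (?T a) *\<^sub>v v) $ k \<cdot>\<^sub>v vh c)" for k h v
  have gi: "g k h v $ j = tsum (\<Delta> h) (\<lambda>a c. (\<rho> (?T a) *\<^sub>v v) $ k * \<phi> j c)" if "j < n" for k h v j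
    using that by (simp add: g_def idx_vh)
  note lin_rules = coord_hopf.lin_rules[OF coord_hopf_axioms] vlin_B
  have "\<exists>M \<in> carrier_mat n (d * n). \<forall>x. \<forall>v \<in> carrier_vec d. M *\<^sub>v kronv v (vh x) = g k x v" if k: "k < d" for k
  proof (rule bmat_exists(2))
    fix v :: "'k vec" and j assume v: "v \<in> carrier_vec d" and j: "j < n"
    have "lin (\<lambda>x. tsum (\<Delta> x) (\<lambda>a c. (\<rho> (?T a) *\<^sub>v v) $ k * \<phi> j c))"
      by (intro tsum_comult_lin bilI lin_rep[OF \<rho> v k] lin_rules)
    then show "lin (\<lambda>x. g k x v $ j)" by (simp add: gi[OF j])
    show "(\<Sum>l<d. v $ l * g k x (unit_vec d l) $ j) = g k x v $ j" for x
      using sum_unit_vec_mv[OF repd_carrier[OF \<rho>] v k]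
      by (simp add: gi[OF j] tsum_mult_left[symmetric] tsum_sum[symmetric] mult.assoc[symmetric] sum_distrib_right[symmetric])
  qed (simp add: g_def)
  then obtain q where qc: "\<And>k. k < d \<Longrightarrow> q k \<in> carrier_mat n (d * n)"
    and qv: "\<And>k x v. k < d \<Longrightarrow> v \<in> carrier_vec d \<Longrightarrow> q k *\<^sub>v kronv v (vh x) = g k x v"
    by metis
  have "powiso ?X (d * n) reg n d i q"
  proof (rule powisoI[OF X reg_rep])
    show "i k \<in> intertwiners reg ?X" for k
      unfolding i_def by (rule rv_intertwiner[OF X]) simp
    show "q k \<in> carrier_mat n (d * n)" if "k < d" for k by (rule qc[OF that])
    show "q k * i l = (if k = l then 1\<^sub>m n else 0\<^sub>m n n)" if k: "k < d" and l: "l < d" for k l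
    proof (rule mat_eq_vhI)
      fix h
      have kc: "kronv (\<rho> a *\<^sub>v unit_vec d l) (vh c) \<in> carrier_vec (d * n)" for a c
        by (intro kronv_carrier vh_carrier repd_vec(1)[OF \<rho>]) simp
      have "(q k * i l) *\<^sub>v vh h = vsum n (\<Delta> h) (\<lambda>a c. g k c (\<rho> a *\<^sub>v unit_vec d l))"
        using assoc_mult_mat_vec[OF qc[OF k] ic vh_carrier]
        by (simp add: iv mult_vsum[OF qc[OF k] kc] qv[OF k] repd_vec[OF \<rho>])
      also have "\<dots> = (if k = l then vh h else 0\<^sub>v n)"
      proof (rule eq_vecI)
        fix j assume "j < dim_vec (if k = l then vh h else 0\<^sub>v n)"
        then have j: "j < n" by (simp split: if_splits)
        have u: "unit_vec d l \<in> carrier_vec d" by simp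
        have "vsum n (\<Delta> h) (\<lambda>a c. g k c (\<rho> a *\<^sub>v unit_vec d l)) $ j =
          tsum (\<Delta> h) (\<lambda>a c. tsum (\<Delta> c) (\<lambda>c1 c2. (\<rho> (?T c1 * a) *\<^sub>v unit_vec d l) $ k * \<phi> j c2))"
          using j by (simp add: gi repd_vec(4)[OF \<rho>])
        also have "\<dots> = tsum (\<Delta> h) (\<lambda>a c. tsum (\<Delta> a) (\<lambda>a1 a2. (\<rho> (?T a2 * a1) *\<^sub>v unit_vec d l) $ k * \<phi> j c))"
          by (rule tsum_coassoc[symmetric]) (intro triI lin_rep[OF \<rho> u k] lin_rules)
        also have "\<dots> = tsum (\<Delta> h) (\<lambda>a c. eps a * ((\<rho> 1 *\<^sub>v unit_vec d l) $ k * \<phi> j c))"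
          by (subst B_l[of "\<lambda>y. (\<rho> y *\<^sub>v unit_vec d l) $ k * \<phi> j c" for c])
            (intro lin_rep[OF \<rho> u k] lin_rules refl)+
        also have "\<dots> = (\<rho> 1 *\<^sub>v unit_vec d l) $ k * \<phi> j h"
          by (rule tsum_counit_left) (intro lin_rules)
        also have "\<dots> = (if k = l then vh h else 0\<^sub>v n) $ j"
          using j k l by (simp add: repd_vec(5)[OF \<rho>] idx_vh)
        finally show "vsum n (\<Delta> h) (\<lambda>a c. g k c (\<rho> a *\<^sub>v unit_vec d l)) $ j = (if k = l then vh h else 0\<^sub>v n) $ j" .
      qed simp
      finally show "(q k * i l) *\<^sub>v vh h = (if k = l then 1\<^sub>m n else 0\<^sub>m n n) *\<^sub>v vh h"
        by (auto simp: zero_mat_mv)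
    qed (use qc[OF k] ic in \<open>auto intro: mult_carrier_mat\<close>)
    show "msum (d * n) (d * n) (\<lambda>k. i k * q k) d = 1\<^sub>m (d * n)"
    proof (rule kron_eq_vecI[of _ "d * n" d n])
      fix w v :: "'k vec" assume v: "v \<in> carrier_vec d" and w: "w \<in> carrier_vec n"
      define h where "h = hv w"
      have wh: "w = vh h" using w by (simp add: h_def)
      have iqc: "i k * q k \<in> carrier_mat (d * n) (d * n)" if "k < d" for k
        using ic qc[OF that] by (rule mult_carrier_mat)
      show "msum (d * n) (d * n) (\<lambda>k. i k * q k) d *\<^sub>v kronv v w = 1\<^sub>m (d * n) *\<^sub>v kronv v w"
        unfolding wh
      proof (rule eq_vecI)
        fix j assume "j < dim_vec (1\<^sub>m (d * n) *\<^sub>v kronv v (vh h))"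
        then have j: "j < d * n" by simp
        have kc: "kronv v (vh h) \<in> carrier_vec (d * n)" using v by simp
        have "((i k * q k) *\<^sub>v kronv v (vh h)) $ j = tsum (\<Delta> h) (\<lambda>a c. tsum (\<Delta> c) (\<lambda>c1 c2.
            (\<rho> (?T a) *\<^sub>v v) $ k * kronv (\<rho> c1 *\<^sub>v unit_vec d k) (vh c2) $ j))" if k: "k < d" for k
        proof -
          have "(i k * q k) *\<^sub>v kronv v (vh h) = i k *\<^sub>v g k h v"
            using assoc_mult_mat_vec[OF ic qc[OF k] kc] by (simp add: qv[OF k v])
          also have "\<dots> = vsum (d * n) (\<Delta> h) (\<lambda>a c. (\<rho> (?T a) *\<^sub>v v) $ k \<cdot>\<^sub>v (i k *\<^sub>v vh c))"
            unfolding g_def by (subst mult_vsum[OF ic]) (simp_all add: mv_smult carrier_matD[OF ic])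
          finally show ?thesis using j by (simp add: iv tsum_mult_left)
        qed
        then have "(msum (d * n) (d * n) (\<lambda>k. i k * q k) d *\<^sub>v kronv v (vh h)) $ j =
          (\<Sum>k<d. tsum (\<Delta> h) (\<lambda>a c. tsum (\<Delta> c) (\<lambda>c1 c2.
            (\<rho> (?T a) *\<^sub>v v) $ k * kronv (\<rho> c1 *\<^sub>v unit_vec d k) (vh c2) $ j)))"
          using msum_mv[OF iqc kc j] by simp
        also have "\<dots> = tsum (\<Delta> h) (\<lambda>a c. tsum (\<Delta> c) (\<lambda>c1 c2. kronv (\<rho> (c1 * ?T a) *\<^sub>v v) (vh c2) $ j))"
          using j v by (simp add: tsum_sum[symmetric]
            sum_kronv_unit_left[OF repd_carrier[OF \<rho>] _ _ vh_carrier] repd_vec[OF \<rho>] mult.commute)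
        also have "\<dots> = tsum (\<Delta> h) (\<lambda>a c. tsum (\<Delta> c) (\<lambda>c1 c2. (\<rho> (c1 * ?T a) *\<^sub>v v) $ (j div n) * \<phi> (j mod n) c2))"
          using j v div_mod_bounds[OF j]
          by (simp add: idx_kron[OF repd_vec(1)[OF \<rho> v] vh_carrier] idx_vh)
        also have "\<dots> = tsum (\<Delta> h) (\<lambda>a c. tsum (\<Delta> a) (\<lambda>a1 a2. (\<rho> (a2 * ?T a1) *\<^sub>v v) $ (j div n) * \<phi> (j mod n) c))"
          by (rule tsum_coassoc[symmetric]) (intro triI lin_rep[OF \<rho> v div_mod_bounds(1)[OF j]] lin_rules)
        also have "\<dots> = tsum (\<Delta> h) (\<lambda>a c. eps a * ((\<rho> 1 *\<^sub>v v) $ (j div n) * \<phi> (j mod n) c))"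
          by (subst B_r[of "\<lambda>y. (\<rho> y *\<^sub>v v) $ (j div n) * \<phi> (j mod n) c" for c])
            (intro lin_rep[OF \<rho> v div_mod_bounds(1)[OF j]] lin_rules refl)+
        also have "\<dots> = (\<rho> 1 *\<^sub>v v) $ (j div n) * \<phi> (j mod n) h"
          by (rule tsum_counit_left) (intro lin_rules)
        also have "\<dots> = (1\<^sub>m (d * n) *\<^sub>v kronv v (vh h)) $ j"
          using j v div_mod_bounds[OF j] kc by (simp add: idx_kron[OF v vh_carrier] repd_vec(5)[OF \<rho>] idx_vh)
        finally show "(msum (d * n) (d * n) (\<lambda>k. i k * q k) d *\<^sub>v kronv v (vh h)) $ j = (1\<^sub>m (d * n) *\<^sub>v kronv v (vh h)) $ j" .
      qed (simp add: carrier_matD[OF msum_carrier])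
    qed simp_all
  qed
  then show ?thesis by blast
qed

end

section \<open>Faithful generators of modules over a Frobenius algebra\<close>

text \<open>The index pairs are flattened: if the identity on N blocks of size r factors through M
  blocks of size r', the product of two rectangular matrices is 1. All dimension counts below take
  this form, including those for spaces of homomorphisms.\<close>

lemma block_dim_le:
  fixes X :: "nat \<Rightarrow> nat \<Rightarrow> nat \<Rightarrow> nat \<Rightarrow> 'k::field"
  assumes "\<And>k l a b. k < N \<Longrightarrow> l < N \<Longrightarrow> a < r \<Longrightarrow> b < r \<Longrightarrow>
    (\<Sum>s<M. \<Sum>c<r'. X k a s c * Y s c l b) = (if k = l \<and> a = b then 1 else 0)"
  shows "N * r \<le> M * r'"
proof (rule left_inverse_dim_le)
  let ?A = "mat (N * r) (M * r') (\<lambda>(i, j). X (i div r) (i mod r) (j div r') (j mod r'))"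
  let ?B = "mat (M * r') (N * r) (\<lambda>(i, j). Y (i div r') (i mod r') (j div r) (j mod r))"
  show "?A \<in> carrier_mat (N * r) (M * r')" "?B \<in> carrier_mat (M * r') (N * r)" by simp_all
  show "?A * ?B = 1\<^sub>m (N * r)"
  proof (rule eq_matI)
    fix i j assume "i < dim_row (1\<^sub>m (N * r) :: 'k mat)" "j < dim_col (1\<^sub>m (N * r) :: 'k mat)"
    then have i: "i < N * r" and j: "j < N * r" by simp_all
    have "(?A * ?B) $$ (i, j) = (\<Sum>t<M * r'. X (i div r) (i mod r) (t div r') (t mod r') * Y (t div r') (t mod r') (j div r) (j mod r))"
      using i j by (simp add: scalar_prod_def atLeast0LessThan)
    also have "\<dots> = (\<Sum>s<M. \<Sum>c<r'. X (i div r) (i mod r) s c * Y s c (j div r) (j mod r))"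
      by (rule sum_div_mod)
    also have "\<dots> = (if i div r = j div r \<and> i mod r = j mod r then 1 else 0)"
      by (rule assms) (use div_mod_bounds[OF i] div_mod_bounds[OF j] in auto)
    also have "(i div r = j div r \<and> i mod r = j mod r) \<longleftrightarrow> i = j" by (metis div_mult_mod_eq)
    finally show "(?A * ?B) $$ (i, j) = 1\<^sub>m (N * r) $$ (i, j)" using i j by simp
  qed simp_all
qed

section \<open>Left ideals and self-injectivity\<close>

context fd_hopf_algebra
begin

definition subsp :: "'h set \<Rightarrow> bool" where
  "subsp W \<longleftrightarrow> 0 \<in> W \<and> (\<forall>x \<in> W. \<forall>y \<in> W. x + y \<in> W) \<and> (\<forall>c. \<forall>x \<in> W. sc c x \<in> W)"

definition vdim :: "'h set \<Rightarrow> nat" where "vdim = vector_space.dim sc"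

text \<open>The coordinate forms \<open>\<psi>\<close> are defined on all of \<open>H\<close>: a
  basis of W is completed to one of \<open>H\<close>, and the coordinates at the basis of W are
  kept. In this way W is handled without becoming a type.\<close>

lemma
  shows subspace_basis: "subsp W \<Longrightarrow> \<exists>w \<psi>. (\<forall>i<vdim W. w i \<in> W) \<and> (\<forall>i. lin (\<psi> i)) \<and>
      (\<forall>i<vdim W. \<forall>j<vdim W. \<psi> i (w j) = (if i = j then 1 else 0)) \<and>
      (\<forall>v \<in> W. (\<Sum>i<vdim W. sc (\<psi> i v) (w i)) = v)"
    and vdim_less: "subsp U \<Longrightarrow> subsp W \<Longrightarrow> U \<subset> W \<Longrightarrow> vdim U < vdim W"
    and vdim_le: "vdim W \<le> vdim UNIV"
proof -
  obtain Bs where "finite_dimensional_vector_space sc Bs" using finite_dim by blast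
  then interpret fdvs: finite_dimensional_vector_space sc Bs .
  have sub: "fdvs.subspace W \<longleftrightarrow> subsp W" for W
    by (simp add: fdvs.subspace_def subsp_def)
  show "vdim U < vdim W" if "subsp U" "subsp W" "U \<subset> W"
  proof -
    have "fdvs.span U = U" "fdvs.span W = W" using that by (simp_all add: fdvs.span_eq_iff sub)
    then show ?thesis unfolding vdim_def using fdvs.dim_psubset[of U W] that(3) by metis
  qed
  show "vdim W \<le> vdim UNIV"
    unfolding vdim_def by (rule fdvs.dim_subset) simp
  assume "subsp W"
  then have W: "fdvs.subspace W" by (simp add: sub)
  obtain B where B: "B \<subseteq> W" "fdvs.independent B" "W \<subseteq> fdvs.span B" "card B = fdvs.dim W"
    using fdvs.basis_exists[of W] by blast
  have fin: "finite B" using fdvs.finiteI_independent B(2) by blast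
  define C where "C = fdvs.extend_basis B"
  have C: "fdvs.independent C" "B \<subseteq> C" "fdvs.span C = UNIV"
    unfolding C_def by (simp_all add: fdvs.independent_extend_basis fdvs.extend_basis_superset fdvs.span_extend_basis B(2))
  obtain w where w: "bij_betw w {..<vdim W} B"
    using ex_bij_betw_nat_finite[OF fin] by (auto simp: atLeast0LessThan vdim_def B(4))
  have "lin (\<lambda>x. fdvs.representation C x (w m))" for m
    unfolding lin_def by (simp add: fdvs.representation_add fdvs.representation_scale C)
  moreover have "w i \<in> W" if "i < vdim W" for i using w B(1) that by (auto simp: bij_betw_def)
  moreover have "fdvs.representation C (w j) (w i) = (if i = j then 1 else 0)" if "i < vdim W" "j < vdim W" for i j
  proof -
    have "w j \<in> C" using w that C by (auto simp: bij_betw_def)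
    moreover have "w j = w i \<longleftrightarrow> j = i" using w that by (auto simp: bij_betw_def inj_on_def)
    ultimately show ?thesis using fdvs.representation_basis[OF C(1), of "w j"] by auto
  qed
  moreover have "(\<Sum>i<vdim W. sc (fdvs.representation C v (w i)) (w i)) = v" if v: "v \<in> W" for v
  proof -
    have vB: "v \<in> fdvs.span B" using B v by blast
    have "(\<Sum>i<vdim W. sc (fdvs.representation C v (w i)) (w i)) = (\<Sum>u\<in>B. sc (fdvs.representation C v u) u)"
      by (rule sum.reindex_bij_betw[OF w])
    also have "\<dots> = (\<Sum>u\<in>B. sc (fdvs.representation B v u) u)"
      by (simp only: fdvs.representation_extend[OF C(1) vB C(2)])
    also have "(\<Sum>u\<in>B. sc (fdvs.representation B v u) u) = v"
      by (rule fdvs.sum_representation_eq[OF B(2) vB fin order_refl])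
    finally show ?thesis .
  qed
  ultimately show "\<exists>w \<psi>. (\<forall>i<vdim W. w i \<in> W) \<and> (\<forall>i. lin (\<psi> i)) \<and>
      (\<forall>i<vdim W. \<forall>j<vdim W. \<psi> i (w j) = (if i = j then 1 else 0)) \<and>
      (\<forall>v \<in> W. (\<Sum>i<vdim W. sc (\<psi> i v) (w i)) = v)"
    by (intro exI[of _ w] exI[of _ "\<lambda>i x. fdvs.representation C x (w i)"]) blast
qed

definition left_ideal :: "'h set \<Rightarrow> bool" where
  "left_ideal A \<longleftrightarrow> 0 \<in> A \<and> (\<forall>x \<in> A. \<forall>y \<in> A. x + y \<in> A) \<and> (\<forall>c. \<forall>x \<in> A. c * x \<in> A)"

lemma sc_mult: "sc c 1 * x = sc c x" by (simp add: scale_mult_left)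

lemma left_ideal_subsp: "left_ideal A \<Longrightarrow> subsp A"
  unfolding left_ideal_def subsp_def by (metis sc_mult)

lemma left_ideal_diff: "left_ideal A \<Longrightarrow> x \<in> A \<Longrightarrow> y \<in> A \<Longrightarrow> x - y \<in> A"
  unfolding left_ideal_def by (metis diff_conv_add_uminus mult_minus1)

lemma left_ideal_principal: "left_ideal {b * x |b. True}"
  unfolding left_ideal_def
proof (intro conjI ballI allI)
  show "0 \<in> {b * x |b. True}" by (rule CollectI, rule exI[of _ 0]) simp
  fix y z c assume "y \<in> {b * x |b. True}"
  then obtain b1 where y: "y = b1 * x" by blast
  show "c * y \<in> {b * x |b. True}" by (rule CollectI, rule exI[of _ "c * b1"]) (simp add: y mult.assoc)
  assume "z \<in> {b * x |b. True}"
  then obtain b2 where "z = b2 * x" by blast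
  then show "y + z \<in> {b * x |b. True}" by (intro CollectI exI[of _ "b1 + b2"]) (simp add: y distrib_right)
qed

text \<open>The form l(x y) is nondegenerate, so \<open>l\<close> is a Frobenius form. Hence l after
  f, extended from A to \<open>H\<close>, has the shape x \<mapsto> l(x y) for some y. As A is a
  left ideal, l(x (f a - a y)) = 0 for all x, and f a = a y follows.\<close>

lemma self_injective:
  assumes int: "normalized_integrals H \<Lambda> l" and A: "left_ideal A"
    and f: "\<And>a c. a \<in> A \<Longrightarrow> c \<in> A \<Longrightarrow> f (a + c) = f a + f c" "\<And>x a. a \<in> A \<Longrightarrow> f (x * a) = x * f a"
  shows "\<exists>y. \<forall>a \<in> A. f a = a * y"
proof -
  have l: "lin l" using int by (simp add: normalized_integrals_def right_cointegral_def lin_iff)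
  \<comment> \<open>The representing element is \<Sum> h(S(\<Lambda>2)) \<Lambda>1, by the dual
    basis identity.\<close>
  have repr: "\<exists>y. \<forall>x. h x = l (x * y)" if h: "lin h" for h
  proof (intro exI allI)
    fix x
    have lx: "lin (\<lambda>y. l (x * y))" by (rule lin_comp[OF l]) (intro vlin_mult2 vlin_id)
    show "h x = l (x * tsum (\<Delta> \<Lambda>) (\<lambda>u v. sc (h (S v)) u))"
      using dual_basis[OF int h, of x] lx unfolding lin_tsum_val[OF lx] by (simp add: lin_def mult.commute)
  qed
  \<comment> \<open>The map \<open>\<Phi>\<close> collects the values l(w i * y) in a basis w. By
    \<open>repr\<close> it is onto, hence injective by finite dimension, and it vanishes at
    z.\<close>
  have nondeg: "z = 0" if z: "\<And>x. l (x * z) = 0" for z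
  proof -
    have "subsp UNIV" by (simp add: subsp_def)
    from subspace_basis[OF this] obtain w \<psi> where
      w': "\<forall>i<vdim UNIV. \<forall>j<vdim UNIV. \<psi> i (w j) = (if i = j then 1 else 0)"
      and \<psi>': "\<forall>i. lin (\<psi> i)" and sum': "\<forall>v \<in> UNIV. (\<Sum>i<vdim UNIV. sc (\<psi> i v) (w i)) = v"
      by blast
    have w: "\<psi> i (w j) = (if i = j then 1 else 0)" if "i < vdim UNIV" "j < vdim UNIV" for i j
      using w' that by blast
    have \<psi>: "lin (\<psi> i)" for i using \<psi>' by blast
    have sum: "(\<Sum>i<vdim UNIV. sc (\<psi> i v) (w i)) = v" for v using sum' by blast
    define \<Phi> where "\<Phi> y = (\<Sum>i<vdim UNIV. sc (l (w i * y)) (w i))" for y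
    have li: "lin (\<lambda>y. l (x * y))" for x by (rule lin_comp[OF l]) (intro vlin_mult2 vlin_id)
    have vs: "sc (c + d) x = sc c x + sc d x" "sc (c * d) x = sc c (sc d x)" for c d x
      using vector_space by (simp_all add: vector_space_def)
    have scsum: "sc c (\<Sum>i\<in>I. g i) = (\<Sum>i\<in>I. sc c (g i))" for c and g :: "nat \<Rightarrow> 'h" and I
      by (metis (no_types, lifting) sc_mult sum.cong sum_distrib_left)
    have "vlin \<Phi>"
      unfolding vlin_def \<Phi>_def using li
      by (auto simp: lin_def vs sum.distrib scsum)
    moreover have "surj \<Phi>"
      unfolding surj_def
    proof
      fix v
      have lv: "lin (\<lambda>x. \<Sum>i<vdim UNIV. \<psi> i v * \<psi> i x)" by (intro lin_sum lin_mult2 \<psi>)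
      obtain y where y: "\<And>x. (\<Sum>i<vdim UNIV. \<psi> i v * \<psi> i x) = l (x * y)" using repr[OF lv] by blast
      have "\<Phi> y = (\<Sum>j<vdim UNIV. sc (\<psi> j v) (w j))"
        unfolding \<Phi>_def y[symmetric] by (rule sum.cong[OF refl]) (simp add: w if_distrib cong: if_cong)
      then show "\<exists>y. v = \<Phi> y" unfolding sum by (intro exI[of _ y]) (rule sym)
    qed
    ultimately have "inj \<Phi>" by (rule surj_imp_inj)
    moreover have "\<Phi> z = \<Phi> 0" by (simp add: \<Phi>_def z lin_0[OF l])
    ultimately show ?thesis by (simp add: inj_def)
  qed
  obtain w \<psi> where w: "\<And>i. i < vdim A \<Longrightarrow> w i \<in> A"
    and \<psi>: "\<And>i. lin (\<psi> i)" and sum: "\<And>v. v \<in> A \<Longrightarrow> (\<Sum>i<vdim A. sc (\<psi> i v) (w i)) = v"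
    using subspace_basis[OF left_ideal_subsp[OF A]] by blast
  \<comment> \<open>The coordinates on A extend l after f to a linear form on the whole
    algebra.\<close>
  have "lin (\<lambda>x. \<Sum>i<vdim A. \<psi> i x * l (f (w i)))" by (intro lin_sum lin_mult1 \<psi>)
  then obtain y where y: "\<And>x. (\<Sum>i<vdim A. \<psi> i x * l (f (w i))) = l (x * y)" using repr by blast
  have f0: "f 0 = 0" using f(2)[of 0 0] A by (simp add: left_ideal_def)
  have lfy: "l (f a) = l (a * y)" if a: "a \<in> A" for a
  proof -
    have fs: "f (\<Sum>i<m. sc (c i) (w i)) = (\<Sum>i<m. sc (c i) (f (w i))) \<and> (\<Sum>i<m. sc (c i) (w i)) \<in> A" if "m \<le> vdim A" for m and c
      using that
    proof (induction m)
      case 0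
      then show ?case using A f0 by (simp add: left_ideal_def)
    next
      case (Suc m)
      then have "w m \<in> A" "sc (c m) (w m) \<in> A" using w left_ideal_subsp[OF A] by (simp_all add: subsp_def)
      moreover have "f (sc (c m) (w m)) = sc (c m) (f (w m))"
        using f(2)[OF \<open>w m \<in> A\<close>, of "sc (c m) 1"] by (simp add: sc_mult)
      ultimately show ?case using Suc f(1) A unfolding left_ideal_def by simp
    qed
    have "f a = (\<Sum>i<vdim A. sc (\<psi> i a) (f (w i)))"
      using fs[of "vdim A" "\<lambda>i. \<psi> i a"] sum[OF a] by simp
    then show ?thesis using y[of a] by (simp only: lin_sum_val[OF l])
  qed
  have "f a = a * y" if a: "a \<in> A" for a
  proof -
    have "l (x * (f a - a * y)) = 0" for x
    proof -
      have "x * a \<in> A" using A a by (simp add: left_ideal_def)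
      from lfy[OF this] have "l (x * f a) = l (x * (a * y))" using f(2)[OF a] by (simp add: mult.assoc)
      moreover have "l (x * (f a - a * y) + x * (a * y)) = l (x * (f a - a * y)) + l (x * (a * y))"
        using l by (simp add: lin_def)
      ultimately show ?thesis by (simp add: algebra_simps)
    qed
    from nondeg[OF this] show ?thesis by simp
  qed
  then show ?thesis by blast
qed

end

lemma mv_vecsum:
  assumes "A \<in> carrier_mat r c" "\<And>k. k < M \<Longrightarrow> u k \<in> carrier_vec c"
  shows "A *\<^sub>v vec c (\<lambda>i. \<Sum>k<M. u k $ i) = vec r (\<lambda>i. \<Sum>k<M. (A *\<^sub>v u k) $ i)"
proof (rule eq_vecI)
  fix i assume "i < dim_vec (vec r (\<lambda>i. \<Sum>k<M. (A *\<^sub>v u k) $ i))"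
  then have i: "i < r" by simp
  have d: "dim_vec (u k) = c" if "k < M" for k using assms(2)[OF that] by (rule carrier_vecD)
  have "(A *\<^sub>v vec c (\<lambda>i. \<Sum>k<M. u k $ i)) $ i = (\<Sum>j\<in>{0..<c}. \<Sum>k<M. A $$ (i, j) * u k $ j)"
    using i assms(1) by (simp add: scalar_prod_def sum_distrib_left)
  also have "\<dots> = (\<Sum>k<M. \<Sum>j\<in>{0..<c}. A $$ (i, j) * u k $ j)" by (rule sum.swap)
  also have "\<dots> = (\<Sum>k<M. (A *\<^sub>v u k) $ i)"
    using i assms(1) d by (intro sum.cong) (auto simp: scalar_prod_def)
  finally show "(A *\<^sub>v vec c (\<lambda>i. \<Sum>k<M. u k $ i)) $ i = vec r (\<lambda>i. \<Sum>k<M. (A *\<^sub>v u k) $ i) $ i"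
    using i by simp
qed (use assms(1) in simp)

context coord_hopf
begin

lemma repd_diff:
  assumes P: "rep P d" and v: "v \<in> carrier_vec d"
  shows "P (x - y) *\<^sub>v v = P x *\<^sub>v v - P y *\<^sub>v v" "P 0 *\<^sub>v v = 0\<^sub>v d"
proof -
  have l: "lin (\<lambda>x. (P x *\<^sub>v v) $ i)" if "i < d" for i by (rule linv_index[OF linv_rep[OF P v] that])
  have l0: "(P 0 *\<^sub>v v) $ i = 0" if "i < d" for i using lin_0[OF l[OF that]] .
  have "(P (x - y + y) *\<^sub>v v) $ i = (P (x - y) *\<^sub>v v) $ i + (P y *\<^sub>v v) $ i" if "i < d" for i
    using l[OF that] unfolding lin_def by blast
  then show "P (x - y) *\<^sub>v v = P x *\<^sub>v v - P y *\<^sub>v v"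
    using repd_dims[OF P] by (intro eq_vecI) (simp_all del: index_mult_mat_vec)
  show "P 0 *\<^sub>v v = 0\<^sub>v d" using l0 repd_dims[OF P] by (intro eq_vecI) (simp_all del: index_mult_mat_vec)
qed

text \<open>This is injectivity in Baer's form. P is a direct summand of N copies of the regular
  module; self-injectivity turns each component be k after f into a right multiplication, and
  \<open>retract\<close> puts the components together to a vector of P.\<close>

lemma module_injective:
  assumes int: "normalized_integrals H \<Lambda> l" and P: "rep P d"
    and al: "\<And>k. k < N \<Longrightarrow> al k \<in> intertwiners reg P" and be: "\<And>k. k < N \<Longrightarrow> be k \<in> intertwiners P reg"
    and retract: "msum d d (\<lambda>k. al k * be k) N = 1\<^sub>m d"
    and A: "left_ideal A" and fc: "\<And>a. a \<in> A \<Longrightarrow> f a \<in> carrier_vec d"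
    and f: "\<And>a c. a \<in> A \<Longrightarrow> c \<in> A \<Longrightarrow> f (a + c) = f a + f c" "\<And>x a. a \<in> A \<Longrightarrow> f (x * a) = P x *\<^sub>v f a"
  shows "\<exists>p \<in> carrier_vec d. \<forall>a \<in> A. f a = P a *\<^sub>v p"
proof -
  have alc: "al k \<in> carrier_mat d n" "\<And>x v. v \<in> carrier_vec n \<Longrightarrow> al k *\<^sub>v (reg x *\<^sub>v v) = P x *\<^sub>v (al k *\<^sub>v v)"
    if "k < N" for k using al[OF that] by (simp_all add: intertwiners_iff[OF reg_rep P])
  have bec: "be k \<in> carrier_mat n d" "\<And>x v. v \<in> carrier_vec d \<Longrightarrow> be k *\<^sub>v (P x *\<^sub>v v) = reg x *\<^sub>v (be k *\<^sub>v v)"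
    if "k < N" for k using be[OF that] by (simp_all add: intertwiners_iff[OF P reg_rep])
  have bv: "be k *\<^sub>v v \<in> carrier_vec n" if "k < N" "v \<in> carrier_vec d" for k v
    by (rule mult_mat_vec_carrier[OF bec(1)[OF that(1)] that(2)])
  have "\<exists>y. \<forall>a \<in> A. hv (be k *\<^sub>v f a) = a * y" if k: "k < N" for k
  proof (rule self_injective[OF int A])
    fix a c assume a: "a \<in> A" and c: "c \<in> A"
    show "hv (be k *\<^sub>v f (a + c)) = hv (be k *\<^sub>v f a) + hv (be k *\<^sub>v f c)"
      using f(1)[OF a c] bec(1)[OF k] fc[OF a] fc[OF c] bv[OF k]
      by (simp add: mult_add_distrib_mat_vec[of _ n d] hv_add)
  next
    fix x a assume a: "a \<in> A"
    have "be k *\<^sub>v f (x * a) = reg x *\<^sub>v vh (hv (be k *\<^sub>v f a))"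
      using f(2)[OF a] bec(2)[OF k fc[OF a]] bv[OF k fc[OF a]] by simp
    then show "hv (be k *\<^sub>v f (x * a)) = x * hv (be k *\<^sub>v f a)" by (simp add: reg_vh)
  qed
  then obtain y where y: "\<And>k a. k < N \<Longrightarrow> a \<in> A \<Longrightarrow> hv (be k *\<^sub>v f a) = a * y k" by metis
  define p where "p = vec d (\<lambda>i. \<Sum>k<N. (al k *\<^sub>v vh (y k)) $ i)"
  have ac: "al k *\<^sub>v vh z \<in> carrier_vec d" if "k < N" for k z
    by (rule mult_mat_vec_carrier[OF alc(1)[OF that] vh_carrier])
  have "f a = P a *\<^sub>v p" if a: "a \<in> A" for a
  proof (rule eq_vecI)
    fix i assume "i < dim_vec (P a *\<^sub>v p)"
    then have i: "i < d" using repd_dims[OF P] by simp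
    have abc: "al k * be k \<in> carrier_mat d d" if "k < N" for k
      using alc(1)[OF that] bec(1)[OF that] by (rule mult_carrier_mat)
    have "(P a *\<^sub>v p) $ i = (\<Sum>k<N. (P a *\<^sub>v (al k *\<^sub>v vh (y k))) $ i)"
    proof -
      have "P a *\<^sub>v p = vec d (\<lambda>i. \<Sum>k<N. (P a *\<^sub>v (al k *\<^sub>v vh (y k))) $ i)"
        unfolding p_def by (rule mv_vecsum[OF repd_carrier[OF P]]) (rule ac)
      then show ?thesis using i by simp
    qed
    also have "\<dots> = (\<Sum>k<N. ((al k * be k) *\<^sub>v f a) $ i)"
    proof (rule sum.cong[OF refl])
      fix k assume "k \<in> {..<N}"
      then have k: "k < N" by simp
      have "P a *\<^sub>v (al k *\<^sub>v vh (y k)) = al k *\<^sub>v vh (a * y k)"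
        using alc(2)[OF k vh_carrier] by (simp add: reg_vh)
      also have "\<dots> = al k *\<^sub>v (be k *\<^sub>v f a)"
        using y[OF k a, symmetric] bv[OF k fc[OF a]] by simp
      also have "\<dots> = (al k * be k) *\<^sub>v f a"
        by (rule assoc_mult_mat_vec[OF alc(1)[OF k] bec(1)[OF k] fc[OF a], symmetric])
      finally show "(P a *\<^sub>v (al k *\<^sub>v vh (y k))) $ i = ((al k * be k) *\<^sub>v f a) $ i" by (rule arg_cong)
    qed
    also have "\<dots> = f a $ i" using msum_mv[OF abc fc[OF a] i, symmetric] fc[OF a] by (simp add: retract)
    finally show "f a $ i = (P a *\<^sub>v p) $ i" by (rule sym)
  qed (use fc[OF a] repd_dims[OF P] in simp)
  then show ?thesis by (intro bexI[of _ p]) (simp_all add: p_def)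
qed

text \<open>The sum of A and the left ideal of x is direct, so a + c x \<mapsto> a p + c x q is a
  module map. It is injective because x q lies outside A p and every nonzero multiple of x generates
  x again. By \<open>injective\<close> it is evaluation at one vector, the new generator.\<close>

lemma hom_extend:
  assumes P: "rep P d" and A: "left_ideal A" and p: "p \<in> carrier_vec d"
    and inj: "\<And>a. a \<in> A \<Longrightarrow> P a *\<^sub>v p = 0\<^sub>v d \<Longrightarrow> a = 0"
    and x: "x \<noteq> 0" "P x *\<^sub>v p = 0\<^sub>v d"
    and min: "\<And>c. c * x \<noteq> 0 \<Longrightarrow> \<exists>e. x = e * (c * x)"
    and q: "q \<in> carrier_vec d" "\<And>a. a \<in> A \<Longrightarrow> P x *\<^sub>v q \<noteq> P a *\<^sub>v p"
    and injective: "\<And>A f. left_ideal A \<Longrightarrow> (\<And>a. a \<in> A \<Longrightarrow> f a \<in> carrier_vec d) \<Longrightarrow>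
      (\<And>a c. a \<in> A \<Longrightarrow> c \<in> A \<Longrightarrow> f (a + c) = f a + f c) \<Longrightarrow>
      (\<And>x a. a \<in> A \<Longrightarrow> f (x * a) = P x *\<^sub>v f a) \<Longrightarrow> \<exists>p \<in> carrier_vec d. \<forall>a \<in> A. f a = P a *\<^sub>v p"
  shows "\<exists>A' p'. left_ideal A' \<and> A \<subset> A' \<and> p' \<in> carrier_vec d \<and> (\<forall>a \<in> A'. P a *\<^sub>v p' = 0\<^sub>v d \<longrightarrow> a = 0)"
proof -
  note Pp = repd_vec[OF P p] repd_diff[OF P p] and Pq = repd_vec[OF P q(1)] repd_diff[OF P q(1)]
  \<comment> \<open>A multiple of x kills p; if it also lies in A, it is zero.\<close>
  have disj: "c * x = 0" if "c * x \<in> A" for c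
  proof (rule inj[OF that])
    have "P (c * x) *\<^sub>v p = P c *\<^sub>v (P 0 *\<^sub>v p)" by (simp add: Pp x)
    also have "\<dots> = P (c * 0) *\<^sub>v p" by (simp only: Pp(4))
    finally show "P (c * x) *\<^sub>v p = 0\<^sub>v d" by (simp add: Pp)
  qed
  define A' where "A' = {a + c * x |a c. a \<in> A}"
  have A': "left_ideal A'"
    unfolding left_ideal_def
  proof (intro conjI ballI allI)
    show "0 \<in> A'" unfolding A'_def using A by (auto simp: left_ideal_def intro!: exI[of _ 0])
    fix y z e assume "y \<in> A'"
    then obtain a c where y: "y = a + c * x" "a \<in> A" by (auto simp: A'_def)
    have "e * y = e * a + (e * c) * x" "e * a \<in> A" using y A by (simp_all add: left_ideal_def algebra_simps)
    then show "e * y \<in> A'" unfolding A'_def by blast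
    assume "z \<in> A'"
    then obtain a' c' where z: "z = a' + c' * x" "a' \<in> A" by (auto simp: A'_def)
    have "y + z = (a + a') + (c + c') * x" "a + a' \<in> A" using y z A by (simp_all add: left_ideal_def algebra_simps)
    then show "y + z \<in> A'" unfolding A'_def by blast
  qed
  have "\<forall>z \<in> A'. \<exists>a. a \<in> A \<and> (\<exists>c. z = a + c * x)" by (auto simp: A'_def)
  then obtain pa where pa: "\<And>z. z \<in> A' \<Longrightarrow> pa z \<in> A" "\<And>z. z \<in> A' \<Longrightarrow> \<exists>c. z = pa z + c * x" by metis
  \<comment> \<open>Directness makes the component in A unique, so the map f below does not depend
    on the chosen decomposition.\<close>
  have pa_eq: "pa z = a" if "a \<in> A" "z = a + c * x" for z a c
  proof -
    have z: "z \<in> A'" using that by (auto simp: A'_def)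
    then obtain c' where c': "z = pa z + c' * x" using pa by blast
    then have "pa z - a = (c - c') * x" using that by (simp add: algebra_simps)
    moreover have "pa z - a \<in> A" using left_ideal_diff[OF A] pa(1)[OF z] that by blast
    ultimately show ?thesis using disj by (metis eq_iff_diff_eq_0)
  qed
  define f where "f z = P (pa z) *\<^sub>v p + P (z - pa z) *\<^sub>v q" for z
  have f: "f (a + c * x) = P a *\<^sub>v p + P (c * x) *\<^sub>v q" if "a \<in> A" for a c
    unfolding f_def by (simp add: pa_eq[OF that refl])
  have "\<exists>p' \<in> carrier_vec d. \<forall>a \<in> A'. f a = P a *\<^sub>v p'"
  proof (rule injective[OF A'])
    show "f z \<in> carrier_vec d" for z unfolding f_def by (simp add: Pp Pq)
    fix y assume "y \<in> A'"
    then obtain a c where y: "y = a + c * x" "a \<in> A" by (auto simp: A'_def)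
    show "f (e * y) = P e *\<^sub>v f y" for e
    proof -
      have "e * y = e * a + (e * c) * x" "e * a \<in> A" using y A by (simp_all add: left_ideal_def algebra_simps)
      then have "f (e * y) = P (e * a) *\<^sub>v p + P ((e * c) * x) *\<^sub>v q" using f by simp
      also have "\<dots> = P e *\<^sub>v (P a *\<^sub>v p) + P e *\<^sub>v (P (c * x) *\<^sub>v q)" by (simp only: mult.assoc Pp Pq)
      also have "\<dots> = P e *\<^sub>v (P a *\<^sub>v p + P (c * x) *\<^sub>v q)"
        by (rule mult_add_distrib_mat_vec[OF repd_carrier[OF P], symmetric]) (rule Pp Pq)+
      finally show ?thesis using f y by simp
    qed
    fix z assume "z \<in> A'"
    then obtain a' c' where z: "z = a' + c' * x" "a' \<in> A" by (auto simp: A'_def)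
    have yz: "y + z = (a + a') + (c + c') * x" "a + a' \<in> A" using y z A by (simp_all add: left_ideal_def algebra_simps)
    have "f (y + z) = P (a + a') *\<^sub>v p + P (c * x + c' * x) *\<^sub>v q"
      unfolding yz(1) f[OF yz(2)] by (simp add: distrib_right)
    also have "\<dots> = (P a *\<^sub>v p + P a' *\<^sub>v p) + (P (c * x) *\<^sub>v q + P (c' * x) *\<^sub>v q)" by (simp only: Pp Pq)
    also have "\<dots> = (P a *\<^sub>v p + P (c * x) *\<^sub>v q) + (P a' *\<^sub>v p + P (c' * x) *\<^sub>v q)"
      using repd_dims[OF P] by (intro eq_vecI) (simp_all del: index_mult_mat_vec add: algebra_simps)
    finally show "f (y + z) = f y + f z" using f y z by simp
  qed
  then obtain p' where p': "p' \<in> carrier_vec d" "\<And>z. z \<in> A' \<Longrightarrow> f z = P z *\<^sub>v p'" by blast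
  have "z = 0" if z: "z \<in> A'" "P z *\<^sub>v p' = 0\<^sub>v d" for z
  proof -
    obtain a c where y: "z = a + c * x" "a \<in> A" using z by (auto simp: A'_def)
    have 0: "P a *\<^sub>v p + P (c * x) *\<^sub>v q = 0\<^sub>v d" using p'(2)[OF z(1)] z(2) f y by simp
    \<comment> \<open>Otherwise some e takes c x back to x, and x q = -(e a) p would lie in A
      p.\<close>
    have cx: "c * x = 0"
    proof (rule ccontr)
      assume "c * x \<noteq> 0"
      then obtain e where e: "x = e * (c * x)" using min by blast
      have "P (c * x) *\<^sub>v q = P (- a) *\<^sub>v p"
      proof (rule eq_vecI)
        fix i assume "i < dim_vec (P (- a) *\<^sub>v p)"
        then have i: "i < d" using repd_dims[OF P] by simp
        have "(P a *\<^sub>v p + P (c * x) *\<^sub>v q) $ i = 0" using 0 i by simp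
        moreover have "(P (0 - a) *\<^sub>v p) $ i = - (P a *\<^sub>v p) $ i"
          unfolding Pp using i repd_dims[OF P] by (simp del: index_mult_mat_vec)
        ultimately show "(P (c * x) *\<^sub>v q) $ i = (P (- a) *\<^sub>v p) $ i"
          using i repd_dims[OF P] by (simp del: index_mult_mat_vec add: add_eq_0_iff)
      qed (use repd_dims[OF P] in simp)
      then have "P e *\<^sub>v (P (c * x) *\<^sub>v q) = P (e * (- a)) *\<^sub>v p" by (simp only: Pp)
      then have "P x *\<^sub>v q = P (e * (- a)) *\<^sub>v p" by (simp only: Pq(4)[symmetric] e[symmetric])
      moreover have "e * (- a) \<in> A" using y(2) A unfolding left_ideal_def by (metis mult_minus_left mult_minus_right)
      ultimately show False using q(2) by blast
    qed
    have "P a *\<^sub>v p = 0\<^sub>v d" using 0 Pp(1)[of a] by (simp add: cx Pq)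
    then show ?thesis using inj[OF y(2)] y(1) cx by simp
  qed
  moreover have "A \<subseteq> A'" unfolding A'_def using add_0_right mult_zero_left by (metis (mono_tags, lifting) mem_Collect_eq subsetI)
  moreover have "x \<in> A'" unfolding A'_def using A by (intro CollectI exI[of _ 0] exI[of _ 1]) (simp add: left_ideal_def)
  moreover have "x \<notin> A" using disj[of 1] x by auto
  ultimately show ?thesis using A' p' by blast
qed

text \<open>\<open>al\<close> and \<open>be\<close> are inverse matrices of module maps between M
  copies of P and N copies of the algebra K. Multiplied by x, this isomorphism would fit N copies of
  x K into M copies of a strictly smaller space, although M \<le> N.\<close>

lemma faithful_generator:
  assumes int: "normalized_integrals H \<Lambda> l" and P: "rep P d"
    and al: "\<And>s k. s < M \<Longrightarrow> k < N \<Longrightarrow> al s k \<in> intertwiners reg P"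
    and be: "\<And>s k. s < M \<Longrightarrow> k < N \<Longrightarrow> be k s \<in> intertwiners P reg"
    and bl: "\<And>k j. k < N \<Longrightarrow> j < N \<Longrightarrow> msum n n (\<lambda>s. be k s * al s j) M = (if k = j then 1\<^sub>m n else 0\<^sub>m n n)"
    and lb: "\<And>s. s < M \<Longrightarrow> msum d d (\<lambda>k. al s k * be k s) N = 1\<^sub>m d"
    and MN: "0 < M" "M \<le> N"
  shows "\<exists>p \<in> carrier_vec d. \<forall>x. P x *\<^sub>v p = 0\<^sub>v d \<longrightarrow> x = 0"
proof -
  have injective: "\<exists>p \<in> carrier_vec d. \<forall>a \<in> A. f a = P a *\<^sub>v p"
    if "left_ideal A" "\<And>a. a \<in> A \<Longrightarrow> f a \<in> carrier_vec d" "\<And>a c. a \<in> A \<Longrightarrow> c \<in> A \<Longrightarrow> f (a + c) = f a + f c"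
      "\<And>x a. a \<in> A \<Longrightarrow> f (x * a) = P x *\<^sub>v f a" for A f
    using module_injective[OF int P al[OF MN(1)] be[OF MN(1)] lb[OF MN(1)]] that by blast
  define good where "good = (\<lambda>(A, p). left_ideal A \<and> p \<in> carrier_vec d \<and> (\<forall>a \<in> A. P a *\<^sub>v p = 0\<^sub>v d \<longrightarrow> a = 0))"
  have g0: "good ({0}, 0\<^sub>v d)" by (simp add: good_def left_ideal_def)
  have gb: "\<forall>y. good y \<longrightarrow> vdim (fst y) < vdim UNIV + 1" using vdim_le by (simp add: less_Suc_eq_le)
  obtain Ap where Ap: "good Ap" "\<And>y. good y \<Longrightarrow> vdim (fst y) \<le> vdim (fst Ap)"
    using ex_has_greatest_nat[of good, OF g0, of "\<lambda>y. vdim (fst y)"] gb by metis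
  obtain A p where Ap_eq: "Ap = (A, p)" by (cases Ap)
  have A: "left_ideal A" and p: "p \<in> carrier_vec d" and inj: "\<And>a. a \<in> A \<Longrightarrow> P a *\<^sub>v p = 0\<^sub>v d \<Longrightarrow> a = 0"
    using Ap(1) by (auto simp: Ap_eq good_def)
  note Pp = repd_vec[OF P p] repd_diff[OF P p]
  show ?thesis
  proof (rule ccontr)
    assume "\<not> ?thesis"
    then have "\<exists>x. x \<noteq> 0 \<and> P x *\<^sub>v p = 0\<^sub>v d" using p by blast
    then obtain x where x: "x \<noteq> 0" "P x *\<^sub>v p = 0\<^sub>v d"
      and xmin: "\<And>y. y \<noteq> 0 \<Longrightarrow> P y *\<^sub>v p = 0\<^sub>v d \<Longrightarrow> vdim {c * x |c. True} \<le> vdim {c * y |c. True}"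
      using ex_has_least_nat[of "\<lambda>x. x \<noteq> 0 \<and> P x *\<^sub>v p = 0\<^sub>v d" _ "\<lambda>y. vdim {c * y |c. True}"] by blast
    have Pcx: "P (c * x) *\<^sub>v p = 0\<^sub>v d" for c
    proof -
      have "P (c * x) *\<^sub>v p = P c *\<^sub>v (P 0 *\<^sub>v p)" by (simp add: Pp x)
      also have "\<dots> = P (c * 0) *\<^sub>v p" by (simp only: Pp(4))
      finally show ?thesis by (simp add: Pp)
    qed
    have min: "\<exists>e. x = e * (c * x)" if c: "c * x \<noteq> 0" for c
    proof (rule ccontr)
      assume no: "\<not> ?thesis"
      have "{e * (c * x) |e. True} \<subseteq> {e * x |e. True}"
        by (auto simp: mult.assoc[symmetric])
      moreover have "x \<in> {e * x |e. True}" by (rule CollectI, rule exI[of _ 1]) simp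
      ultimately have "{e * (c * x) |e. True} \<subset> {e * x |e. True}" using no by blast
      then have "vdim {e * (c * x) |e. True} < vdim {e * x |e. True}"
        by (intro vdim_less left_ideal_subsp left_ideal_principal)
      with xmin[OF c Pcx] show False by simp
    qed
    \<comment> \<open>Otherwise \<open>hom_extend\<close> would enlarge A, against its maximality.
      So x P is contained in A p.\<close>
    have "\<exists>a \<in> A. P x *\<^sub>v q = P a *\<^sub>v p" if q: "q \<in> carrier_vec d" for q
    proof (rule ccontr)
      assume "\<not> ?thesis"
      then have q': "\<And>a. a \<in> A \<Longrightarrow> P x *\<^sub>v q \<noteq> P a *\<^sub>v p" by blast
      obtain A' p' where A': "left_ideal A'" "A \<subset> A'" "p' \<in> carrier_vec d" "\<forall>a \<in> A'. P a *\<^sub>v p' = 0\<^sub>v d \<longrightarrow> a = 0"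
        using hom_extend[OF P A p inj x min q q' injective] by blast
      then have "vdim A' \<le> vdim A" using Ap(2)[of "(A', p')"] by (simp add: good_def Ap_eq)
      moreover have "vdim A < vdim A'" using A A' by (intro vdim_less left_ideal_subsp)
      ultimately show False by simp
    qed
    then obtain \<tau> where \<tau>A: "\<And>q. q \<in> carrier_vec d \<Longrightarrow> \<tau> q \<in> A"
      and \<tau>: "\<And>q. q \<in> carrier_vec d \<Longrightarrow> P x *\<^sub>v q = P (\<tau> q) *\<^sub>v p" by metis
    have ann: "e * x = 0 \<Longrightarrow> q \<in> carrier_vec d \<Longrightarrow> e * \<tau> q = 0" for e q
    proof (rule inj)
      assume e: "e * x = 0" and q: "q \<in> carrier_vec d"
      show "e * \<tau> q \<in> A" using \<tau>A[OF q] A by (simp add: left_ideal_def)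
      have "P (e * \<tau> q) *\<^sub>v p = P (e * x) *\<^sub>v q" using \<tau>[OF q] by (simp only: Pp(4) repd_vec(4)[OF P q])
      then show "P (e * \<tau> q) *\<^sub>v p = 0\<^sub>v d" by (simp add: e repd_diff[OF P q])
    qed
    \<comment> \<open>By \<open>ann\<close>, c x \<mapsto> c \<tau>(q) is well defined on the left
      ideal of x. By self-injectivity it is right multiplication by some y, and its value at x is
      \<tau>(q) = x y.\<close>
    have \<tau>x: "\<exists>y. \<tau> q = x * y" if q: "q \<in> carrier_vec d" for q
    proof -
      define L where "L = {c * x |c. True}"
      have L: "left_ideal L" unfolding L_def by (rule left_ideal_principal)
      have "\<forall>z \<in> L. \<exists>c. z = c * x" by (auto simp: L_def)
      then obtain co where co: "\<And>z. z \<in> L \<Longrightarrow> z = co z * x" by metis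
      have ce: "co z * \<tau> q = c * \<tau> q" if "z = c * x" for z c
      proof -
        have "z \<in> L" using that by (auto simp: L_def)
        then have "(co z - c) * x = 0" using co[of z] that by (simp add: left_diff_distrib)
        from ann[OF this q] show ?thesis by (simp add: left_diff_distrib)
      qed
      have "\<exists>y. \<forall>z \<in> L. co z * \<tau> q = z * y"
      proof (rule self_injective[OF int L])
        fix z z' assume "z \<in> L" "z' \<in> L"
        then have "z + z' = (co z + co z') * x" using co by (simp add: distrib_right)
        from ce[OF this] show "co (z + z') * \<tau> q = co z * \<tau> q + co z' * \<tau> q" by (simp add: distrib_right)
      next
        fix z e assume "z \<in> L"
        then have "e * z = (e * co z) * x" using co[of z] by (simp add: mult.assoc)
        from ce[OF this] show "co (e * z) * \<tau> q = e * (co z * \<tau> q)" by (simp add: mult.assoc)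
      qed
      moreover have "x \<in> L" unfolding L_def by (rule CollectI, rule exI[of _ 1]) simp
      ultimately obtain y where xy: "co x * \<tau> q = x * y" by blast
      have "\<tau> q = co x * \<tau> q" using ce[of x 1] by simp
      also have "\<dots> = x * y" by (rule xy)
      finally show ?thesis by (rule exI)
    qed
    \<comment> \<open>\<open>W\<close> is the right ideal x K. It contains x, which is not in A
      because x kills p, so the intersection of \<open>W\<close> with A is a proper subspace of
      \<open>W\<close>. All \<tau>(q) lie in it.\<close>
    define W where "W = {x * y |y. True}"
    have W: "subsp W"
      unfolding subsp_def W_def
    proof (intro conjI ballI allI)
      show "0 \<in> {x * y |y. True}" by (rule CollectI, rule exI[of _ 0]) simp
      fix u v c assume "u \<in> {x * y |y. True}"
      then obtain y1 where u: "u = x * y1" by blast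
      show "sc c u \<in> {x * y |y. True}" by (rule CollectI, rule exI[of _ "sc c y1"]) (simp add: u scale_mult_right)
      assume "v \<in> {x * y |y. True}"
      then obtain y2 where "v = x * y2" by blast
      then show "u + v \<in> {x * y |y. True}" by (intro CollectI exI[of _ "y1 + y2"]) (simp add: u distrib_left)
    qed
    have U: "subsp (W \<inter> A)" using W left_ideal_subsp[OF A] by (simp add: subsp_def)
    have "x \<notin> A" using inj[of x] x by blast
    moreover have "x \<in> W" unfolding W_def by (rule CollectI, rule exI[of _ 1]) simp
    ultimately have r: "vdim (W \<inter> A) < vdim W" by (intro vdim_less U W) blast
    have \<tau>U: "\<tau> q \<in> W \<inter> A" if "q \<in> carrier_vec d" for q using \<tau>x[OF that] \<tau>A[OF that] by (auto simp: W_def)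
    obtain w \<psi> where w: "\<And>i. i < vdim W \<Longrightarrow> w i \<in> W" and \<psi>: "\<And>i. lin (\<psi> i)"
      and w\<psi>: "\<And>i j. i < vdim W \<Longrightarrow> j < vdim W \<Longrightarrow> \<psi> i (w j) = (if i = j then 1 else 0)"
      using subspace_basis[OF W] by metis
    obtain u \<chi> where \<chi>: "\<And>v. v \<in> W \<inter> A \<Longrightarrow> (\<Sum>i<vdim (W \<inter> A). sc (\<chi> i v) (u i)) = v"
      using subspace_basis[OF U] by metis
    have "\<forall>i. \<exists>y. i < vdim W \<longrightarrow> w i = x * y" using w by (auto simp: W_def)
    then obtain y where y: "\<And>i. i < vdim W \<Longrightarrow> w i = x * y i" by metis
    have alc: "al s k \<in> carrier_mat d n" if "s < M" "k < N" for s k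
      using al[OF that] by (simp add: intertwiners_iff[OF reg_rep P])
    have bec: "be k s \<in> carrier_mat n d" "\<And>x v. v \<in> carrier_vec d \<Longrightarrow> be k s *\<^sub>v (P x *\<^sub>v v) = reg x *\<^sub>v (be k s *\<^sub>v v)"
      if "s < M" "k < N" for s k using be[OF that] by (simp_all add: intertwiners_iff[OF P reg_rep])
    \<comment> \<open>The matrix Y records \<tau>(al(y_e)) in coordinates of the intersection, and X
      lets such elements act on p and then applies \<open>be\<close>. Since \<tau>(q) p = x q, the
      sum over s is x times \<Sum> be(al(y_e)), which for k = j is x y_e, the e-th basis vector of
      \<open>W\<close>. Only single values of \<tau> enter, so any choice of \<tau> will do.\<close>
    have "N * vdim W \<le> M * vdim (W \<inter> A)"
    proof (rule block_dim_le[where X = "\<lambda>k a s c. \<psi> a (hv (be k s *\<^sub>v (P (u c) *\<^sub>v p)))"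
          and Y = "\<lambda>s c j e. \<chi> c (\<tau> (al s j *\<^sub>v vh (y e)))"])
      fix k j a e assume k: "k < N" and j: "j < N" and a: "a < vdim W" and e: "e < vdim W"
      define g where "g s z = \<psi> a (hv (be k s *\<^sub>v (P z *\<^sub>v p)))" for s z
      have g: "lin (g s)" if s: "s < M" for s
      proof -
        have c: "be k s *\<^sub>v (P z *\<^sub>v p) \<in> carrier_vec n" for z
          by (rule mult_mat_vec_carrier[OF bec(1)[OF s k] Pp(1)])
        show ?thesis
          unfolding lin_def g_def using \<psi>[of a] c Pp(1) carrier_matD[OF bec(1)[OF s k]] carrier_vecD[OF Pp(1)]
          by (simp add: Pp(2,3) mv hv_add hv_smult lin_def)
      qed
      have ac: "al s j *\<^sub>v vh z \<in> carrier_vec d" if "s < M" for s z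
        by (rule mult_mat_vec_carrier[OF alc[OF that j] vh_carrier])
      have "(\<Sum>s<M. \<Sum>c<vdim (W \<inter> A). g s (u c) * \<chi> c (\<tau> (al s j *\<^sub>v vh (y e)))) =
          (\<Sum>s<M. g s (\<tau> (al s j *\<^sub>v vh (y e))))"
      proof (rule sum.cong[OF refl])
        fix s assume "s \<in> {..<M}"
        then have s: "s < M" by simp
        show "(\<Sum>c<vdim (W \<inter> A). g s (u c) * \<chi> c (\<tau> (al s j *\<^sub>v vh (y e)))) = g s (\<tau> (al s j *\<^sub>v vh (y e)))"
          using lin_sum_val[OF g[OF s], of "\<lambda>c. \<chi> c (\<tau> (al s j *\<^sub>v vh (y e)))" u "{..<vdim (W \<inter> A)}"]
            \<chi>[OF \<tau>U[OF ac[OF s, of "y e"]]] by (simp add: mult.commute)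
      qed
      also have "\<dots> = (\<Sum>s<M. \<psi> a (x * hv ((be k s * al s j) *\<^sub>v vh (y e))))"
      proof (rule sum.cong[OF refl])
        fix s assume "s \<in> {..<M}"
        then have s: "s < M" by simp
        have c: "(be k s * al s j) *\<^sub>v vh (y e) \<in> carrier_vec n"
          by (rule mult_mat_vec_carrier[OF mult_carrier_mat[OF bec(1)[OF s k] alc[OF s j]] vh_carrier])
        have "be k s *\<^sub>v (P (\<tau> (al s j *\<^sub>v vh (y e))) *\<^sub>v p) = be k s *\<^sub>v (P x *\<^sub>v (al s j *\<^sub>v vh (y e)))"
          by (simp only: \<tau>[OF ac[OF s]])
        also have "\<dots> = reg x *\<^sub>v ((be k s * al s j) *\<^sub>v vh (y e))"
          by (simp only: bec(2)[OF s k ac[OF s]] assoc_mult_mat_vec[OF bec(1)[OF s k] alc[OF s j] vh_carrier])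
        also have "\<dots> = vh (x * hv ((be k s * al s j) *\<^sub>v vh (y e)))"
          using reg_vh[of x "hv ((be k s * al s j) *\<^sub>v vh (y e))"] by (simp only: vh_hv[OF c])
        finally show "g s (\<tau> (al s j *\<^sub>v vh (y e))) = \<psi> a (x * hv ((be k s * al s j) *\<^sub>v vh (y e)))"
          by (simp add: g_def)
      qed
      also have "\<dots> = \<psi> a (x * hv (msum n n (\<lambda>s. be k s * al s j) M *\<^sub>v vh (y e)))"
      proof -
        have lx: "lin (\<lambda>z. \<psi> a (x * z))" by (rule lin_comp[OF \<psi>]) (intro vlin_mult2 vlin_id)
        have bac: "be k s * al s j \<in> carrier_mat n n" if "s < M" for s
          using bec(1)[OF that k] alc[OF that j] by (rule mult_carrier_mat)
        have "(\<Sum>s<M. \<psi> a (x * hv ((be k s * al s j) *\<^sub>v vh (y e)))) =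
          (\<Sum>s<M. \<Sum>m<n. ((be k s * al s j) *\<^sub>v vh (y e)) $ m * \<psi> a (x * b m))"
          by (simp only: lin_hv[OF lx])
        also have "\<dots> = (\<Sum>m<n. (\<Sum>s<M. ((be k s * al s j) *\<^sub>v vh (y e)) $ m) * \<psi> a (x * b m))"
          by (subst sum.swap) (simp only: sum_distrib_right)
        also have "\<dots> = (\<Sum>m<n. (msum n n (\<lambda>s. be k s * al s j) M *\<^sub>v vh (y e)) $ m * \<psi> a (x * b m))"
          by (rule sum.cong[OF refl]) (use msum_mv[OF bac vh_carrier] in simp)
        finally show ?thesis by (simp only: lin_hv[OF lx])
      qed
      also have "\<dots> = (if k = j \<and> a = e then 1 else 0)"
      proof -
        have "vh 0 = 0\<^sub>v n" by (intro eq_vecI) (simp_all add: vh_def lin_0[OF \<phi>_lin])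
        then have "hv (0\<^sub>v n) = 0" using hv_vh[of 0] by (simp only:)
        moreover have "\<psi> a 0 = 0" by (rule lin_0[OF \<psi>])
        ultimately show ?thesis
          using bl[OF k j] w\<psi>[OF a e] y[OF e] by (auto simp: zero_mat_mv)
      qed
      finally show "(\<Sum>s<M. \<Sum>c<vdim (W \<inter> A). \<psi> a (hv (be k s *\<^sub>v (P (u c) *\<^sub>v p))) * \<chi> c (\<tau> (al s j *\<^sub>v vh (y e)))) =
          (if k = j \<and> a = e then 1 else 0)"
        unfolding g_def .
    qed
    also have "\<dots> \<le> N * vdim (W \<inter> A)" using MN by simp
    finally have "vdim W \<le> vdim (W \<inter> A)" using MN by simp
    with r show False by simp
  qed
qed

end

section \<open>The twist of a monoidal equivalence\<close>

lemma intertwiners_carrier: "f \<in> intertwiners X Y \<Longrightarrow> f \<in> carrier_mat (rep_dim Y) (rep_dim X)"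
  by (simp add: intertwiners_def)

lemma intertwiners_comp:
  assumes X: "repd s X d" and Y: "repd s Y e" and Z: "repd s Z r"
    and f: "f \<in> intertwiners X Y" and g: "g \<in> intertwiners Y Z"
  shows "g * f \<in> intertwiners X Z"
proof -
  have f': "f \<in> carrier_mat e d" "\<And>x. f * X x = Y x * f"
    using f by (simp_all add: intertwiners_def rep_dim_eq[OF X] rep_dim_eq[OF Y])
  have g': "g \<in> carrier_mat r e" "\<And>x. g * Y x = Z x * g"
    using g by (simp_all add: intertwiners_def rep_dim_eq[OF Y] rep_dim_eq[OF Z])
  have "g * f * X x = Z x * (g * f)" for x
  proof -
    have "g * f * X x = g * (f * X x)" by (rule assoc_mult_mat[OF g'(1) f'(1) repd_carrier[OF X]])
    also have "\<dots> = g * Y x * f" unfolding f'(2) by (rule assoc_mult_mat[OF g'(1) repd_carrier[OF Y] f'(1), symmetric])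
    also have "\<dots> = Z x * (g * f)" unfolding g'(2) by (rule assoc_mult_mat[OF repd_carrier[OF Z] g'(1) f'(1)])
    finally show ?thesis .
  qed
  then show ?thesis
    using mult_carrier_mat[OF g'(1) f'(1)] by (simp add: intertwiners_def rep_dim_eq[OF X] rep_dim_eq[OF Z])
qed

lemma intertwiners_one: "repd s X d \<Longrightarrow> 1\<^sub>m d \<in> intertwiners X X"
  by (simp add: intertwiners_def rep_dim_eq repd_dims repd_carrier left_mult_one_mat[OF repd_carrier]
      right_mult_one_mat[OF repd_carrier])

lemma kron_one: "kron (1\<^sub>m a) (1\<^sub>m c) = (1\<^sub>m (a * c) :: 'k::field mat)"
  by (rule kron_eq_vecI[of _ "a * c" a c]) (auto simp: kron_mult_kronv)

lemma kron_mult: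
  fixes A :: "'k::field mat"
  assumes "A \<in> carrier_mat a a'" "A' \<in> carrier_mat a' a''" "B \<in> carrier_mat c c'" "B' \<in> carrier_mat c' c''"
  shows "kron A B * kron A' B' = kron (A * A') (B * B')"
proof (rule kron_eq_vecI[of _ "a * c" a'' c''])
  note k1 = kron_carrier[OF assms(1,3)] and k2 = kron_carrier[OF assms(2,4)]
  note m1 = mult_carrier_mat[OF assms(1,2)] and m2 = mult_carrier_mat[OF assms(3,4)]
  show "kron A B * kron A' B' \<in> carrier_mat (a * c) (a'' * c'')" by (rule mult_carrier_mat[OF k1 k2])
  show "kron (A * A') (B * B') \<in> carrier_mat (a * c) (a'' * c'')" by (rule kron_carrier[OF m1 m2])
  fix v w :: "'k vec" assume v: "v \<in> carrier_vec a''" and w: "w \<in> carrier_vec c''"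
  show "kron A B * kron A' B' *\<^sub>v kronv v w = kron (A * A') (B * B') *\<^sub>v kronv v w"
    using assms v w
    by (simp add: assoc_mult_mat_vec[OF k1 k2 kronv_carrier[OF v w]] kron_mult_kronv
        assoc_mult_mat_vec[OF assms(1,2) v] assoc_mult_mat_vec[OF assms(3,4) w])
qed

context coord_hopf
begin

lemma kron_intertwiner:
  assumes X: "rep X d" and Y: "rep Y e" and X': "rep X' d'" and Y': "rep Y' e'"
    and f: "f \<in> intertwiners X X'" and g: "g \<in> intertwiners Y Y'"
  shows "kron f g \<in> intertwiners (tens X Y) (tens X' Y')"
proof -
  have f': "f \<in> carrier_mat d' d" "\<And>x v. v \<in> carrier_vec d \<Longrightarrow> f *\<^sub>v (X x *\<^sub>v v) = X' x *\<^sub>v (f *\<^sub>v v)"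
    using f by (simp_all add: intertwiners_iff[OF X X'])
  have g': "g \<in> carrier_mat e' e" "\<And>x v. v \<in> carrier_vec e \<Longrightarrow> g *\<^sub>v (Y x *\<^sub>v v) = Y' x *\<^sub>v (g *\<^sub>v v)"
    using g by (simp_all add: intertwiners_iff[OF Y Y'])
  note k = kron_carrier[OF f'(1) g'(1)] and t = tens_carrier[OF X Y] and t' = tens_carrier[OF X' Y']
  have "kron f g * tens X Y x = tens X' Y' x * kron f g" for x
  proof (rule kron_eq_vecI[of _ "d' * e'" d e])
    show "kron f g * tens X Y x \<in> carrier_mat (d' * e') (d * e)" by (rule mult_carrier_mat[OF k t])
    show "tens X' Y' x * kron f g \<in> carrier_mat (d' * e') (d * e)" by (rule mult_carrier_mat[OF t' k])
    fix v w :: "'k vec" assume v: "v \<in> carrier_vec d" and w: "w \<in> carrier_vec e"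
    have fv: "f *\<^sub>v v \<in> carrier_vec d'" and gw: "g *\<^sub>v w \<in> carrier_vec e'"
      using f'(1) g'(1) v w by (auto intro: mult_mat_vec_carrier)
    have kc: "kronv (X a *\<^sub>v v) (Y c *\<^sub>v w) \<in> carrier_vec (d * e)" for a c
      by (intro kronv_carrier repd_vec(1)[OF X v] repd_vec(1)[OF Y w])
    have kfg: "kron f g *\<^sub>v kronv v' w' = kronv (f *\<^sub>v v') (g *\<^sub>v w')"
      if "v' \<in> carrier_vec d" "w' \<in> carrier_vec e" for v' w'
      using that f'(1) g'(1) by (intro kron_mult_kronv) simp_all
    have "kron f g * tens X Y x *\<^sub>v kronv v w = vsum (d' * e') (\<Delta> x) (\<lambda>a c. kronv (X' a *\<^sub>v (f *\<^sub>v v)) (Y' c *\<^sub>v (g *\<^sub>v w)))"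
      unfolding assoc_mult_mat_vec[OF k t kronv_carrier[OF v w]] tens_kronv[OF X Y v w] mult_vsum[OF k kc]
      by (simp only: kfg[OF repd_vec(1)[OF X v] repd_vec(1)[OF Y w]] f'(2)[OF v] g'(2)[OF w])
    also have "\<dots> = tens X' Y' x * kron f g *\<^sub>v kronv v w"
      unfolding assoc_mult_mat_vec[OF t' k kronv_carrier[OF v w]] kfg[OF v w] tens_kronv[OF X' Y' fv gw] ..
    finally show "kron f g * tens X Y x *\<^sub>v kronv v w = tens X' Y' x * kron f g *\<^sub>v kronv v w" .
  qed
  then show ?thesis
    using k by (simp add: intertwiners_def rep_dim_eq[OF tens_rep[OF X Y]] rep_dim_eq[OF tens_rep[OF X' Y']])
qed

text \<open>Injections and projections form mutually inverse block matrices, which bounds N from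
  both sides.\<close>

lemma powiso_dim:
  assumes "powiso X N Y e M i q"
  shows "N = M * e"
proof (rule antisym)
  have X: "rep X N" and Y: "rep Y e" using assms by (simp_all add: powiso_def)
  have i: "i k \<in> carrier_mat N e" and q: "q k \<in> carrier_mat e N" if "k < M" for k
    using assms that intertwiners_carrier by (auto simp: powiso_def rep_dim_eq[OF X] rep_dim_eq[OF Y] dest!: intertwiners_carrier)
  have qi: "q k * i l = (if k = l then 1\<^sub>m e else 0\<^sub>m e e)" if "k < M" "l < M" for k l
    using assms that by (simp add: powiso_def)
  have iq: "msum N N (\<lambda>k. i k * q k) M = 1\<^sub>m N" using assms by (simp add: powiso_def)
  have "1 * N \<le> M * e"
  proof (rule block_dim_le[where X = "\<lambda>k a s c. i s $$ (a, c)" and Y = "\<lambda>s c l b. q s $$ (c, b)"])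
    fix k l a c :: nat assume *: "k < 1" "l < 1" "a < N" "c < N"
    have "(\<Sum>s<M. \<Sum>t<e. i s $$ (a, t) * q s $$ (t, c)) = (\<Sum>s<M. (i s * q s) $$ (a, c))"
    proof (rule sum.cong[OF refl])
      fix s assume "s \<in> {..<M}"
      then show "(\<Sum>t<e. i s $$ (a, t) * q s $$ (t, c)) = (i s * q s) $$ (a, c)"
        using * i[of s] q[of s] by (simp add: scalar_prod_def atLeast0LessThan)
    qed
    also have "\<dots> = msum N N (\<lambda>k. i k * q k) M $$ (a, c)" using * by (simp add: msum_def)
    finally show "(\<Sum>s<M. \<Sum>t<e. i s $$ (a, t) * q s $$ (t, c)) = (if k = l \<and> a = c then 1 else 0)"
      using * by (simp add: iq)
  qed
  then show "N \<le> M * e" by simp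
  have "M * e \<le> 1 * N"
  proof (rule block_dim_le[where X = "\<lambda>k a s c. q k $$ (a, c)" and Y = "\<lambda>s c l b. i l $$ (c, b)"])
    fix k l a c assume *: "k < M" "l < M" "a < e" "c < e"
    have "(\<Sum>s<1::nat. \<Sum>t<N. q k $$ (a, t) * i l $$ (t, c)) = (q k * i l) $$ (a, c)"
      using * q[of k] i[of l] by (simp add: scalar_prod_def atLeast0LessThan)
    then show "(\<Sum>s<1::nat. \<Sum>t<N. q k $$ (a, t) * i l $$ (t, c)) = (if k = l \<and> a = c then 1 else 0)"
      using * by (simp add: qi)
  qed
  then show "M * e \<le> N" by simp
qed

lemma msum_mult:
  assumes "B \<in> carrier_mat c e" "\<And>k. k < M \<Longrightarrow> f k \<in> carrier_mat r c"
  shows "msum r c f M * B = msum r e (\<lambda>k. f k * B) M"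
  using assms(2)
proof (induction M)
  case 0
  then show ?case using assms(1) by (simp add: msum_0)
next
  case (Suc M)
  then have "msum r c f (Suc M) * B = msum r c f M * B + f M * B"
    using assms(1) by (simp add: msum_Suc add_mult_distrib_mat[of _ r c _ _ e])
  then show ?case using Suc assms(1) by (simp add: msum_Suc mult_carrier_mat[of _ r c])
qed

lemma powiso_iso:
  assumes p: "powiso X N Y e M i q" and X': "rep X' N'"
    and s: "s \<in> intertwiners X X'" and t: "t \<in> intertwiners X' X" and st: "s * t = 1\<^sub>m N'" and ts: "t * s = 1\<^sub>m N"
  shows "powiso X' N' Y e M (\<lambda>k. s * i k) (\<lambda>k. q k * t)"
proof -
  have X: "rep X N" and Y: "rep Y e" using p by (simp_all add: powiso_def)
  have i: "i k \<in> intertwiners Y X" and q: "q k \<in> intertwiners X Y" if "k < M" for k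
    using p that by (simp_all add: powiso_def)
  have ic: "i k \<in> carrier_mat N e" and qc: "q k \<in> carrier_mat e N" if "k < M" for k
    using intertwiners_carrier[OF i[OF that]] intertwiners_carrier[OF q[OF that]] by (simp_all add: rep_dim_eq[OF X] rep_dim_eq[OF Y])
  have sc: "s \<in> carrier_mat N' N" and tc: "t \<in> carrier_mat N N'"
    using intertwiners_carrier[OF s] intertwiners_carrier[OF t] by (simp_all add: rep_dim_eq[OF X] rep_dim_eq[OF X'])
  have qi: "q k * i l = (if k = l then 1\<^sub>m e else 0\<^sub>m e e)" if "k < M" "l < M" for k l
    using p that by (simp add: powiso_def)
  have iq: "msum N N (\<lambda>k. i k * q k) M = 1\<^sub>m N" using p by (simp add: powiso_def)
  show ?thesis
    unfolding powiso_def
  proof (intro conjI allI impI)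
    fix k assume k: "k < M"
    show "s * i k \<in> intertwiners Y X'" by (rule intertwiners_comp[OF Y X X' i[OF k] s])
    show "q k * t \<in> intertwiners X' Y" by (rule intertwiners_comp[OF X' X Y t q[OF k]])
    fix l assume l: "l < M"
    have "q k * t * (s * i l) = q k * (t * s) * i l"
      using assoc_mult_mat[OF qc[OF k] tc mult_carrier_mat[OF sc ic[OF l]]] assoc_mult_mat[OF tc sc ic[OF l]]
        assoc_mult_mat[OF qc[OF k] mult_carrier_mat[OF tc sc] ic[OF l]] by simp
    then show "q k * t * (s * i l) = (if k = l then 1\<^sub>m e else 0\<^sub>m e e)"
      using qi[OF k l] right_mult_one_mat[OF qc[OF k]] by (simp add: ts)
  next
    have c: "i k * q k \<in> carrier_mat N N" if "k < M" for k using ic[OF that] qc[OF that] by (rule mult_carrier_mat)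
    have "msum N' N' (\<lambda>k. s * i k * (q k * t)) M = msum N' N' (\<lambda>k. (s * (i k * q k)) * t) M"
    proof (rule msum_cong)
      fix k assume k: "k < M"
      show "s * i k * (q k * t) = (s * (i k * q k)) * t"
        using assoc_mult_mat[OF mult_carrier_mat[OF sc ic[OF k]] qc[OF k] tc] assoc_mult_mat[OF sc ic[OF k] qc[OF k]] by simp
    qed
    also have "\<dots> = s * msum N N (\<lambda>k. i k * q k) M * t"
      using msum_mult[OF tc mult_carrier_mat[OF sc c]] mult_msum[OF sc c] by simp
    also have "\<dots> = 1\<^sub>m N'" using right_mult_one_mat[OF sc] by (simp add: iq st)
    finally show "msum N' N' (\<lambda>k. s * i k * (q k * t)) M = 1\<^sub>m N'" .
  qed (rule X' Y)+
qed

end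

section \<open>Full faithfulness and direct sums under a linear equivalence\<close>

locale rep_equivalence =
  H: coord_hopf H n b \<phi> + K: coord_hopf K n' b' \<phi>'
  for H :: "('k::field, 'h::ring_1) hopf" and n b \<phi> and K :: "('k, 'l::ring_1) hopf" and n' b' \<phi>' +
  fixes F Fm G Gm \<eta> \<theta> J u \<Lambda>\<^sub>H l\<^sub>H \<Lambda>\<^sub>K l\<^sub>K
  assumes lf: "linear_functor (Rep H) (Rep K) F Fm"
    and lg: "linear_functor (Rep K) (Rep H) G Gm"
    and ni_\<eta>: "natural_iso (Rep H) (Rep H) (\<lambda>X. X) (\<lambda>X Y f. f)
          (\<lambda>X. G (F X)) (\<lambda>X Y f. Gm (F X) (F Y) (Fm X Y f)) \<eta>"
    and ni_\<theta>: "natural_iso (Rep K) (Rep K) (\<lambda>X. F (G X)) (\<lambda>X Y f. Fm (G X) (G Y) (Gm X Y f))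
          (\<lambda>X. X) (\<lambda>X Y f. f) \<theta>"
    and ms: "monoidal_structure (Rep H) (Rep K) F Fm J u"
    and int_H: "normalized_integrals H \<Lambda>\<^sub>H l\<^sub>H" and int_K: "normalized_integrals K \<Lambda>\<^sub>K l\<^sub>K"
begin

abbreviation "objH \<equiv> representation_of H"
abbreviation "objK \<equiv> representation_of K"

lemma objH: "H.rep X d \<Longrightarrow> objH X" and objK: "K.rep Y e \<Longrightarrow> objK Y"
  by (auto simp: representation_of_iff)

lemma repH: "objH X \<Longrightarrow> H.rep X (rep_dim X)" and repK: "objK Y \<Longrightarrow> K.rep Y (rep_dim Y)"
  by (auto simp: representation_of_iff rep_dim_eq)

lemma F_obj: "objH X \<Longrightarrow> objK (F X)" and G_obj: "objK Y \<Longrightarrow> objH (G Y)"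
  using lf lg by (simp_all add: linear_functor_def Rep_def)

lemma F_rep: "objH X \<Longrightarrow> K.rep (F X) (rep_dim (F X))"
  by (intro repK F_obj)

lemma F_hom: "objH X \<Longrightarrow> objH Y \<Longrightarrow> f \<in> intertwiners X Y \<Longrightarrow> Fm X Y f \<in> intertwiners (F X) (F Y)"
  and F_id: "objH X \<Longrightarrow> Fm X X (1\<^sub>m (rep_dim X)) = 1\<^sub>m (rep_dim (F X))"
  and F_comp: "objH X \<Longrightarrow> objH Y \<Longrightarrow> objH Z \<Longrightarrow> f \<in> intertwiners X Y \<Longrightarrow> g \<in> intertwiners Y Z \<Longrightarrow>
      Fm X Z (g * f) = Fm Y Z g * Fm X Y f"
  and F_add: "objH X \<Longrightarrow> objH Y \<Longrightarrow> f \<in> intertwiners X Y \<Longrightarrow> f' \<in> intertwiners X Y \<Longrightarrow>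
      Fm X Y (f + f') = Fm X Y f + Fm X Y f'"
  and F_scale: "objH X \<Longrightarrow> objH Y \<Longrightarrow> f \<in> intertwiners X Y \<Longrightarrow> Fm X Y (c \<cdot>\<^sub>m f) = c \<cdot>\<^sub>m Fm X Y f"
  using lf by (simp_all add: linear_functor_def Rep_def)

lemma G_hom: "objK X \<Longrightarrow> objK Y \<Longrightarrow> f \<in> intertwiners X Y \<Longrightarrow> Gm X Y f \<in> intertwiners (G X) (G Y)"
  using lg by (simp add: linear_functor_def Rep_def)

lemma \<eta>_iso: "objH X \<Longrightarrow> \<eta> X \<in> intertwiners X (G (F X)) \<and> (\<exists>e \<in> intertwiners (G (F X)) X.
     e * \<eta> X = 1\<^sub>m (rep_dim X) \<and> \<eta> X * e = 1\<^sub>m (rep_dim (G (F X))))"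
  and \<eta>_nat: "objH X \<Longrightarrow> objH Y \<Longrightarrow> f \<in> intertwiners X Y \<Longrightarrow> \<eta> Y * f = Gm (F X) (F Y) (Fm X Y f) * \<eta> X"
  using ni_\<eta> by (simp_all add: natural_iso_def Rep_def iso_in_def)

lemma \<theta>_iso: "objK X \<Longrightarrow> \<theta> X \<in> intertwiners (F (G X)) X \<and> (\<exists>e \<in> intertwiners X (F (G X)).
     e * \<theta> X = 1\<^sub>m (rep_dim (F (G X))) \<and> \<theta> X * e = 1\<^sub>m (rep_dim X))"
  and \<theta>_nat: "objK X \<Longrightarrow> objK Y \<Longrightarrow> f \<in> intertwiners X Y \<Longrightarrow> \<theta> Y * Fm (G X) (G Y) (Gm X Y f) = f * \<theta> X"
  using ni_\<theta> by (simp_all add: natural_iso_def Rep_def iso_in_def)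

lemma F_faithful:
  assumes X: "objH X" and Y: "objH Y" and f: "f \<in> intertwiners X Y" and g: "g \<in> intertwiners X Y"
    and eq: "Fm X Y f = Fm X Y g"
  shows "f = g"
proof -
  obtain e where e: "e \<in> intertwiners (G (F Y)) Y" "e * \<eta> Y = 1\<^sub>m (rep_dim Y)" and \<eta>: "\<eta> Y \<in> intertwiners Y (G (F Y))"
    using \<eta>_iso[OF Y] by blast
  note ec = intertwiners_carrier[OF e(1)] and \<eta>c = intertwiners_carrier[OF \<eta>]
  have "h = e * (\<eta> Y * h)" if "h \<in> intertwiners X Y" for h
    using assoc_mult_mat[OF ec \<eta>c intertwiners_carrier[OF that]] left_mult_one_mat[OF intertwiners_carrier[OF that]]
    by (simp add: e(2))
  then show ?thesis using f g eq \<eta>_nat[OF X Y f] \<eta>_nat[OF X Y g] by metis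
qed

text \<open>Naturality of \<eta> forces the candidate f and yields G(F f) = G h. Naturality of
  \<theta> then removes G, since \<theta> is invertible.\<close>

lemma F_full:
  assumes X: "objH X" and Y: "objH Y" and h: "h \<in> intertwiners (F X) (F Y)"
  shows "\<exists>f \<in> intertwiners X Y. Fm X Y f = h"
proof -
  note FX = F_obj[OF X] and FY = F_obj[OF Y]
  note GX = G_obj[OF FX] and GY = G_obj[OF FY]
  obtain e where e: "e \<in> intertwiners (G (F Y)) Y" "\<eta> Y * e = 1\<^sub>m (rep_dim (G (F Y)))"
    using \<eta>_iso[OF Y] by blast
  obtain e' where e': "e' \<in> intertwiners (G (F X)) X" "\<eta> X * e' = 1\<^sub>m (rep_dim (G (F X)))"
    using \<eta>_iso[OF X] by blast
  have \<eta>X: "\<eta> X \<in> intertwiners X (G (F X))" and \<eta>Y: "\<eta> Y \<in> intertwiners Y (G (F Y))"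
    using \<eta>_iso X Y by blast+
  note Gh = G_hom[OF FX FY h]
  define f where "f = e * (Gm (F X) (F Y) h * \<eta> X)"
  have f: "f \<in> intertwiners X Y"
    unfolding f_def
    by (intro intertwiners_comp[OF repH[OF X] repH[OF GY] repH[OF Y]] e
        intertwiners_comp[OF repH[OF X] repH[OF GX] repH[OF GY]] \<eta>X Gh)
  note c = intertwiners_carrier[OF e(1)] intertwiners_carrier[OF e'(1)] intertwiners_carrier[OF \<eta>X]
    intertwiners_carrier[OF \<eta>Y] intertwiners_carrier[OF Gh]
  have Ff: "Fm X Y f \<in> intertwiners (F X) (F Y)" by (rule F_hom[OF X Y f])
  note GFf = G_hom[OF FX FY Ff]
  have "Gm (F X) (F Y) (Fm X Y f) * \<eta> X = \<eta> Y * (e * (Gm (F X) (F Y) h * \<eta> X))"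
    using \<eta>_nat[OF X Y f] by (simp add: f_def)
  also have "\<dots> = Gm (F X) (F Y) h * \<eta> X"
    using assoc_mult_mat[OF c(4) c(1) mult_carrier_mat[OF c(5) c(3)]] left_mult_one_mat[OF mult_carrier_mat[OF c(5) c(3)]]
    by (simp add: e(2))
  finally have "Gm (F X) (F Y) (Fm X Y f) * \<eta> X * e' = Gm (F X) (F Y) h * \<eta> X * e'" by simp
  then have GG: "Gm (F X) (F Y) (Fm X Y f) = Gm (F X) (F Y) h"
    using assoc_mult_mat[OF intertwiners_carrier[OF GFf] c(3) c(2)] assoc_mult_mat[OF c(5) c(3) c(2)]
      right_mult_one_mat[OF c(5)] right_mult_one_mat[OF intertwiners_carrier[OF GFf]] by (simp add: e'(2))
  obtain t where t: "t \<in> intertwiners (F X) (F (G (F X)))" "\<theta> (F X) * t = 1\<^sub>m (rep_dim (F X))"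
    and \<theta>: "\<theta> (F X) \<in> intertwiners (F (G (F X))) (F X)"
    using \<theta>_iso[OF FX] by blast
  note tc = intertwiners_carrier[OF t(1)] and \<theta>c = intertwiners_carrier[OF \<theta>]
  have "k = (k * \<theta> (F X)) * t" if "k \<in> intertwiners (F X) (F Y)" for k
    using assoc_mult_mat[OF intertwiners_carrier[OF that] \<theta>c tc] right_mult_one_mat[OF intertwiners_carrier[OF that]]
    by (simp add: t(2))
  then have "Fm X Y f = h" using \<theta>_nat[OF FX FY h] \<theta>_nat[OF FX FY Ff] GG Ff h by metis
  then show ?thesis using f by blast
qed

lemma F_zero: "objH X \<Longrightarrow> objH Y \<Longrightarrow> Fm X Y (0\<^sub>m (rep_dim Y) (rep_dim X)) = 0\<^sub>m (rep_dim (F Y)) (rep_dim (F X))"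
proof -
  assume X: "objH X" and Y: "objH Y"
  have z: "0\<^sub>m (rep_dim Y) (rep_dim X) \<in> intertwiners X Y"
    using repd_carrier[OF repH[OF X]] repd_carrier[OF repH[OF Y]]
    by (simp add: intertwiners_def left_mult_zero_mat[OF repd_carrier[OF repH[OF X]]] right_mult_zero_mat[OF repd_carrier[OF repH[OF Y]]])
  have s: "0 \<cdot>\<^sub>m A = 0\<^sub>m r c" if "A \<in> carrier_mat r c" for A :: "'k mat" and r c
    using that by (intro eq_matI) auto
  have "Fm X Y (0 \<cdot>\<^sub>m 0\<^sub>m (rep_dim Y) (rep_dim X)) = 0 \<cdot>\<^sub>m Fm X Y (0\<^sub>m (rep_dim Y) (rep_dim X))"
    by (rule F_scale[OF X Y z])
  then show ?thesis by (simp add: s s[OF intertwiners_carrier[OF F_hom[OF X Y z]]])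
qed

lemma msum_intertwiner:
  assumes X: "objH X" and Y: "objH Y" and f: "\<And>k. k < M \<Longrightarrow> f k \<in> intertwiners X Y"
  shows "msum (rep_dim Y) (rep_dim X) f M \<in> intertwiners X Y \<and>
    Fm X Y (msum (rep_dim Y) (rep_dim X) f M) = msum (rep_dim (F Y)) (rep_dim (F X)) (\<lambda>k. Fm X Y (f k)) M"
  using f
proof (induction M)
  case 0
  show ?case
    using F_zero[OF X Y] by (simp add: msum_0 intertwiners_def left_mult_zero_mat[OF repd_carrier[OF repH[OF X]]]
        right_mult_zero_mat[OF repd_carrier[OF repH[OF Y]]])
next
  case (Suc M)
  have fM: "f M \<in> intertwiners X Y" using Suc by simp
  have IH: "msum (rep_dim Y) (rep_dim X) f M \<in> intertwiners X Y" using Suc by simp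
  have add: "A + B \<in> intertwiners X Y" if A: "A \<in> intertwiners X Y" and B: "B \<in> intertwiners X Y" for A B
    using that add_mult_distrib_mat[OF intertwiners_carrier[OF A] intertwiners_carrier[OF B] repd_carrier[OF repH[OF X]]]
      mult_add_distrib_mat[OF repd_carrier[OF repH[OF Y]] intertwiners_carrier[OF A] intertwiners_carrier[OF B]]
    by (simp add: intertwiners_def)
  show ?case
    using Suc F_add[OF X Y IH fM] add[OF IH fM]
    by (simp add: msum_Suc intertwiners_carrier[OF fM] intertwiners_carrier[OF F_hom[OF X Y fM]])
qed

text \<open>The equations that characterise a finite direct sum involve only composition, sums,
  identities and zero maps, all of which a linear functor preserves.\<close>

lemma F_powiso:
  assumes p: "H.powiso X N Y e M i q"
  shows "K.powiso (F X) (rep_dim (F X)) (F Y) (rep_dim (F Y)) M (\<lambda>k. Fm Y X (i k)) (\<lambda>k. Fm X Y (q k))"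
proof -
  have X': "H.rep X N" and Y': "H.rep Y e" using p by (simp_all add: H.powiso_def)
  note X = objH[OF X'] and Y = objH[OF Y'] and dX = rep_dim_eq[OF X'] and dY = rep_dim_eq[OF Y']
  have i: "i k \<in> intertwiners Y X" and q: "q k \<in> intertwiners X Y" if "k < M" for k
    using p that by (simp_all add: H.powiso_def)
  have iq: "i k * q k \<in> intertwiners X X" if "k < M" for k
    by (rule intertwiners_comp[OF X' Y' X' q[OF that] i[OF that]])
  show ?thesis
    unfolding K.powiso_def
  proof (intro conjI allI impI)
    fix k l assume k: "k < M" and l: "l < M"
    have "Fm X Y (q k) * Fm Y X (i l) = Fm Y Y (q k * i l)"
      by (rule F_comp[OF Y X Y i[OF l] q[OF k], symmetric])
    also have "q k * i l = (if k = l then 1\<^sub>m e else 0\<^sub>m e e)" using p k l by (simp add: H.powiso_def)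
    finally show "Fm X Y (q k) * Fm Y X (i l) = (if k = l then 1\<^sub>m (rep_dim (F Y)) else 0\<^sub>m (rep_dim (F Y)) (rep_dim (F Y)))"
      using F_id[OF Y] F_zero[OF Y Y] by (simp add: dY)
  next
    have "msum (rep_dim (F X)) (rep_dim (F X)) (\<lambda>k. Fm Y X (i k) * Fm X Y (q k)) M =
      msum (rep_dim (F X)) (rep_dim (F X)) (\<lambda>k. Fm X X (i k * q k)) M"
      by (rule msum_cong) (simp add: F_comp[OF X Y X q i])
    also have "\<dots> = Fm X X (msum (rep_dim X) (rep_dim X) (\<lambda>k. i k * q k) M)"
      using msum_intertwiner[OF X X iq] by simp
    also have "msum (rep_dim X) (rep_dim X) (\<lambda>k. i k * q k) M = 1\<^sub>m (rep_dim X)"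
      using p by (simp add: H.powiso_def dX)
    finally show "msum (rep_dim (F X)) (rep_dim (F X)) (\<lambda>k. Fm Y X (i k) * Fm X Y (q k)) M = 1\<^sub>m (rep_dim (F X))"
      by (simp add: F_id[OF X])
  qed (use F_rep[OF X] F_rep[OF Y] F_hom[OF Y X i] F_hom[OF X Y q] in auto)
qed

lemma J_iso: "objH X \<Longrightarrow> objH Y \<Longrightarrow> J X Y \<in> intertwiners (K.tens (F X) (F Y)) (F (H.tens X Y)) \<and>
    (\<exists>e \<in> intertwiners (F (H.tens X Y)) (K.tens (F X) (F Y)).
      e * J X Y = 1\<^sub>m (rep_dim (K.tens (F X) (F Y))) \<and> J X Y * e = 1\<^sub>m (rep_dim (F (H.tens X Y))))"
  and J_nat: "objH X \<Longrightarrow> objH Y \<Longrightarrow> objH X' \<Longrightarrow> objH Y' \<Longrightarrow> f \<in> intertwiners X X' \<Longrightarrow> g \<in> intertwiners Y Y' \<Longrightarrow>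
    Fm (H.tens X Y) (H.tens X' Y') (kron f g) * J X Y = J X' Y' * kron (Fm X X' f) (Fm Y Y' g)"
  and u_iso: "u \<in> intertwiners K.triv (F H.triv) \<and> (\<exists>e \<in> intertwiners (F H.triv) K.triv.
      e * u = 1\<^sub>m (rep_dim K.triv) \<and> u * e = 1\<^sub>m (rep_dim (F H.triv)))"
  using ms by (simp_all add: monoidal_structure_def Rep_def iso_in_def)

lemma J_hexagon: "objH X \<Longrightarrow> objH Y \<Longrightarrow> objH Z \<Longrightarrow>
    Fm (H.tens (H.tens X Y) Z) (H.tens X (H.tens Y Z)) (1\<^sub>m (rep_dim X * rep_dim Y * rep_dim Z)) *
      (J (H.tens X Y) Z * kron (J X Y) (1\<^sub>m (rep_dim (F Z)))) =
    J X (H.tens Y Z) * (kron (1\<^sub>m (rep_dim (F X))) (J Y Z) * 1\<^sub>m (rep_dim (F X) * rep_dim (F Y) * rep_dim (F Z)))"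
  and J_unit_left: "objH X \<Longrightarrow> Fm (H.tens H.triv X) X (1\<^sub>m (rep_dim X)) *
      (J H.triv X * kron u (1\<^sub>m (rep_dim (F X)))) = 1\<^sub>m (rep_dim (F X))"
  and J_unit_right: "objH X \<Longrightarrow> Fm (H.tens X H.triv) X (1\<^sub>m (rep_dim X)) *
      (J X H.triv * kron (1\<^sub>m (rep_dim (F X))) u) = 1\<^sub>m (rep_dim (F X))"
  using ms by (simp_all add: monoidal_structure_def Rep_def)

end

text \<open>Induction on k for the truncation of v to its first k coordinates.\<close>

lemma vec_lin_expand:
  fixes f :: "'k::field vec \<Rightarrow> 'k"
  assumes add: "\<And>v w. v \<in> carrier_vec m \<Longrightarrow> w \<in> carrier_vec m \<Longrightarrow> f (v + w) = f v + f w"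
    and smult: "\<And>c v. v \<in> carrier_vec m \<Longrightarrow> f (c \<cdot>\<^sub>v v) = c * f v" and v: "v \<in> carrier_vec m"
  shows "f v = (\<Sum>a<m. v $ a * f (unit_vec m a))"
proof -
  have "f (vec m (\<lambda>i. if i < k then v $ i else 0)) = (\<Sum>a<k. v $ a * f (unit_vec m a))" if "k \<le> m" for k
    using that
  proof (induction k)
    case 0
    have "vec m (\<lambda>i. if i < 0 then v $ i else 0) = 0 \<cdot>\<^sub>v unit_vec m 0" by (intro eq_vecI) auto
    then have "f (vec m (\<lambda>i. if i < 0 then v $ i else 0)) = 0 * f (unit_vec m 0)"
      using smult[of "unit_vec m 0" 0] by simp
    then show ?case by simp
  next
    case (Suc k)
    have "vec m (\<lambda>i. if i < Suc k then v $ i else 0) = vec m (\<lambda>i. if i < k then v $ i else 0) + v $ k \<cdot>\<^sub>v unit_vec m k"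
      using Suc by (intro eq_vecI) (auto simp: less_Suc_eq)
    then show ?case using Suc add smult by simp
  qed
  from this[OF order_refl] have "f (vec m (\<lambda>i. if i < m then v $ i else 0)) = (\<Sum>a<m. v $ a * f (unit_vec m a))" .
  moreover have "vec m (\<lambda>i. if i < m then v $ i else 0) = v" using v by (intro eq_vecI) auto
  ultimately show ?thesis by simp
qed

context coord_hopf
begin

text \<open>In the class \<open>ring_1\<close> the elements 0 and 1 differ, so the basis is not
  empty. This permits cancelling the dimension in the counts below.\<close>

lemma n_pos: "0 < n"
proof (rule ccontr)
  assume "\<not> 0 < n"
  then have "(1::'h) = 0" using basis_eq[of 1] by simp
  then show False by simp
qed

lemma rv_add:
  assumes \<rho>: "rep \<rho> d" and "v \<in> carrier_vec d" "w \<in> carrier_vec d"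
  shows "rv \<rho> d (v + w) = rv \<rho> d v + rv \<rho> d w"
  using assms(2-) repd_dims[OF \<rho>] carrier_matD[OF rv_carrier]
  by (intro mat_eq_vhI[of _ d]) (simp_all add: mv_add_mat rv_vh[OF \<rho>] mv_add)

lemma rv_smult:
  assumes \<rho>: "rep \<rho> d" and "v \<in> carrier_vec d"
  shows "rv \<rho> d (c \<cdot>\<^sub>v v) = c \<cdot>\<^sub>m rv \<rho> d v"
  using assms(2-) repd_dims[OF \<rho>] carrier_matD[OF rv_carrier]
  by (intro mat_eq_vhI[of _ d]) (simp_all add: mv_smult_mat rv_vh[OF \<rho>] mv_smult)

text \<open>Two decompositions of the same module are compared. The blocks \<open>q k * i' s\<close>
  and \<open>q' s * i j\<close> form inverse matrices because \<Sum> i' q' = 1.\<close>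

lemma powiso_pair:
  assumes p: "powiso X N Y e M i q" and p': "powiso X N Z r M' i' q'" and k: "k < M" and j: "j < M"
  shows "msum e e (\<lambda>s. (q k * i' s) * (q' s * i j)) M' = (if k = j then 1\<^sub>m e else 0\<^sub>m e e)"
proof -
  have X: "rep X N" and Y: "rep Y e" and Z: "rep Z r" using p p' by (simp_all add: powiso_def)
  have ic: "i k \<in> carrier_mat N e" and qc: "q k \<in> carrier_mat e N" if "k < M" for k
    using p that by (auto simp: powiso_def rep_dim_eq[OF X] rep_dim_eq[OF Y] dest!: intertwiners_carrier)
  have ic': "i' k \<in> carrier_mat N r" and qc': "q' k \<in> carrier_mat r N" if "k < M'" for k
    using p' that by (auto simp: powiso_def rep_dim_eq[OF X] rep_dim_eq[OF Z] dest!: intertwiners_carrier)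
  have c: "i' s * q' s \<in> carrier_mat N N" if "s < M'" for s using ic'[OF that] qc'[OF that] by (rule mult_carrier_mat)
  have "msum e e (\<lambda>s. (q k * i' s) * (q' s * i j)) M' = msum e e (\<lambda>s. (q k * (i' s * q' s)) * i j) M'"
  proof (rule msum_cong)
    fix s assume s: "s < M'"
    show "(q k * i' s) * (q' s * i j) = (q k * (i' s * q' s)) * i j"
      using assoc_mult_mat[OF mult_carrier_mat[OF qc[OF k] ic'[OF s]] qc'[OF s] ic[OF j]] assoc_mult_mat[OF qc[OF k] ic'[OF s] qc'[OF s]]
      by simp
  qed
  also have "\<dots> = q k * msum N N (\<lambda>s. i' s * q' s) M' * i j"
    using msum_mult[OF ic[OF j] mult_carrier_mat[OF qc[OF k] c]] mult_msum[OF qc[OF k] c] by simp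
  also have "\<dots> = q k * i j" using p' right_mult_one_mat[OF qc[OF k]] by (simp add: powiso_def)
  finally show ?thesis using p k j by (simp add: powiso_def)
qed

end

section \<open>The image of the regular module is free of rank one\<close>

context rep_equivalence
begin

abbreviation "P \<equiv> F H.reg"
abbreviation "V0 \<equiv> G K.reg"

lemma regH: "objH H.reg" and regK: "objK K.reg" and P_obj: "objK P" and V0_obj: "objH V0"
  using objH[OF H.reg_rep] objK[OF K.reg_rep] F_obj G_obj by blast+

lemma P_rep: "K.rep P (rep_dim P)" and V0_rep: "H.rep V0 (rep_dim V0)"
  using repK[OF P_obj] repH[OF V0_obj] by blast+

lemma dim_P_pos: "0 < rep_dim P"
proof (rule ccontr)
  assume "\<not> 0 < rep_dim P"
  then have "Fm H.reg H.reg (1\<^sub>m n) = Fm H.reg H.reg (0\<^sub>m n n)"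
    using F_id[OF regH] F_zero[OF regH regH] by (auto simp: rep_dim_eq[OF H.reg_rep] intro!: eq_matI)
  moreover have "0\<^sub>m n n \<in> intertwiners H.reg H.reg"
    by (simp add: intertwiners_def rep_dim_eq[OF H.reg_rep] left_mult_zero_mat[OF H.reg_carrier] right_mult_zero_mat[OF H.reg_carrier])
  ultimately have "(1\<^sub>m n :: 'k mat) = 0\<^sub>m n n"
    using F_faithful[OF regH regH intertwiners_one[OF H.reg_rep]] by blast
  then have "(1\<^sub>m n :: 'k mat) $$ (0, 0) = 0\<^sub>m n n $$ (0, 0)" by simp
  then show False using H.n_pos by simp
qed

text \<open>The module F(H \<otimes> V0) is decomposed twice. H \<otimes> V0 is a sum of copies of
  H, which the functor turns into dim V0 copies of P; through J and \<theta> the module is also P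
  \<otimes> K, a sum of dim P copies of K. The blocks compare the two decompositions.\<close>

lemma exchange_system:
  "\<exists>al be. (\<forall>s<n'. \<forall>k<rep_dim P. al s k \<in> intertwiners K.reg P) \<and>
    (\<forall>s<n'. \<forall>k<rep_dim P. be k s \<in> intertwiners P K.reg) \<and>
    (\<forall>k<rep_dim P. \<forall>j<rep_dim P. msum n' n' (\<lambda>s. be k s * al s j) n' = (if k = j then 1\<^sub>m n' else 0\<^sub>m n' n')) \<and>
    (\<forall>s<n'. \<forall>t<n'. msum (rep_dim P) (rep_dim P) (\<lambda>k. al s k * be k t) (rep_dim P) =
       (if s = t then 1\<^sub>m (rep_dim P) else 0\<^sub>m (rep_dim P) (rep_dim P))) \<and>
    rep_dim V0 = n'"
proof -
  let ?d = "rep_dim P" and ?m = "rep_dim V0" and ?X = "H.tens H.reg V0" and ?X1 = "K.tens P K.reg"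
  obtain i1 q1 where p1: "K.powiso ?X1 (?d * n') K.reg n' ?d i1 q1"
    using K.tens_reg_powiso[OF P_rep K.bij_S[OF int_K]] by blast
  obtain i2 q2 where p2: "H.powiso ?X (n * ?m) H.reg n ?m i2 q2"
    using H.reg_tens_powiso[OF V0_rep] by blast
  let ?FX = "F ?X"
  have X: "objH ?X" by (rule objH[OF H.tens_rep[OF H.reg_rep V0_rep]])
  have FX: "K.rep ?FX (rep_dim ?FX)" by (rule F_rep[OF X])
  have FV0: "K.rep (F V0) (rep_dim (F V0))" by (rule F_rep[OF V0_obj])
  have X1: "K.rep ?X1 (?d * n')" by (rule K.tens_rep[OF P_rep K.reg_rep])
  have PV: "K.rep (K.tens P (F V0)) (?d * rep_dim (F V0))" by (rule K.tens_rep[OF P_rep FV0])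
  obtain e where J: "J H.reg V0 \<in> intertwiners (K.tens P (F V0)) ?FX" and e: "e \<in> intertwiners ?FX (K.tens P (F V0))"
    "e * J H.reg V0 = 1\<^sub>m (?d * rep_dim (F V0))" "J H.reg V0 * e = 1\<^sub>m (rep_dim ?FX)"
    using J_iso[OF regH V0_obj] by (auto simp: rep_dim_eq[OF PV])
  obtain e' where \<iota>: "\<theta> K.reg \<in> intertwiners (F V0) K.reg" and e': "e' \<in> intertwiners K.reg (F V0)"
    "e' * \<theta> K.reg = 1\<^sub>m (rep_dim (F V0))" "\<theta> K.reg * e' = 1\<^sub>m n'"
    using \<theta>_iso[OF regK] by (auto simp: rep_dim_eq[OF K.reg_rep])
  let ?k = "kron (1\<^sub>m ?d) (\<theta> K.reg)" and ?k' = "kron (1\<^sub>m ?d) e'"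
  have k: "?k \<in> intertwiners (K.tens P (F V0)) ?X1" and k': "?k' \<in> intertwiners ?X1 (K.tens P (F V0))"
    by (rule K.kron_intertwiner[OF P_rep FV0 P_rep K.reg_rep intertwiners_one[OF P_rep] \<iota>]
        K.kron_intertwiner[OF P_rep K.reg_rep P_rep FV0 intertwiners_one[OF P_rep] e'(1)])+
  note \<iota>c = intertwiners_carrier[OF \<iota>, unfolded rep_dim_eq[OF K.reg_rep]]
    and e'c = intertwiners_carrier[OF e'(1), unfolded rep_dim_eq[OF K.reg_rep]]
    and Jc = intertwiners_carrier[OF J, unfolded rep_dim_eq[OF PV]]
    and ec = intertwiners_carrier[OF e(1), unfolded rep_dim_eq[OF PV]]
    and kc = intertwiners_carrier[OF k, unfolded rep_dim_eq[OF PV] rep_dim_eq[OF X1]]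
    and kc' = intertwiners_carrier[OF k', unfolded rep_dim_eq[OF PV] rep_dim_eq[OF X1]]
  have kk: "?k * ?k' = 1\<^sub>m (?d * n')" "?k' * ?k = 1\<^sub>m (?d * rep_dim (F V0))"
    using kron_mult[OF one_carrier_mat one_carrier_mat \<iota>c e'c] kron_mult[OF one_carrier_mat one_carrier_mat e'c \<iota>c]
    by (simp_all add: e' kron_one)
  have st: "(?k * e) * (J H.reg V0 * ?k') = 1\<^sub>m (?d * n')"
    using assoc_mult_mat[OF kc ec mult_carrier_mat[OF Jc kc']] assoc_mult_mat[OF ec Jc kc'] left_mult_one_mat[OF kc']
    by (simp add: e kk)
  have ts: "(J H.reg V0 * ?k') * (?k * e) = 1\<^sub>m (rep_dim ?FX)"
    using assoc_mult_mat[OF Jc kc' mult_carrier_mat[OF kc ec]] assoc_mult_mat[OF kc' kc ec] left_mult_one_mat[OF ec]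
    by (simp add: e kk)
  obtain I Q where pI: "K.powiso ?X1 (?d * n') P ?d ?m I Q"
    using K.powiso_iso[OF F_powiso[OF p2] X1 intertwiners_comp[OF FX PV X1 e(1) k] intertwiners_comp[OF X1 PV FX k' J] st ts]
    by blast
  \<comment> \<open>Both decompositions have the same dimension: dim P times n' equals dim V0 times
    dim P.\<close>
  have m: "?m = n'" using K.powiso_dim[OF pI] dim_P_pos by simp
  note pI = pI[unfolded m]
  have 1: "Q s * i1 k \<in> intertwiners K.reg P" if "s < n'" "k < ?d" for s k
    using that p1 pI by (intro intertwiners_comp[OF K.reg_rep X1 P_rep]) (auto simp: K.powiso_def)
  have 2: "q1 k * I s \<in> intertwiners P K.reg" if "s < n'" "k < ?d" for s k
    using that p1 pI by (intro intertwiners_comp[OF P_rep X1 K.reg_rep]) (auto simp: K.powiso_def)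
  show ?thesis
    by (intro exI[of _ "\<lambda>s k. Q s * i1 k"] exI[of _ "\<lambda>k s. q1 k * I s"] conjI allI impI)
      (rule 1 2 m K.powiso_pair[OF p1 pI] K.powiso_pair[OF pI p1]; assumption)+
qed

text \<open>Full faithfulness gives Hom(P, K) = Hom(H, V0) = V0, of dimension n', and Hom(K, K) = K
  has dimension n' as well. Applying Hom(_, K) to the isomorphism of n' copies of P with dim P
  copies of K shows that n' n' and n' dim P agree. After that \<open>faithful_generator\<close>
  applies.\<close>

lemma
  shows dim_P: "rep_dim P = n'"
    and generator: "\<exists>p \<in> carrier_vec n'. \<forall>x. P x *\<^sub>v p = 0\<^sub>v n' \<longrightarrow> x = 0"
proof -
  let ?d = "rep_dim P"
  obtain al be where *: "\<forall>s<n'. \<forall>k<?d. al s k \<in> intertwiners K.reg P" "\<forall>s<n'. \<forall>k<?d. be k s \<in> intertwiners P K.reg"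
    "\<forall>k<?d. \<forall>j<?d. msum n' n' (\<lambda>s. be k s * al s j) n' = (if k = j then 1\<^sub>m n' else 0\<^sub>m n' n')"
    "\<forall>s<n'. \<forall>t<n'. msum ?d ?d (\<lambda>k. al s k * be k t) ?d = (if s = t then 1\<^sub>m ?d else 0\<^sub>m ?d ?d)"
    and m: "rep_dim V0 = n'"
    using exchange_system by - (elim exE conjE, (rule that; assumption))
  have al: "al s k \<in> intertwiners K.reg P" and be: "be k s \<in> intertwiners P K.reg" if "s < n'" "k < ?d" for s k
    using * that by blast+
  have bl: "msum n' n' (\<lambda>s. be k s * al s j) n' = (if k = j then 1\<^sub>m n' else 0\<^sub>m n' n')" if "k < ?d" "j < ?d" for k j
    using * that by blast
  have lb: "msum ?d ?d (\<lambda>k. al s k * be k t) ?d = (if s = t then 1\<^sub>m ?d else 0\<^sub>m ?d ?d)" if "s < n'" "t < n'" for s t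
    using * that by blast
  note V0r = V0_rep[unfolded m]
  have FV0: "K.rep (F V0) (rep_dim (F V0))" by (rule F_rep[OF V0_obj])
  obtain e where \<iota>: "\<theta> K.reg \<in> intertwiners (F V0) K.reg" and e: "e \<in> intertwiners K.reg (F V0)"
    "e * \<theta> K.reg = 1\<^sub>m (rep_dim (F V0))" "\<theta> K.reg * e = 1\<^sub>m n'"
    using \<theta>_iso[OF regK] by (auto simp: rep_dim_eq[OF K.reg_rep])
  note \<iota>c = intertwiners_carrier[OF \<iota>, unfolded rep_dim_eq[OF K.reg_rep]] and ec = intertwiners_carrier[OF e(1), unfolded rep_dim_eq[OF K.reg_rep]]
  \<comment> \<open>\<open>h\<close> is the isomorphism from V0 onto Hom(P, K);
    \<open>\<Phi>\<close> below is its inverse.\<close>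
  define h where "h v = \<theta> K.reg * Fm H.reg V0 (H.rv V0 n' v)" for v
  have rvV: "v \<in> carrier_vec n' \<Longrightarrow> H.rv V0 n' v \<in> intertwiners H.reg V0" for v by (rule H.rv_intertwiner[OF V0r])
  have Frv: "v \<in> carrier_vec n' \<Longrightarrow> Fm H.reg V0 (H.rv V0 n' v) \<in> intertwiners P (F V0)" for v
    by (rule F_hom[OF regH V0_obj rvV])
  have hI: "h v \<in> intertwiners P K.reg" if "v \<in> carrier_vec n'" for v
    unfolding h_def by (rule intertwiners_comp[OF P_rep FV0 K.reg_rep Frv[OF that] \<iota>])
  have hc: "h v \<in> carrier_mat n' ?d" if "v \<in> carrier_vec n'" for v
    using intertwiners_carrier[OF hI[OF that]] by (simp add: rep_dim_eq[OF K.reg_rep])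
  have h_inj: "v = w" if v: "v \<in> carrier_vec n'" and w: "w \<in> carrier_vec n'" and eq: "h v = h w" for v w
  proof -
    have "Fm H.reg V0 (H.rv V0 n' v) = e * h v" if v: "v \<in> carrier_vec n'" for v
      unfolding h_def using assoc_mult_mat[OF ec \<iota>c intertwiners_carrier[OF Frv[OF v]]] left_mult_one_mat[OF intertwiners_carrier[OF Frv[OF v]]]
      by (simp add: e)
    then have "Fm H.reg V0 (H.rv V0 n' v) = Fm H.reg V0 (H.rv V0 n' w)" using v w eq by metis
    then have "H.rv V0 n' v = H.rv V0 n' w" by (rule F_faithful[OF regH V0_obj rvV[OF v] rvV[OF w]])
    then have "H.rv V0 n' v *\<^sub>v H.vh 1 = H.rv V0 n' w *\<^sub>v H.vh 1" by simp
    then show ?thesis by (simp add: H.rv_vh[OF V0r v] H.rv_vh[OF V0r w] repd_vec(5)[OF V0r v] repd_vec(5)[OF V0r w])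
  qed
  have "\<exists>v. v \<in> carrier_vec n' \<and> h v = g" if g: "g \<in> intertwiners P K.reg" for g
  proof -
    have "e * g \<in> intertwiners P (F V0)" by (rule intertwiners_comp[OF P_rep K.reg_rep FV0 g e(1)])
    then obtain f where f: "f \<in> intertwiners H.reg V0" "Fm H.reg V0 f = e * g"
      using F_full[OF regH V0_obj] by blast
    have fc: "f \<in> carrier_mat n' n" using intertwiners_carrier[OF f(1)] by (simp add: rep_dim_eq[OF V0r] rep_dim_eq[OF H.reg_rep])
    have gc: "g \<in> carrier_mat n' ?d" using intertwiners_carrier[OF g] by (simp add: rep_dim_eq[OF K.reg_rep])
    have "h (f *\<^sub>v H.vh 1) = \<theta> K.reg * (e * g)"
      unfolding h_def using H.intertwiner_reg[OF V0r f(1)] f(2) by simp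
    also have "\<dots> = g" using assoc_mult_mat[OF \<iota>c ec gc] left_mult_one_mat[OF gc] by (simp add: e)
    finally show ?thesis using mult_mat_vec_carrier[OF fc H.vh_carrier] by blast
  qed
  then obtain \<Phi> where \<Phi>c: "\<And>g. g \<in> intertwiners P K.reg \<Longrightarrow> \<Phi> g \<in> carrier_vec n'"
    and h\<Phi>: "\<And>g. g \<in> intertwiners P K.reg \<Longrightarrow> h (\<Phi> g) = g" by metis
  have \<Phi>h: "\<Phi> (h v) = v" if "v \<in> carrier_vec n'" for v
    using h_inj[OF \<Phi>c[OF hI[OF that]] that] h\<Phi>[OF hI[OF that]] by blast
  have h_add: "h (v + w) = h v + h w" if v: "v \<in> carrier_vec n'" and w: "w \<in> carrier_vec n'" for v w
    unfolding h_def H.rv_add[OF V0r v w] F_add[OF regH V0_obj rvV[OF v] rvV[OF w]]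
    by (rule mult_add_distrib_mat[OF \<iota>c intertwiners_carrier[OF Frv[OF v]] intertwiners_carrier[OF Frv[OF w]]])
  have h_smult: "h (c \<cdot>\<^sub>v v) = c \<cdot>\<^sub>m h v" if v: "v \<in> carrier_vec n'" for v c
    unfolding h_def H.rv_smult[OF V0r v] F_scale[OF regH V0_obj rvV[OF v]]
    by (rule mult_smult_distrib[OF \<iota>c intertwiners_carrier[OF Frv[OF v]]])
  have \<Phi>_add: "\<Phi> (g + g') = \<Phi> g + \<Phi> g'" if "g \<in> intertwiners P K.reg" "g' \<in> intertwiners P K.reg" for g g'
    using \<Phi>h[of "\<Phi> g + \<Phi> g'"] h_add[OF \<Phi>c[OF that(1)] \<Phi>c[OF that(2)]] h\<Phi>[OF that(1)] h\<Phi>[OF that(2)]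
      \<Phi>c[OF that(1)] \<Phi>c[OF that(2)] by simp
  have \<Phi>_smult: "\<Phi> (c \<cdot>\<^sub>m g) = c \<cdot>\<^sub>v \<Phi> g" if "g \<in> intertwiners P K.reg" for g c
    using \<Phi>h[of "c \<cdot>\<^sub>v \<Phi> g"] h_smult[OF \<Phi>c[OF that]] h\<Phi>[OF that] \<Phi>c[OF that] by simp
  have hz: "h (0\<^sub>v n') = 0\<^sub>m n' ?d"
  proof -
    have "h (0 \<cdot>\<^sub>v 0\<^sub>v n') = 0 \<cdot>\<^sub>m h (0\<^sub>v n')" by (rule h_smult) simp
    also have "\<dots> = 0\<^sub>m n' ?d" using hc[of "0\<^sub>v n'"] by (intro eq_matI) auto
    also have "0 \<cdot>\<^sub>v 0\<^sub>v n' = (0\<^sub>v n' :: 'k vec)" by (intro eq_vecI) auto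
    finally show ?thesis .
  qed
  have \<Phi>_zero: "\<Phi> (0\<^sub>m n' ?d) = 0\<^sub>v n'" using \<Phi>h[of "0\<^sub>v n'"] hz by simp
  have gcar: "g \<in> carrier_mat n' ?d" if "g \<in> intertwiners P K.reg" for g
    using intertwiners_carrier[OF that] by (simp add: rep_dim_eq[OF K.reg_rep])
  have \<Phi>_msum: "msum n' ?d g M \<in> intertwiners P K.reg \<and> (\<forall>a<n'. \<Phi> (msum n' ?d g M) $ a = (\<Sum>k<M. \<Phi> (g k) $ a))"
    if "\<And>k. k < M \<Longrightarrow> g k \<in> intertwiners P K.reg" for g M
    using that
  proof (induction M)
    case 0
    then show ?case using hI[of "0\<^sub>v n'"] by (simp add: msum_0 \<Phi>_zero hz)
  next
    case (Suc M)
    then have gM: "g M \<in> intertwiners P K.reg" and IH: "msum n' ?d g M \<in> intertwiners P K.reg"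
      "\<forall>a<n'. \<Phi> (msum n' ?d g M) $ a = (\<Sum>k<M. \<Phi> (g k) $ a)" by simp_all
    have "msum n' ?d g M + g M = h (\<Phi> (msum n' ?d g M) + \<Phi> (g M))"
      by (simp add: h_add \<Phi>c gM IH(1) h\<Phi>)
    then have I: "msum n' ?d g M + g M \<in> intertwiners P K.reg"
      using hI[of "\<Phi> (msum n' ?d g M) + \<Phi> (g M)"] \<Phi>c[OF gM] \<Phi>c[OF IH(1)] by simp
    then show ?case using IH gM \<Phi>c[OF gM] by (simp add: msum_Suc gcar \<Phi>_add)
  qed
  \<comment> \<open>Right multiplication by y: this identifies K with Hom(K, K).\<close>
  define R where "R y = K.rv K.reg n' (K.vh y)" for y
  have RI: "R y \<in> intertwiners K.reg K.reg" for y unfolding R_def by (rule K.rv_intertwiner[OF K.reg_rep K.vh_carrier])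
  have Rc: "R y \<in> carrier_mat n' n'" for y by (simp add: R_def)
  have R1: "R y *\<^sub>v K.vh 1 = K.vh y" for y by (simp add: R_def K.rv_vh[OF K.reg_rep] K.reg_vh)
  have R_add: "R (x + y) = R x + R y" and R_sc: "R (K.sc c y) = c \<cdot>\<^sub>m R y" for x y c
    unfolding R_def K.vh_add K.vh_scale
    by (rule K.rv_add[OF K.reg_rep K.vh_carrier K.vh_carrier] K.rv_smult[OF K.reg_rep K.vh_carrier])+
  have R_hv: "R (K.hv (g *\<^sub>v K.vh 1)) = g" if "g \<in> intertwiners K.reg K.reg" for g
  proof -
    have "g *\<^sub>v K.vh 1 \<in> carrier_vec n'"
      using mult_mat_vec_carrier[OF intertwiners_carrier[OF that]] by (simp add: rep_dim_eq[OF K.reg_rep])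
    then show ?thesis unfolding R_def using K.intertwiner_reg[OF K.reg_rep that] by simp
  qed
  have Rbe: "R y * be k s \<in> intertwiners P K.reg" if "s < n'" "k < ?d" for y k s
    by (rule intertwiners_comp[OF P_rep K.reg_rep K.reg_rep be[OF that] RI])
  have alc: "al s k \<in> carrier_mat ?d n'" if "s < n'" "k < ?d" for s k
    using intertwiners_carrier[OF al[OF that]] by (simp add: rep_dim_eq[OF K.reg_rep])
  have bec: "be k s \<in> carrier_mat n' ?d" if "s < n'" "k < ?d" for s k by (rule gcar[OF be[OF that]])
  have uc: "unit_vec n' a \<in> carrier_vec n'" for a by simp
  \<comment> \<open>Composing with \<open>al\<close> and then with \<open>be\<close> is the identity
    on n' copies of Hom(P, K) and factors through dim P copies of Hom(K, K). The second count
    exchanges the roles of the two sides.\<close>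
  have "n' * n' \<le> ?d * n'"
  proof (rule block_dim_le[where X = "\<lambda>s a k t. \<Phi> (R (b' t) * be k s) $ a"
        and Y = "\<lambda>k t s a. ((h (unit_vec n' a) * al s k) *\<^sub>v K.vh 1) $ t"])
    fix s' s a' a assume s': "s' < n'" and s: "s < n'" and a': "a' < n'" and a: "a < n'"
    have "(\<Sum>t<n'. \<Phi> (R (b' t) * be k s') $ a' * ((h (unit_vec n' a) * al s k) *\<^sub>v K.vh 1) $ t) =
        \<Phi> (h (unit_vec n' a) * (al s k * be k s')) $ a'" if k: "k < ?d" for k
    proof -
      have lin: "K.lin (\<lambda>y. \<Phi> (R y * be k s') $ a')"
        unfolding K.lin_def R_add R_sc
        using add_mult_distrib_mat[OF Rc Rc bec[OF s' k]] mult_smult_assoc_mat[OF Rc bec[OF s' k]]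
          \<Phi>_add[OF Rbe[OF s' k] Rbe[OF s' k]] \<Phi>_smult[OF Rbe[OF s' k]] carrier_vecD[OF \<Phi>c[OF Rbe[OF s' k]]] a' by simp
      have g: "h (unit_vec n' a) * al s k \<in> intertwiners K.reg K.reg"
        by (rule intertwiners_comp[OF K.reg_rep P_rep K.reg_rep al[OF s k] hI[OF uc]])
      show ?thesis
        using K.lin_hv[OF lin, of "(h (unit_vec n' a) * al s k) *\<^sub>v K.vh 1"] R_hv[OF g]
          assoc_mult_mat[OF hc[OF uc] alc[OF s k] bec[OF s' k]] by (simp add: mult.commute)
    qed
    then have "(\<Sum>k<?d. \<Sum>t<n'. \<Phi> (R (b' t) * be k s') $ a' * ((h (unit_vec n' a) * al s k) *\<^sub>v K.vh 1) $ t) =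
        (\<Sum>k<?d. \<Phi> (h (unit_vec n' a) * (al s k * be k s')) $ a')" by simp
    also have "\<dots> = \<Phi> (msum n' ?d (\<lambda>k. h (unit_vec n' a) * (al s k * be k s')) ?d) $ a'"
    proof -
      have "h (unit_vec n' a) * (al s k * be k s') \<in> intertwiners P K.reg" if k: "k < ?d" for k
        by (intro intertwiners_comp[OF P_rep P_rep K.reg_rep _ hI[OF uc]] intertwiners_comp[OF P_rep K.reg_rep P_rep be[OF s' k] al[OF s k]])
      then show ?thesis using \<Phi>_msum[of ?d "\<lambda>k. h (unit_vec n' a) * (al s k * be k s')"] a' by simp
    qed
    also have "msum n' ?d (\<lambda>k. h (unit_vec n' a) * (al s k * be k s')) ?d =
        h (unit_vec n' a) * msum ?d ?d (\<lambda>k. al s k * be k s') ?d"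
      by (rule mult_msum[OF hc[OF uc] mult_carrier_mat[OF alc[OF s] bec[OF s']], symmetric])
    also have "\<dots> = (if s = s' then h (unit_vec n' a) else 0\<^sub>m n' ?d)"
      using lb[OF s s'] right_mult_one_mat[OF hc[OF uc]] right_mult_zero_mat[OF hc[OF uc]] by simp
    also have "\<Phi> \<dots> $ a' = (if s' = s \<and> a' = a then 1 else 0)"
      using \<Phi>h[OF uc] \<Phi>_zero a a' by auto
    finally show "(\<Sum>k<?d. \<Sum>t<n'. \<Phi> (R (b' t) * be k s') $ a' * ((h (unit_vec n' a) * al s k) *\<^sub>v K.vh 1) $ t) =
      (if s' = s \<and> a' = a then 1 else 0)" .
  qed
  then have le1: "n' \<le> ?d" using K.n_pos by simp
  have "?d * n' \<le> n' * n'"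
  proof (rule block_dim_le[where X = "\<lambda>k t s a. ((h (unit_vec n' a) * al s k) *\<^sub>v K.vh 1) $ t"
        and Y = "\<lambda>s a k t. \<Phi> (R (b' t) * be k s) $ a"])
    fix k' k t' t assume k': "k' < ?d" and k: "k < ?d" and t': "t' < n'" and t: "t < n'"
    have "(\<Sum>a<n'. ((h (unit_vec n' a) * al s k') *\<^sub>v K.vh 1) $ t' * \<Phi> (R (b' t) * be k s) $ a) =
        ((R (b' t) * (be k s * al s k')) *\<^sub>v K.vh 1) $ t'" if s: "s < n'" for s
    proof -
      have "((h (\<Phi> (R (b' t) * be k s)) * al s k') *\<^sub>v K.vh 1) $ t' =
        (\<Sum>a<n'. \<Phi> (R (b' t) * be k s) $ a * ((h (unit_vec n' a) * al s k') *\<^sub>v K.vh 1) $ t')"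
      proof (rule vec_lin_expand[OF _ _ \<Phi>c[OF Rbe[OF s k]]])
        have hal: "h v * al s k' \<in> carrier_mat n' n'" if "v \<in> carrier_vec n'" for v
          by (rule mult_carrier_mat[OF hc[OF that] alc[OF s k']])
        show "((h (v + w) * al s k') *\<^sub>v K.vh 1) $ t' = ((h v * al s k') *\<^sub>v K.vh 1) $ t' + ((h w * al s k') *\<^sub>v K.vh 1) $ t'"
          if v: "v \<in> carrier_vec n'" and w: "w \<in> carrier_vec n'" for v w
          using t' carrier_matD[OF hal[OF w]]
          by (simp add: h_add[OF v w] add_mult_distrib_mat[OF hc[OF v] hc[OF w] alc[OF s k']]
              add_mult_distrib_mat_vec[OF hal[OF v] hal[OF w] K.vh_carrier] del: index_mult_mat_vec)
        show "((h (c \<cdot>\<^sub>v v) * al s k') *\<^sub>v K.vh 1) $ t' = c * ((h v * al s k') *\<^sub>v K.vh 1) $ t'"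
          if v: "v \<in> carrier_vec n'" for c v
          using t' carrier_matD[OF hal[OF v]]
          by (simp add: h_smult[OF v] mult_smult_assoc_mat[OF hc[OF v] alc[OF s k']] mv_smult_mat del: index_mult_mat_vec)
      qed
      then show ?thesis
        using h\<Phi>[OF Rbe[OF s k]] assoc_mult_mat[OF Rc bec[OF s k] alc[OF s k']] by (simp add: mult.commute)
    qed
    then have "(\<Sum>s<n'. \<Sum>a<n'. ((h (unit_vec n' a) * al s k') *\<^sub>v K.vh 1) $ t' * \<Phi> (R (b' t) * be k s) $ a) =
        (\<Sum>s<n'. ((R (b' t) * (be k s * al s k')) *\<^sub>v K.vh 1) $ t')" by simp
    also have "\<dots> = (msum n' n' (\<lambda>s. R (b' t) * (be k s * al s k')) n' *\<^sub>v K.vh 1) $ t'"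
      by (rule msum_mv[OF mult_carrier_mat[OF Rc mult_carrier_mat[OF bec alc]] K.vh_carrier t', symmetric]) (use k k' in auto)
    also have "msum n' n' (\<lambda>s. R (b' t) * (be k s * al s k')) n' = R (b' t) * msum n' n' (\<lambda>s. be k s * al s k') n'"
      by (rule mult_msum[OF Rc mult_carrier_mat[OF bec alc], symmetric]) (use k k' in auto)
    also have "(\<dots> *\<^sub>v K.vh 1) $ t' = (if k' = k \<and> t' = t then 1 else 0)"
      using bl[OF k k'] right_mult_one_mat[OF Rc] right_mult_zero_mat[OF Rc] R1 t t'
      by (simp add: zero_mat_mv K.idx_vh K.basis_dual)
    finally show "(\<Sum>s<n'. \<Sum>a<n'. ((h (unit_vec n' a) * al s k') *\<^sub>v K.vh 1) $ t' * \<Phi> (R (b' t) * be k s) $ a) =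
      (if k' = k \<and> t' = t then 1 else 0)" .
  qed
  then have le2: "?d \<le> n'" using K.n_pos by simp
  show d: "?d = n'" using le1 le2 by simp
  have lb1: "msum ?d ?d (\<lambda>k. al s k * be k s) ?d = 1\<^sub>m ?d" if "s < n'" for s using lb[OF that that] by simp
  show "\<exists>p \<in> carrier_vec n'. \<forall>x. P x *\<^sub>v p = 0\<^sub>v n' \<longrightarrow> x = 0"
    using K.faithful_generator[OF int_K P_rep al be bl lb1 K.n_pos le1] by (simp add: d)
qed

end

section \<open>Tensors as coordinate vectors\<close>

lemma tsum_map_upt: "tsum (map g [0..<N]) f = (\<Sum>i<N. f (fst (g i)) (snd (g i)))"
  by (induction N) (simp_all add: tsum_def split_def)

lemma vsum_Nil: "vsum N [] f = 0\<^sub>v N"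
  by (intro eq_vecI) (simp_all add: tsum_def)

lemma vsum_Cons: "f a c \<in> carrier_vec N \<Longrightarrow> vsum N ((a, c) # t) f = f a c + vsum N t f"
  by (intro eq_vecI) (auto simp: tsum_def)

definition ev :: "nat \<Rightarrow> (nat \<Rightarrow> 'k) \<Rightarrow> 'k::comm_ring_1 vec \<Rightarrow> 'k" where
  "ev N \<alpha> z = (\<Sum>i<N. z $ i * \<alpha> i)"

lemma ev_vsum: "ev N \<alpha> (vsum N t f) = tsum t (\<lambda>a c. ev N \<alpha> (f a c))"
  by (simp add: ev_def tsum_mult_right[symmetric] tsum_sum)

context coord_hopf
begin

text \<open>This is the linear form on k^n \<otimes> k^n induced by a bilinear f. It converts
  equations between coordinate vectors into equations of formal sums tested against f.\<close>

definition ev2 :: "('h \<Rightarrow> 'h \<Rightarrow> 'k) \<Rightarrow> 'k vec \<Rightarrow> 'k" where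
  "ev2 f = ev (n * n) (\<lambda>i. f (b (i div n)) (b (i mod n)))"

definition ev3 :: "('h \<Rightarrow> 'h \<Rightarrow> 'h \<Rightarrow> 'k) \<Rightarrow> 'k vec \<Rightarrow> 'k" where
  "ev3 f = ev (n * n * n) (\<lambda>i. f (b (i div n div n)) (b (i div n mod n)) (b (i mod n)))"

lemma lin_expand_b: "lin f \<Longrightarrow> (\<Sum>m<n. \<phi> m x * f (b m)) = f x"
  using lin_hv[of f "vh x"] by (simp add: idx_vh)

lemma ev2_kronv: "bil f \<Longrightarrow> ev2 f (kronv (vh x) (vh y)) = f x y"
proof -
  assume f: "bil f"
  have "ev2 f (kronv (vh x) (vh y)) = (\<Sum>i<n * n. \<phi> (i div n) x * \<phi> (i mod n) y * f (b (i div n)) (b (i mod n)))"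
    unfolding ev2_def ev_def by (rule sum.cong[OF refl]) (simp add: index_kronv idx_vh div_mod_bounds)
  also have "\<dots> = (\<Sum>p<n. \<Sum>q<n. \<phi> p x * \<phi> q y * f (b p) (b q))" by (rule sum_div_mod)
  also have "\<dots> = (\<Sum>p<n. \<phi> p x * f (b p) y)"
    using f by (simp add: mult.assoc sum_distrib_left[symmetric] lin_expand_b bil_def)
  also have "\<dots> = f x y" using f by (simp add: lin_expand_b[of "\<lambda>x. f x y"] bil_def)
  finally show ?thesis .
qed

lemma ev3_kronv: "tri f \<Longrightarrow> ev3 f (kronv (kronv (vh x) (vh y)) (vh z)) = f x y z"
proof -
  assume f: "tri f"
  have "ev3 f (kronv (kronv (vh x) (vh y)) (vh z)) =
      (\<Sum>i<n * n * n. kronv (vh x) (vh y) $ (i div n) * \<phi> (i mod n) z * f (b (i div n div n)) (b (i div n mod n)) (b (i mod n)))"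
    unfolding ev3_def ev_def by (rule sum.cong[OF refl]) (simp add: index_kronv[of _ "kronv (vh x) (vh y)"] idx_vh div_mod_bounds)
  also have "\<dots> = (\<Sum>p<n * n. \<Sum>q<n. kronv (vh x) (vh y) $ p * \<phi> q z * f (b (p div n)) (b (p mod n)) (b q))"
    by (rule sum_div_mod)
  also have "\<dots> = (\<Sum>p<n * n. kronv (vh x) (vh y) $ p * f (b (p div n)) (b (p mod n)) z)"
    using f by (simp add: mult.assoc sum_distrib_left[symmetric] lin_expand_b tri_def)
  also have "\<dots> = ev2 (\<lambda>x y. f x y z) (kronv (vh x) (vh y))" by (simp add: ev2_def ev_def)
  also have "\<dots> = f x y z" by (rule ev2_kronv) (use f in \<open>simp add: tri_def bil_def\<close>)
  finally show ?thesis .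
qed

lemma ev2_vsum: "ev2 f (vsum (n * n) t g) = tsum t (\<lambda>a c. ev2 f (g a c))"
  and ev3_vsum: "ev3 f' (vsum (n * n * n) t g) = tsum t (\<lambda>a c. ev3 f' (g a c))"
  by (simp_all add: ev2_def ev3_def ev_vsum)

text \<open>A coordinate vector becomes a formal sum in the tensor square; each coordinate is
  carried by the first tensor factor.\<close>

definition tensor_list :: "'k vec \<Rightarrow> ('h \<times> 'h) list" where
  "tensor_list z = map (\<lambda>i. (sc (z $ i) (b (i div n)), b (i mod n))) [0..<n * n]"

text \<open>The maps h \<mapsto> h v and h \<mapsto> h w, tensored, send s \<otimes> t to s v
  \<otimes> t w, so a tensor z goes to its action on v \<otimes> w. With naturality of J for such
  maps, a single value of J will determine all others.\<close>

lemma kron_rv_tensor_list: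
  assumes V: "rep V d" and W: "rep W e" and v: "v \<in> carrier_vec d" and w: "w \<in> carrier_vec e" and z: "z \<in> carrier_vec (n * n)"
  shows "kron (rv V d v) (rv W e w) *\<^sub>v z = vsum (d * e) (tensor_list z) (\<lambda>s t. kronv (V s *\<^sub>v v) (W t *\<^sub>v w))"
proof (rule eq_vecI)
  let ?M = "kron (rv V d v) (rv W e w)"
  have M: "?M \<in> carrier_mat (d * e) (n * n)" by (rule kron_carrier) simp_all
  show "dim_vec (?M *\<^sub>v z) = dim_vec (vsum (d * e) (tensor_list z) (\<lambda>s t. kronv (V s *\<^sub>v v) (W t *\<^sub>v w)))"
    using carrier_matD[OF M] by simp
  fix r assume "r < dim_vec (vsum (d * e) (tensor_list z) (\<lambda>s t. kronv (V s *\<^sub>v v) (W t *\<^sub>v w)))"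
  then have r: "r < d * e" by simp
  have "(?M *\<^sub>v z) $ r = (\<Sum>i<n * n. z $ i * (?M *\<^sub>v unit_vec (n * n) i) $ r)"
    by (rule sum_unit_vec_mv[OF M z r, symmetric])
  also have "\<dots> = (\<Sum>i<n * n. kronv (V (sc (z $ i) (b (i div n))) *\<^sub>v v) (W (b (i mod n)) *\<^sub>v w) $ r)"
  proof (rule sum.cong[OF refl])
    fix i assume "i \<in> {..<n * n}"
    then have i: "i < n * n" by simp
    have u: "unit_vec n p = vh (b p)" if "p < n" for p
      using that by (intro eq_vecI) (auto simp: idx_vh basis_dual)
    have "?M *\<^sub>v unit_vec (n * n) i = kronv (V (b (i div n)) *\<^sub>v v) (W (b (i mod n)) *\<^sub>v w)"
      unfolding unit_vec_kronv[OF i]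
      using div_mod_bounds[OF i] carrier_matD[OF rv_carrier] by (simp add: u kron_mult_kronv rv_vh[OF V v] rv_vh[OF W w])
    then show "z $ i * (?M *\<^sub>v unit_vec (n * n) i) $ r = kronv (V (sc (z $ i) (b (i div n))) *\<^sub>v v) (W (b (i mod n)) *\<^sub>v w) $ r"
      using r repd_dims[OF V] repd_dims[OF W] by (simp add: repd_vec(3)[OF V v] kronv_smult_left del: index_mult_mat_vec)
  qed
  finally show "(?M *\<^sub>v z) $ r = vsum (d * e) (tensor_list z) (\<lambda>s t. kronv (V s *\<^sub>v v) (W t *\<^sub>v w)) $ r"
    using r by (simp add: tensor_list_def tsum_map_upt)
qed

lemma tens_unit_intertwiner:
  assumes \<rho>: "rep \<rho> d"
  shows "1\<^sub>m d \<in> intertwiners (tens triv \<rho>) \<rho>" and "1\<^sub>m d \<in> intertwiners (tens \<rho> triv) \<rho>"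
proof -
  have k1: "kronv (c \<cdot>\<^sub>v v) w = (c * v $ 0) \<cdot>\<^sub>v w" "kronv w (c \<cdot>\<^sub>v v) = (c * v $ 0) \<cdot>\<^sub>v w"
    "kronv v w = (v $ 0) \<cdot>\<^sub>v w" "kronv w v = (v $ 0) \<cdot>\<^sub>v w" if "v \<in> carrier_vec 1" for c and v w :: "'k vec"
    using carrier_vecD[OF that] by (intro eq_vecI; simp add: index_kronv mult.commute)+
  have "tens triv \<rho> x = \<rho> x" for x
  proof (rule kron_eq_vecI[of _ d 1 d])
    show "tens triv \<rho> x \<in> carrier_mat d (1 * d)" using tens_carrier[OF triv_rep \<rho>, of x] by simp
    show "\<rho> x \<in> carrier_mat d (1 * d)" using repd_carrier[OF \<rho>] by simp
    fix v w :: "'k vec" assume v: "v \<in> carrier_vec 1" and w: "w \<in> carrier_vec d"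
    have l: "lin (\<lambda>y. v $ 0 * (\<rho> y *\<^sub>v w) $ i)" if "i < d" for i by (intro lin_mult2 lin_rep[OF \<rho> w that] vlin_id)
    have "tens triv \<rho> x *\<^sub>v kronv v w = vsum d (\<Delta> x) (\<lambda>a c. (eps a * v $ 0) \<cdot>\<^sub>v (\<rho> c *\<^sub>v w))"
      unfolding tens_kronv[OF triv_rep \<rho> v w] triv_mv[OF v] by (simp add: k1[OF v])
    also have "\<dots> = (v $ 0) \<cdot>\<^sub>v (\<rho> x *\<^sub>v w)"
      using tsum_counit_left[OF l] repd_dims[OF \<rho>] by (intro eq_vecI) (simp_all add: mult.assoc del: index_mult_mat_vec)
    also have "\<dots> = \<rho> x *\<^sub>v kronv v w"
      using w repd_dims[OF \<rho>] by (simp add: k1[OF v] mv_smult)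
    finally show "tens triv \<rho> x *\<^sub>v kronv v w = \<rho> x *\<^sub>v kronv v w" .
  qed
  moreover have "tens \<rho> triv x = \<rho> x" for x
  proof (rule kron_eq_vecI[of _ d d 1])
    show "tens \<rho> triv x \<in> carrier_mat d (d * 1)" using tens_carrier[OF \<rho> triv_rep, of x] by simp
    show "\<rho> x \<in> carrier_mat d (d * 1)" using repd_carrier[OF \<rho>] by simp
    fix w v :: "'k vec" assume w: "w \<in> carrier_vec d" and v: "v \<in> carrier_vec 1"
    have l: "lin (\<lambda>y. v $ 0 * (\<rho> y *\<^sub>v w) $ i)" if "i < d" for i by (intro lin_mult2 lin_rep[OF \<rho> w that] vlin_id)
    have "tens \<rho> triv x *\<^sub>v kronv w v = vsum d (\<Delta> x) (\<lambda>a c. (eps c * v $ 0) \<cdot>\<^sub>v (\<rho> a *\<^sub>v w))"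
      unfolding tens_kronv[OF \<rho> triv_rep w v] triv_mv[OF v] by (simp add: k1[OF v])
    also have "\<dots> = (v $ 0) \<cdot>\<^sub>v (\<rho> x *\<^sub>v w)"
      using tsum_counit_right[OF l] repd_dims[OF \<rho>] by (intro eq_vecI) (simp_all add: mult.assoc del: index_mult_mat_vec)
    also have "\<dots> = \<rho> x *\<^sub>v kronv w v"
      using w repd_dims[OF \<rho>] by (simp add: k1[OF v] mv_smult)
    finally show "tens \<rho> triv x *\<^sub>v kronv w v = \<rho> x *\<^sub>v kronv w v" .
  qed
  ultimately show "1\<^sub>m d \<in> intertwiners (tens triv \<rho>) \<rho>" "1\<^sub>m d \<in> intertwiners (tens \<rho> triv) \<rho>"
    using rep_dim_eq[OF tens_rep[OF triv_rep \<rho>]] rep_dim_eq[OF tens_rep[OF \<rho> triv_rep]]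
      left_mult_one_mat[OF repd_carrier[OF \<rho>]] right_mult_one_mat[OF repd_carrier[OF \<rho>]]
    by (simp_all add: intertwiners_def rep_dim_eq[OF \<rho>])
qed

text \<open>\<open>L\<close> represents a tensor by left multiplication on the square of the
  algebra, where a one-sided inverse of a square matrix is two-sided. Evaluation at 1 \<otimes> 1
  leads back to tensors.\<close>

lemma tensor_right_inverse_imp_left:
  assumes GF: "\<And>f. bil f \<Longrightarrow> tsum G (\<lambda>a c. tsum F (\<lambda>a' c'. f (a * a') (c * c'))) = f 1 1" and f: "bil f"
  shows "tsum F (\<lambda>a c. tsum G (\<lambda>a' c'. f (a * a') (c * c'))) = f 1 1"
proof -
  define L where "L t = mat (n * n) (n * n) (\<lambda>ij. tsum t (\<lambda>s c. kron (reg s) (reg c) $$ ij))" for t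
  have Lc: "L t \<in> carrier_mat (n * n) (n * n)" for t by (simp add: L_def)
  have Lv: "L t *\<^sub>v kronv (vh x) (vh y) = vsum (n * n) t (\<lambda>s c. kronv (vh (s * x)) (vh (c * y)))" for t x y
  proof (rule eq_vecI)
    fix i assume "i < dim_vec (vsum (n * n) t (\<lambda>s c. kronv (vh (s * x)) (vh (c * y))))"
    then have i: "i < n * n" by simp
    have "(L t *\<^sub>v kronv (vh x) (vh y)) $ i = (\<Sum>j\<in>{0..<n * n}. tsum t (\<lambda>s c. kron (reg s) (reg c) $$ (i, j)) * kronv (vh x) (vh y) $ j)"
      using i by (simp add: L_def scalar_prod_def)
    also have "\<dots> = tsum t (\<lambda>s c. \<Sum>j\<in>{0..<n * n}. kron (reg s) (reg c) $$ (i, j) * kronv (vh x) (vh y) $ j)"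
      by (simp add: tsum_sum tsum_mult_right)
    also have "\<dots> = tsum t (\<lambda>s c. (kron (reg s) (reg c) *\<^sub>v kronv (vh x) (vh y)) $ i)"
      using i by (simp add: scalar_prod_def)
    finally show "(L t *\<^sub>v kronv (vh x) (vh y)) $ i = vsum (n * n) t (\<lambda>s c. kronv (vh (s * x)) (vh (c * y))) $ i"
      using i by (simp add: kron_mult_kronv reg_vh del: index_mult_mat_vec)
  qed (simp add: L_def)
  have LL: "(L s * L t) *\<^sub>v kronv (vh x) (vh y) = vsum (n * n) t (\<lambda>a' c'. vsum (n * n) s (\<lambda>a c.
      kronv (vh (a * (a' * x))) (vh (c * (c' * y)))))" for s t x y
  proof -
    have kc: "kronv (vh p) (vh q) \<in> carrier_vec (n * n)" for p q by simp
    show ?thesis unfolding assoc_mult_mat_vec[OF Lc Lc kc] Lv mult_vsum[OF Lc kc] ..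
  qed
  have "L G * L F = 1\<^sub>m (n * n)"
  proof (rule kron_eq_vecI[of _ "n * n" n n])
    show "L G * L F \<in> carrier_mat (n * n) (n * n)" by (rule mult_carrier_mat[OF Lc Lc])
    fix v w :: "'k vec" assume v: "v \<in> carrier_vec n" and w: "w \<in> carrier_vec n"
    define x y where "x = hv v" and "y = hv w"
    have vw: "v = vh x" "w = vh y" using v w by (simp_all add: x_def y_def)
    show "L G * L F *\<^sub>v kronv v w = 1\<^sub>m (n * n) *\<^sub>v kronv v w"
      unfolding vw LL
    proof (rule eq_vecI)
      fix i assume "i < dim_vec (1\<^sub>m (n * n) *\<^sub>v kronv (vh x) (vh y))"
      then have i: "i < n * n" by simp
      have ik: "kronv (vh p) (vh q) $ i = \<phi> (i div n) p * \<phi> (i mod n) q" for p q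
        using i div_mod_bounds[OF i] by (simp add: index_kronv idx_vh)
      have "bil (\<lambda>p q. \<phi> (i div n) (p * x) * \<phi> (i mod n) (q * y))" by (intro bilI lin_rules)
      from GF[OF this] show "vsum (n * n) F (\<lambda>a' c'. vsum (n * n) G (\<lambda>a c. kronv (vh (a * (a' * x))) (vh (c * (c' * y))))) $ i =
          (1\<^sub>m (n * n) *\<^sub>v kronv (vh x) (vh y)) $ i"
        using i by (simp add: ik mult.assoc tsum_swap[of F])
    qed simp
  qed simp
  then have "L F * L G = 1\<^sub>m (n * n)" by (rule mat_mult_left_right_inverse[OF Lc Lc])
  then have "(L F * L G) *\<^sub>v kronv (vh 1) (vh 1) = kronv (vh 1) (vh 1)" by simp
  then have "vsum (n * n) G (\<lambda>a' c'. vsum (n * n) F (\<lambda>a c. kronv (vh (a * a')) (vh (c * c')))) = kronv (vh 1) (vh 1)"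
    unfolding LL by simp
  then have "ev2 f (vsum (n * n) G (\<lambda>a' c'. vsum (n * n) F (\<lambda>a c. kronv (vh (a * a')) (vh (c * c'))))) = f 1 1"
    by (simp add: ev2_kronv[OF f])
  then show ?thesis by (simp add: ev2_vsum ev2_kronv[OF f] tsum_swap[of F])
qed

lemma tsum_tensor_list: "bil f \<Longrightarrow> tsum (tensor_list z) f = (\<Sum>i<n * n. z $ i * f (b (i div n)) (b (i mod n)))"
  unfolding tensor_list_def tsum_map_upt by (rule sum.cong[OF refl]) (simp add: bil_def lin_def)

lemma tsum_tensor_list_smult: "z \<in> carrier_vec (n * n) \<Longrightarrow> bil f \<Longrightarrow> tsum (tensor_list (c \<cdot>\<^sub>v z)) f = c * tsum (tensor_list z) f"
  by (simp add: tsum_tensor_list sum_distrib_left mult.assoc)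

end

section \<open>The twist read off from a generator\<close>

context rep_equivalence
begin

definition p0 :: "'k vec" where
  "p0 = (SOME p. p \<in> carrier_vec n' \<and> (\<forall>x. P x *\<^sub>v p = 0\<^sub>v n' \<longrightarrow> x = 0))"

lemma p0_carrier: "p0 \<in> carrier_vec n'" and p0_faithful: "P x *\<^sub>v p0 = 0\<^sub>v n' \<Longrightarrow> x = 0"
proof -
  have "\<exists>p. p \<in> carrier_vec n' \<and> (\<forall>x. P x *\<^sub>v p = 0\<^sub>v n' \<longrightarrow> x = 0)" using generator by blast
  from someI_ex[OF this] show "p0 \<in> carrier_vec n'" "P x *\<^sub>v p0 = 0\<^sub>v n' \<Longrightarrow> x = 0"
    unfolding p0_def by blast+
qed

lemmas P_rep' = P_rep[unfolded dim_P]

text \<open>By \<open>dim_P\<close> the matrix of k \<mapsto> k p0 is square, so faithfulness of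
  \<open>p0\<close> makes it invertible: P is free on \<open>p0\<close>.\<close>

lemma P_inverse: "\<exists>B \<in> carrier_mat n' n'. (\<forall>k. B *\<^sub>v (P k *\<^sub>v p0) = K.vh k) \<and>
    (\<forall>w \<in> carrier_vec n'. w = P (K.hv (B *\<^sub>v w)) *\<^sub>v p0)"
proof -
  let ?Q = "K.rv P n' p0"
  have Qv: "?Q *\<^sub>v K.vh k = P k *\<^sub>v p0" for k by (rule K.rv_vh[OF P_rep' p0_carrier])
  have "\<exists>B \<in> carrier_mat n' n'. ?Q * B = 1\<^sub>m n' \<and> B * ?Q = 1\<^sub>m n'"
  proof (rule inj_mat_inverse)
    fix v assume v: "v \<in> carrier_vec n'" "?Q *\<^sub>v v = 0\<^sub>v n'"
    then have "P (K.hv v) *\<^sub>v p0 = 0\<^sub>v n'" using Qv[of "K.hv v"] by simp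
    then have "K.hv v = 0" by (rule p0_faithful)
    then have "v = K.vh 0" using v(1) K.vh_hv by metis
    then show "v = 0\<^sub>v n'" by (simp add: K.vh_def K.lin_0[OF K.\<phi>_lin]) (intro eq_vecI; simp)
  qed simp
  then obtain B where B: "B \<in> carrier_mat n' n'" "?Q * B = 1\<^sub>m n'" "B * ?Q = 1\<^sub>m n'" by blast
  have "B *\<^sub>v (P k *\<^sub>v p0) = K.vh k" for k
    using assoc_mult_mat_vec[OF B(1) K.rv_carrier K.vh_carrier] B(3) Qv[of k] by (metis K.vh_carrier one_mult_mat_vec)
  moreover have "w = P (K.hv (B *\<^sub>v w)) *\<^sub>v p0" if w: "w \<in> carrier_vec n'" for w
  proof -
    have "B *\<^sub>v w \<in> carrier_vec n'" by (rule mult_mat_vec_carrier[OF B(1) w])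
    then have "P (K.hv (B *\<^sub>v w)) *\<^sub>v p0 = ?Q *\<^sub>v (B *\<^sub>v w)" using Qv[of "K.hv (B *\<^sub>v w)"] by simp
    also have "\<dots> = w" unfolding assoc_mult_mat_vec[OF K.rv_carrier B(1) w, symmetric] B(2) using w by simp
    finally show ?thesis ..
  qed
  ultimately show ?thesis using B(1) by blast
qed

lemma P_gen: "w \<in> carrier_vec n' \<Longrightarrow> \<exists>k. w = P k *\<^sub>v p0"
  using P_inverse by blast

lemma P_inj: "P k *\<^sub>v p0 = P k' *\<^sub>v p0 \<Longrightarrow> k = k'"
  using P_inverse by (metis K.hv_vh)

lemma hom_P_act: "g \<in> intertwiners P Y \<Longrightarrow> K.rep Y e \<Longrightarrow> g *\<^sub>v (P x *\<^sub>v p0) = Y x *\<^sub>v (g *\<^sub>v p0)"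
  using intertwiners_iff[OF P_rep'] p0_carrier by blast

lemma hom_P_ext:
  assumes Y: "K.rep Y e" and g: "g \<in> intertwiners P Y" and h: "h \<in> intertwiners P Y" and eq: "g *\<^sub>v p0 = h *\<^sub>v p0"
  shows "g = h"
proof (rule mat_eq_vecI)
  show "g \<in> carrier_mat e n'" "h \<in> carrier_mat e n'"
    using intertwiners_carrier[OF g] intertwiners_carrier[OF h] by (simp_all add: rep_dim_eq[OF Y] dim_P)
  fix v :: "'k vec" assume "v \<in> carrier_vec n'"
  then obtain k where k: "v = P k *\<^sub>v p0" using P_gen by blast
  show "g *\<^sub>v v = h *\<^sub>v v" unfolding k hom_P_act[OF g Y] hom_P_act[OF h Y] eq ..
qed

lemma hom_P_exists:
  assumes Y: "K.rep Y e" and w: "w \<in> carrier_vec e"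
  shows "\<exists>g \<in> intertwiners P Y. g *\<^sub>v p0 = w"
proof -
  obtain B where B: "B \<in> carrier_mat n' n'" "\<And>k. B *\<^sub>v (P k *\<^sub>v p0) = K.vh k" using P_inverse by blast
  define g where "g = K.rv Y e w * B"
  have gc: "g \<in> carrier_mat e n'" unfolding g_def by (rule mult_carrier_mat[OF K.rv_carrier B(1)])
  have gv: "g *\<^sub>v (P k *\<^sub>v p0) = Y k *\<^sub>v w" for k
    unfolding g_def assoc_mult_mat_vec[OF K.rv_carrier B(1) repd_vec(1)[OF P_rep' p0_carrier]] B(2) by (rule K.rv_vh[OF Y w])
  have "g *\<^sub>v (P x *\<^sub>v v) = Y x *\<^sub>v (g *\<^sub>v v)" if v: "v \<in> carrier_vec n'" for x v
  proof -
    obtain k where k: "v = P k *\<^sub>v p0" using P_gen v by blast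
    show ?thesis unfolding k repd_vec(4)[OF P_rep' p0_carrier, symmetric] gv repd_vec(4)[OF Y w] ..
  qed
  then have "g \<in> intertwiners P Y" using gc by (simp add: intertwiners_iff[OF P_rep' Y])
  moreover have "g *\<^sub>v p0 = w" using gv[of 1] by (simp add: repd_vec(5)[OF P_rep' p0_carrier] repd_vec(5)[OF Y w])
  ultimately show ?thesis by blast
qed

text \<open>The bijection from a module \<open>V\<close> onto \<open>F V\<close> given by the generator \<open>p0\<close>.\<close>

definition th :: "('h \<Rightarrow> 'k mat) \<Rightarrow> 'k vec \<Rightarrow> 'k vec" where
  "th V v = Fm H.reg V (H.rv V (rep_dim V) v) *\<^sub>v p0"

lemma rv_hom: "objH V \<Longrightarrow> v \<in> carrier_vec (rep_dim V) \<Longrightarrow> H.rv V (rep_dim V) v \<in> intertwiners H.reg V"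
  by (rule H.rv_intertwiner[OF repH])

lemma Frv_hom: "objH V \<Longrightarrow> v \<in> carrier_vec (rep_dim V) \<Longrightarrow> Fm H.reg V (H.rv V (rep_dim V) v) \<in> intertwiners P (F V)"
  by (intro F_hom regH rv_hom)

lemma Frv_carrier: "objH V \<Longrightarrow> v \<in> carrier_vec (rep_dim V) \<Longrightarrow> Fm H.reg V (H.rv V (rep_dim V) v) \<in> carrier_mat (rep_dim (F V)) n'"
  using intertwiners_carrier[OF Frv_hom] by (simp add: dim_P)

lemma th_carrier: "objH V \<Longrightarrow> v \<in> carrier_vec (rep_dim V) \<Longrightarrow> th V v \<in> carrier_vec (rep_dim (F V))"
  unfolding th_def by (rule mult_mat_vec_carrier[OF Frv_carrier p0_carrier])

lemma th_add: "objH V \<Longrightarrow> v \<in> carrier_vec (rep_dim V) \<Longrightarrow> w \<in> carrier_vec (rep_dim V) \<Longrightarrow> th V (v + w) = th V v + th V w"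
  unfolding th_def by (simp add: H.rv_add[OF repH] F_add[OF regH _ rv_hom rv_hom] add_mult_distrib_mat_vec[OF Frv_carrier Frv_carrier p0_carrier])

lemma th_smult: "objH V \<Longrightarrow> v \<in> carrier_vec (rep_dim V) \<Longrightarrow> th V (c \<cdot>\<^sub>v v) = c \<cdot>\<^sub>v th V v"
  unfolding th_def
  using carrier_matD[OF Frv_carrier[of V v]] carrier_vecD[OF p0_carrier]
  by (simp add: H.rv_smult[OF repH] F_scale[OF regH _ rv_hom] mv_smult_mat)

text \<open>\<open>th\<close> is the composite V = Hom(H, V) = Hom(P, F V) = F V of
  \<open>rv\<close>, the fully faithful functor and evaluation at the free generator
  \<open>p0\<close>. Injectivity, and surjectivity below, hold at each stage.\<close>

lemma th_inj:
  assumes V: "objH V" and v: "v \<in> carrier_vec (rep_dim V)" and w: "w \<in> carrier_vec (rep_dim V)" and eq: "th V v = th V w"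
  shows "v = w"
proof -
  have "Fm H.reg V (H.rv V (rep_dim V) v) = Fm H.reg V (H.rv V (rep_dim V) w)"
    by (rule hom_P_ext[OF F_rep[OF V] Frv_hom[OF V v] Frv_hom[OF V w] eq[unfolded th_def]])
  then have "H.rv V (rep_dim V) v = H.rv V (rep_dim V) w" by (rule F_faithful[OF regH V rv_hom[OF V v] rv_hom[OF V w]])
  then have "H.rv V (rep_dim V) v *\<^sub>v H.vh 1 = H.rv V (rep_dim V) w *\<^sub>v H.vh 1" by simp
  then show ?thesis
    by (simp add: H.rv_vh[OF repH[OF V] v] H.rv_vh[OF repH[OF V] w] repd_vec(5)[OF repH[OF V] v] repd_vec(5)[OF repH[OF V] w])
qed

lemma th_surj:
  assumes V: "objH V" and w: "w \<in> carrier_vec (rep_dim (F V))"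
  shows "\<exists>v \<in> carrier_vec (rep_dim V). th V v = w"
proof -
  obtain g where g: "g \<in> intertwiners P (F V)" "g *\<^sub>v p0 = w" using hom_P_exists[OF F_rep[OF V] w] by blast
  obtain f where f: "f \<in> intertwiners H.reg V" "Fm H.reg V f = g" using F_full[OF regH V g(1)] by blast
  have fc: "f \<in> carrier_mat (rep_dim V) n" using intertwiners_carrier[OF f(1)] by (simp add: rep_dim_eq[OF H.reg_rep])
  have "th V (f *\<^sub>v H.vh 1) = w" unfolding th_def H.intertwiner_reg[OF repH[OF V] f(1), symmetric] f(2) g(2) ..
  then show ?thesis using mult_mat_vec_carrier[OF fc H.vh_carrier] by blast
qed

lemma th_nat:
  assumes V: "objH V" and W: "objH W" and f: "f \<in> intertwiners V W" and v: "v \<in> carrier_vec (rep_dim V)"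
  shows "th W (f *\<^sub>v v) = Fm V W f *\<^sub>v th V v"
proof -
  note fc = intertwiners_carrier[OF f]
  note fv = mult_mat_vec_carrier[OF fc v]
  have "f * H.rv V (rep_dim V) v \<in> intertwiners H.reg W"
    by (rule intertwiners_comp[OF H.reg_rep repH[OF V] repH[OF W] rv_hom[OF V v] f])
  from H.intertwiner_reg[OF repH[OF W] this]
  have "f * H.rv V (rep_dim V) v = H.rv W (rep_dim W) (f *\<^sub>v v)"
    by (simp add: assoc_mult_mat_vec[OF fc H.rv_carrier H.vh_carrier] H.rv_vh[OF repH[OF V] v] repd_vec(5)[OF repH[OF V] v])
  then have "th W (f *\<^sub>v v) = (Fm V W f * Fm H.reg V (H.rv V (rep_dim V) v)) *\<^sub>v p0"
    unfolding th_def using F_comp[OF regH V W rv_hom[OF V v] f] by simp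
  then show ?thesis
    unfolding th_def
    using assoc_mult_mat_vec[OF intertwiners_carrier[OF F_hom[OF V W f]] Frv_carrier[OF V v] p0_carrier] by simp
qed

lemma th_vsum:
  assumes V: "objH V" and f: "\<And>a c. f a c \<in> carrier_vec (rep_dim V)"
  shows "th V (vsum (rep_dim V) t f) = vsum (rep_dim (F V)) t (\<lambda>a c. th V (f a c))"
proof (induction t)
  case Nil
  have z: "0 \<cdot>\<^sub>v v = 0\<^sub>v (dim_vec v)" for v :: "'k vec" by (intro eq_vecI) auto
  have "th V (0 \<cdot>\<^sub>v 0\<^sub>v (rep_dim V)) = 0 \<cdot>\<^sub>v th V (0\<^sub>v (rep_dim V))" by (rule th_smult[OF V]) simp
  then show ?case by (simp add: vsum_Nil z carrier_vecD[OF th_carrier[OF V]])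
next
  case (Cons p t)
  obtain a c where p: "p = (a, c)" by (cases p)
  show ?case unfolding p vsum_Cons[of f a c, OF f]
    by (subst vsum_Cons) (simp_all add: th_carrier[OF V f] th_add[OF V f vsum_carrier] Cons)
qed

lemma dim_reg: "rep_dim H.reg = n" by (rule rep_dim_eq[OF H.reg_rep])

text \<open>The regular module gives a bijection \<open>th\<close> from H to P, and k \<mapsto> k p0
  is one from K to P; \<open>ph\<close> compares them and will be an isomorphism of
  algebras.\<close>

definition ph :: "'h \<Rightarrow> 'l" where "ph x = (SOME k. P k *\<^sub>v p0 = th H.reg (H.vh x))"

lemma th_reg_carrier: "th H.reg (H.vh x) \<in> carrier_vec n'"
  using th_carrier[OF regH, of "H.vh x"] by (simp add: dim_reg dim_P)

lemma ph: "P (ph x) *\<^sub>v p0 = th H.reg (H.vh x)"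
proof -
  have "\<exists>k. P k *\<^sub>v p0 = th H.reg (H.vh x)" using P_gen[OF th_reg_carrier[of x]] by metis
  from someI_ex[OF this] show ?thesis unfolding ph_def .
qed

text \<open>Naturality of \<open>th\<close> along h \<mapsto> h v reduces this to the regular
  module, where it is the defining property of \<open>ph\<close>. So \<open>th\<close> identifies V
  with F V restricted along \<open>ph\<close>.\<close>

lemma th_act:
  assumes V: "objH V" and v: "v \<in> carrier_vec (rep_dim V)"
  shows "th V (V x *\<^sub>v v) = F V (ph x) *\<^sub>v th V v"
proof -
  have "th V (H.rv V (rep_dim V) v *\<^sub>v H.vh x) = Fm H.reg V (H.rv V (rep_dim V) v) *\<^sub>v th H.reg (H.vh x)"
    by (rule th_nat[OF regH V rv_hom[OF V v]]) (simp add: dim_reg)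
  then show ?thesis
    unfolding ph[symmetric] hom_P_act[OF Frv_hom[OF V v] F_rep[OF V]] H.rv_vh[OF repH[OF V] v] by (simp only: th_def)
qed

lemma ph_add: "ph (x + y) = ph x + ph y"
  by (rule P_inj) (simp add: repd_vec(2)[OF P_rep' p0_carrier] ph H.vh_add th_add[OF regH] dim_reg)

lemma ph_scale: "ph (H.sc c x) = K.sc c (ph x)"
  by (rule P_inj) (simp add: repd_vec(3)[OF P_rep' p0_carrier] ph H.vh_scale th_smult[OF regH] dim_reg)

text \<open>At the regular module \<open>th_act\<close> says that th(x y) = ph(x) th(y), and th(y) =
  ph(y) p0; freeness of \<open>p0\<close> lets it be cancelled.\<close>

lemma ph_mult: "ph (x * y) = ph x * ph y"
  by (rule P_inj) (simp add: repd_vec(4)[OF P_rep' p0_carrier] ph H.reg_vh[symmetric] th_act[OF regH] dim_reg)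

lemma th_one: "th H.reg (H.vh 1) = p0"
proof -
  have "H.rv H.reg n (H.vh 1) = 1\<^sub>m n" by (rule H.mat_eq_vhI[of _ n]) (simp_all add: H.rv_vh[OF H.reg_rep] H.reg_vh)
  then show ?thesis unfolding th_def dim_reg using F_id[OF regH] p0_carrier by (simp add: dim_reg dim_P)
qed

lemma ph_one: "ph 1 = 1"
  by (rule P_inj) (simp add: ph th_one repd_vec(5)[OF P_rep' p0_carrier])

lemma ph_bij: "bij ph"
proof (rule bijI)
  show "inj ph"
  proof (rule injI)
    fix x y assume "ph x = ph y"
    then have "th H.reg (H.vh x) = th H.reg (H.vh y)" using ph by metis
    then have "H.vh x = H.vh y" by (rule th_inj[OF regH, rotated 2]) (simp_all add: dim_reg)
    then show "x = y" by (simp add: H.vh_eq_iff)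
  qed
  show "surj ph"
    unfolding surj_def
  proof
    fix k
    obtain v where v: "v \<in> carrier_vec n" "th H.reg v = P k *\<^sub>v p0"
      using th_surj[OF regH, of "P k *\<^sub>v p0"] repd_vec(1)[OF P_rep' p0_carrier] by (auto simp: dim_reg dim_P)
    then have "P (ph (H.hv v)) *\<^sub>v p0 = P k *\<^sub>v p0" by (simp add: ph)
    then show "\<exists>x. k = ph x" using P_inj by metis
  qed
qed

abbreviation "RR \<equiv> H.tens H.reg H.reg"

lemma tensH: "objH V \<Longrightarrow> objH W \<Longrightarrow> objH (H.tens V W)" "objH V \<Longrightarrow> objH W \<Longrightarrow> rep_dim (H.tens V W) = rep_dim V * rep_dim W"
  using objH[OF H.tens_rep[OF repH repH]] rep_dim_eq[OF H.tens_rep[OF repH repH]] by blast+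

lemma J_carrier: "objH V \<Longrightarrow> objH W \<Longrightarrow> J V W \<in> carrier_mat (rep_dim (F (H.tens V W))) (rep_dim (F V) * rep_dim (F W))"
  using J_iso[of V W] intertwiners_carrier rep_dim_eq[OF K.tens_rep[OF F_rep F_rep]] by metis

text \<open>J(p0 \<otimes> p0) is brought back along \<open>th\<close> to a tensor over H. Up to a
  scalar it is the inverse of the twist.\<close>

definition jv :: "'k vec" where
  "jv = (SOME v. v \<in> carrier_vec (n * n) \<and> th RR v = J H.reg H.reg *\<^sub>v kronv p0 p0)"

lemma jv: "jv \<in> carrier_vec (n * n)" "th RR jv = J H.reg H.reg *\<^sub>v kronv p0 p0"
proof -
  have "J H.reg H.reg *\<^sub>v kronv p0 p0 \<in> carrier_vec (rep_dim (F RR))"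
    by (rule mult_mat_vec_carrier[OF J_carrier[OF regH regH]]) (simp add: dim_P p0_carrier)
  then have "\<exists>v. v \<in> carrier_vec (n * n) \<and> th RR v = J H.reg H.reg *\<^sub>v kronv p0 p0"
    using th_surj[OF tensH(1)[OF regH regH]] by (auto simp: tensH(2)[OF regH regH] dim_reg)
  from someI_ex[OF this] show "jv \<in> carrier_vec (n * n)" "th RR jv = J H.reg H.reg *\<^sub>v kronv p0 p0"
    unfolding jv_def by blast+
qed

abbreviation "Gl \<equiv> H.tensor_list jv"

definition actG :: "('h \<Rightarrow> 'k mat) \<Rightarrow> ('h \<Rightarrow> 'k mat) \<Rightarrow> 'k vec \<Rightarrow> 'k vec \<Rightarrow> 'k vec" where
  "actG V W v w = vsum (rep_dim V * rep_dim W) Gl (\<lambda>s t. kronv (V s *\<^sub>v v) (W t *\<^sub>v w))"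

lemma actG_carrier [simp]: "actG V W v w \<in> carrier_vec (rep_dim V * rep_dim W)" by (simp add: actG_def)

text \<open>By naturality of J for the maps h \<mapsto> h v and h \<mapsto> h w, the left-hand side
  comes from J(p0 \<otimes> p0), which is \<open>th\<close> of \<open>jv\<close>. Seen through
  \<open>th\<close>, J is therefore the action of the tensor \<open>Gl\<close> on V \<otimes>
  W.\<close>

lemma J_th:
  assumes V: "objH V" and W: "objH W" and v: "v \<in> carrier_vec (rep_dim V)" and w: "w \<in> carrier_vec (rep_dim W)"
  shows "J V W *\<^sub>v kronv (th V v) (th W w) = th (H.tens V W) (actG V W v w)"
proof -
  let ?f = "H.rv V (rep_dim V) v" and ?g = "H.rv W (rep_dim W) w"
  let ?Ff = "Fm H.reg V ?f" and ?Fg = "Fm H.reg W ?g"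
  have kp: "kronv p0 p0 \<in> carrier_vec (rep_dim P * rep_dim P)" using p0_carrier by (simp add: dim_P)
  have kI: "kron ?f ?g \<in> intertwiners RR (H.tens V W)"
    by (rule H.kron_intertwiner[OF H.reg_rep H.reg_rep repH[OF V] repH[OF W] rv_hom[OF V v] rv_hom[OF W w]])
  have FkI: "Fm RR (H.tens V W) (kron ?f ?g) \<in> carrier_mat (rep_dim (F (H.tens V W))) (rep_dim (F RR))"
    by (rule intertwiners_carrier[OF F_hom[OF tensH(1)[OF regH regH] tensH(1)[OF V W] kI]])
  have kc: "kron ?Ff ?Fg \<in> carrier_mat (rep_dim (F V) * rep_dim (F W)) (rep_dim P * rep_dim P)"
    using kron_carrier[OF Frv_carrier[OF V v] Frv_carrier[OF W w]] by (simp add: dim_P)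
  have "kronv (th V v) (th W w) = kron ?Ff ?Fg *\<^sub>v kronv p0 p0"
    unfolding th_def using carrier_matD[OF Frv_carrier[OF V v]] carrier_matD[OF Frv_carrier[OF W w]] carrier_vecD[OF p0_carrier]
    by (simp add: kron_mult_kronv)
  then have "J V W *\<^sub>v kronv (th V v) (th W w) = (J V W * kron ?Ff ?Fg) *\<^sub>v kronv p0 p0"
    using assoc_mult_mat_vec[OF J_carrier[OF V W] kc kp] by simp
  also have "\<dots> = (Fm RR (H.tens V W) (kron ?f ?g) * J H.reg H.reg) *\<^sub>v kronv p0 p0"
    by (simp only: J_nat[OF regH regH V W rv_hom[OF V v] rv_hom[OF W w]])
  also have "\<dots> = Fm RR (H.tens V W) (kron ?f ?g) *\<^sub>v th RR jv"
    unfolding jv(2) by (rule assoc_mult_mat_vec[OF FkI J_carrier[OF regH regH] kp])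
  also have "\<dots> = th (H.tens V W) (kron ?f ?g *\<^sub>v jv)"
    by (rule th_nat[OF tensH(1)[OF regH regH] tensH(1)[OF V W] kI, symmetric]) (simp add: tensH(2)[OF regH regH] dim_reg jv(1))
  also have "kron ?f ?g *\<^sub>v jv = actG V W v w"
    unfolding actG_def by (rule H.kron_rv_tensor_list[OF repH[OF V] repH[OF W] v w jv(1)])
  finally show ?thesis .
qed

lemma one_vec: "vec 1 (\<lambda>_. 1) \<in> carrier_vec 1" by simp

lemma triv_obj: "objH H.triv" and dim_triv: "rep_dim H.triv = 1"
  using objH[OF H.triv_rep] rep_dim_eq[OF H.triv_rep] by blast+

lemma unit_scalar: "\<exists>v \<in> carrier_vec 1. th H.triv v = u *\<^sub>v vec 1 (\<lambda>_. 1)"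
proof -
  have "u \<in> carrier_mat (rep_dim (F H.triv)) 1"
    using intertwiners_carrier[of u K.triv "F H.triv"] u_iso rep_dim_eq[OF K.triv_rep] by simp
  then have "u *\<^sub>v vec 1 (\<lambda>_. 1) \<in> carrier_vec (rep_dim (F H.triv))" using one_vec by (rule mult_mat_vec_carrier)
  from th_surj[OF triv_obj this] show ?thesis by (simp add: dim_triv)
qed

text \<open>The trivial module is a line, so the vector u(1), brought back along \<open>th\<close>,
  is a scalar. This scalar, called \<open>c0\<close> below, measures how far \<open>Gl\<close> is
  from being counital.\<close>

definition uv :: "'k vec" where "uv = (SOME v. v \<in> carrier_vec 1 \<and> th H.triv v = u *\<^sub>v vec 1 (\<lambda>_. 1))"

lemma uv: "uv \<in> carrier_vec 1" "th H.triv uv = u *\<^sub>v vec 1 (\<lambda>_. 1)"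
proof -
  have "\<exists>v. v \<in> carrier_vec 1 \<and> th H.triv v = u *\<^sub>v vec 1 (\<lambda>_. 1)" using unit_scalar by blast
  from someI_ex[OF this] show "uv \<in> carrier_vec 1" "th H.triv uv = u *\<^sub>v vec 1 (\<lambda>_. 1)" unfolding uv_def by blast+
qed

lemma u_carrier: "u \<in> carrier_mat (rep_dim (F H.triv)) 1"
  using intertwiners_carrier[of u K.triv "F H.triv"] u_iso rep_dim_eq[OF K.triv_rep] by simp

text \<open>On the image of the trivial module ph(x) acts by \<epsilon>(x) because of
  \<open>th_act\<close>, and by the counit of \<open>K\<close> because u is a module map from the
  trivial module of \<open>K\<close>. As u is invertible, the two scalars agree.\<close>

lemma ph_counit: "counit K (ph x) = counit H x"
proof -
  obtain e where e: "e \<in> intertwiners (F H.triv) K.triv" "e * u = 1\<^sub>m 1"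
    using u_iso rep_dim_eq[OF K.triv_rep] by auto
  have ec: "e \<in> carrier_mat 1 (rep_dim (F H.triv))" using intertwiners_carrier[OF e(1)] rep_dim_eq[OF K.triv_rep] by simp
  let ?U = "u *\<^sub>v vec 1 (\<lambda>_. 1)"
  have U: "?U \<in> carrier_vec (rep_dim (F H.triv))" by (rule mult_mat_vec_carrier[OF u_carrier one_vec])
  have eU: "e *\<^sub>v ?U = vec 1 (\<lambda>_. 1)" using assoc_mult_mat_vec[OF ec u_carrier one_vec] e(2) by simp
  have "F H.triv (ph x) *\<^sub>v ?U = u *\<^sub>v (K.triv (ph x) *\<^sub>v vec 1 (\<lambda>_. 1))"
    using u_iso intertwiners_iff[OF K.triv_rep F_rep[OF triv_obj]] one_vec by metis
  also have "\<dots> = counit K (ph x) \<cdot>\<^sub>v ?U"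
    unfolding K.triv_mv[OF one_vec] using carrier_matD[OF u_carrier] by (simp add: mv_smult)
  finally have 1: "F H.triv (ph x) *\<^sub>v ?U = counit K (ph x) \<cdot>\<^sub>v ?U" .
  have "F H.triv (ph x) *\<^sub>v ?U = th H.triv (counit H x \<cdot>\<^sub>v uv)"
    using th_act[OF triv_obj, of uv x] uv H.triv_mv[OF uv(1)] by (simp add: dim_triv)
  also have "\<dots> = counit H x \<cdot>\<^sub>v ?U" using th_smult[OF triv_obj, of uv] uv by (simp add: dim_triv)
  finally have "counit K (ph x) \<cdot>\<^sub>v ?U = counit H x \<cdot>\<^sub>v ?U" using 1 by simp
  then have "e *\<^sub>v (counit K (ph x) \<cdot>\<^sub>v ?U) = e *\<^sub>v (counit H x \<cdot>\<^sub>v ?U)" by simp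
  then have "counit K (ph x) \<cdot>\<^sub>v vec 1 (\<lambda>_. 1) = counit H x \<cdot>\<^sub>v (vec 1 (\<lambda>_. 1) :: 'k vec)"
    using carrier_matD[OF ec] carrier_vecD[OF U] eU by (simp add: mv_smult)
  then have "(counit K (ph x) \<cdot>\<^sub>v vec 1 (\<lambda>_. 1)) $ 0 = (counit H x \<cdot>\<^sub>v (vec 1 (\<lambda>_. 1) :: 'k vec)) $ 0" by simp
  then show ?thesis by simp
qed

lemma Fm_one_th:
  assumes V: "objH V" and W: "objH W" and d: "rep_dim V = rep_dim W" and f: "1\<^sub>m (rep_dim W) \<in> intertwiners V W"
    and v: "v \<in> carrier_vec (rep_dim W)"
  shows "Fm V W (1\<^sub>m (rep_dim W)) *\<^sub>v th V v = th W v"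
  using th_nat[OF V W f, of v] v d by simp

lemma kronv_one: "kronv (vec 1 (\<lambda>_. 1)) w = w" "kronv w (vec 1 (\<lambda>_. 1)) = w" for w :: "'k vec"
  by (intro eq_vecI; simp add: index_kronv)+

definition c0 :: 'k where "c0 = uv $ 0"

lemma kronv_uv: "kronv (c \<cdot>\<^sub>v uv) w = (c * c0) \<cdot>\<^sub>v w" "kronv w (c \<cdot>\<^sub>v uv) = (c * c0) \<cdot>\<^sub>v w"
  using carrier_vecD[OF uv(1)] by (intro eq_vecI; simp add: index_kronv c0_def mult.commute)+

text \<open>Evaluated at th(1), the unit squares say that \<open>Gl\<close> takes uv \<otimes> 1,
  and likewise 1 \<otimes> uv, to 1. On the trivial module a leg of \<open>Gl\<close> acts through
  \<epsilon>, and \<open>uv\<close> contributes the factor \<open>c0\<close>.\<close>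

lemma counit_Gl:
  assumes h: "H.lin h"
  shows "tsum Gl (\<lambda>a c. c0 * (counit H a * h c)) = h 1" and "tsum Gl (\<lambda>a c. c0 * (counit H c * h a)) = h 1"
proof -
  have hb: "H.lin h \<Longrightarrow> (\<Sum>m<n. H.vh x $ m * h (b m)) = h x" for x
    using H.lin_hv[of h "H.vh x"] by simp
  let ?q = "th H.reg (H.vh 1)"
  have qc: "?q \<in> carrier_vec n'" by (rule th_reg_carrier)
  have v1: "H.vh 1 \<in> carrier_vec (rep_dim H.reg)" by (simp add: dim_reg)
  have uvc: "uv \<in> carrier_vec (rep_dim H.triv)" by (simp only: dim_triv uv(1))
  note dl = tensH(2)[OF triv_obj regH] and dr = tensH(2)[OF regH triv_obj]
  have ku: "kron u (1\<^sub>m n') \<in> carrier_mat (rep_dim (F H.triv) * n') (1 * n')" "kron (1\<^sub>m n') u \<in> carrier_mat (n' * rep_dim (F H.triv)) (n' * 1)"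
    by (rule kron_carrier[OF u_carrier one_carrier_mat] kron_carrier[OF one_carrier_mat u_carrier])+
  have ql: "?q \<in> carrier_vec (1 * n')" and qr: "?q \<in> carrier_vec (n' * 1)" using qc by simp_all
  have "kron u (1\<^sub>m n') *\<^sub>v kronv (vec 1 (\<lambda>_. 1)) ?q = kronv (th H.triv uv) ?q"
    using carrier_matD[OF u_carrier] qc by (subst kron_mult_kronv) (simp_all add: uv(2))
  then have k1: "kron u (1\<^sub>m n') *\<^sub>v ?q = kronv (th H.triv uv) ?q" by (simp only: kronv_one)
  have "kron (1\<^sub>m n') u *\<^sub>v kronv ?q (vec 1 (\<lambda>_. 1)) = kronv ?q (th H.triv uv)"
    using carrier_matD[OF u_carrier] qc by (subst kron_mult_kronv) (simp_all add: uv(2))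
  then have k2: "kron (1\<^sub>m n') u *\<^sub>v ?q = kronv ?q (th H.triv uv)" by (simp only: kronv_one)
  note Jl = J_carrier[OF triv_obj regH, unfolded dim_P] and Jr = J_carrier[OF regH triv_obj, unfolded dim_P]
  have Fl: "Fm (H.tens H.triv H.reg) H.reg (1\<^sub>m n) \<in> carrier_mat n' (rep_dim (F (H.tens H.triv H.reg)))"
    using intertwiners_carrier[OF F_hom[OF tensH(1)[OF triv_obj regH] regH H.tens_unit_intertwiner(1)[OF H.reg_rep]]] by (simp add: dim_P)
  have Fr: "Fm (H.tens H.reg H.triv) H.reg (1\<^sub>m n) \<in> carrier_mat n' (rep_dim (F (H.tens H.reg H.triv)))"
    using intertwiners_carrier[OF F_hom[OF tensH(1)[OF regH triv_obj] regH H.tens_unit_intertwiner(2)[OF H.reg_rep]]] by (simp add: dim_P)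
  have "?q = (Fm (H.tens H.triv H.reg) H.reg (1\<^sub>m n) * (J H.triv H.reg * kron u (1\<^sub>m n'))) *\<^sub>v ?q"
    using J_unit_left[OF regH] qc by (simp add: dim_reg dim_P)
  also have "\<dots> = Fm (H.tens H.triv H.reg) H.reg (1\<^sub>m n) *\<^sub>v (J H.triv H.reg *\<^sub>v kronv (th H.triv uv) ?q)"
    unfolding assoc_mult_mat_vec[OF Fl mult_carrier_mat[OF Jl ku(1)] ql] assoc_mult_mat_vec[OF Jl ku(1) ql] k1 ..
  also have "\<dots> = th H.reg (actG H.triv H.reg uv (H.vh 1))"
    unfolding J_th[OF triv_obj regH uvc v1]
    using Fm_one_th[OF tensH(1)[OF triv_obj regH] regH, of "actG H.triv H.reg uv (H.vh 1)"] H.tens_unit_intertwiner(1)[OF H.reg_rep]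
      actG_carrier[of H.triv H.reg uv "H.vh 1"] by (simp add: dl dim_reg dim_triv)
  finally have "H.vh 1 = actG H.triv H.reg uv (H.vh 1)"
    using th_inj[OF regH v1, of "actG H.triv H.reg uv (H.vh 1)"] actG_carrier[of H.triv H.reg uv "H.vh 1"] by (simp add: dim_reg dim_triv)
  also have "\<dots> = vsum n Gl (\<lambda>s t. (counit H s * c0) \<cdot>\<^sub>v H.vh t)"
    unfolding actG_def H.triv_mv[OF uv(1)] kronv_uv by (simp add: dim_triv dim_reg H.reg_vh)
  finally have e1: "H.vh 1 = vsum n Gl (\<lambda>s t. (counit H s * c0) \<cdot>\<^sub>v H.vh t)" .
  have "?q = (Fm (H.tens H.reg H.triv) H.reg (1\<^sub>m n) * (J H.reg H.triv * kron (1\<^sub>m n') u)) *\<^sub>v ?q"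
    using J_unit_right[OF regH] qc by (simp add: dim_reg dim_P)
  also have "\<dots> = Fm (H.tens H.reg H.triv) H.reg (1\<^sub>m n) *\<^sub>v (J H.reg H.triv *\<^sub>v kronv ?q (th H.triv uv))"
    unfolding assoc_mult_mat_vec[OF Fr mult_carrier_mat[OF Jr ku(2)] qr] assoc_mult_mat_vec[OF Jr ku(2) qr] k2 ..
  also have "\<dots> = th H.reg (actG H.reg H.triv (H.vh 1) uv)"
    unfolding J_th[OF regH triv_obj v1 uvc]
    using Fm_one_th[OF tensH(1)[OF regH triv_obj] regH, of "actG H.reg H.triv (H.vh 1) uv"] H.tens_unit_intertwiner(2)[OF H.reg_rep]
      actG_carrier[of H.reg H.triv "H.vh 1" uv] by (simp add: dr dim_reg dim_triv)
  finally have "H.vh 1 = actG H.reg H.triv (H.vh 1) uv"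
    using th_inj[OF regH v1, of "actG H.reg H.triv (H.vh 1) uv"] actG_carrier[of H.reg H.triv "H.vh 1" uv] by (simp add: dim_reg dim_triv)
  also have "\<dots> = vsum n Gl (\<lambda>s t. (counit H t * c0) \<cdot>\<^sub>v H.vh s)"
    unfolding actG_def H.triv_mv[OF uv(1)] kronv_uv by (simp add: dim_triv dim_reg H.reg_vh)
  finally have e2: "H.vh 1 = vsum n Gl (\<lambda>s t. (counit H t * c0) \<cdot>\<^sub>v H.vh s)" .
  have ev_vh: "ev n (\<lambda>m. h (b m)) (H.vh x) = h x" for x using hb[OF h] by (simp add: ev_def)
  have ev_sm: "ev n (\<lambda>m. h (b m)) (c \<cdot>\<^sub>v H.vh x) = c * h x" for c x
    using ev_vh[of x] by (simp add: ev_def sum_distrib_left[symmetric] mult.assoc)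
  show "tsum Gl (\<lambda>a c. c0 * (counit H a * h c)) = h 1"
    using arg_cong[OF e1, of "ev n (\<lambda>m. h (b m))"] by (simp add: ev_vh ev_vsum ev_sm ac_simps)
  show "tsum Gl (\<lambda>a c. c0 * (counit H c * h a)) = h 1"
    using arg_cong[OF e2, of "ev n (\<lambda>m. h (b m))"] by (simp add: ev_vh ev_vsum ev_sm ac_simps)
qed

lemma v1: "H.vh x \<in> carrier_vec (rep_dim H.reg)" by (simp add: dim_reg)

lemma objRR: "objH RR" and dimRR: "rep_dim RR = n * n"
  using tensH[OF regH regH] by (simp_all add: dim_reg)

lemma actG_reg: "actG H.reg H.reg (H.vh x) (H.vh y) = vsum (n * n) Gl (\<lambda>s t. kronv (H.vh (s * x)) (H.vh (t * y)))"
  by (simp add: actG_def dim_reg H.reg_vh)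

lemma RR_vh: "RR x *\<^sub>v kronv (H.vh y) (H.vh z) = vsum (n * n) (comult H x) (\<lambda>a c. kronv (H.vh (a * y)) (H.vh (c * z)))"
  by (simp add: H.tens_kronv[OF H.reg_rep H.reg_rep] H.reg_vh)

lemma RR_actG: "RR x *\<^sub>v actG H.reg H.reg (H.vh y) (H.vh z) =
    vsum (n * n) Gl (\<lambda>s t. vsum (n * n) (comult H x) (\<lambda>a c. kronv (H.vh (a * (s * y))) (H.vh (c * (t * z)))))"
  unfolding actG_reg by (subst mult_vsum[OF H.tens_carrier[OF H.reg_rep H.reg_rep]]) (simp_all add: RR_vh)

text \<open>J commutes with the action of ph(x), which on P \<otimes> P is given by the coproduct of
  \<open>K\<close>. Evaluated at th(1) \<otimes> th(1), this is \<Delta>(x) G = G \<Delta>'(x),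
  where \<Delta>' is the coproduct of ph(x) brought back by the inverse of
  \<open>ph\<close>.\<close>

lemma twist_Gl:
  assumes f: "H.bil f"
  shows "tsum (comult H x) (\<lambda>a c. tsum Gl (\<lambda>s t. f (a * s) (c * t))) =
    tsum Gl (\<lambda>s t. tsum (comult K (ph x)) (\<lambda>a c. f (s * inv_into UNIV ph a) (t * inv_into UNIV ph c)))"
proof -
  let ?\<psi> = "inv_into UNIV ph"
  let ?q = "th H.reg (H.vh 1)"
  have ph\<psi>: "ph (?\<psi> a) = a" for a using ph_bij by (simp add: bij_is_surj surj_f_inv_f)
  note PP = K.tens_rep[OF P_rep' P_rep']
  have qq: "kronv ?q ?q \<in> carrier_vec (n' * n')" by (rule kronv_carrier[OF th_reg_carrier th_reg_carrier])
  have Pq: "P a *\<^sub>v ?q = th H.reg (H.vh (?\<psi> a))" for a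
    using th_act[OF regH v1, of "?\<psi> a" 1] by (simp add: ph\<psi> H.reg_vh)
  have JI: "J H.reg H.reg \<in> intertwiners (K.tens P P) (F RR)" using J_iso[OF regH regH] by blast
  note Jc = J_carrier[OF regH regH, unfolded dim_P]
  have kc: "kronv (th H.reg (H.vh y)) (th H.reg (H.vh z)) \<in> carrier_vec (n' * n')" for y z
    by (rule kronv_carrier[OF th_reg_carrier th_reg_carrier])
  have "th RR (RR x *\<^sub>v actG H.reg H.reg (H.vh 1) (H.vh 1)) = F RR (ph x) *\<^sub>v (J H.reg H.reg *\<^sub>v kronv ?q ?q)"
    unfolding J_th[OF regH regH v1 v1] by (rule th_act[OF objRR]) (simp add: dimRR actG_reg)
  also have "\<dots> = J H.reg H.reg *\<^sub>v (K.tens P P (ph x) *\<^sub>v kronv ?q ?q)"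
    using JI qq unfolding intertwiners_iff[OF PP F_rep[OF objRR]] by simp
  also have "\<dots> = vsum (rep_dim (F RR)) (comult K (ph x)) (\<lambda>a c. th RR (actG H.reg H.reg (H.vh (?\<psi> a)) (H.vh (?\<psi> c))))"
    unfolding K.tens_kronv[OF P_rep' P_rep' th_reg_carrier th_reg_carrier] Pq mult_vsum[OF Jc kc] J_th[OF regH regH v1 v1] ..
  also have "\<dots> = th RR (vsum (n * n) (comult K (ph x)) (\<lambda>a c. actG H.reg H.reg (H.vh (?\<psi> a)) (H.vh (?\<psi> c))))"
    using th_vsum[OF objRR, of "\<lambda>a c. actG H.reg H.reg (H.vh (?\<psi> a)) (H.vh (?\<psi> c))" "comult K (ph x)"] by (simp add: dimRR actG_reg)
  finally have "RR x *\<^sub>v actG H.reg H.reg (H.vh 1) (H.vh 1) =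
      vsum (n * n) (comult K (ph x)) (\<lambda>a c. actG H.reg H.reg (H.vh (?\<psi> a)) (H.vh (?\<psi> c)))"
    by (rule th_inj[OF objRR, rotated 2]) (simp_all add: RR_actG dimRR)
  from arg_cong[OF this[unfolded RR_actG], of "H.ev2 f"] show ?thesis
    by (simp add: actG_reg H.ev2_vsum H.ev2_kronv[OF f] tsum_swap[of Gl "comult H x"] tsum_swap[of "comult K (ph x)" Gl])
qed

text \<open>The hexagon for three regular modules is evaluated at th(1) \<otimes> th(1) \<otimes>
  th(1). One path gives (\<Delta> \<otimes> id)(G) (G \<otimes> 1), the other (id \<otimes>
  \<Delta>)(G) (1 \<otimes> G); the associator disappears because \<open>th\<close> is natural along
  it.\<close>

lemma cocycle_Gl:
  assumes g: "H.tri g"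
  shows "tsum Gl (\<lambda>a c. tsum (comult H a) (\<lambda>a1 a2. tsum Gl (\<lambda>s t. g (a1 * s) (a2 * t) c))) =
    tsum Gl (\<lambda>a c. tsum (comult H c) (\<lambda>c1 c2. tsum Gl (\<lambda>s t. g a (c1 * s) (c2 * t))))"
proof -
  let ?q = "th H.reg (H.vh 1)" and ?g = "actG H.reg H.reg (H.vh 1) (H.vh 1)"
  let ?X = "H.tens RR H.reg" and ?Y = "H.tens H.reg RR"
  have X: "objH ?X" and Y: "objH ?Y" and dX: "rep_dim ?X = n * n * n" and dY: "rep_dim ?Y = n * n * n"
    using tensH[OF objRR regH] tensH[OF regH objRR] by (simp_all add: dimRR dim_reg mult.assoc)
  have gc: "?g \<in> carrier_vec (rep_dim RR)" by (simp add: dimRR actG_reg)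
  have qc: "?q \<in> carrier_vec n'" by (rule th_reg_carrier)
  note J1 = J_carrier[OF objRR regH, unfolded dim_P] and J2 = J_carrier[OF regH objRR, unfolded dim_P]
    and J0 = J_carrier[OF regH regH, unfolded dim_P]
  have k1: "kron (J H.reg H.reg) (1\<^sub>m n') \<in> carrier_mat (rep_dim (F RR) * n') (n' * n' * n')"
    and k2: "kron (1\<^sub>m n') (J H.reg H.reg) \<in> carrier_mat (n' * rep_dim (F RR)) (n' * n' * n')"
    using kron_carrier[OF J0 one_carrier_mat] kron_carrier[OF one_carrier_mat J0] by (simp_all add: mult.assoc)
  have qqq: "kronv (kronv ?q ?q) ?q \<in> carrier_vec (n' * n' * n')" by (intro kronv_carrier qc)
  have A: "1\<^sub>m (n * n * n) \<in> intertwiners ?X ?Y" by (rule H.assoc_intertwiner[OF H.reg_rep H.reg_rep H.reg_rep])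
  have FA: "Fm ?X ?Y (1\<^sub>m (n * n * n)) \<in> carrier_mat (rep_dim (F ?Y)) (rep_dim (F ?X))"
    by (rule intertwiners_carrier[OF F_hom[OF X Y A]])
  have e1: "kron (J H.reg H.reg) (1\<^sub>m n') *\<^sub>v kronv (kronv ?q ?q) ?q = kronv (th RR ?g) ?q"
    using carrier_matD[OF J0] carrier_vecD[OF qc] qc by (subst kron_mult_kronv) (simp_all add: J_th[OF regH regH v1 v1])
  have e2: "kron (1\<^sub>m n') (J H.reg H.reg) *\<^sub>v kronv (kronv ?q ?q) ?q = kronv ?q (th RR ?g)"
    unfolding kronv_assoc using carrier_matD[OF J0] carrier_vecD[OF qc] qc
    by (subst kron_mult_kronv) (simp_all add: J_th[OF regH regH v1 v1])
  have hex: "Fm ?X ?Y (1\<^sub>m (n * n * n)) * (J RR H.reg * kron (J H.reg H.reg) (1\<^sub>m n')) = J H.reg RR * kron (1\<^sub>m n') (J H.reg H.reg)"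
    using J_hexagon[OF regH regH regH] right_mult_one_mat[OF k2] by (simp add: dim_reg dim_P)
  have "th ?Y (actG RR H.reg ?g (H.vh 1)) = Fm ?X ?Y (1\<^sub>m (n * n * n)) *\<^sub>v th ?X (actG RR H.reg ?g (H.vh 1))"
    using th_nat[OF X Y A, of "actG RR H.reg ?g (H.vh 1)"] actG_carrier[of RR H.reg ?g "H.vh 1"] by (simp add: dX dimRR dim_reg)
  also have "\<dots> = Fm ?X ?Y (1\<^sub>m (n * n * n)) *\<^sub>v (J RR H.reg *\<^sub>v (kron (J H.reg H.reg) (1\<^sub>m n') *\<^sub>v kronv (kronv ?q ?q) ?q))"
    unfolding e1 J_th[OF objRR regH gc v1] ..
  also have "\<dots> = (J H.reg RR * kron (1\<^sub>m n') (J H.reg H.reg)) *\<^sub>v kronv (kronv ?q ?q) ?q"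
    unfolding hex[symmetric] assoc_mult_mat_vec[OF FA mult_carrier_mat[OF J1 k1] qqq] assoc_mult_mat_vec[OF J1 k1 qqq] ..
  also have "\<dots> = th ?Y (actG H.reg RR (H.vh 1) ?g)"
    unfolding assoc_mult_mat_vec[OF J2 k2 qqq] e2 J_th[OF regH objRR v1 gc] ..
  finally have eq: "actG RR H.reg ?g (H.vh 1) = actG H.reg RR (H.vh 1) ?g"
  proof (rule th_inj[OF Y, rotated 2])
    show "actG RR H.reg ?g (H.vh 1) \<in> carrier_vec (rep_dim ?Y)"
      using actG_carrier[of RR H.reg ?g "H.vh 1"] by (simp only: dY dimRR dim_reg)
    show "actG H.reg RR (H.vh 1) ?g \<in> carrier_vec (rep_dim ?Y)"
      using actG_carrier[of H.reg RR "H.vh 1" ?g] by (simp only: dY dimRR dim_reg mult.assoc)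
  qed
  have kc: "kronv (H.vh y) (H.vh z) \<in> carrier_vec (n * n)" for y z by simp
  have l: "actG RR H.reg ?g (H.vh 1) = vsum (n * n * n) Gl (\<lambda>s t. vsum (n * n * n) Gl (\<lambda>s' t'. vsum (n * n * n) (comult H s)
      (\<lambda>a c. kronv (kronv (H.vh (a * s')) (H.vh (c * t'))) (H.vh t))))"
    unfolding actG_def[of RR] RR_actG by (simp add: dimRR dim_reg H.reg_vh kronv_vsum_left[OF vsum_carrier] kronv_vsum_left[OF kc])
  have r: "actG H.reg RR (H.vh 1) ?g = vsum (n * n * n) Gl (\<lambda>s t. vsum (n * n * n) Gl (\<lambda>s' t'. vsum (n * n * n) (comult H t)
      (\<lambda>a c. kronv (kronv (H.vh s) (H.vh (a * s'))) (H.vh (c * t')))))"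
    unfolding actG_def[of _ RR] RR_actG kronv_assoc
    by (simp add: dimRR dim_reg H.reg_vh kronv_vsum_right[OF vsum_carrier] kronv_vsum_right[OF kc] mult.assoc)
  from arg_cong[OF eq, of "H.ev3 g"] show ?thesis
    unfolding l r by (simp add: H.ev3_vsum H.ev3_kronv[OF g] tsum_swap[of "comult H _" Gl])
qed

text \<open>J is onto, so \<open>th\<close> of 1 \<otimes> 1 is J of some tensor. Every basis vector
  of P is th(x) for some x, so that tensor is a sum of terms th(s) \<otimes> th(t), and by
  \<open>J_th\<close> the elements s \<otimes> t form a right inverse.\<close>

lemma Gl_right_inverse: "\<exists>F0. \<forall>f. H.bil f \<longrightarrow> tsum Gl (\<lambda>a c. tsum F0 (\<lambda>s t. f (a * s) (c * t))) = f 1 1"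
proof -
  obtain e where e: "e \<in> intertwiners (F RR) (K.tens P P)" "J H.reg H.reg * e = 1\<^sub>m (rep_dim (F RR))"
    using J_iso[OF regH regH] by blast
  note Jc = J_carrier[OF regH regH, unfolded dim_P]
  have ec: "e \<in> carrier_mat (n' * n') (rep_dim (F RR))"
    using intertwiners_carrier[OF e(1)] rep_dim_eq[OF K.tens_rep[OF P_rep' P_rep']] by simp
  let ?w = "th RR (kronv (H.vh 1) (H.vh 1))"
  have wc: "?w \<in> carrier_vec (rep_dim (F RR))" by (rule th_carrier[OF objRR]) (simp add: dimRR)
  define z where "z = e *\<^sub>v ?w"
  have zc: "z \<in> carrier_vec (n' * n')" unfolding z_def by (rule mult_mat_vec_carrier[OF ec wc])
  have Jz: "J H.reg H.reg *\<^sub>v z = ?w" unfolding z_def assoc_mult_mat_vec[OF Jc ec wc, symmetric] e(2) using wc by simp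
  have "\<forall>i. \<exists>x. i < n' \<longrightarrow> th H.reg (H.vh x) = unit_vec n' i"
  proof
    fix i
    obtain v where "v \<in> carrier_vec n" "th H.reg v = unit_vec n' i"
      using th_surj[OF regH, of "unit_vec n' i"] by (auto simp: dim_reg dim_P)
    then show "\<exists>x. i < n' \<longrightarrow> th H.reg (H.vh x) = unit_vec n' i" by (intro exI[of _ "H.hv v"]) simp
  qed
  then obtain x where x: "\<And>i. i < n' \<Longrightarrow> th H.reg (H.vh (x i)) = unit_vec n' i" by metis
  define F0 where "F0 = map (\<lambda>i. (H.sc (z $ i) (x (i div n')), x (i mod n'))) [0..<n' * n']"
  have kc: "kronv (th H.reg (H.vh y)) (th H.reg (H.vh y')) \<in> carrier_vec (n' * n')" for y y'
    by (rule kronv_carrier[OF th_reg_carrier th_reg_carrier])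
  have "z = vsum (n' * n') F0 (\<lambda>s t. kronv (th H.reg (H.vh s)) (th H.reg (H.vh t)))"
  proof (rule eq_vecI)
    fix r assume "r < dim_vec (vsum (n' * n') F0 (\<lambda>s t. kronv (th H.reg (H.vh s)) (th H.reg (H.vh t))))"
    then have r: "r < n' * n'" by simp
    have "vsum (n' * n') F0 (\<lambda>s t. kronv (th H.reg (H.vh s)) (th H.reg (H.vh t))) $ r =
      (\<Sum>i<n' * n'. kronv (th H.reg (H.vh (H.sc (z $ i) (x (i div n'))))) (th H.reg (H.vh (x (i mod n')))) $ r)"
      using r by (simp add: F0_def tsum_map_upt)
    also have "\<dots> = (\<Sum>i<n' * n'. z $ i * unit_vec (n' * n') i $ r)"
    proof (rule sum.cong[OF refl])
      fix i assume "i \<in> {..<n' * n'}"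
      then have i: "i < n' * n'" by simp
      have "th H.reg (H.vh (H.sc (z $ i) (x (i div n')))) = z $ i \<cdot>\<^sub>v unit_vec n' (i div n')"
        using th_smult[OF regH v1] x div_mod_bounds[OF i] by (simp add: H.vh_scale)
      then show "kronv (th H.reg (H.vh (H.sc (z $ i) (x (i div n'))))) (th H.reg (H.vh (x (i mod n')))) $ r =
          z $ i * unit_vec (n' * n') i $ r"
        using r x div_mod_bounds[OF i] by (simp only: unit_vec_kronv[OF i] kronv_smult_left) simp
    qed
    also have "\<dots> = z $ r" using r by (simp add: if_distrib sum.delta cong: if_cong)
    finally show "z $ r = vsum (n' * n') F0 (\<lambda>s t. kronv (th H.reg (H.vh s)) (th H.reg (H.vh t))) $ r" ..
  qed (use zc in simp)
  then have "?w = J H.reg H.reg *\<^sub>v vsum (n' * n') F0 (\<lambda>s t. kronv (th H.reg (H.vh s)) (th H.reg (H.vh t)))" using Jz by simp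
  also have "\<dots> = th RR (vsum (n * n) F0 (\<lambda>s t. actG H.reg H.reg (H.vh s) (H.vh t)))"
    unfolding mult_vsum[OF Jc kc] J_th[OF regH regH v1 v1]
    using th_vsum[OF objRR, of "\<lambda>s t. actG H.reg H.reg (H.vh s) (H.vh t)" F0] by (simp add: dimRR actG_reg)
  finally have *: "kronv (H.vh 1) (H.vh 1) = vsum (n * n) F0 (\<lambda>s t. actG H.reg H.reg (H.vh s) (H.vh t))"
    by (rule th_inj[OF objRR, rotated 2]) (simp_all add: dimRR)
  have "tsum Gl (\<lambda>a c. tsum F0 (\<lambda>s t. f (a * s) (c * t))) = f 1 1" if f: "H.bil f" for f
    using arg_cong[OF *, of "H.ev2 f"] by (simp add: actG_reg H.ev2_vsum H.ev2_kronv[OF f] tsum_swap[of F0 Gl])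
  then show ?thesis by blast
qed

end

section \<open>Transport of a Hopf algebra along an algebra isomorphism\<close>

locale hopf_transport =
  H: fd_hopf_algebra H + K: fd_hopf_algebra K
  for H :: "('k::field, 'h::ring_1) hopf" and K :: "('k, 'l::ring_1) hopf" +
  fixes f :: "'h \<Rightarrow> 'l" and g :: "'l \<Rightarrow> 'h"
  assumes fg: "f (g y) = y" and gf: "g (f x) = x"
    and f_add: "f (x + x') = f x + f x'" and f_scale: "f (H.sc c x) = K.sc c (f x)"
    and f_mult: "f (x * x') = f x * f x'" and f_one: "f 1 = 1"
    and f_counit: "counit K (f x) = counit H x"
begin

lemma g_add: "g (y + y') = g y + g y'"
  by (metis f_add fg gf)

lemma g_scale: "g (K.sc c y) = H.sc c (g y)"
  by (metis f_scale fg gf)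

lemma g_mult: "g (y * y') = g y * g y'"
  by (metis f_mult fg gf)

lemma g_one: "g 1 = 1"
  by (metis f_one gf)

lemma g_tsum: "g (tsum t h) = tsum t (\<lambda>a c. g (h a c))"
proof -
  have "g 0 = 0" using g_add[of 0 0] by simp
  then show ?thesis by (induction t) (auto simp: g_add)
qed

text \<open>A twist relates two Hopf structures on one algebra, so the structure of \<open>K\<close>
  is moved to the type of \<open>H\<close>. The scalars and the counit of \<open>H\<close> can be
  kept because \<open>f\<close> respects both.\<close>

definition pullback :: "('k, 'h) hopf" where
  "pullback = \<lparr>hscale = hscale H, comult = \<lambda>x. map (\<lambda>(a, c). (g a, g c)) (comult K (f x)),
     counit = counit H, antipode = \<lambda>x. g (antipode K (f x))\<rparr>"

lemma pullback_simps [simp]: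
  "hscale pullback = hscale H" "counit pullback = counit H" "antipode pullback x = g (antipode K (f x))"
  by (simp_all add: pullback_def)

lemma tsum_pullback: "tsum (comult pullback x) h = tsum (comult K (f x)) (\<lambda>a c. h (g a) (g c))"
  by (simp add: pullback_def tsum_map)

lemma lin_pullback: "H.lin h \<Longrightarrow> K.lin (\<lambda>y. h (g y))"
  by (simp add: H.lin_def K.lin_def g_add g_scale)

lemma bil_pullback: "H.bil h \<Longrightarrow> K.bil (\<lambda>x y. h (g x) (g y))"
  unfolding H.bil_def K.bil_def by (auto intro!: lin_pullback)

lemma tri_pullback: "H.tri h \<Longrightarrow> K.tri (\<lambda>x y z. h (g x) (g y) (g z))"
  unfolding H.tri_def K.tri_def by (auto intro!: lin_pullback)

lemma pullback_hopf: "fd_hopf_algebra pullback"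
proof (rule fd_hopf_algebra.intro; (unfold pullback_simps(1,2))?)
  show "\<exists>B. finite_dimensional_vector_space (hscale H) B" by (rule H.finite_dim)
  show "H.sc c x * y = H.sc c (x * y)" "x * H.sc c y = H.sc c (x * y)" for c x y
    by (rule H.scale_mult_left H.scale_mult_right)+
  show "linear_form H.sc (counit H)" by (rule H.counit_linear)
  show "counit H (x * y) = counit H x * counit H y" "counit H 1 = 1" for x y
    by (rule H.counit_mult H.counit_one)+
  show "Vector_Spaces.linear H.sc H.sc (antipode pullback)"
    using K.S_vlin unfolding H.vlin_iff H.vlin_def K.vlin_def by (simp add: f_add f_scale g_add g_scale)
  show "tensor2_eq H.sc (comult pullback (x + y)) (comult pullback x @ comult pullback y)" for x y
    unfolding tensor2_eq_def H.bil_iff tsum_def[symmetric]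
  proof (intro allI impI)
    fix h assume "H.bil h"
    from K.tsum_comult_lin[OF bil_pullback[OF this]]
    show "tsum (comult pullback (x + y)) h = tsum (comult pullback x @ comult pullback y) h"
      by (simp add: tsum_pullback f_add K.lin_def)
  qed
  show "tensor2_eq H.sc (comult pullback (H.sc c x)) [(H.sc c a, b). (a, b) \<leftarrow> comult pullback x]" for c x
    unfolding tensor2_eq_def H.bil_iff tsum_def[symmetric]
  proof (intro allI impI)
    fix h assume h: "H.bil h"
    have "tsum [(H.sc c a, b). (a, b) \<leftarrow> t] h = c * tsum t h" for t
      using h by (induction t) (auto simp: tsum_def H.bil_def H.lin_def algebra_simps)
    then show "tsum (comult pullback (H.sc c x)) h = tsum [(H.sc c a, b). (a, b) \<leftarrow> comult pullback x] h"
      using K.tsum_comult_lin[OF bil_pullback[OF h]] by (simp add: tsum_pullback f_scale K.lin_def)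
  qed
  show "tensor3_eq H.sc [(a1, a2, b). (a, b) \<leftarrow> comult pullback x, (a1, a2) \<leftarrow> comult pullback a]
      [(a, b1, b2). (a, b) \<leftarrow> comult pullback x, (b1, b2) \<leftarrow> comult pullback b]" for x
    unfolding tensor3_eq_def H.tri_iff
  proof (intro allI impI)
    fix T assume T: "H.tri T"
    have "tsum (comult pullback x) (\<lambda>a r. tsum (comult pullback a) (\<lambda>a1 a2. T a1 a2 r)) =
      tsum (comult pullback x) (\<lambda>a r. tsum (comult pullback r) (\<lambda>r1 r2. T a r1 r2))"
      using K.tsum_coassoc[OF tri_pullback[OF T], of "f x"] by (simp add: tsum_pullback fg)
    then show "(\<Sum>(a, b, c)\<leftarrow>[(a1, a2, b). (a, b) \<leftarrow> comult pullback x, (a1, a2) \<leftarrow> comult pullback a]. T a b c) =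
      (\<Sum>(a, b, c)\<leftarrow>[(a, b1, b2). (a, b) \<leftarrow> comult pullback x, (b1, b2) \<leftarrow> comult pullback b]. T a b c)"
      by (simp add: tsum_def split_def sum_list_concat_map comp_def)
  qed
  show "tensor2_eq H.sc (comult pullback (x * y)) [(a * c, b * d). (a, b) \<leftarrow> comult pullback x, (c, d) \<leftarrow> comult pullback y]" for x y
    unfolding tensor2_eq_def H.bil_iff
  proof (intro allI impI)
    fix h assume h: "H.bil h"
    have "tsum (comult pullback (x * y)) h = tsum (comult pullback x) (\<lambda>a r. tsum (comult pullback y) (\<lambda>c d. h (a * c) (r * d)))"
      using K.tsum_comult_mult[OF bil_pullback[OF h], of "f x" "f y"] by (simp add: tsum_pullback f_mult g_mult)
    then show "(\<Sum>(a, b)\<leftarrow>comult pullback (x * y). h a b) =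
      (\<Sum>(a, b)\<leftarrow>[(a * c, b * d). (a, b) \<leftarrow> comult pullback x, (c, d) \<leftarrow> comult pullback y]. h a b)"
      by (simp add: tsum_def split_def sum_list_concat_map comp_def)
  qed
  show "tensor2_eq H.sc (comult pullback 1) [(1, 1)]"
    unfolding tensor2_eq_def H.bil_iff tsum_def[symmetric]
  proof (intro allI impI)
    fix h assume h: "H.bil h"
    show "tsum (comult pullback 1) h = tsum [(1, 1)] h"
      using K.tsum_comult_one[OF bil_pullback[OF h]] by (simp add: tsum_pullback f_one g_one tsum_def[of "[(1, 1)]"])
  qed
  have cu: "counit H (g a) = counit K a" for a by (metis f_counit fg)
  show "(\<Sum>(a, b)\<leftarrow>comult pullback x. H.sc (counit H a) b) = x" "(\<Sum>(a, b)\<leftarrow>comult pullback x. H.sc (counit H b) a) = x" for x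
    unfolding tsum_def[symmetric] tsum_pullback cu g_scale[symmetric] g_tsum[symmetric]
    using K.counit_left[of "f x"] K.counit_right[of "f x"] by (simp_all add: tsum_def gf)
  have one: "H.sc c 1 = g (K.sc c 1)" for c by (simp add: g_scale g_one)
  show "(\<Sum>(a, b)\<leftarrow>comult pullback x. antipode pullback a * b) = H.sc (counit H x) 1"
    "(\<Sum>(a, b)\<leftarrow>comult pullback x. a * antipode pullback b) = H.sc (counit H x) 1" for x
    unfolding tsum_def[symmetric] tsum_pullback pullback_simps fg g_mult[symmetric] g_tsum[symmetric]
    using K.antipode_left[of "f x"] K.antipode_right[of "f x"] by (simp_all add: tsum_def f_counit one)
qed

lemma pullback_integrals:
  assumes "normalized_integrals K \<Lambda> l"
  shows "normalized_integrals pullback (g \<Lambda>) (\<lambda>x. l (f x))"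
proof -
  have i: "y * \<Lambda> = K.sc (counit K y) \<Lambda>" and c: "right_cointegral K l" and n: "l \<Lambda> = 1" for y
    using assms by (simp_all add: normalized_integrals_def left_integral_def)
  have "x * g \<Lambda> = H.sc (counit H x) (g \<Lambda>)" for x
    using i[of "f x"] by (metis f_counit g_mult g_scale gf)
  moreover have "H.lin (\<lambda>x. l (f x))"
    using c by (simp add: right_cointegral_def K.lin_iff H.lin_def K.lin_def f_add f_scale)
  moreover have "(\<Sum>(a, b)\<leftarrow>comult pullback x. H.sc (l (f a)) b) = H.sc (l (f x)) 1" for x
    unfolding tsum_def[symmetric] tsum_pullback fg g_scale[symmetric] g_tsum[symmetric]
    using c by (simp add: right_cointegral_def tsum_def g_scale g_one)
  ultimately show ?thesis
    by (simp add: normalized_integrals_def left_integral_def right_cointegral_def H.lin_iff fg n)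
qed

lemma pullback_kuperberg: "kuperberg_T3 pullback (g \<Lambda>) (\<lambda>x. l (f x)) = kuperberg_T3 K \<Lambda> l"
  unfolding K.kuperberg_T3_tsum fd_hopf_algebra.kuperberg_T3_tsum[OF pullback_hopf]
  by (simp add: tsum_pullback fg f_mult)

end

section \<open>Normalization of the twist and conclusion\<close>

context rep_equivalence
begin

lemma bil_mult:
  assumes "H.bil f"
  shows "H.bil (\<lambda>s t. f (a * s) (c * t))" and "H.bil (\<lambda>s t. f (s * a) (t * c))"
  by (intro H.bilI H.pre.bil_lin[OF assms] H.vlin_id H.vlin_mult1 H.vlin_mult2)+

text \<open>\<open>counit_Gl\<close> for h = \<epsilon> exhibits an inverse of
  \<open>c0\<close>.\<close>

lemma c0_nonzero: "c0 \<noteq> 0"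
  using counit_Gl(1)[OF H.eps_lin] by (auto simp: H.counit_one)

lemma kuperberg_invariance: "kuperberg_T3 H \<Lambda>\<^sub>H l\<^sub>H = kuperberg_T3 K \<Lambda>\<^sub>K l\<^sub>K"
proof -
  let ?\<psi> = "inv_into UNIV ph"
  interpret tr: hopf_transport H K ph ?\<psi>
    using ph_bij by unfold_locales
      (simp_all add: ph_add ph_scale ph_mult ph_one ph_counit bij_is_surj surj_f_inv_f bij_is_inj)
  obtain F0 where F0: "\<And>f. H.bil f \<Longrightarrow> tsum Gl (\<lambda>a c. tsum F0 (\<lambda>s t. f (a * s) (c * t))) = f 1 1"
    using Gl_right_inverse by blast
  \<comment> \<open>The twist and cocycle laws are homogeneous in \<open>Gl\<close>, so they survive
    rescaling; multiplication by \<open>c0\<close> makes the tensor counital, and its inverse is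
    divided by \<open>c0\<close>.\<close>
  define G1 where "G1 = H.tensor_list (c0 \<cdot>\<^sub>v jv)"
  define F1 where "F1 = map (\<lambda>(a, c). (H.sc (inverse c0) a, c)) F0"
  have G1: "tsum G1 f = c0 * tsum Gl f" if "H.bil f" for f
    unfolding G1_def by (rule H.tsum_tensor_list_smult[OF jv(1) that])
  have F1: "tsum F1 f = inverse c0 * tsum F0 f" if "H.bil f" for f
    using that by (simp add: F1_def tsum_map split_def H.bil_def H.lin_def tsum_mult_left)
  have bil_tsum: "H.bil (\<lambda>a c. tsum t (\<lambda>s r. f (a * s) (c * r)))" if "H.bil f" for t f
    by (intro H.bilI H.lin_tsum H.pre.bil_lin[OF that] H.lin_rules)
  have GF: "tsum G1 (\<lambda>a c. tsum F1 (\<lambda>s t. f (a * s) (c * t))) = f 1 1" if f: "H.bil f" for f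
  proof -
    have "tsum G1 (\<lambda>a c. tsum F1 (\<lambda>s t. f (a * s) (c * t))) = c0 * (inverse c0 * tsum Gl (\<lambda>a c. tsum F0 (\<lambda>s t. f (a * s) (c * t))))"
      by (simp only: G1[OF bil_tsum[OF f]] F1[OF bil_mult(1)[OF f]] tsum_mult_left mult.left_commute)
    then show ?thesis using c0_nonzero by (simp add: F0[OF f])
  qed
  interpret tw: gauge_twist H tr.pullback F1 G1
  proof (intro gauge_twist.intro gauge_twist_axioms.intro tr.pullback_hopf H.fd_hopf_algebra_axioms)
    show "hscale tr.pullback = H.sc" "counit tr.pullback = counit H" by simp_all
    show "tsum G1 (\<lambda>a c. tsum F1 (\<lambda>s t. f (a * s) (c * t))) = f 1 1" if "H.bil f" for f
      by (rule GF[OF that])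
    show "tsum F1 (\<lambda>a c. tsum G1 (\<lambda>s t. f (a * s) (c * t))) = f 1 1" if "H.bil f" for f
      by (rule H.tensor_right_inverse_imp_left[OF GF that])
    show "tsum (comult H x) (\<lambda>a c. tsum G1 (\<lambda>s t. f (a * s) (c * t))) =
        tsum G1 (\<lambda>a c. tsum (comult tr.pullback x) (\<lambda>s t. f (a * s) (c * t)))" if f: "H.bil f" for f x
    proof -
      have "tsum (comult H x) (\<lambda>a c. tsum G1 (\<lambda>s t. f (a * s) (c * t))) = c0 * tsum (comult H x) (\<lambda>a c. tsum Gl (\<lambda>s t. f (a * s) (c * t)))"
        by (simp only: G1[OF bil_mult(1)[OF f]] tsum_mult_left)
      also have "\<dots> = tsum G1 (\<lambda>a c. tsum (comult tr.pullback x) (\<lambda>s t. f (a * s) (c * t)))"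
      proof -
        have "H.bil (\<lambda>a c. tsum (comult K (ph x)) (\<lambda>s t. f (a * ?\<psi> s) (c * ?\<psi> t)))"
          by (intro H.bilI H.lin_tsum H.pre.bil_lin[OF f] H.vlin_id H.vlin_mult1)
        then show ?thesis by (simp only: twist_Gl[OF f] tr.tsum_pullback G1)
      qed
      finally show ?thesis .
    qed
    show "tsum G1 (\<lambda>a c. tsum (comult H a) (\<lambda>a1 a2. tsum G1 (\<lambda>s t. g (a1 * s) (a2 * t) c))) =
        tsum G1 (\<lambda>a c. tsum (comult H c) (\<lambda>c1 c2. tsum G1 (\<lambda>s t. g a (c1 * s) (c2 * t))))" if g: "H.tri g" for g
    proof -
      have b12: "H.bil (\<lambda>x y. g x y z)" and b23: "H.bil (\<lambda>y z. g x y z)" for x z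
        using g by (auto simp: H.tri_def H.bil_def)
      have l3: "H.lin (\<lambda>z. g x y z)" and l1: "H.lin (\<lambda>x. g x y z)" for x y z using g by (auto simp: H.tri_def)
      have d: "H.lin (\<lambda>x. tsum (comult H x) h)" if "H.bil h" for h by (rule H.tsum_comult_lin[OF that])
      have B1: "H.bil (\<lambda>a c. tsum (comult H a) (\<lambda>a1 a2. tsum Gl (\<lambda>s t. g (a1 * s) (a2 * t) c)))"
        by (intro H.bilI d bil_tsum[OF b12] H.lin_tsum l3)
      have B2: "H.bil (\<lambda>a c. tsum (comult H c) (\<lambda>c1 c2. tsum Gl (\<lambda>s t. g a (c1 * s) (c2 * t))))"
        by (intro H.bilI d bil_tsum[OF b23] H.lin_tsum l1)
      have "tsum G1 (\<lambda>a c. tsum (comult H a) (\<lambda>a1 a2. tsum G1 (\<lambda>s t. g (a1 * s) (a2 * t) c))) =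
        tsum G1 (\<lambda>a c. c0 * tsum (comult H a) (\<lambda>a1 a2. tsum Gl (\<lambda>s t. g (a1 * s) (a2 * t) c)))"
        by (simp only: G1[OF bil_mult(1)[OF b12]] tsum_mult_left)
      also have "\<dots> = c0 * (c0 * tsum Gl (\<lambda>a c. tsum (comult H a) (\<lambda>a1 a2. tsum Gl (\<lambda>s t. g (a1 * s) (a2 * t) c))))"
        by (simp only: tsum_mult_left G1[OF B1])
      also have "\<dots> = c0 * (c0 * tsum Gl (\<lambda>a c. tsum (comult H c) (\<lambda>c1 c2. tsum Gl (\<lambda>s t. g a (c1 * s) (c2 * t)))))"
        by (simp only: cocycle_Gl[OF g])
      also have "\<dots> = tsum G1 (\<lambda>a c. c0 * tsum (comult H c) (\<lambda>c1 c2. tsum Gl (\<lambda>s t. g a (c1 * s) (c2 * t))))"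
        by (simp only: tsum_mult_left G1[OF B2])
      also have "\<dots> = tsum G1 (\<lambda>a c. tsum (comult H c) (\<lambda>c1 c2. tsum G1 (\<lambda>s t. g a (c1 * s) (c2 * t))))"
        by (simp only: G1[OF bil_mult(1)[OF b23]] tsum_mult_left)
      finally show ?thesis .
    qed
    show "tsum G1 (\<lambda>a c. counit H a * h c) = h 1" if h: "H.lin h" for h
    proof -
      have "H.bil (\<lambda>a c. counit H a * h c)" by (intro H.bilI H.lin_mult1[OF H.eps_lin] H.lin_mult2[OF h])
      then show ?thesis using counit_Gl(1)[OF h] by (simp add: G1 tsum_mult_left)
    qed
    show "tsum G1 (\<lambda>a c. counit H c * h a) = h 1" if h: "H.lin h" for h
    proof -
      have "H.bil (\<lambda>a c. counit H c * h a)" by (intro H.bilI H.lin_mult1[OF H.eps_lin] H.lin_mult2[OF h])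
      then show ?thesis using counit_Gl(2)[OF h] by (simp add: G1 tsum_mult_left)
    qed
  qed
  \<comment> \<open>The twisted form of \<open>H\<close> is the pullback of \<open>K\<close>, and
    the invariant of the pullback is that of \<open>K\<close> for the transported integrals.\<close>
  show ?thesis
    using tw.kuperberg_T3_eq[OF int_H tr.pullback_integrals[OF int_K]] tr.pullback_kuperberg by simp
qed

end

theorem theorem3:
  fixes H :: "('k::field, 'h::ring_1) hopf" and K :: "('k, 'l::ring_1) hopf"
    and \<Lambda> :: 'h and l :: "'h \<Rightarrow> 'k" and \<Lambda>' :: 'l and l' :: "'l \<Rightarrow> 'k"
  assumes "fd_hopf_algebra H" and "fd_hopf_algebra K"
    and "normalized_integrals H \<Lambda> l" and "normalized_integrals K \<Lambda>' l'"
    and "gauge_equivalent H K"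
  shows "kuperberg_T3 H \<Lambda> l = kuperberg_T3 K \<Lambda>' l'"
proof -
  obtain n b \<phi> where H: "coord_hopf H n b \<phi>"
    using fd_hopf_algebra.exists_coord_hopf[OF assms(1)] by blast
  obtain n' b' \<phi>' where K: "coord_hopf K n' b' \<phi>'"
    using fd_hopf_algebra.exists_coord_hopf[OF assms(2)] by blast
  obtain F Fm J u where "linear_equivalence (Rep H) (Rep K) F Fm" and ms: "monoidal_structure (Rep H) (Rep K) F Fm J u"
    using assms(5) unfolding gauge_equivalent_def monoidally_equivalent_def by blast
  then obtain G Gm \<eta> \<theta> where "linear_functor (Rep H) (Rep K) F Fm" "linear_functor (Rep K) (Rep H) G Gm"
    "natural_iso (Rep H) (Rep H) (\<lambda>X. X) (\<lambda>X Y f. f) (\<lambda>X. G (F X)) (\<lambda>X Y f. Gm (F X) (F Y) (Fm X Y f)) \<eta>"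
    "natural_iso (Rep K) (Rep K) (\<lambda>X. F (G X)) (\<lambda>X Y f. Fm (G X) (G Y) (Gm X Y f)) (\<lambda>X. X) (\<lambda>X Y f. f) \<theta>"
    unfolding linear_equivalence_def by blast
  then interpret rep_equivalence H n b \<phi> K n' b' \<phi>' F Fm G Gm \<eta> \<theta> J u \<Lambda> l \<Lambda>' l'
    using H K ms assms(3,4) by (intro rep_equivalence.intro rep_equivalence_axioms.intro)
  show ?thesis by (rule kuperberg_invariance)
qed

end
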